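(* Let $T>0$ and let $Z(\cdot,t)$ be a smooth solution of the system (S) (see context) on $[0,T]$ with $(Z_{,\alpha'}-1,\frac{1}{Z_{,\alpha'}}-1)\in L^\infty([0,T],H^s(\mathbb{R})\times H^s(\mathbb{R}))$ for all $s\ge2$, and let $g=\mathrm{Im}(\log Z_{,\alpha'})$. Then for all $t\in[0,T]$ $$\frac{d}{dt}\int_{\mathbb{R}}|Z_{,\alpha'}|^2g^2\,d\alpha'+\int_{\mathbb{R}}|Z_{,\alpha'}|^2g^2B_1\,d\alpha'+2\|g\|_{\dot H^{1/2}}^2=0 .$$
   Context: $P_-=\{x'+iy'\in\mathbb{C}:y'<0\}$. The Hilbert transform is $\mathbb{H}f(\alpha')=\frac{1}{i\pi}\,\mathrm{p.v.}\int_{\mathbb{R}}\frac{f(\beta')}{\alpha'-\beta'}\,d\beta'$ (Fourier multiplier $-\mathrm{sgn}(\xi)$, $\mathbb{H}1=0$). $[A,B]=AB-BA$. $\|f\|_{\dot H^{1/2}}=\||\xi|^{1/2}\hat f\|_{L^2}$ (unitary Fourier transform). System (S) (one-phase Muskat problem in Riemann mapping coordinates), with unknown $Z(\cdot,t):\mathbb{R}\to\mathbb{C}$, $Z_{,\alpha'}=\partial_{\alpha'}Z$: $$b=-i\mathbb{H}\Big(\tfrac{1}{|Z_{,\alpha'}|^2}\Big),\qquad B_1=-2\,\mathrm{Im}\Big(\Big[\tfrac{1}{\overline{Z}_{,\alpha'}},\mathbb{H}\Big]\partial_{\alpha'}\tfrac{1}{Z_{,\alpha'}}\Big),\qquad (\partial_t+b\,\partial_{\alpha'})\tfrac{1}{Z_{,\alpha'}}=-\tfrac{i}{|Z_{,\alpha'}|^2}\partial_{\alpha'}\tfrac{1}{Z_{,\alpha'}}+\tfrac{B_1}{Z_{,\alpha'}},$$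 together with the conditions that the extension $\Psi(\cdot,t)$ of $Z(\cdot,t)$ to $P_-$ (with $\Psi_{z'}$ the Poisson extension of $Z_{,\alpha'}$) is holomorphic, $\lim_{z'\to\infty}\partial_t\Psi(z',t)=0$, $\lim_{c\to\infty}\sup_{|z'|\ge c}|\Psi_{z'}(z',t)-1|=0$, and $\Psi_{z'}\neq0$ on $P_-$. $\log Z_{,\alpha'}$ is the boundary value of the continuous branch of $\log\Psi_{z'}$ on $P_-$ that tends to $0$ at infinity. *)

theory Defs
  imports "HOL-Complex_Analysis.Complex_Analysis"
begin

section \<open>Functions on the line: square integrability, Fourier transform, Sobolev spaces\<close>

definition square_integrable :: "(real \<Rightarrow> complex) \<Rightarrow> bool" where
  "square_integrable f \<longleftrightarrow>
     f \<in> borel_measurable lborel \<and> integrable lborel (\<lambda>x. (norm (f x))\<^sup>2)"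

definition L2_norm :: "(real \<Rightarrow> complex) \<Rightarrow> real" where
  "L2_norm f = sqrt (LINT x|lborel. (norm (f x))\<^sup>2)"

definition truncated_fourier :: "real \<Rightarrow> (real \<Rightarrow> complex) \<Rightarrow> real \<Rightarrow> complex" where
  "truncated_fourier R f \<xi> =
     complex_of_real (1 / sqrt (2 * pi)) *
     (LINT x:{-R..R}|lborel. exp (- \<i> * complex_of_real (x * \<xi>)) * f x)"

text \<open>The unitary Fourier transform with kernel \<open>exp (- i x \<xi>)\<close>, so that differentiation
  is multiplication by \<open>i \<xi>\<close>. As functions in L2 need not be integrable, it is the L2 limit of
  the transforms of the truncations; it is determined up to null sets only.\<close>

definition is_fourier_transform :: "(real \<Rightarrow> complex) \<Rightarrow> (real \<Rightarrow> complex) \<Rightarrow> bool" where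
  "is_fourier_transform f F \<longleftrightarrow>
     square_integrable F \<and>
     ((\<lambda>R. \<integral>\<^sup>+ \<xi>. ennreal ((norm (truncated_fourier R f \<xi> - F \<xi>))\<^sup>2) \<partial>lborel) \<longlongrightarrow> 0) at_top"

definition fourier_transform :: "(real \<Rightarrow> complex) \<Rightarrow> real \<Rightarrow> complex" where
  "fourier_transform f = (SOME F. is_fourier_transform f F)"

definition sobolev_weighted :: "real \<Rightarrow> (real \<Rightarrow> complex) \<Rightarrow> real \<Rightarrow> complex" where
  "sobolev_weighted s f \<xi> = complex_of_real ((1 + \<xi>\<^sup>2) powr (s / 2)) * fourier_transform f \<xi>"

definition sobolev_space :: "real \<Rightarrow> (real \<Rightarrow> complex) set" where
  "sobolev_space s = {f. square_integrable f \<and> square_integrable (sobolev_weighted s f)}"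

definition sobolev_norm :: "real \<Rightarrow> (real \<Rightarrow> complex) \<Rightarrow> real" where
  "sobolev_norm s f = L2_norm (sobolev_weighted s f)"

definition half_weighted :: "(real \<Rightarrow> complex) \<Rightarrow> real \<Rightarrow> complex" where
  "half_weighted f \<xi> = complex_of_real (\<bar>\<xi>\<bar> powr (1 / 2)) * fourier_transform f \<xi>"

definition Hdot_half_norm :: "(real \<Rightarrow> complex) \<Rightarrow> real" where
  "Hdot_half_norm f = L2_norm (half_weighted f)"

text \<open>The time variable comes first. For the functions considered here, which are smooth in both
  variables, the measurability in time that belongs to the Bochner space is automatic.\<close>

definition Linf_sobolev :: "real \<Rightarrow> real \<Rightarrow> (real \<Rightarrow> real \<Rightarrow> complex) \<Rightarrow> bool" where
  "Linf_sobolev T s u \<longleftrightarrow>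
     (\<exists>C. AE t in lborel. t \<in> {0..T} \<longrightarrow> u t \<in> sobolev_space s \<and> sobolev_norm s (u t) \<le> C)"

section \<open>Hilbert transform and commutators\<close>

text \<open>The principal value is symmetric at the singularity and at infinity; the latter makes the
  transform meaningful for constants plus L2 functions, and constants are sent to 0.\<close>

definition hilbert :: "(real \<Rightarrow> complex) \<Rightarrow> real \<Rightarrow> complex" where
  "hilbert f \<alpha> = 1 / (\<i> * complex_of_real pi) *
     Lim (at_right 0 \<times>\<^sub>F at_top)
       (\<lambda>(\<epsilon>, R). LINT \<beta>:{\<beta>. \<epsilon> < \<bar>\<alpha> - \<beta>\<bar> \<and> \<bar>\<alpha> - \<beta>\<bar> < R}|lborel. f \<beta> / complex_of_real (\<alpha> - \<beta>))"

definition mult_op :: "(real \<Rightarrow> complex) \<Rightarrow> (real \<Rightarrow> complex) \<Rightarrow> real \<Rightarrow> complex" where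
  "mult_op a f = (\<lambda>\<alpha>. a \<alpha> * f \<alpha>)"

definition commutator ::
  "((real \<Rightarrow> complex) \<Rightarrow> real \<Rightarrow> complex) \<Rightarrow> ((real \<Rightarrow> complex) \<Rightarrow> real \<Rightarrow> complex)
   \<Rightarrow> (real \<Rightarrow> complex) \<Rightarrow> real \<Rightarrow> complex" where
  "commutator A B f = (\<lambda>\<alpha>. A (B f) \<alpha> - B (A f) \<alpha>)"

section \<open>Smoothness and partial derivatives on a time strip\<close>

text \<open>\<open>D j k\<close> is the derivative of order \<open>j\<close> in time and \<open>k\<close> in space; at the two ends of the
  time interval the time derivatives are one-sided.\<close>

definition smooth_on_strip :: "real \<Rightarrow> (real \<Rightarrow> real \<Rightarrow> complex) \<Rightarrow> bool" where
  "smooth_on_strip T u \<longleftrightarrow>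
     (\<exists>D :: nat \<Rightarrow> nat \<Rightarrow> real \<Rightarrow> real \<Rightarrow> complex.
        (\<forall>t\<in>{0..T}. \<forall>\<alpha>. D 0 0 t \<alpha> = u t \<alpha>) \<and>
        (\<forall>j k. continuous_on ({0..T} \<times> UNIV) (\<lambda>(t, \<alpha>). D j k t \<alpha>)) \<and>
        (\<forall>j k. \<forall>t\<in>{0..T}. \<forall>\<alpha>.
           ((\<lambda>\<tau>. D j k \<tau> \<alpha>) has_vector_derivative D (Suc j) k t \<alpha>) (at t within {0..T}) \<and>
           (D j k t has_vector_derivative D j (Suc k) t \<alpha>) (at \<alpha>)))"

definition d_space :: "(real \<Rightarrow> complex) \<Rightarrow> real \<Rightarrow> complex" where
  "d_space f \<alpha> = vector_derivative f (at \<alpha>)"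

definition d_time :: "real \<Rightarrow> (real \<Rightarrow> complex) \<Rightarrow> real \<Rightarrow> complex" where
  "d_time T f t = vector_derivative f (at t within {0..T})"

section \<open>The lower half-plane\<close>

definition P_minus :: "complex set" where
  "P_minus = {z. Im z < 0}"

definition poisson_extension :: "(real \<Rightarrow> complex) \<Rightarrow> complex \<Rightarrow> complex" where
  "poisson_extension f z =
     (LINT \<beta>|lborel. complex_of_real (- Im z / (pi * ((Re z - \<beta>)\<^sup>2 + (Im z)\<^sup>2))) * f \<beta>)"

definition infinity_in_P_minus :: "complex filter" where
  "infinity_in_P_minus = inf at_infinity (principal P_minus)"

definition is_log_branch :: "(complex \<Rightarrow> complex) \<Rightarrow> (complex \<Rightarrow> complex) \<Rightarrow> bool" where
  "is_log_branch F L \<longleftrightarrow>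
     continuous_on P_minus L \<and> (\<forall>z\<in>P_minus. exp (L z) = F z) \<and> (L \<longlongrightarrow> 0) infinity_in_P_minus"

text \<open>The conditions on a branch determine it on the half-plane.\<close>

definition boundary_log :: "(complex \<Rightarrow> complex) \<Rightarrow> real \<Rightarrow> complex" where
  "boundary_log F \<alpha> = Lim (at (complex_of_real \<alpha>) within P_minus) (SOME L. is_log_branch F L)"

section \<open>The one-phase Muskat problem in Riemann mapping coordinates\<close>

text \<open>Below, \<open>Z\<close> is the boundary parametrisation at a fixed time.\<close>

definition inv_Z' :: "(real \<Rightarrow> complex) \<Rightarrow> real \<Rightarrow> complex" where
  "inv_Z' Z \<alpha> = 1 / d_space Z \<alpha>"

definition muskat_b :: "(real \<Rightarrow> complex) \<Rightarrow> real \<Rightarrow> complex" where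
  "muskat_b Z \<alpha> = - \<i> * hilbert (\<lambda>\<beta>. complex_of_real (1 / (norm (d_space Z \<beta>))\<^sup>2)) \<alpha>"

definition muskat_B1 :: "(real \<Rightarrow> complex) \<Rightarrow> real \<Rightarrow> real" where
  "muskat_B1 Z \<alpha> =
     - 2 * Im (commutator (mult_op (\<lambda>\<beta>. 1 / cnj (d_space Z \<beta>))) hilbert (d_space (inv_Z' Z)) \<alpha>)"

text \<open>The non-vanishing of the space derivative on the boundary is what gives its reciprocal
  a meaning at every point.\<close>

definition muskat_solution ::
  "real \<Rightarrow> (real \<Rightarrow> real \<Rightarrow> complex) \<Rightarrow> (real \<Rightarrow> complex \<Rightarrow> complex) \<Rightarrow> bool" where
  "muskat_solution T Z \<Psi> \<longleftrightarrow>
     (\<forall>t\<in>{0..T}. \<forall>\<alpha>.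
        d_space (Z t) \<alpha> \<noteq> 0 \<and>
        d_time T (\<lambda>\<tau>. inv_Z' (Z \<tau>) \<alpha>) t + muskat_b (Z t) \<alpha> * d_space (inv_Z' (Z t)) \<alpha> =
          - \<i> / complex_of_real ((norm (d_space (Z t) \<alpha>))\<^sup>2) * d_space (inv_Z' (Z t)) \<alpha>
          + complex_of_real (muskat_B1 (Z t) \<alpha>) / d_space (Z t) \<alpha>) \<and>
     (\<forall>t\<in>{0..T}.
        \<Psi> t holomorphic_on P_minus \<and>
        (\<forall>\<alpha>. (\<Psi> t \<longlongrightarrow> Z t \<alpha>) (at (complex_of_real \<alpha>) within P_minus)) \<and>
        (\<forall>z\<in>P_minus. deriv (\<Psi> t) z = poisson_extension (d_space (Z t)) z) \<and>
        (\<forall>z\<in>P_minus. (\<lambda>\<tau>. \<Psi> \<tau> z) differentiable (at t within {0..T})) \<and>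
        ((\<lambda>z. d_time T (\<lambda>\<tau>. \<Psi> \<tau> z) t) \<longlongrightarrow> 0) infinity_in_P_minus \<and>
        ((\<lambda>c. SUP z\<in>{z \<in> P_minus. norm z \<ge> c}. ennreal (norm (deriv (\<Psi> t) z - 1))) \<longlongrightarrow> 0) at_top \<and>
        (\<forall>z\<in>P_minus. deriv (\<Psi> t) z \<noteq> 0))"

end

theory Submission
  imports Defs "HOL-Probability.Probability"
begin

text \<open>Write \<open>L = log Z'\<close>, \<open>w = L' = Z'' / Z'\<close>, \<open>p = 1 / Z'\<close> and \<open>\<beta> = b\<close>. The system says
  \<open>\<partial>\<^sub>t L = - \<beta> w - i |p|\<^sup>2 w - B\<^sub>1\<close>, and since \<open>p - 1\<close> is the boundary value of a holomorphic
  function on the lower half-plane, \<open>\<beta>' = B\<^sub>1 - 2 |p|\<^sup>2 Im w\<close>. With \<open>f = |Z'|\<^sup>2 g\<^sup>2\<close> these combine to the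
  pointwise conservation law \<open>\<partial>\<^sub>t f + (\<beta> f)' = - f B\<^sub>1 - 2 g Re w\<close>. Integration in space removes the
  flux. As \<open>L\<close> is a boundary value from the lower half-plane, its Fourier transform vanishes for
  positive frequencies, and Parseval's identity turns the integral of \<open>g Re w = Im L Re L'\<close> into the
  squared half-norm of \<open>g\<close>.\<close>

section \<open>The Fourier transform of square-integrable functions\<close>

text \<open>The transform in the statement is a choice among L2 limits of truncated integrals, so it
  is usable only once such limits are known to exist, to be unique up to null sets and to preserve
  norms; Gaussian damping supplies this. The Hilbert transform is likewise a limit of truncations.
  On functions with an H1 bound it equals an absolutely convergent integral whose truncation error
  depends on that bound alone, which is why it can be differentiated. The other obstacle is time.
  The Sobolev bounds hold at almost every time, the logarithm is chosen at each time separately, and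
  no integrable majorant of the time derivative of f is at hand. So g is recovered as a time
  integral of the imaginary part of the quotient of the time derivative of Z' by Z'; the possible
  jump by a multiple of 2 pi, constant in space, is excluded by square integrability of g. The time
  derivative of f is split into g, which is Lipschitz in time with values in L2, and a factor merely
  bounded in L2. This makes its integral continuous in time, and the energy is differentiated
  through its time-integrated form instead of under the integral sign.\<close>

definition sq_nn :: "(real \<Rightarrow> complex) \<Rightarrow> ennreal" where
  "sq_nn f = (\<integral>\<^sup>+x. ennreal ((norm (f x))\<^sup>2) \<partial>lborel)"

lemma borel_measurable_cnj [measurable (raw)]:
  "f \<in> borel_measurable M \<Longrightarrow> (\<lambda>x. cnj (f x)) \<in> borel_measurable M"
  by (erule measurable_compose) (intro borel_measurable_continuous_onI continuous_intros)

text \<open>Supplies the hypothesis of Fubini's theorem for oscillating kernels: one integrable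
  factor in each variable, and a jointly measurable bounded \<open>k\<close> such as an
  exponential.\<close>

lemma integrable_pair_prod:
  fixes f g :: "real \<Rightarrow> complex" and k :: "real \<Rightarrow> real \<Rightarrow> complex"
  assumes f: "integrable lborel f" and g: "integrable lborel g"
    and k: "(\<lambda>(x, y). k x y) \<in> borel_measurable (lborel \<Otimes>\<^sub>M lborel)" and B: "\<And>x y. norm (k x y) \<le> B"
  shows "integrable (lborel \<Otimes>\<^sub>M lborel) (\<lambda>(x, y). f x * g y * k x y)"
proof -
  have [measurable]: "f \<in> borel_measurable borel" "g \<in> borel_measurable borel" using f g by auto
  note k[measurable]
  have 1: "integrable (lborel \<Otimes>\<^sub>M lborel) (\<lambda>(x, y). f x * g y)"
  proof (rule lborel_pair.Fubini_integrable)
    show "integrable lborel (\<lambda>x. LINT y|lborel. norm (case (x, y) of (x, y) \<Rightarrow> f x * g y))"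
      using f g by (simp add: norm_mult integrable_norm)
    show "AE x in lborel. integrable lborel (\<lambda>y. case (x, y) of (x, y) \<Rightarrow> f x * g y)"
      using g by simp
  qed measurable
  have 2: "integrable (lborel \<Otimes>\<^sub>M lborel) (\<lambda>p. of_real B * (case p of (x, y) \<Rightarrow> f x * g y))"
    using 1 by simp
  show ?thesis
  proof (rule Bochner_Integration.integrable_bound[OF 2])
    have "norm (f x * g y * k x y) \<le> norm (of_real B * (f x * g y))" for x y
      using B[of x y] norm_ge_zero[of "k x y"]
      by (simp add: norm_mult mult.commute[of _ "norm (k x y)"] mult_right_mono)
    then show "AE p in lborel \<Otimes>\<^sub>M lborel. norm (case p of (x, y) \<Rightarrow> f x * g y * k x y)
        \<le> norm (of_real B * (case p of (x, y) \<Rightarrow> f x * g y))" by auto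
  qed measurable
qed

section \<open>Absolutely convergent Fourier integrals and Gaussian summation\<close>

lemma norm_iexp [simp]: "norm (exp (- \<i> * complex_of_real u)) = 1" "norm (exp (\<i> * complex_of_real u)) = 1"
  using norm_exp_i_times[of u] norm_exp_i_times[of "-u"] by simp_all

lemma integrable_iexp_mult:
  assumes "integrable lborel (f :: real \<Rightarrow> complex)"
  shows "integrable lborel (\<lambda>x. exp (- \<i> * complex_of_real (x * \<xi>)) * f x)"
    "integrable lborel (\<lambda>x. exp (\<i> * complex_of_real (x * \<xi>)) * f x)"
  using assms by (auto intro!: Bochner_Integration.integrable_bound[OF assms] simp: norm_mult simp del: of_real_mult)

definition ft1 :: "(real \<Rightarrow> complex) \<Rightarrow> real \<Rightarrow> complex" where
  "ft1 f \<xi> = complex_of_real (1 / sqrt (2 * pi)) *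
     (LINT x|lborel. exp (- \<i> * complex_of_real (x * \<xi>)) * f x)"

lemma ft1_measurable [measurable]:
  assumes [measurable]: "f \<in> borel_measurable borel"
  shows "ft1 f \<in> borel_measurable borel"
  unfolding ft1_def by measurable

lemma ft1_bounded:
  assumes "integrable lborel f"
  shows "norm (ft1 f \<xi>) \<le> 1 / sqrt (2 * pi) * (LINT x|lborel. norm (f x))"
proof -
  have "norm (LINT x|lborel. exp (- \<i> * complex_of_real (x * \<xi>)) * f x)
    \<le> (LINT x|lborel. norm (exp (- \<i> * complex_of_real (x * \<xi>)) * f x))"
    by (rule integral_norm_bound)
  also have "\<dots> = (LINT x|lborel. norm (f x))"
    by (intro Bochner_Integration.integral_cong refl) (simp add: norm_mult del: of_real_mult)
  finally show ?thesis
    unfolding ft1_def norm_mult norm_of_real by (intro mult_mono) auto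
qed

lemma std_normal_ft:
  "(LINT x|lborel. exp (\<i> * complex_of_real (u * x)) * complex_of_real (std_normal_density x))
     = complex_of_real (exp (- u\<^sup>2 / 2))"
proof -
  have "char std_normal_distribution u
      = (LINT x|lborel. std_normal_density x *\<^sub>R exp (\<i> * complex_of_real (u * x)))"
    unfolding char_def by (subst integral_density) auto
  then show ?thesis
    by (simp add: char_std_normal_distribution scaleR_conv_of_real mult.commute)
qed

text \<open>A dilated form of the characteristic function of the standard normal law: stretching the
  Gaussian by \<open>\<delta>\<close> concentrates its transform at scale
  \<open>\<delta>\<close>.\<close>

lemma std_normal_ft_scaled:
  assumes "\<delta> > 0"
  shows "(LINT x|lborel. exp (\<i> * complex_of_real (u * x)) * complex_of_real (std_normal_density (\<delta> * x)))
     = complex_of_real (sqrt (2 * pi) / \<delta> * std_normal_density (u / \<delta>))"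
proof -
  have "complex_of_real (exp (- (u / \<delta>)\<^sup>2 / 2)) =
     (LINT x|lborel. exp (\<i> * complex_of_real (u / \<delta> * x)) * complex_of_real (std_normal_density x))"
    by (rule std_normal_ft[symmetric])
  also have "\<dots> = \<bar>\<delta>\<bar> *\<^sub>R (LINT x|lborel. exp (\<i> * complex_of_real (u / \<delta> * (0 + \<delta> * x))) *
      complex_of_real (std_normal_density (0 + \<delta> * x)))"
    using assms by (intro lborel_integral_real_affine) auto
  also have "\<dots> = of_real \<delta> * (LINT x|lborel. exp (\<i> * complex_of_real (u * x)) * complex_of_real (std_normal_density (\<delta> * x)))"
    using assms by (simp add: scaleR_conv_of_real)
  finally show ?thesis
    using assms by (simp add: field_simps normal_density_def)
qed

lemma integrable_std_normal: "integrable lborel (\<lambda>s. std_normal_density s)"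
  by (intro integrable_normal_density) auto

lemma integral_std_normal: "(LINT s|lborel. std_normal_density s) = 1"
  by (intro integral_normal_density) auto

text \<open>Fourier inversion with Gaussian damping. The damping makes the double integral
  absolutely convergent; after Fubini the frequency integral is again a Gaussian, of width
  \<open>\<delta>\<close> around \<open>y\<close>, so the right side is a local average of
  \<open>f\<close>.\<close>

lemma ft1_gauss_inverse:
  assumes f: "integrable lborel f" and \<delta>: "\<delta> > 0"
  shows "(LINT \<xi>|lborel. complex_of_real (std_normal_density (\<delta> * \<xi>)) * (exp (\<i> * complex_of_real (y * \<xi>)) * ft1 f \<xi>))
     = (LINT s|lborel. f (y - \<delta> * s) * complex_of_real (std_normal_density s))" (is "?L = ?R")
proof -
  let ?n = "\<lambda>\<xi>. complex_of_real (std_normal_density (\<delta> * \<xi>))"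
  let ?c = "complex_of_real (1 / sqrt (2 * pi))"
  have [measurable]: "f \<in> borel_measurable borel" using f by auto
  have n: "integrable lborel ?n"
    using lborel_integrable_real_affine[OF integrable_std_normal, of \<delta> 0] \<delta> by auto
  have int: "integrable (lborel \<Otimes>\<^sub>M lborel) (\<lambda>(\<xi>, x). ?n \<xi> * f x * exp (\<i> * complex_of_real ((y - x) * \<xi>)))"
    by (rule integrable_pair_prod[OF n f, where B=1]) (auto simp del: of_real_mult of_real_diff)
  have "?L = (LINT \<xi>|lborel. ?c * (LINT x|lborel. ?n \<xi> * f x * exp (\<i> * complex_of_real ((y - x) * \<xi>))))"
  proof (rule Bochner_Integration.integral_cong[OF refl])
    fix \<xi>
    have "(LINT x|lborel. ?n \<xi> * f x * exp (\<i> * complex_of_real ((y - x) * \<xi>)))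
       = (LINT x|lborel. (?n \<xi> * exp (\<i> * complex_of_real (y * \<xi>))) * (exp (- \<i> * complex_of_real (x * \<xi>)) * f x))"
      by (intro Bochner_Integration.integral_cong refl) (simp add: algebra_simps exp_diff exp_minus field_simps)
    also have "\<dots> = (?n \<xi> * exp (\<i> * complex_of_real (y * \<xi>))) * (LINT x|lborel. (exp (- \<i> * complex_of_real (x * \<xi>)) * f x))"
      by simp
    finally show "?n \<xi> * (exp (\<i> * complex_of_real (y * \<xi>)) * ft1 f \<xi>) =
      ?c * (LINT x|lborel. ?n \<xi> * f x * exp (\<i> * complex_of_real ((y - x) * \<xi>)))"
      by (simp only: ft1_def mult_ac)
  qed
  also have "\<dots> = ?c * (LINT \<xi>|lborel. (LINT x|lborel. ?n \<xi> * f x * exp (\<i> * complex_of_real ((y - x) * \<xi>))))"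
    by simp
  also have "\<dots> = ?c * (LINT x|lborel. (LINT \<xi>|lborel. ?n \<xi> * f x * exp (\<i> * complex_of_real ((y - x) * \<xi>))))"
    using lborel_pair.Fubini_integral[OF int] by simp
  also have "\<dots> = ?c * (LINT x|lborel. f x * complex_of_real (sqrt (2 * pi) / \<delta> * std_normal_density ((y - x) / \<delta>)))"
  proof -
    have "(LINT \<xi>|lborel. ?n \<xi> * f x * exp (\<i> * complex_of_real ((y - x) * \<xi>)))
      = (LINT \<xi>|lborel. f x * (exp (\<i> * complex_of_real ((y - x) * \<xi>)) * ?n \<xi>))" for x
      by (intro Bochner_Integration.integral_cong refl) (simp add: mult_ac)
    then show ?thesis by (simp only: integral_mult_right_zero std_normal_ft_scaled[OF \<delta>])
  qed
  \<comment> \<open>Substitution x = y - \<delta> s. Its Jacobian \<open>\<delta>\<close> cancels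
    the \<open>1 / \<delta>\<close> of the scaled Gaussian, and sqrt(2 pi) cancels
    \<open>?c\<close>.\<close>
  also have "\<dots> = ?c * (\<bar>-\<delta>\<bar> *\<^sub>R (LINT s|lborel. f (y + (-\<delta>) * s) *
      complex_of_real (sqrt (2 * pi) / \<delta> * std_normal_density ((y - (y + (-\<delta>) * s)) / \<delta>))))"
    using \<delta> by (subst lborel_integral_real_affine[of "-\<delta>" _ y]) auto
  also have "\<dots> = ?c * of_real \<delta> * (LINT s|lborel. complex_of_real (sqrt (2 * pi) / \<delta>) * (f (y - \<delta> * s) * complex_of_real (std_normal_density s)))"
    using \<delta> by (simp add: scaleR_conv_of_real mult_ac)
  also have "\<dots> = ?R"
    by (subst integral_mult_right_zero) (use \<delta> in simp)
  finally show ?thesis .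
qed

text \<open>The Gaussian regularisation of the energy of the transform is an average of
  autocorrelations of \<open>f\<close> at distance of order \<open>\<delta>\<close>.\<close>

lemma ft1_gauss_energy:
  assumes f: "integrable lborel f" and \<delta>: "\<delta> > 0"
  shows "(LINT \<xi>|lborel. complex_of_real (exp (- (\<delta> * \<xi>)\<^sup>2 / 2)) * (ft1 f \<xi> * cnj (ft1 f \<xi>)))
     = (LINT y|lborel. cnj (f y) * (LINT s|lborel. f (y - \<delta> * s) * complex_of_real (std_normal_density s)))" (is "?L = ?R")
proof -
  let ?n = "\<lambda>\<xi>. complex_of_real (std_normal_density (\<delta> * \<xi>))"
  let ?c = "complex_of_real (1 / sqrt (2 * pi))"
  have [measurable]: "f \<in> borel_measurable borel" using f by auto
  have n: "integrable lborel ?n"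
    using lborel_integrable_real_affine[OF integrable_std_normal, of \<delta> 0] \<delta> by auto
  have fc: "integrable lborel (\<lambda>x. cnj (f x))" using f by simp
  have int: "integrable (lborel \<Otimes>\<^sub>M lborel) (\<lambda>(\<xi>, x). ?n \<xi> * cnj (f x) * (exp (\<i> * complex_of_real (x * \<xi>)) * ft1 f \<xi>))"
    by (rule integrable_pair_prod[OF n fc, where B="1 / sqrt (2 * pi) * (LINT x|lborel. norm (f x))"])
      (use ft1_bounded[OF f] in \<open>auto simp: norm_mult simp del: of_real_mult\<close>)
  \<comment> \<open>The bare exponential is sqrt(2 pi) times the normal density; this factor absorbs
    the normalisation of one of the two transforms.\<close>
  have "?L = (LINT \<xi>|lborel. of_real (sqrt (2*pi)) * ?n \<xi> * ft1 f \<xi> * cnj (ft1 f \<xi>))"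
    by (intro Bochner_Integration.integral_cong refl) (simp add: normal_density_def power_mult_distrib)
  also have "\<dots> = (LINT \<xi>|lborel. (LINT x|lborel. ?n \<xi> * cnj (f x) * (exp (\<i> * complex_of_real (x * \<xi>)) * ft1 f \<xi>)))"
  proof (rule Bochner_Integration.integral_cong[OF refl])
    fix \<xi>
    have "cnj (ft1 f \<xi>) = ?c * cnj (LINT x|lborel. exp (- \<i> * complex_of_real (x * \<xi>)) * f x)"
      by (simp add: ft1_def)
    also have "cnj (LINT x|lborel. exp (- \<i> * complex_of_real (x * \<xi>)) * f x)
       = (LINT x|lborel. cnj (f x) * exp (\<i> * complex_of_real (x * \<xi>)))"
      by (subst Bochner_Integration.integral_cnj[symmetric]) (simp add: exp_cnj mult_ac)
    finally have 1: "cnj (ft1 f \<xi>) = ?c * (LINT x|lborel. cnj (f x) * exp (\<i> * complex_of_real (x * \<xi>)))" .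
    have "(LINT x|lborel. ?n \<xi> * cnj (f x) * (exp (\<i> * complex_of_real (x * \<xi>)) * ft1 f \<xi>))
       = (LINT x|lborel. (?n \<xi> * ft1 f \<xi>) * (cnj (f x) * exp (\<i> * complex_of_real (x * \<xi>))))"
      by (intro Bochner_Integration.integral_cong refl) (simp add: mult_ac)
    also have "\<dots> = (?n \<xi> * ft1 f \<xi>) * (LINT x|lborel. (cnj (f x) * exp (\<i> * complex_of_real (x * \<xi>))))"
      by simp
    also have "(LINT x|lborel. (cnj (f x) * exp (\<i> * complex_of_real (x * \<xi>)))) = of_real (sqrt (2*pi)) * cnj (ft1 f \<xi>)"
      unfolding 1 by simp
    finally have 2: "(LINT x|lborel. ?n \<xi> * cnj (f x) * (exp (\<i> * complex_of_real (x * \<xi>)) * ft1 f \<xi>))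
      = ?n \<xi> * ft1 f \<xi> * (of_real (sqrt (2*pi)) * cnj (ft1 f \<xi>))" .
    show "of_real (sqrt (2*pi)) * ?n \<xi> * ft1 f \<xi> * cnj (ft1 f \<xi>) =
       (LINT x|lborel. ?n \<xi> * cnj (f x) * (exp (\<i> * complex_of_real (x * \<xi>)) * ft1 f \<xi>))"
      unfolding 2 by (simp only: mult_ac)
  qed
  also have "\<dots> = (LINT x|lborel. (LINT \<xi>|lborel. ?n \<xi> * cnj (f x) * (exp (\<i> * complex_of_real (x * \<xi>)) * ft1 f \<xi>)))"
    using lborel_pair.Fubini_integral[OF int] by simp
  also have "\<dots> = (LINT x|lborel. cnj (f x) * (LINT \<xi>|lborel. ?n \<xi> * (exp (\<i> * complex_of_real (x * \<xi>)) * ft1 f \<xi>)))"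
    by (intro Bochner_Integration.integral_cong refl)
      (subst integral_mult_right_zero[symmetric], intro Bochner_Integration.integral_cong refl, simp add: mult_ac)
  also have "\<dots> = ?R"
    by (simp only: ft1_gauss_inverse[OF f \<delta>])
  finally show ?thesis .
qed

section \<open>Plancherel's identity for bounded, compactly supported, almost everywhere continuous
  functions\<close>

definition bdd_ae_cont :: "(real \<Rightarrow> complex) \<Rightarrow> bool" where
  "bdd_ae_cont f \<longleftrightarrow> f \<in> borel_measurable borel \<and> (\<exists>M. \<forall>x. norm (f x) \<le> M) \<and>
     (\<exists>R. \<forall>x. R < \<bar>x\<bar> \<longrightarrow> f x = 0) \<and> (AE x in lborel. isCont f x)"

lemma bdd_ae_cont_integrable:
  assumes "bdd_ae_cont f" shows "integrable lborel f"
proof -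
  obtain M R where [measurable]: "f \<in> borel_measurable borel" and M: "\<And>x. norm (f x) \<le> M"
    and R: "\<And>x. R < \<bar>x\<bar> \<Longrightarrow> f x = 0"
    using assms unfolding bdd_ae_cont_def by auto
  have i: "integrable lborel (\<lambda>x. indicator {-R..R} x *\<^sub>R M)"
    using borel_integrable_compact[of "{-R..R}" "\<lambda>_. M"] by simp
  show ?thesis
  proof (rule Bochner_Integration.integrable_bound[OF i])
    have "norm (f x) \<le> norm (indicator {-R..R} x *\<^sub>R M)" for x
      using M[of x] R[of x] norm_ge_zero[of "f x"] by (cases "\<bar>x\<bar> \<le> R") (auto simp: indicator_def)
    then show "AE x in lborel. norm (f x) \<le> norm (indicator {-R..R} x *\<^sub>R M)" by simp
  qed measurable
qed

lemma bdd_ae_cont_diff: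
  assumes "bdd_ae_cont f" "bdd_ae_cont g" shows "bdd_ae_cont (\<lambda>x. f x - g x)"
proof -
  obtain M R where 1: "f \<in> borel_measurable borel" "\<And>x. norm (f x) \<le> M"
    "\<And>x. R < \<bar>x\<bar> \<Longrightarrow> f x = 0" "AE x in lborel. isCont f x"
    using assms unfolding bdd_ae_cont_def by auto
  obtain M' R' where 2: "g \<in> borel_measurable borel" "\<And>x. norm (g x) \<le> M'"
    "\<And>x. R' < \<bar>x\<bar> \<Longrightarrow> g x = 0" "AE x in lborel. isCont g x"
    using assms unfolding bdd_ae_cont_def by auto
  have "norm (f x - g x) \<le> M + M'" for x
    using 1(2)[of x] 2(2)[of x] norm_triangle_ineq4[of "f x" "g x"] by linarith
  moreover have "max R R' < \<bar>x\<bar> \<longrightarrow> f x - g x = 0" for x using 1(3)[of x] 2(3)[of x] by auto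
  moreover have "AE x in lborel. isCont (\<lambda>x. f x - g x) x"
    using 1(4) 2(4) by eventually_elim (rule continuous_diff)
  moreover have "(\<lambda>x. f x - g x) \<in> borel_measurable borel" using 1(1) 2(1) by (rule borel_measurable_diff)
  ultimately show ?thesis unfolding bdd_ae_cont_def by blast
qed

text \<open>Let the width of the damping tend to 0 in \<open>ft1_gauss_energy\<close>. On the
  frequency side monotone convergence applies; on the space side the Gaussian averages of
  \<open>f\<close> converge at every point of continuity and are dominated. Almost everywhere
  continuity is therefore the regularity required, and sharp cutoffs of continuous functions have
  it.\<close>

lemma plancherel_bdd_ae_cont:
  assumes "bdd_ae_cont f" shows "sq_nn (ft1 f) = sq_nn f"
proof -
  obtain M R where [measurable]: "f \<in> borel_measurable borel" and M: "\<And>x. norm (f x) \<le> M"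
    and R: "\<And>x. R < \<bar>x\<bar> \<Longrightarrow> f x = 0" and C: "AE x in lborel. isCont f x"
    using assms unfolding bdd_ae_cont_def by auto
  have M0: "M \<ge> 0" using M[of 0] norm_ge_zero order_trans by blast
  have f: "integrable lborel f" by (rule bdd_ae_cont_integrable[OF assms])
  \<comment> \<open>Decreasing widths make the damping factors increase, so the energy converges
    although square integrability of \<open>ft1 f\<close> is not yet known.\<close>
  define \<delta> where "\<delta> n = 1 / real (Suc n)" for n
  have \<delta>: "\<delta> n > 0" for n by (simp add: \<delta>_def)
  have \<delta>0: "\<delta> \<longlonglongrightarrow> 0" unfolding \<delta>_def by (rule LIMSEQ_Suc) (rule lim_1_over_n)
  define A where "A n y = (LINT s|lborel. f (y - \<delta> n * s) * complex_of_real (std_normal_density s))" for n y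
  have Am[measurable]: "A n \<in> borel_measurable borel" for n unfolding A_def by measurable
  have AM: "norm (A n y) \<le> M" for n y
  proof -
    have i: "integrable lborel (\<lambda>s. M * std_normal_density s)" using integrable_std_normal by simp
    have "norm (A n y) \<le> (LINT s|lborel. M * std_normal_density s)"
      unfolding A_def by (rule Bochner_Integration.integral_norm_bound_integral)
        (use i M0 in \<open>auto simp: norm_mult abs_mult M mult_right_mono intro!: Bochner_Integration.integrable_bound[OF i]\<close>)
    then show ?thesis using integral_std_normal by simp
  qed
  have Alim: "(\<lambda>n. A n y) \<longlonglongrightarrow> f y" if c: "isCont f y" for y
  proof -
    have "(\<lambda>n. A n y) \<longlonglongrightarrow> (LINT s|lborel. f y * complex_of_real (std_normal_density s))"
      unfolding A_def
    proof (rule integral_dominated_convergence[where w="\<lambda>s. M * std_normal_density s"])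
      show "integrable lborel (\<lambda>s. M * std_normal_density s)" using integrable_std_normal by simp
      have "(\<lambda>n. f (y - \<delta> n * s) * complex_of_real (std_normal_density s)) \<longlonglongrightarrow> f y * complex_of_real (std_normal_density s)" for s
      proof -
        have "(\<lambda>n. y - \<delta> n * s) \<longlonglongrightarrow> y - 0 * s" by (intro tendsto_intros \<delta>0)
        then have "(\<lambda>n. f (y - \<delta> n * s)) \<longlonglongrightarrow> f y" using isCont_tendsto_compose[OF c] by simp
        then show ?thesis by (intro tendsto_intros)
      qed
      then show "AE s in lborel. (\<lambda>n. f (y - \<delta> n * s) * complex_of_real (std_normal_density s)) \<longlonglongrightarrow> f y * complex_of_real (std_normal_density s)"
        by simp
    qed (auto simp: norm_mult M mult_right_mono)
    moreover have "(LINT s|lborel. complex_of_real (std_normal_density s)) = 1"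
      using integral_std_normal by (simp add: integral_of_real)
    ultimately show ?thesis by simp
  qed
  have "(\<lambda>n. LINT y|lborel. cnj (f y) * A n y) \<longlonglongrightarrow> (LINT y|lborel. cnj (f y) * f y)"
  proof (rule integral_dominated_convergence[where w="\<lambda>y. M * norm (f y)"])
    show "integrable lborel (\<lambda>y. M * norm (f y))" using f by simp
    show "AE y in lborel. (\<lambda>n. cnj (f y) * A n y) \<longlonglongrightarrow> cnj (f y) * f y"
      using C by eventually_elim (intro tendsto_intros Alim)
    show "AE y in lborel. norm (cnj (f y) * A n y) \<le> M * norm (f y)" for n
      using AM by (auto simp: norm_mult mult.commute[of M] mult_left_mono)
  qed measurable
  moreover have "(LINT y|lborel. cnj (f y) * f y) = complex_of_real (LINT y|lborel. (norm (f y))\<^sup>2)"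
    by (subst integral_complex_of_real[symmetric]) (simp only: complex_norm_square mult.commute)
  ultimately have lim1: "(\<lambda>n. LINT y|lborel. cnj (f y) * A n y) \<longlonglongrightarrow> complex_of_real (LINT y|lborel. (norm (f y))\<^sup>2)" by simp
  define c where "c = 1 / sqrt (2 * pi) * (LINT x|lborel. norm (f x))"
  have ftb: "(norm (ft1 f \<xi>))\<^sup>2 \<le> c\<^sup>2" for \<xi> using ft1_bounded[OF f, of \<xi>] unfolding c_def by (intro power_mono) auto
  define E where "E n \<xi> = exp (- (\<delta> n * \<xi>)\<^sup>2 / 2) * (norm (ft1 f \<xi>))\<^sup>2" for n \<xi>
  have Em[measurable]: "E n \<in> borel_measurable borel" for n unfolding E_def by measurable
  have Eint: "integrable lborel (E n)" for n
  proof -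
    have "integrable lborel (\<lambda>\<xi>. std_normal_density (0 + \<delta> n * \<xi>))"
      using \<delta>[of n] by (intro lborel_integrable_real_affine integrable_std_normal) auto
    then have i: "integrable lborel (\<lambda>\<xi>. (sqrt (2*pi) * c\<^sup>2) * std_normal_density (0 + \<delta> n * \<xi>))" by simp
    show ?thesis
      by (rule Bochner_Integration.integrable_bound[OF i])
        (auto simp: E_def normal_density_def ftb mult.commute[of _ "exp _"])
  qed
  have Eeq: "complex_of_real (LINT \<xi>|lborel. E n \<xi>) = (LINT y|lborel. cnj (f y) * A n y)" for n
    unfolding A_def ft1_gauss_energy[OF f \<delta>, symmetric] E_def
    by (subst integral_complex_of_real[symmetric]) (simp only: of_real_mult complex_norm_square)
  have "(\<lambda>n. complex_of_real (LINT \<xi>|lborel. E n \<xi>)) \<longlonglongrightarrow> complex_of_real (LINT y|lborel. (norm (f y))\<^sup>2)"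
    using lim1 unfolding Eeq .
  then have "(\<lambda>n. LINT \<xi>|lborel. E n \<xi>) \<longlonglongrightarrow> (LINT y|lborel. (norm (f y))\<^sup>2)"
    using tendsto_of_real_iff by blast
  then have l1: "(\<lambda>n. ennreal (LINT \<xi>|lborel. E n \<xi>)) \<longlonglongrightarrow> ennreal (LINT y|lborel. (norm (f y))\<^sup>2)"
    by (rule tendsto_ennrealI)
  have "integrable lborel (\<lambda>y. (norm (f y))\<^sup>2)"
  proof (rule Bochner_Integration.integrable_bound)
    show "integrable lborel (\<lambda>y. M * norm (f y))" using f by simp
    show "AE y in lborel. norm ((norm (f y))\<^sup>2) \<le> norm (M * norm (f y))"
      using M M0 by (auto simp: power2_eq_square mult_right_mono)
  qed measurable
  then have r: "ennreal (LINT y|lborel. (norm (f y))\<^sup>2) = sq_nn f"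
    unfolding sq_nn_def by (subst nn_integral_eq_integral) auto
  have l: "ennreal (LINT \<xi>|lborel. E n \<xi>) = (\<integral>\<^sup>+\<xi>. ennreal (E n \<xi>) \<partial>lborel)" for n
    using Eint by (subst nn_integral_eq_integral) (auto simp: E_def)
  have "(\<lambda>n. \<integral>\<^sup>+\<xi>. ennreal (E n \<xi>) \<partial>lborel) \<longlonglongrightarrow> sq_nn (ft1 f)"
    unfolding sq_nn_def
  proof (rule nn_integral_LIMSEQ)
    have "(\<delta> (Suc n) * \<xi>)\<^sup>2 \<le> (\<delta> n * \<xi>)\<^sup>2" for n \<xi>
      unfolding power_mult_distrib using \<delta>[of "Suc n"]
      by (intro mult_right_mono power_mono) (auto simp: \<delta>_def field_simps)
    then have "E n \<xi> \<le> E (Suc n) \<xi>" for n \<xi> unfolding E_def by (intro mult_right_mono) auto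
    then show "incseq (\<lambda>n \<xi>. ennreal (E n \<xi>))"
      by (intro incseq_SucI) (auto simp: le_fun_def intro!: ennreal_leI)
    fix \<xi>
    have "(\<lambda>n. E n \<xi>) \<longlonglongrightarrow> exp (- (0 * \<xi>)\<^sup>2 / 2) * (norm (ft1 f \<xi>))\<^sup>2"
      unfolding E_def by (intro tendsto_intros \<delta>0) auto
    then show "(\<lambda>n. ennreal (E n \<xi>)) \<longlonglongrightarrow> ennreal ((norm (ft1 f \<xi>))\<^sup>2)"
      by (intro tendsto_ennrealI) simp
  qed measurable
  with l1 show ?thesis unfolding l r by (rule LIMSEQ_unique[symmetric])
qed

section \<open>Squared L2 norms with values in [0, infinity]: limits and completeness\<close>

lemma sq_norm_add_le:
  fixes a b :: complex
  assumes "\<eta> > 0"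
  shows "(norm (a + b))\<^sup>2 \<le> (1 + \<eta>) * (norm a)\<^sup>2 + (1 + 1 / \<eta>) * (norm b)\<^sup>2"
proof -
  have "(norm (a + b))\<^sup>2 \<le> (norm a + norm b)\<^sup>2" by (intro power_mono norm_triangle_ineq) auto
  also have "\<dots> = (norm a)\<^sup>2 + (norm b)\<^sup>2 + 2 * norm a * norm b" by (simp add: power2_sum)
  also have "2 * norm a * norm b \<le> \<eta> * (norm a)\<^sup>2 + (1 / \<eta>) * (norm b)\<^sup>2"
  proof -
    have "0 \<le> (sqrt \<eta> * norm a - norm b / sqrt \<eta>)\<^sup>2" by simp
    also have "\<dots> = \<eta> * (norm a)\<^sup>2 + (1 / \<eta>) * (norm b)\<^sup>2 - 2 * norm a * norm b"
      using assms by (simp add: power2_diff power_mult_distrib power_divide)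
    finally show ?thesis by simp
  qed
  finally show ?thesis by (simp add: algebra_simps)
qed

text \<open>The weight \<open>\<eta>\<close> serves two purposes: \<open>\<eta> = 1\<close> gives
  the crude triangle inequality with factor 2, and \<open>\<eta>\<close> tending to 0 brings the
  factor of the leading term to 1, which yields exact limits of norms.\<close>

lemma sq_nn_add_le:
  assumes [measurable]: "f \<in> borel_measurable borel" "g \<in> borel_measurable borel" and \<eta>: "\<eta> > 0"
  shows "sq_nn (\<lambda>x. f x + g x) \<le> ennreal (1 + \<eta>) * sq_nn f + ennreal (1 + 1 / \<eta>) * sq_nn g"
proof -
  have "sq_nn (\<lambda>x. f x + g x) \<le> (\<integral>\<^sup>+x. ennreal (1 + \<eta>) * ennreal ((norm (f x))\<^sup>2) + ennreal (1 + 1 / \<eta>) * ennreal ((norm (g x))\<^sup>2) \<partial>lborel)"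
    unfolding sq_nn_def
    using sq_norm_add_le[OF \<eta>] \<eta>
    by (intro nn_integral_mono) (simp add: ennreal_mult[symmetric] ennreal_plus[symmetric] del: ennreal_plus)
  also have "\<dots> = ennreal (1 + \<eta>) * sq_nn f + ennreal (1 + 1 / \<eta>) * sq_nn g"
    unfolding sq_nn_def by (subst nn_integral_add) (auto simp: nn_integral_cmult)
  finally show ?thesis .
qed

lemma sq_nn_diff_le:
  assumes [measurable]: "f \<in> borel_measurable borel" "g \<in> borel_measurable borel" "h \<in> borel_measurable borel"
  shows "sq_nn (\<lambda>x. f x - h x) \<le> 2 * sq_nn (\<lambda>x. f x - g x) + 2 * sq_nn (\<lambda>x. g x - h x)"
  using sq_nn_add_le[of "\<lambda>x. f x - g x" "\<lambda>x. g x - h x" 1] by simp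

lemma sq_nn_commute: "sq_nn (\<lambda>x. f x - g x) = sq_nn (\<lambda>x. g x - f x)"
  unfolding sq_nn_def by (simp add: norm_minus_commute)

lemma square_integrable_iff:
  "square_integrable f \<longleftrightarrow> f \<in> borel_measurable borel \<and> sq_nn f < \<infinity>"
  unfolding square_integrable_def sq_nn_def by (auto simp: integrable_iff_bounded)

lemma sq_nn_eq_LINT:
  assumes "square_integrable f"
  shows "sq_nn f = ennreal (LINT x|lborel. (norm (f x))\<^sup>2)"
  using assms unfolding square_integrable_def sq_nn_def by (subst nn_integral_eq_integral) auto

lemma tendsto_0_le_2_2:
  fixes a b c :: "'i \<Rightarrow> ennreal"
  assumes "(a \<longlongrightarrow> 0) F" "(b \<longlongrightarrow> 0) F" "\<forall>\<^sub>F i in F. c i \<le> 2 * a i + 2 * b i"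
  shows "(c \<longlongrightarrow> 0) F"
proof (rule tendsto_sandwich[of "\<lambda>_. 0" c F "\<lambda>i. 2 * a i + 2 * b i" 0])
  have "((\<lambda>i. 2 * a i + 2 * b i) \<longlongrightarrow> 2 * 0 + 2 * 0) F"
    by (intro tendsto_add ennreal_tendsto_cmult assms) auto
  then show "((\<lambda>i. 2 * a i + 2 * b i) \<longlongrightarrow> 0) F" by simp
qed (use assms in auto)

lemma le_of_le_mult_ennreal:
  fixes a c :: ennreal
  assumes "\<And>\<eta>. \<eta> > 0 \<Longrightarrow> a \<le> ennreal (1 + \<eta>) * c"
  shows "a \<le> c"
proof -
  have "(\<lambda>n. ennreal (1 + 1 / real (Suc n)) * c) \<longlonglongrightarrow> ennreal (1 + 0) * c"
    by (intro tendsto_mult_ennreal tendsto_ennrealI tendsto_add tendsto_const LIMSEQ_Suc[OF lim_1_over_n]) auto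
  then have "(\<lambda>n. ennreal (1 + 1 / real (Suc n)) * c) \<longlonglongrightarrow> c" by simp
  then show ?thesis
    by (rule tendsto_lowerbound) (use assms in \<open>auto intro!: always_eventually\<close>)
qed

text \<open>For fixed \<open>\<eta>\<close> the error term vanishes in the limit, however large its
  factor 1 + 1 / \<eta>; only afterwards is \<open>\<eta>\<close> sent to 0. Both inequalities come
  from the same weighted estimate with the roles of \<open>G\<close> and \<open>T i\<close>
  exchanged.\<close>

lemma sq_nn_lim:
  assumes ne: "F \<noteq> bot"
    and [measurable]: "\<And>i. T i \<in> borel_measurable borel" "G \<in> borel_measurable borel"
    and 0: "((\<lambda>i. sq_nn (\<lambda>x. T i x - G x)) \<longlongrightarrow> 0) F" and c: "((\<lambda>i. sq_nn (T i)) \<longlongrightarrow> c) F"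
  shows "sq_nn G = c"
proof (rule antisym)
  have *: "((\<lambda>i. ennreal (1 + 1 / \<eta>) * sq_nn (\<lambda>x. T i x - G x)) \<longlongrightarrow> ennreal (1 + 1 / \<eta>) * 0) F" if "\<eta> > 0" for \<eta>
    by (intro ennreal_tendsto_cmult 0) auto
  show "sq_nn G \<le> c"
  proof (rule le_of_le_mult_ennreal)
    fix \<eta> :: real assume \<eta>: "\<eta> > 0"
    have lim: "((\<lambda>i. ennreal (1 + \<eta>) * sq_nn (T i) + ennreal (1 + 1 / \<eta>) * sq_nn (\<lambda>x. T i x - G x))
       \<longlongrightarrow> ennreal (1 + \<eta>) * c + ennreal (1 + 1 / \<eta>) * 0) F"
      by (intro tendsto_add *[OF \<eta>] ennreal_tendsto_cmult c) auto
    have "sq_nn G \<le> ennreal (1 + \<eta>) * sq_nn (T i) + ennreal (1 + 1 / \<eta>) * sq_nn (\<lambda>x. T i x - G x)" for i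
      using sq_nn_add_le[OF _ _ \<eta>, of "T i" "\<lambda>x. G x - T i x"] by (simp add: sq_nn_commute)
    from tendsto_lowerbound[OF lim always_eventually ne] this show "sq_nn G \<le> ennreal (1 + \<eta>) * c" by auto
  qed
  show "c \<le> sq_nn G"
  proof (rule le_of_le_mult_ennreal)
    fix \<eta> :: real assume \<eta>: "\<eta> > 0"
    have lim: "((\<lambda>i. ennreal (1 + \<eta>) * sq_nn G + ennreal (1 + 1 / \<eta>) * sq_nn (\<lambda>x. T i x - G x))
       \<longlongrightarrow> ennreal (1 + \<eta>) * sq_nn G + ennreal (1 + 1 / \<eta>) * 0) F"
      by (intro tendsto_add *[OF \<eta>] tendsto_const)
    have "sq_nn (T i) \<le> ennreal (1 + \<eta>) * sq_nn G + ennreal (1 + 1 / \<eta>) * sq_nn (\<lambda>x. T i x - G x)" for i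
      using sq_nn_add_le[OF _ _ \<eta>, of G "\<lambda>x. T i x - G x"] by simp
    then have "c \<le> ennreal (1 + \<eta>) * sq_nn G + ennreal (1 + 1 / \<eta>) * 0"
      by (intro tendsto_le[OF ne lim c] always_eventually) auto
    then show "c \<le> ennreal (1 + \<eta>) * sq_nn G" by simp
  qed
qed

lemma sq_nn_0_AE:
  assumes "f \<in> borel_measurable borel" "g \<in> borel_measurable borel" "sq_nn (\<lambda>x. f x - g x) = 0"
  shows "AE x in lborel. f x = g x"
proof -
  have "(\<lambda>x. ennreal ((norm (f x - g x))\<^sup>2)) \<in> borel_measurable borel" using assms by measurable
  then have "(\<lambda>x. ennreal ((norm (f x - g x))\<^sup>2)) \<in> borel_measurable lborel" by simp
  from nn_integral_0_iff_AE[OF this] have "AE x in lborel. ennreal ((norm (f x - g x))\<^sup>2) = 0"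
    using assms(3) by (simp add: sq_nn_def)
  then show ?thesis by eventually_elim simp
qed

lemma sq_nn_cong_AE:
  assumes "AE x in lborel. f x = g x" shows "sq_nn f = sq_nn g"
  unfolding sq_nn_def using assms by (intro nn_integral_cong_AE) auto

text \<open>Lower semicontinuity of the norm. It carries bounds from difference quotients to
  derivatives and from almost every time to every time, without knowing beforehand that the limit
  lies in L2.\<close>

lemma sq_nn_fatou:
  assumes [measurable]: "\<And>n. f n \<in> borel_measurable borel"
    and lim: "AE x in lborel. (\<lambda>n::nat. f n x) \<longlonglongrightarrow> g x" and B: "\<And>n. sq_nn (f n) \<le> C"
  shows "sq_nn g \<le> C"
proof -
  have "sq_nn g = (\<integral>\<^sup>+x. liminf (\<lambda>n. ennreal ((norm (f n x))\<^sup>2)) \<partial>lborel)"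
    unfolding sq_nn_def
  proof (rule nn_integral_cong_AE, use lim in eventually_elim)
    fix x assume "(\<lambda>n. f n x) \<longlonglongrightarrow> g x"
    then have "(\<lambda>n. ennreal ((norm (f n x))\<^sup>2)) \<longlonglongrightarrow> ennreal ((norm (g x))\<^sup>2)"
      by (intro tendsto_intros)
    then show "ennreal ((norm (g x))\<^sup>2) = liminf (\<lambda>n. ennreal ((norm (f n x))\<^sup>2))"
      by (rule lim_imp_Liminf[symmetric, OF trivial_limit_sequentially])
  qed
  also have "\<dots> \<le> liminf (\<lambda>n. sq_nn (f n))"
    unfolding sq_nn_def by (rule nn_integral_liminf) measurable
  also have "\<dots> \<le> C" using B
    by (intro Liminf_le) auto
  finally show ?thesis .
qed

text \<open>The Riesz-Fischer argument: a sufficiently fast subsequence converges almost everywhere,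
  and Fatou's lemma upgrades this to convergence of the whole sequence in L2.\<close>

lemma L2_Cauchy_converges:
  assumes m[measurable]: "\<And>n. F n \<in> borel_measurable borel"
    and C: "\<And>e. e > 0 \<Longrightarrow> \<exists>N. \<forall>m\<ge>N. \<forall>n\<ge>N. sq_nn (\<lambda>x. F m x - F n x) \<le> ennreal e"
  shows "\<exists>G. G \<in> borel_measurable borel \<and> (\<lambda>n. sq_nn (\<lambda>x. F n x - G x)) \<longlonglongrightarrow> 0"
proof -
  \<comment> \<open>With squared distances below 8^-k, the increments weighted by 4^k have summable
    integrals 2^-k. Finiteness of the weighted sum then bounds the k-th increment by a multiple of
    2^-k at almost every point.\<close>
  have "\<exists>N. \<forall>m\<ge>N. \<forall>n\<ge>N. sq_nn (\<lambda>x. F m x - F n x) \<le> ennreal ((1/8)^k)" for k by (rule C) simp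
  then obtain N where N: "\<And>k m n. m \<ge> N k \<Longrightarrow> n \<ge> N k \<Longrightarrow> sq_nn (\<lambda>x. F m x - F n x) \<le> ennreal ((1/8)^k)"
    by metis
  \<comment> \<open>Adding up the thresholds makes \<open>r k\<close> and \<open>r (Suc k)\<close>
    both exceed \<open>N k\<close>; the summand \<open>k\<close> sends the subsequence to
    infinity.\<close>
  define r where "r k = (\<Sum>i\<le>k. N i) + k" for k
  have rN: "r k \<ge> N k" for k unfolding r_def by (rule trans_le_add1) (rule member_le_sum, auto)
  have rS: "r (Suc k) \<ge> N k" for k using rN[of k] by (simp add: r_def)
  have rk: "r k \<ge> k" for k by (simp add: r_def)
  have p4: "((2::real)^k)\<^sup>2 = 4^k" for k by (simp add: power2_eq_square flip: power_mult_distrib)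
  define h where "h k x = ennreal (4^k * (norm (F (r (Suc k)) x - F (r k) x))\<^sup>2)" for k x
  have [measurable]: "h k \<in> borel_measurable borel" for k unfolding h_def by measurable
  have hk: "(\<integral>\<^sup>+x. h k x \<partial>lborel) \<le> ennreal ((1/2)^k)" for k
  proof -
    have "(\<integral>\<^sup>+x. h k x \<partial>lborel) = ennreal (4^k) * sq_nn (\<lambda>x. F (r (Suc k)) x - F (r k) x)"
      unfolding h_def sq_nn_def by (subst nn_integral_cmult[symmetric]) (auto simp: ennreal_mult)
    also have "\<dots> \<le> ennreal (4^k) * ennreal ((1/8)^k)" by (intro mult_left_mono N rN rS) auto
    also have "\<dots> = ennreal ((1/2)^k)"
      by (subst ennreal_mult[symmetric]) (auto simp: power_mult_distrib[symmetric])
    finally show ?thesis .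
  qed
  have "(\<integral>\<^sup>+x. (\<Sum>k. h k x) \<partial>lborel) = (\<Sum>k. \<integral>\<^sup>+x. h k x \<partial>lborel)"
    by (rule nn_integral_suminf) measurable
  also have "\<dots> \<le> (\<Sum>k. ennreal ((1/2)^k))" by (intro suminf_le hk) auto
  also have "\<dots> = ennreal (\<Sum>k. (1/2)^k)" by (intro suminf_ennreal2 summable_geometric) auto
  finally have "(\<integral>\<^sup>+x. (\<Sum>k. h k x) \<partial>lborel) \<noteq> \<infinity>" by (auto simp: top_unique)
  then have "AE x in lborel. (\<Sum>k. h k x) \<noteq> \<infinity>" by (intro nn_integral_PInf_AE) auto
  then have AEC: "AE x in lborel. convergent (\<lambda>k. F (r k) x)"
  proof eventually_elim
    fix x assume a: "(\<Sum>k. h k x) \<noteq> \<infinity>"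
    define S where "S = enn2real (\<Sum>k. h k x)"
    have S: "(\<Sum>k. h k x) = ennreal S" unfolding S_def using a by (simp add: less_top)
    have S0: "S \<ge> 0" by (simp add: S_def)
    have b: "norm (F (r (Suc k)) x - F (r k) x) \<le> sqrt S * (1/2)^k" for k
    proof -
      have "h k x \<le> (\<Sum>k. h k x)" using sum_le_suminf[of "\<lambda>k. h k x" "{k}"] by simp
      then have "h k x \<le> ennreal S" unfolding S .
      then have "4^k * (norm (F (r (Suc k)) x - F (r k) x))\<^sup>2 \<le> S"
        unfolding h_def using S0 by (simp add: ennreal_le_iff)
      then have "(2^k * norm (F (r (Suc k)) x - F (r k) x))\<^sup>2 \<le> S"
        using p4[of k] by (simp add: power_mult_distrib)
      then have "2^k * norm (F (r (Suc k)) x - F (r k) x) \<le> sqrt S" by (rule real_le_rsqrt)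
      then show ?thesis by (simp add: field_simps power_divide)
    qed
    have "summable (\<lambda>k. F (r (Suc k)) x - F (r k) x)"
      by (rule summable_comparison_test[of _ "\<lambda>k. sqrt S * (1/2)^k"])
        (use b in \<open>auto intro!: summable_mult summable_geometric\<close>)
    then have "convergent (\<lambda>n. \<Sum>k<n. F (r (Suc k)) x - F (r k) x)" by (simp add: summable_iff_convergent)
    then have "convergent (\<lambda>n. F (r n) x - F (r 0) x)" using sum_lessThan_telescope[of "\<lambda>k. F (r k) x"] by simp
    then have "convergent (\<lambda>n. (F (r n) x - F (r 0) x) + F (r 0) x)" by (intro convergent_add convergent_const)
    then show "convergent (\<lambda>k. F (r k) x)" by simp
  qed
  define G where "G x = lim (\<lambda>k. F (r k) x)" for x
  have [measurable]: "G \<in> borel_measurable borel" unfolding G_def by measurable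
  have AEL: "AE x in lborel. (\<lambda>k. F (r k) x) \<longlonglongrightarrow> G x"
    using AEC unfolding G_def by eventually_elim (simp add: convergent_LIMSEQ_iff)
  \<comment> \<open>Fatou's lemma along the subsequence with one index frozen. The shift by
    \<open>M\<close> keeps all indices in the range where the Cauchy bound holds.\<close>
  have *: "sq_nn (\<lambda>x. F m x - G x) \<le> ennreal e" if m: "m \<ge> M" and M: "\<And>m n. m \<ge> M \<Longrightarrow> n \<ge> M \<Longrightarrow> sq_nn (\<lambda>x. F m x - F n x) \<le> ennreal e" for m e M
  proof (rule sq_nn_fatou)
    show "AE x in lborel. (\<lambda>n. F m x - F (r (n + M)) x) \<longlonglongrightarrow> F m x - G x"
      using AEL by eventually_elim (intro tendsto_intros LIMSEQ_ignore_initial_segment[of "\<lambda>k. F (r k) _"])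
    have "r (n + M) \<ge> M" for n using rk[of "n+M"] by simp
    then show "sq_nn (\<lambda>x. F m x - F (r (n + M)) x) \<le> ennreal e" for n by (intro M m)
  qed measurable
  have "(\<lambda>n. sq_nn (\<lambda>x. F n x - G x)) \<longlonglongrightarrow> 0"
  proof (rule order_tendstoI)
    fix a :: ennreal assume "0 < a"
    then obtain e where e: "e > 0" "ennreal e < a"
    proof (cases a rule: ennreal_cases)
      case (real r)
      then show ?thesis using \<open>0 < a\<close> by (intro that[of "r/2"]) (auto simp: ennreal_less_iff)
    next
      case top
      then show ?thesis by (intro that[of 1]) auto
    qed
    obtain M where M: "\<And>m n. m \<ge> M \<Longrightarrow> n \<ge> M \<Longrightarrow> sq_nn (\<lambda>x. F m x - F n x) \<le> ennreal e" using C[OF e(1)] by blast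
    show "\<forall>\<^sub>F n in sequentially. sq_nn (\<lambda>x. F n x - G x) < a"
      using *[OF _ M] e(2) by (intro eventually_sequentiallyI[of M]) (meson le_less_trans)
  qed auto
  then show ?thesis by (intro exI[of _ G]) simp
qed

section \<open>The L2 transform: existence, uniqueness and Plancherel's identity\<close>

definition cutoff :: "real \<Rightarrow> real \<Rightarrow> (real \<Rightarrow> complex) \<Rightarrow> real \<Rightarrow> complex" where
  "cutoff a b f x = indicator {a..b} x *\<^sub>R f x"

lemma truncated_fourier_eq: "truncated_fourier R f = ft1 (cutoff (-R) R f)"
  unfolding truncated_fourier_def ft1_def set_lebesgue_integral_def cutoff_def
  by (intro ext arg_cong2[where f="(*)"] refl Bochner_Integration.integral_cong) (simp add: indicator_def)

text \<open>The only possible jumps are at the two end points, which form a null set.\<close>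

lemma cutoff_bdd_ae_cont:
  assumes f: "continuous_on UNIV f" shows "bdd_ae_cont (cutoff a b f)"
proof -
  have [measurable]: "f \<in> borel_measurable borel" by (rule borel_measurable_continuous_onI[OF f])
  have "bounded (f ` {a..b})"
    by (intro compact_imp_bounded compact_continuous_image continuous_on_subset[OF f]) auto
  then obtain M where M: "\<And>x. x \<in> {a..b} \<Longrightarrow> norm (f x) \<le> M" unfolding bounded_iff by blast
  have 1: "norm (cutoff a b f x) \<le> \<bar>M\<bar>" for x using M[of x] by (auto simp: cutoff_def indicator_def)
  have 2: "max \<bar>a\<bar> \<bar>b\<bar> < \<bar>x\<bar> \<longrightarrow> cutoff a b f x = 0" for x by (auto simp: cutoff_def indicator_def)
  have "AE x in lborel. x \<notin> {a, b}" by (intro AE_not_in) (simp add: finite_imp_null_set_lborel)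
  then have "AE x in lborel. isCont (cutoff a b f) x"
  proof eventually_elim
    fix x assume x: "x \<notin> {a, b}"
    have fx: "isCont f x" using f by (simp add: continuous_on_eq_continuous_at)
    consider "x < a" | "x > b" | "a < x" "x < b" using x by fastforce
    then show "isCont (cutoff a b f) x"
    proof cases
      case 1
      have "\<forall>\<^sub>F y in nhds x. y < a" using 1 by (intro eventually_nhds_in_open[of "{..<a}" x, simplified])
      then have "\<forall>\<^sub>F y in nhds x. cutoff a b f y = 0" by eventually_elim (auto simp: cutoff_def)
      then show ?thesis by (subst isCont_cong[where g="\<lambda>_. 0"]) auto
    next
      case 2
      have "\<forall>\<^sub>F y in nhds x. y > b" using 2 by (intro eventually_nhds_in_open[of "{b<..}" x, simplified])
      then have "\<forall>\<^sub>F y in nhds x. cutoff a b f y = 0" by eventually_elim (auto simp: cutoff_def)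
      then show ?thesis by (subst isCont_cong[where g="\<lambda>_. 0"]) auto
    next
      case 3
      have "\<forall>\<^sub>F y in nhds x. y \<in> {a<..<b}" using 3 by (intro eventually_nhds_in_open) auto
      then have "\<forall>\<^sub>F y in nhds x. cutoff a b f y = f y" by eventually_elim (auto simp: cutoff_def)
      then show ?thesis using fx by (subst isCont_cong[where g=f]) auto
    qed
  qed
  moreover have "cutoff a b f \<in> borel_measurable borel" unfolding cutoff_def by measurable
  ultimately show ?thesis unfolding bdd_ae_cont_def using 1 2 by blast
qed

text \<open>Continuity is what puts the cutoffs into the class \<open>bdd_ae_cont\<close>, so that
  no density argument is required to extend Plancherel's identity.\<close>

definition cont_L2 :: "(real \<Rightarrow> complex) \<Rightarrow> bool" where
  "cont_L2 f \<longleftrightarrow> continuous_on UNIV f \<and> square_integrable f"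

lemma cont_L2_measurable: "cont_L2 f \<Longrightarrow> f \<in> borel_measurable borel"
  unfolding cont_L2_def square_integrable_def by simp

lemma cutoff_measurable [measurable]:
  "f \<in> borel_measurable borel \<Longrightarrow> cutoff a b f \<in> borel_measurable borel"
  unfolding cutoff_def by measurable

text \<open>One scalar, on the second summand, covers all linear combinations: a multiple of
  \<open>f\<close> is written as \<open>f\<close> plus \<open>c - 1\<close> times \<open>f\<close>.
  This is the origin of the odd coefficients in later applications.\<close>

lemma cont_L2_add:
  assumes "cont_L2 f" "cont_L2 g" shows "cont_L2 (\<lambda>x. f x + c * g x)"
proof -
  have [measurable]: "f \<in> borel_measurable borel" "g \<in> borel_measurable borel"
    using assms by (simp_all add: cont_L2_measurable)
  have "sq_nn (\<lambda>x. f x + c * g x) \<le> ennreal (1 + 1) * sq_nn f + ennreal (1 + 1 / 1) * sq_nn (\<lambda>x. c * g x)"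
    by (rule sq_nn_add_le) auto
  also have "sq_nn (\<lambda>x. c * g x) = ennreal ((norm c)\<^sup>2) * sq_nn g"
    unfolding sq_nn_def by (subst nn_integral_cmult[symmetric]) (auto simp: norm_mult power_mult_distrib ennreal_mult)
  also have "ennreal (1 + 1) * sq_nn f + ennreal (1 + 1 / 1) * (ennreal ((norm c)\<^sup>2) * sq_nn g) < \<infinity>"
    using assms unfolding cont_L2_def square_integrable_iff by (simp add: ennreal_mult_less_top)
  finally have "sq_nn (\<lambda>x. f x + c * g x) < \<infinity>" .
  moreover have "continuous_on UNIV (\<lambda>x. f x + c * g x)"
    using assms unfolding cont_L2_def by (auto intro!: continuous_intros)
  ultimately show ?thesis by (auto simp: cont_L2_def square_integrable_iff)
qed

text \<open>The window is centred at \<open>h\<close> because translation by \<open>h\<close> turns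
  the symmetric cut at R into a cut to [h - R, h + R].\<close>

lemma cutoff_tail:
  assumes "square_integrable f"
  shows "((\<lambda>R. sq_nn (\<lambda>x. cutoff (h - R) (h + R) f x - f x)) \<longlongrightarrow> 0) at_top"
proof -
  have [measurable]: "f \<in> borel_measurable borel" and i: "integrable lborel (\<lambda>x. (norm (f x))\<^sup>2)"
    using assms unfolding square_integrable_def by auto
  have b: "(norm (cutoff (h - R) (h + R) f x - f x))\<^sup>2 \<le> (norm (f x))\<^sup>2" for R x
    by (auto simp: cutoff_def indicator_def)
  have "((\<lambda>R. LINT x|lborel. (norm (cutoff (h - R) (h + R) f x - f x))\<^sup>2) \<longlongrightarrow> (LINT x::real|lborel. 0)) at_top"
  proof (rule integral_dominated_convergence_at_top[where w="\<lambda>x. (norm (f x))\<^sup>2"])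
    have "((\<lambda>R. (norm (cutoff (h - R) (h + R) f x - f x))\<^sup>2) \<longlongrightarrow> 0) at_top" for x
    proof (rule tendsto_eventually)
      show "\<forall>\<^sub>F R in at_top. (norm (cutoff (h - R) (h + R) f x - f x))\<^sup>2 = 0"
        using eventually_ge_at_top[of "\<bar>x - h\<bar>"] by eventually_elim (auto simp: cutoff_def indicator_def)
    qed
    then show "AE x in lborel. ((\<lambda>R. (norm (cutoff (h - R) (h + R) f x - f x))\<^sup>2) \<longlongrightarrow> 0) at_top" by simp
    show "\<forall>\<^sub>F R in at_top. AE x in lborel. norm ((norm (cutoff (h - R) (h + R) f x - f x))\<^sup>2) \<le> (norm (f x))\<^sup>2"
      using b by auto
  qed (use i in auto)
  then have "((\<lambda>R. ennreal (LINT x|lborel. (norm (cutoff (h - R) (h + R) f x - f x))\<^sup>2)) \<longlongrightarrow> ennreal 0) at_top"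
    by (intro tendsto_ennrealI) simp
  moreover have "ennreal (LINT x|lborel. (norm (cutoff (h - R) (h + R) f x - f x))\<^sup>2) = sq_nn (\<lambda>x. cutoff (h - R) (h + R) f x - f x)" for R
  proof (rule sq_nn_eq_LINT[symmetric])
    show "square_integrable (\<lambda>x. cutoff (h - R) (h + R) f x - f x)"
      unfolding square_integrable_def
      by (intro conjI Bochner_Integration.integrable_bound[OF i]) (use b in \<open>measurable, auto\<close>)
  qed
  ultimately show ?thesis by simp
qed

lemma ft1_diff:
  assumes "integrable lborel f" "integrable lborel g"
  shows "ft1 (\<lambda>x. f x - g x) \<xi> = ft1 f \<xi> - ft1 g \<xi>"
proof -
  have "(LINT x|lborel. exp (- \<i> * complex_of_real (x * \<xi>)) * (f x - g x))
    = (LINT x|lborel. exp (- \<i> * complex_of_real (x * \<xi>)) * f x - exp (- \<i> * complex_of_real (x * \<xi>)) * g x)"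
    by (simp only: right_diff_distrib)
  also have "\<dots> = (LINT x|lborel. exp (- \<i> * complex_of_real (x * \<xi>)) * f x) - (LINT x|lborel. exp (- \<i> * complex_of_real (x * \<xi>)) * g x)"
    by (intro Bochner_Integration.integral_diff integrable_iexp_mult assms)
  finally show ?thesis unfolding ft1_def by (simp only: right_diff_distrib)
qed

lemma plancherel_diff:
  assumes "bdd_ae_cont f" "bdd_ae_cont g"
  shows "sq_nn (\<lambda>\<xi>. ft1 f \<xi> - ft1 g \<xi>) = sq_nn (\<lambda>x. f x - g x)"
  using plancherel_bdd_ae_cont[OF bdd_ae_cont_diff[OF assms]]
  by (simp add: ft1_diff bdd_ae_cont_integrable assms sq_nn_def)

lemma bdd_ae_cont_measurable: "bdd_ae_cont f \<Longrightarrow> f \<in> borel_measurable borel"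
  by (simp add: bdd_ae_cont_def)

lemma is_fourier_transform_sq_nn:
  "is_fourier_transform f F \<longleftrightarrow> square_integrable F \<and>
     ((\<lambda>R. sq_nn (\<lambda>\<xi>. truncated_fourier R f \<xi> - F \<xi>)) \<longlongrightarrow> 0) at_top"
  unfolding is_fourier_transform_def sq_nn_def ..

text \<open>Plancherel's identity for differences of cutoffs turns the tail estimate for
  \<open>f\<close> into the Cauchy property of the truncated transforms, and completeness gives the
  limit.\<close>

lemma is_fourier_transform_exists:
  assumes f: "cont_L2 f" shows "\<exists>F. is_fourier_transform f F"
proof -
  have fc: "continuous_on UNIV f" and fs: "square_integrable f" using f by (auto simp: cont_L2_def)
  have [measurable]: "f \<in> borel_measurable borel" by (rule cont_L2_measurable[OF f])
  note c = cutoff_bdd_ae_cont[OF fc]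
  have T[measurable]: "truncated_fourier R f \<in> borel_measurable borel" for R
    unfolding truncated_fourier_eq by measurable
  have tail: "((\<lambda>R. sq_nn (\<lambda>x. cutoff (- R) R f x - f x)) \<longlongrightarrow> 0) at_top" using cutoff_tail[OF fs, of 0] by simp
  have D: "sq_nn (\<lambda>\<xi>. truncated_fourier R f \<xi> - truncated_fourier S f \<xi>)
      \<le> 2 * sq_nn (\<lambda>x. cutoff (- R) R f x - f x) + 2 * sq_nn (\<lambda>x. cutoff (- S) S f x - f x)" for R S
  proof -
    have "sq_nn (\<lambda>\<xi>. truncated_fourier R f \<xi> - truncated_fourier S f \<xi>) = sq_nn (\<lambda>x. cutoff (- R) R f x - cutoff (- S) S f x)"
      unfolding truncated_fourier_eq by (rule plancherel_diff[OF c c])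
    also have "\<dots> \<le> 2 * sq_nn (\<lambda>x. cutoff (- R) R f x - f x) + 2 * sq_nn (\<lambda>x. f x - cutoff (- S) S f x)"
      by (rule sq_nn_diff_le) measurable
    finally show ?thesis by (simp only: sq_nn_commute[of f])
  qed
  have tn: "(\<lambda>n. sq_nn (\<lambda>x. cutoff (- real n) (real n) f x - f x)) \<longlonglongrightarrow> 0"
    by (rule filterlim_compose[OF tail filterlim_real_sequentially])
  have "\<exists>G. G \<in> borel_measurable borel \<and> (\<lambda>n. sq_nn (\<lambda>\<xi>. truncated_fourier (real n) f \<xi> - G \<xi>)) \<longlonglongrightarrow> 0"
  proof (rule L2_Cauchy_converges)
    fix e :: real assume e: "e > 0"
    have "\<forall>\<^sub>F n in sequentially. sq_nn (\<lambda>x. cutoff (- real n) (real n) f x - f x) < ennreal (e/4)"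
      by (rule order_tendstoD(2)[OF tn]) (use e in simp)
    then obtain N where N: "\<And>n. n \<ge> N \<Longrightarrow> sq_nn (\<lambda>x. cutoff (- real n) (real n) f x - f x) \<le> ennreal (e/4)"
      unfolding eventually_sequentially by (meson less_imp_le)
    have "2 * ennreal (e/4) = ennreal (e/2)" using ennreal_mult[of 2 "e/4"] e by simp
    moreover have "ennreal (e/2) + ennreal (e/2) = ennreal e" using e by (subst ennreal_plus[symmetric]) auto
    ultimately have ee: "2 * ennreal (e/4) + 2 * ennreal (e/4) = ennreal e" by simp
    show "\<exists>N. \<forall>m\<ge>N. \<forall>n\<ge>N. sq_nn (\<lambda>x. truncated_fourier (real m) f x - truncated_fourier (real n) f x) \<le> ennreal e"
    proof (intro exI[of _ N] allI impI)
      fix m n assume mn: "N \<le> m" "N \<le> n"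
      have "2 * sq_nn (\<lambda>x. cutoff (- real m) (real m) f x - f x) + 2 * sq_nn (\<lambda>x. cutoff (- real n) (real n) f x - f x)
        \<le> 2 * ennreal (e/4) + 2 * ennreal (e/4)"
        by (intro add_mono mult_left_mono N mn) auto
      then show "sq_nn (\<lambda>x. truncated_fourier (real m) f x - truncated_fourier (real n) f x) \<le> ennreal e"
        unfolding ee by (rule order_trans[OF D])
    qed
  qed measurable
  then obtain G where [measurable]: "G \<in> borel_measurable borel"
    and G: "(\<lambda>n. sq_nn (\<lambda>\<xi>. truncated_fourier (real n) f \<xi> - G \<xi>)) \<longlonglongrightarrow> 0" by blast
  \<comment> \<open>Completeness was applied along integers only; a real \<open>R\<close> is
    compared with the integer above it, the difference being controlled by two tails of
    \<open>f\<close>.\<close>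
  have R: "((\<lambda>R. sq_nn (\<lambda>\<xi>. truncated_fourier R f \<xi> - G \<xi>)) \<longlongrightarrow> 0) at_top"
  proof -
    have fl: "filterlim (\<lambda>R :: real. nat \<lceil>R\<rceil>) at_top (at_top :: real filter)"
      unfolding filterlim_at_top
    proof
      fix Z :: nat
      show "\<forall>\<^sub>F R :: real in at_top. Z \<le> nat \<lceil>R\<rceil>"
        using eventually_ge_at_top[of "real Z"] by eventually_elim linarith
    qed
    have 1: "((\<lambda>R :: real. sq_nn (\<lambda>x. cutoff (- real (nat \<lceil>R\<rceil>)) (real (nat \<lceil>R\<rceil>)) f x - f x)) \<longlongrightarrow> 0) at_top"
      by (rule filterlim_compose[OF tn fl])
    have 2: "((\<lambda>R :: real. sq_nn (\<lambda>\<xi>. truncated_fourier (real (nat \<lceil>R\<rceil>)) f \<xi> - G \<xi>)) \<longlongrightarrow> 0) at_top"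
      by (rule filterlim_compose[OF G fl])
    have 3: "((\<lambda>R. sq_nn (\<lambda>\<xi>. truncated_fourier R f \<xi> - truncated_fourier (real (nat \<lceil>R\<rceil>)) f \<xi>)) \<longlongrightarrow> 0) at_top"
      by (rule tendsto_0_le_2_2[OF tail 1]) (use D in auto)
    show ?thesis
      by (rule tendsto_0_le_2_2[OF 3 2]) (intro always_eventually allI sq_nn_diff_le, measurable)
  qed
  have "sq_nn G < \<infinity>"
  proof -
    have "\<forall>\<^sub>F R in at_top. sq_nn (\<lambda>\<xi>. truncated_fourier R f \<xi> - G \<xi>) < 1"
      by (rule order_tendstoD(2)[OF R]) simp
    then obtain R where R1: "sq_nn (\<lambda>\<xi>. truncated_fourier R f \<xi> - G \<xi>) < 1"
      using eventually_happens by fastforce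
    have "sq_nn (truncated_fourier R f) = sq_nn (cutoff (-R) R f)"
      unfolding truncated_fourier_eq by (rule plancherel_bdd_ae_cont[OF c])
    also have "\<dots> \<le> sq_nn f" unfolding sq_nn_def by (intro nn_integral_mono) (auto simp: cutoff_def indicator_def)
    also have "\<dots> < \<infinity>" using fs by (simp add: square_integrable_iff)
    finally have R2: "sq_nn (truncated_fourier R f) < \<infinity>" .
    have "sq_nn G \<le> 2 * sq_nn (\<lambda>\<xi>. G \<xi> - truncated_fourier R f \<xi>) + 2 * sq_nn (truncated_fourier R f)"
      using sq_nn_diff_le[of G "truncated_fourier R f" "\<lambda>_. 0"] by simp
    also have "\<dots> < \<infinity>" using less_trans[OF R1 ennreal_one_less_top] R2 unfolding sq_nn_commute[of G]
      by (simp add: ennreal_mult_less_top)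
    finally show ?thesis .
  qed
  then show ?thesis using R unfolding is_fourier_transform_sq_nn square_integrable_iff
    by (intro exI[of _ G]) auto
qed

lemma truncated_fourier_measurable [measurable]:
  "f \<in> borel_measurable borel \<Longrightarrow> truncated_fourier R f \<in> borel_measurable borel"
  unfolding truncated_fourier_eq by measurable

lemma is_fourier_transform_measurable: "is_fourier_transform f F \<Longrightarrow> F \<in> borel_measurable borel"
  unfolding is_fourier_transform_def square_integrable_def by simp

lemma is_fourier_transform_unique:
  assumes f: "cont_L2 f" and F: "is_fourier_transform f F" and G: "is_fourier_transform f G"
  shows "AE \<xi> in lborel. F \<xi> = G \<xi>"
proof (rule sq_nn_0_AE)
  show [measurable]: "F \<in> borel_measurable borel" "G \<in> borel_measurable borel"
    using F G by (simp_all add: is_fourier_transform_measurable)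
  have [measurable]: "f \<in> borel_measurable borel" by (rule cont_L2_measurable[OF f])
  have "((\<lambda>R. sq_nn (\<lambda>\<xi>. F \<xi> - G \<xi>)) \<longlongrightarrow> 0) (at_top :: real filter)"
  proof (rule tendsto_0_le_2_2)
    show "((\<lambda>R. sq_nn (\<lambda>\<xi>. truncated_fourier R f \<xi> - F \<xi>)) \<longlongrightarrow> 0) at_top"
      "((\<lambda>R. sq_nn (\<lambda>\<xi>. truncated_fourier R f \<xi> - G \<xi>)) \<longlongrightarrow> 0) at_top"
      using F G by (auto simp: is_fourier_transform_sq_nn)
    show "\<forall>\<^sub>F R in at_top. sq_nn (\<lambda>\<xi>. F \<xi> - G \<xi>) \<le> 2 * sq_nn (\<lambda>\<xi>. truncated_fourier R f \<xi> - F \<xi>) + 2 * sq_nn (\<lambda>\<xi>. truncated_fourier R f \<xi> - G \<xi>)"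
    proof (intro always_eventually allI)
      fix R
      show "sq_nn (\<lambda>\<xi>. F \<xi> - G \<xi>) \<le> 2 * sq_nn (\<lambda>\<xi>. truncated_fourier R f \<xi> - F \<xi>) + 2 * sq_nn (\<lambda>\<xi>. truncated_fourier R f \<xi> - G \<xi>)"
        using sq_nn_diff_le[of F "truncated_fourier R f" G] by (simp add: sq_nn_commute[of F])
    qed
  qed
  then show "sq_nn (\<lambda>\<xi>. F \<xi> - G \<xi>) = 0" by (simp add: tendsto_const_iff)
qed

lemma plancherel:
  assumes f: "cont_L2 f" and F: "is_fourier_transform f F"
  shows "sq_nn F = sq_nn f"
proof (rule sq_nn_lim[of "at_top :: real filter" "\<lambda>R. truncated_fourier R f"])
  have fc: "continuous_on UNIV f" and fs: "square_integrable f" using f by (auto simp: cont_L2_def)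
  have [measurable]: "f \<in> borel_measurable borel" by (rule cont_L2_measurable[OF f])
  show "F \<in> borel_measurable borel" by (rule is_fourier_transform_measurable[OF F])
  show "truncated_fourier R f \<in> borel_measurable borel" for R by measurable
  show "((\<lambda>R. sq_nn (\<lambda>\<xi>. truncated_fourier R f \<xi> - F \<xi>)) \<longlongrightarrow> 0) at_top"
    using F by (simp add: is_fourier_transform_sq_nn)
  have e: "sq_nn (truncated_fourier R f) = sq_nn (cutoff (-R) R f)" for R
    unfolding truncated_fourier_eq by (rule plancherel_bdd_ae_cont[OF cutoff_bdd_ae_cont[OF fc]])
  have i: "integrable lborel (\<lambda>x. (norm (f x))\<^sup>2)" using fs by (simp add: square_integrable_def)
  have "((\<lambda>R. LINT x|lborel. (norm (cutoff (-R) R f x))\<^sup>2) \<longlongrightarrow> (LINT x|lborel. (norm (f x))\<^sup>2)) at_top"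
  proof (rule integral_dominated_convergence_at_top[where w="\<lambda>x. (norm (f x))\<^sup>2"])
    have "((\<lambda>R. (norm (cutoff (-R) R f x))\<^sup>2) \<longlongrightarrow> (norm (f x))\<^sup>2) at_top" for x
    proof (rule tendsto_eventually)
      show "\<forall>\<^sub>F R in at_top. (norm (cutoff (-R) R f x))\<^sup>2 = (norm (f x))\<^sup>2"
        using eventually_ge_at_top[of "\<bar>x\<bar>"] by eventually_elim (auto simp: cutoff_def indicator_def)
    qed
    then show "AE x in lborel. ((\<lambda>R. (norm (cutoff (-R) R f x))\<^sup>2) \<longlongrightarrow> (norm (f x))\<^sup>2) at_top" by simp
    show "\<forall>\<^sub>F R in at_top. AE x in lborel. norm ((norm (cutoff (-R) R f x))\<^sup>2) \<le> (norm (f x))\<^sup>2"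
      by (auto simp: cutoff_def indicator_def)
  qed (use i in auto)
  then have "((\<lambda>R. ennreal (LINT x|lborel. (norm (cutoff (-R) R f x))\<^sup>2)) \<longlongrightarrow> ennreal (LINT x|lborel. (norm (f x))\<^sup>2)) at_top"
    by (rule tendsto_ennrealI)
  moreover have "square_integrable (cutoff (-R) R f)" for R
    unfolding square_integrable_def
    by (intro conjI Bochner_Integration.integrable_bound[OF i]) (auto simp: cutoff_def indicator_def)
  ultimately show "((\<lambda>R. sq_nn (truncated_fourier R f)) \<longlongrightarrow> sq_nn f) at_top"
    unfolding e using fs by (simp add: sq_nn_eq_LINT)
qed auto

text \<open>The transform can be computed along any approximants in the class, not only along
  symmetric cutoffs. The factor 4 comes from two uses of the triangle inequality with factor 2, the
  other terms vanishing as the cutoff grows.\<close>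

lemma ft1_approx:
  assumes f: "cont_L2 f" and F: "is_fourier_transform f F" and k: "bdd_ae_cont k"
  shows "sq_nn (\<lambda>\<xi>. ft1 k \<xi> - F \<xi>) \<le> 4 * sq_nn (\<lambda>x. k x - f x)"
proof -
  have fc: "continuous_on UNIV f" and fs: "square_integrable f" using f by (auto simp: cont_L2_def)
  have [measurable]: "f \<in> borel_measurable borel" "F \<in> borel_measurable borel" "k \<in> borel_measurable borel"
    using f F k by (simp_all add: cont_L2_measurable is_fourier_transform_measurable bdd_ae_cont_measurable)
  note c = cutoff_bdd_ae_cont[OF fc]
  have tail: "((\<lambda>R. sq_nn (\<lambda>x. cutoff (- R) R f x - f x)) \<longlongrightarrow> 0) at_top" using cutoff_tail[OF fs, of 0] by simp
  have F0: "((\<lambda>R. sq_nn (\<lambda>\<xi>. truncated_fourier R f \<xi> - F \<xi>)) \<longlongrightarrow> 0) at_top"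
    using F by (auto simp: is_fourier_transform_sq_nn)
  have lim: "((\<lambda>R. 2 * (2 * sq_nn (\<lambda>x. k x - f x) + 2 * sq_nn (\<lambda>x. cutoff (-R) R f x - f x)) + 2 * sq_nn (\<lambda>\<xi>. truncated_fourier R f \<xi> - F \<xi>))
      \<longlongrightarrow> 2 * (2 * sq_nn (\<lambda>x. k x - f x) + 2 * 0) + 2 * 0) at_top"
    by (intro tendsto_add ennreal_tendsto_cmult tail F0 tendsto_const) auto
  have le: "sq_nn (\<lambda>\<xi>. ft1 k \<xi> - F \<xi>) \<le> 2 * (2 * sq_nn (\<lambda>x. k x - f x) + 2 * sq_nn (\<lambda>x. cutoff (-R) R f x - f x)) + 2 * sq_nn (\<lambda>\<xi>. truncated_fourier R f \<xi> - F \<xi>)" for R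
  proof -
    have "sq_nn (\<lambda>\<xi>. ft1 k \<xi> - F \<xi>) \<le> 2 * sq_nn (\<lambda>\<xi>. ft1 k \<xi> - truncated_fourier R f \<xi>) + 2 * sq_nn (\<lambda>\<xi>. truncated_fourier R f \<xi> - F \<xi>)"
      by (rule sq_nn_diff_le) measurable
    also have "sq_nn (\<lambda>\<xi>. ft1 k \<xi> - truncated_fourier R f \<xi>) = sq_nn (\<lambda>x. k x - cutoff (-R) R f x)"
      unfolding truncated_fourier_eq by (rule plancherel_diff[OF k c])
    also have "sq_nn (\<lambda>x. k x - cutoff (-R) R f x) \<le> 2 * sq_nn (\<lambda>x. k x - f x) + 2 * sq_nn (\<lambda>x. f x - cutoff (-R) R f x)"
      by (rule sq_nn_diff_le) measurable
    finally show ?thesis by (simp add: sq_nn_commute[of f] add_mono mult_left_mono)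
  qed
  have "sq_nn (\<lambda>\<xi>. ft1 k \<xi> - F \<xi>) \<le> 2 * (2 * sq_nn (\<lambda>x. k x - f x) + 2 * 0) + 2 * 0"
    by (rule tendsto_lowerbound[OF lim]) (use le in auto)
  then show ?thesis by (simp add: mult.assoc[symmetric])
qed

section \<open>Linear combinations, translations and conjugates under the transform\<close>

lemma is_fourier_transform_add:
  assumes f: "cont_L2 f" and g: "cont_L2 g" and F: "is_fourier_transform f F" and G: "is_fourier_transform g G"
  shows "is_fourier_transform (\<lambda>x. f x + c * g x) (\<lambda>\<xi>. F \<xi> + c * G \<xi>)"
proof -
  have [measurable]: "f \<in> borel_measurable borel" "F \<in> borel_measurable borel" "g \<in> borel_measurable borel" "G \<in> borel_measurable borel"
    using f F g G by (simp_all add: cont_L2_measurable is_fourier_transform_measurable)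
  have c2: "sq_nn (\<lambda>x. c * h x) = ennreal ((norm c)\<^sup>2) * sq_nn h" if [measurable]: "h \<in> borel_measurable borel" for h
    unfolding sq_nn_def by (subst nn_integral_cmult[symmetric]) (auto simp: norm_mult power_mult_distrib ennreal_mult)
  have T: "truncated_fourier R (\<lambda>x. f x + c * g x) \<xi> = truncated_fourier R f \<xi> + c * truncated_fourier R g \<xi>" for R \<xi>
  proof -
    have i: "integrable lborel (cutoff (-R) R h)" if "cont_L2 h" for h
      using that by (intro bdd_ae_cont_integrable cutoff_bdd_ae_cont) (simp add: cont_L2_def)
    have "(LINT x|lborel. exp (- \<i> * complex_of_real (x * \<xi>)) * cutoff (-R) R (\<lambda>x. f x + c * g x) x)
      = (LINT x|lborel. exp (- \<i> * complex_of_real (x * \<xi>)) * cutoff (-R) R f x + c * (exp (- \<i> * complex_of_real (x * \<xi>)) * cutoff (-R) R g x))"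
      by (intro Bochner_Integration.integral_cong refl) (simp add: cutoff_def indicator_def algebra_simps)
    also have "\<dots> = (LINT x|lborel. exp (- \<i> * complex_of_real (x * \<xi>)) * cutoff (-R) R f x) + c * (LINT x|lborel. (exp (- \<i> * complex_of_real (x * \<xi>)) * cutoff (-R) R g x))"
      by (subst Bochner_Integration.integral_add, (intro integrable_iexp_mult i f g integrable_mult_right)+)
        (simp only: integral_mult_right_zero)
    finally show ?thesis unfolding truncated_fourier_eq ft1_def by (simp only: distrib_left mult_ac)
  qed
  have F0: "((\<lambda>R. sq_nn (\<lambda>\<xi>. truncated_fourier R f \<xi> - F \<xi>)) \<longlongrightarrow> 0) at_top"
    using F by (auto simp: is_fourier_transform_sq_nn)
  have "((\<lambda>R. sq_nn (\<lambda>\<xi>. truncated_fourier R g \<xi> - G \<xi>)) \<longlongrightarrow> 0) at_top"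
    using G by (auto simp: is_fourier_transform_sq_nn)
  then have "((\<lambda>R. ennreal ((norm c)\<^sup>2) * sq_nn (\<lambda>\<xi>. truncated_fourier R g \<xi> - G \<xi>)) \<longlongrightarrow> ennreal ((norm c)\<^sup>2) * 0) at_top"
    by (intro ennreal_tendsto_cmult) auto
  then have G0: "((\<lambda>R. sq_nn (\<lambda>\<xi>. c * (truncated_fourier R g \<xi> - G \<xi>))) \<longlongrightarrow> 0) at_top"
    by (simp add: c2)
  have lim: "((\<lambda>R. sq_nn (\<lambda>\<xi>. truncated_fourier R (\<lambda>x. f x + c * g x) \<xi> - (F \<xi> + c * G \<xi>))) \<longlongrightarrow> 0) at_top"
  proof (rule tendsto_0_le_2_2[OF F0 G0], intro always_eventually allI)
    fix R
    have "sq_nn (\<lambda>\<xi>. truncated_fourier R (\<lambda>x. f x + c * g x) \<xi> - (F \<xi> + c * G \<xi>))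
       = sq_nn (\<lambda>\<xi>. (truncated_fourier R f \<xi> - F \<xi>) + c * (truncated_fourier R g \<xi> - G \<xi>))"
      unfolding T by (simp add: algebra_simps)
    also have "\<dots> \<le> ennreal (1 + 1) * sq_nn (\<lambda>\<xi>. truncated_fourier R f \<xi> - F \<xi>) + ennreal (1 + 1 / 1) * sq_nn (\<lambda>\<xi>. c * (truncated_fourier R g \<xi> - G \<xi>))"
      by (rule sq_nn_add_le) auto
    finally show "sq_nn (\<lambda>\<xi>. truncated_fourier R (\<lambda>x. f x + c * g x) \<xi> - (F \<xi> + c * G \<xi>))
      \<le> 2 * sq_nn (\<lambda>\<xi>. truncated_fourier R f \<xi> - F \<xi>) + 2 * sq_nn (\<lambda>\<xi>. c * (truncated_fourier R g \<xi> - G \<xi>))"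
      by simp
  qed
  have "sq_nn (\<lambda>x. F x + c * G x) \<le> ennreal (1 + 1) * sq_nn F + ennreal (1 + 1 / 1) * sq_nn (\<lambda>x. c * G x)"
    by (rule sq_nn_add_le) auto
  also have "\<dots> < \<infinity>"
    using F G unfolding is_fourier_transform_def square_integrable_iff by (simp add: ennreal_mult_less_top c2)
  finally show ?thesis using lim by (simp add: is_fourier_transform_sq_nn square_integrable_iff)
qed

text \<open>The truncation of the translate is, up to a factor of modulus 1, the transform of an
  off-centre cutoff of \<open>f\<close>, and such cutoffs are admissible approximants by
  \<open>ft1_approx\<close>.\<close>

lemma is_fourier_transform_shift:
  assumes f: "cont_L2 f" and F: "is_fourier_transform f F"
  shows "is_fourier_transform (\<lambda>x. f (x + h)) (\<lambda>\<xi>. exp (\<i> * complex_of_real (h * \<xi>)) * F \<xi>)"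
proof -
  have fc: "continuous_on UNIV f" and fs: "square_integrable f" using f by (auto simp: cont_L2_def)
  have [measurable]: "f \<in> borel_measurable borel" "F \<in> borel_measurable borel"
    using f F by (simp_all add: cont_L2_measurable is_fourier_transform_measurable)
  have n: "sq_nn (\<lambda>\<xi>. exp (\<i> * complex_of_real (h * \<xi>)) * k \<xi>) = sq_nn k" for k
    by (simp add: sq_nn_def norm_mult del: of_real_mult)
  have T: "truncated_fourier R (\<lambda>x. f (x + h)) \<xi> = exp (\<i> * complex_of_real (h * \<xi>)) * ft1 (cutoff (h - R) (h + R) f) \<xi>" for R \<xi>
  proof -
    have "(LINT x|lborel. exp (- \<i> * complex_of_real (x * \<xi>)) * cutoff (-R) R (\<lambda>x. f (x + h)) x)
      = \<bar>1\<bar> *\<^sub>R (LINT x|lborel. exp (- \<i> * complex_of_real ((-h + 1 * x) * \<xi>)) * cutoff (-R) R (\<lambda>x. f (x + h)) (-h + 1 * x))"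
      by (rule lborel_integral_real_affine) simp
    also have "\<dots> = (LINT x|lborel. exp (\<i> * complex_of_real (h * \<xi>)) * (exp (- \<i> * complex_of_real (x * \<xi>)) * cutoff (h - R) (h + R) f x))"
      unfolding abs_one scaleR_one
      by (intro Bochner_Integration.integral_cong refl) (auto simp add: cutoff_def indicator_def algebra_simps exp_diff exp_minus field_simps)
    also have "\<dots> = exp (\<i> * complex_of_real (h * \<xi>)) * (LINT x|lborel. (exp (- \<i> * complex_of_real (x * \<xi>)) * cutoff (h - R) (h + R) f x))"
      by simp
    finally show ?thesis unfolding truncated_fourier_eq ft1_def by (simp only: mult_ac)
  qed
  have "((\<lambda>R. sq_nn (\<lambda>\<xi>. ft1 (cutoff (h - R) (h + R) f) \<xi> - F \<xi>)) \<longlongrightarrow> 0) at_top"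
  proof (rule tendsto_sandwich[of "\<lambda>_. 0"])
    have "((\<lambda>R. 4 * sq_nn (\<lambda>x. cutoff (h - R) (h + R) f x - f x)) \<longlongrightarrow> 4 * 0) at_top"
      by (intro ennreal_tendsto_cmult cutoff_tail[OF fs]) auto
    then show "((\<lambda>R. 4 * sq_nn (\<lambda>x. cutoff (h - R) (h + R) f x - f x)) \<longlongrightarrow> 0) at_top" by simp
    show "\<forall>\<^sub>F R in at_top. sq_nn (\<lambda>\<xi>. ft1 (cutoff (h - R) (h + R) f) \<xi> - F \<xi>) \<le> 4 * sq_nn (\<lambda>x. cutoff (h - R) (h + R) f x - f x)"
      by (intro always_eventually allI ft1_approx[OF f F] cutoff_bdd_ae_cont fc)
  qed auto
  moreover have "sq_nn (\<lambda>\<xi>. truncated_fourier R (\<lambda>x. f (x + h)) \<xi> - exp (\<i> * complex_of_real (h * \<xi>)) * F \<xi>) = sq_nn (\<lambda>\<xi>. ft1 (cutoff (h - R) (h + R) f) \<xi> - F \<xi>)" for R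
    unfolding T right_diff_distrib[symmetric] by (rule n)
  ultimately show ?thesis
    using F by (simp add: is_fourier_transform_sq_nn square_integrable_iff n del: of_real_mult)
qed

lemma sq_nn_reflect:
  assumes [measurable]: "f \<in> borel_measurable borel"
  shows "sq_nn (\<lambda>x. f (- x)) = sq_nn f"
  unfolding sq_nn_def using nn_integral_real_affine[of "\<lambda>x. ennreal ((norm (f x))\<^sup>2)" "-1" 0] by simp

lemma is_fourier_transform_cnj:
  assumes f: "cont_L2 f" and F: "is_fourier_transform f F"
  shows "is_fourier_transform (\<lambda>x. cnj (f x)) (\<lambda>\<xi>. cnj (F (- \<xi>)))"
proof -
  have [measurable]: "f \<in> borel_measurable borel" "F \<in> borel_measurable borel"
    using f F by (simp_all add: cont_L2_measurable is_fourier_transform_measurable)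
  have T: "truncated_fourier R (\<lambda>x. cnj (f x)) \<xi> = cnj (truncated_fourier R f (- \<xi>))" for R \<xi>
  proof -
    have "cnj (LINT x|lborel. exp (- \<i> * complex_of_real (x * - \<xi>)) * cutoff (- R) R f x)
      = (LINT x|lborel. cnj (exp (- \<i> * complex_of_real (x * - \<xi>)) * cutoff (- R) R f x))"
      by (rule Bochner_Integration.integral_cnj[symmetric])
    also have "\<dots> = (LINT x|lborel. exp (- \<i> * complex_of_real (x * \<xi>)) * cutoff (- R) R (\<lambda>x. cnj (f x)) x)"
      by (intro Bochner_Integration.integral_cong refl) (simp add: cutoff_def exp_cnj)
    finally show ?thesis
      unfolding truncated_fourier_eq ft1_def complex_cnj_mult complex_cnj_complex_of_real by simp
  qed
  have c: "sq_nn (\<lambda>x. cnj (k x)) = sq_nn k" for k by (simp add: sq_nn_def)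
  have "sq_nn (\<lambda>\<xi>. truncated_fourier R (\<lambda>x. cnj (f x)) \<xi> - cnj (F (- \<xi>))) = sq_nn (\<lambda>\<xi>. truncated_fourier R f \<xi> - F \<xi>)" for R
    unfolding T complex_cnj_diff[symmetric] c using sq_nn_reflect[of "\<lambda>\<xi>. truncated_fourier R f \<xi> - F \<xi>"] by simp
  moreover have "sq_nn (\<lambda>\<xi>. cnj (F (- \<xi>))) = sq_nn F" using sq_nn_reflect[of F] c[of "\<lambda>\<xi>. F (-\<xi>)"] by simp
  ultimately show ?thesis using F by (simp add: is_fourier_transform_sq_nn square_integrable_iff)
qed

text \<open>L2 convergence gives almost everywhere convergence along a subsequence. It is extracted
  from a prescribed sequence \<open>s\<close> so that two transforms can be made to converge along
  one common sequence of radii.\<close>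

lemma is_fourier_transform_AE_subseq:
  assumes f: "cont_L2 f" and F: "is_fourier_transform f F" and s: "strict_mono (s :: nat \<Rightarrow> nat)"
  shows "\<exists>r. strict_mono r \<and> (AE \<xi> in lborel. (\<lambda>n. truncated_fourier (real (s (r n))) f \<xi>) \<longlonglongrightarrow> F \<xi>)"
proof -
  have fc: "continuous_on UNIV f" using f by (auto simp: cont_L2_def)
  have [measurable]: "f \<in> borel_measurable borel" "F \<in> borel_measurable borel"
    using f F by (simp_all add: cont_L2_measurable is_fourier_transform_measurable)
  define u where "u n \<xi> = (norm (truncated_fourier (real (s n)) f \<xi> - F \<xi>))\<^sup>2" for n \<xi>
  have u0: "u n \<xi> \<ge> 0" and un: "\<bar>u n \<xi>\<bar> = u n \<xi>" for n \<xi> by (simp_all add: u_def)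
  have nn: "(\<integral>\<^sup>+\<xi>. ennreal (u n \<xi>) \<partial>lborel) = sq_nn (\<lambda>\<xi>. truncated_fourier (real (s n)) f \<xi> - F \<xi>)" for n
    by (simp add: u_def sq_nn_def)
  have fin: "sq_nn (\<lambda>\<xi>. truncated_fourier R f \<xi> - F \<xi>) < \<infinity>" for R
  proof -
    have "sq_nn (\<lambda>\<xi>. truncated_fourier R f \<xi> - F \<xi>) \<le> 4 * sq_nn (\<lambda>x. cutoff (-R) R f x - f x)"
      unfolding truncated_fourier_eq by (rule ft1_approx[OF f F cutoff_bdd_ae_cont[OF fc]])
    also have "\<dots> \<le> 4 * sq_nn f" unfolding sq_nn_def
      by (intro mult_left_mono nn_integral_mono) (auto simp: cutoff_def indicator_def)
    also have "\<dots> < \<infinity>" using f by (simp add: cont_L2_def square_integrable_iff ennreal_mult_less_top)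
    finally show ?thesis .
  qed
  have [measurable]: "u n \<in> borel_measurable borel" for n unfolding u_def by measurable
  have int: "integrable lborel (u n)" for n
    by (rule integrableI_bounded) (use fin[of "real (s n)"] nn[of n] in \<open>auto simp: u_def sq_nn_def\<close>)
  have "((\<lambda>R. sq_nn (\<lambda>\<xi>. truncated_fourier R f \<xi> - F \<xi>)) \<longlongrightarrow> 0) at_top"
    using F by (auto simp: is_fourier_transform_sq_nn)
  moreover have "filterlim (\<lambda>n. real (s n)) at_top sequentially"
    by (rule filterlim_compose[OF filterlim_real_sequentially filterlim_subseq[OF s]])
  ultimately have "(\<lambda>n. sq_nn (\<lambda>\<xi>. truncated_fourier (real (s n)) f \<xi> - F \<xi>)) \<longlonglongrightarrow> 0"
    by (rule filterlim_compose)
  then have "(\<lambda>n. ennreal (LINT \<xi>|lborel. norm (u n \<xi>))) \<longlonglongrightarrow> 0"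
    unfolding nn[symmetric] using int by (subst (asm) nn_integral_eq_integral) (auto simp: un u0)
  then have "(\<lambda>n. LINT \<xi>|lborel. norm (u n \<xi>)) \<longlonglongrightarrow> 0"
    by (subst (asm) ennreal_tendsto_0_iff) auto
  from tendsto_L1_AE_subseq[OF int this] obtain r where r: "strict_mono r"
    and A: "AE \<xi> in lborel. (\<lambda>n. u (r n) \<xi>) \<longlonglongrightarrow> 0" by blast
  have "AE \<xi> in lborel. (\<lambda>n. truncated_fourier (real (s (r n))) f \<xi>) \<longlonglongrightarrow> F \<xi>"
    using A
  proof eventually_elim
    fix \<xi> assume "(\<lambda>n. u (r n) \<xi>) \<longlonglongrightarrow> 0"
    then have "(\<lambda>n. sqrt (u (r n) \<xi>)) \<longlonglongrightarrow> sqrt 0" by (intro tendsto_intros)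
    then have "(\<lambda>n. norm (truncated_fourier (real (s (r n))) f \<xi> - F \<xi>)) \<longlonglongrightarrow> 0" by (simp add: u_def)
    then show "(\<lambda>n. truncated_fourier (real (s (r n))) f \<xi>) \<longlonglongrightarrow> F \<xi>"
      using LIM_zero_cancel tendsto_norm_zero_iff by blast
  qed
  then show ?thesis using r by blast
qed

section \<open>Derivatives, Sobolev bounds and the half-norm\<close>

lemma LINT_indicator_FTC:
  fixes h :: "real \<Rightarrow> 'a :: euclidean_space"
  assumes ab: "a \<le> b" and d: "\<And>x. (h has_vector_derivative h' x) (at x)" and c: "continuous_on UNIV h'"
  shows "(LINT t|lborel. indicator {a..b} t *\<^sub>R h' t) = h b - h a"
proof -
  have i: "set_integrable lborel {a..b} h'"
    by (intro borel_integrable_atLeastAtMost' continuous_on_subset[OF c]) auto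
  have "(LINT t:{a..b}|lborel. h' t) = integral {a..b} h'" by (rule set_borel_integral_eq_integral(2)[OF i])
  also have "\<dots> = h b - h a"
    by (rule integral_unique[OF fundamental_theorem_of_calculus[OF ab]]) (use d has_vector_derivative_at_within in blast)
  finally show ?thesis by (simp add: set_lebesgue_integral_def)
qed

text \<open>Integrability of the derivative gives existence of the limit; integrability of the
  function forces the limit to be 0.\<close>

lemma integrable_C1_limit_0:
  fixes h h' :: "real \<Rightarrow> real"
  assumes d: "\<And>x. (h has_vector_derivative h' x) (at x)" and c: "continuous_on UNIV h'"
    and h: "integrable lborel h" and h': "integrable lborel h'"
  shows "(h \<longlongrightarrow> 0) at_top"
proof -
  have "((\<lambda>x. LINT t|lborel. indicator {0..x} t *\<^sub>R h' t) \<longlongrightarrow> (LINT t|lborel. indicator {0..} t *\<^sub>R h' t)) at_top"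
  proof (rule integral_dominated_convergence_at_top[where w="\<lambda>t. \<bar>h' t\<bar>"])
    have "((\<lambda>x. indicator {0..x} t *\<^sub>R h' t) \<longlongrightarrow> indicator {0..} t *\<^sub>R h' t) at_top" for t
      by (rule tendsto_eventually, use eventually_ge_at_top[of "\<bar>t\<bar>"] in eventually_elim) (auto simp: indicator_def)
    then show "AE t in lborel. ((\<lambda>x. indicator {0..x} t *\<^sub>R h' t) \<longlongrightarrow> indicator {0..} t *\<^sub>R h' t) at_top" by simp
  qed (use h' in \<open>auto simp: indicator_def\<close>)
  then have "((\<lambda>x. h x - h 0) \<longlongrightarrow> (LINT t|lborel. indicator {0..} t *\<^sub>R h' t)) at_top"
    by (rule Lim_transform_eventually) (use eventually_ge_at_top[of 0] in eventually_elim, rule LINT_indicator_FTC[OF _ d c])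
  then have "((\<lambda>x. h x - h 0 + h 0) \<longlongrightarrow> (LINT t|lborel. indicator {0..} t *\<^sub>R h' t) + h 0) at_top"
    by (intro tendsto_add tendsto_const)
  then obtain l where l: "(h \<longlongrightarrow> l) at_top" by auto
  \<comment> \<open>A nonzero limit bounds |h| below on a half-line, whose measure would then be
    finite.\<close>
  have "l = 0"
  proof (rule ccontr)
    assume l0: "l \<noteq> 0"
    have "((\<lambda>x. \<bar>h x\<bar>) \<longlongrightarrow> \<bar>l\<bar>) at_top" by (intro tendsto_rabs l)
    then have "\<forall>\<^sub>F x in at_top. \<bar>h x\<bar> > \<bar>l\<bar> / 2" by (rule order_tendstoD(1)) (use l0 in simp)
    then obtain X where X: "\<And>x. x \<ge> X \<Longrightarrow> \<bar>h x\<bar> > \<bar>l\<bar> / 2" by (auto simp: eventually_at_top_linorder)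
    have "integrable lborel (\<lambda>x. indicator {X..} x * (\<bar>l\<bar> / 2))"
      by (rule Bochner_Integration.integrable_bound[OF h]) (use X in \<open>auto simp: indicator_def intro: less_imp_le\<close>)
    then have "integrable lborel (\<lambda>x. (indicator {X..} x * (\<bar>l\<bar> / 2)) * (2 / \<bar>l\<bar>))" by (rule integrable_mult_left)
    then have "integrable lborel (indicator {X..} :: real \<Rightarrow> real)" using l0 by simp
    then have fin: "emeasure lborel {X..} < \<infinity>" by (subst (asm) integrable_indicator_iff) auto
    have "ennreal (real n) \<le> emeasure lborel {X..}" for n :: nat
      using emeasure_mono[of "{X..X + real n}" "{X..}" lborel] by auto
    note le = this
    obtain r where r: "emeasure lborel {X..} = ennreal r" "r \<ge> 0"
      using fin by (cases "emeasure lborel {X..}" rule: ennreal_cases) auto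
    obtain n :: nat where "r < real n" using reals_Archimedean2 by blast
    then show False using le[of n] r by (simp add: ennreal_le_iff)
  qed
  then show ?thesis using l by simp
qed

text \<open>The third claim removes fluxes and total derivatives: it is used for the half-norm and
  for the conservation law.\<close>

lemma integrable_C1_limits_0:
  fixes h h' :: "real \<Rightarrow> real"
  assumes d: "\<And>x. (h has_vector_derivative h' x) (at x)" and c: "continuous_on UNIV h'"
    and h: "integrable lborel h" and h': "integrable lborel h'"
  shows "(h \<longlongrightarrow> 0) at_top" "((\<lambda>x. h (- x)) \<longlongrightarrow> 0) at_top" "(LINT x|lborel. h' x) = 0"
proof -
  show 1: "(h \<longlongrightarrow> 0) at_top" by (rule integrable_C1_limit_0[OF assms])
  show 2: "((\<lambda>x. h (- x)) \<longlongrightarrow> 0) at_top"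
  proof (rule integrable_C1_limit_0[where h'="\<lambda>x. - h' (- x)"])
    show "((\<lambda>x. h (- x)) has_vector_derivative - h' (- x)) (at x)" for x
    proof -
      have "((\<lambda>x. h (- x)) has_vector_derivative (-1) *\<^sub>R h' (- x)) (at x)"
        by (rule vector_diff_chain_at[of uminus "-1" x h, unfolded o_def]) (auto intro!: derivative_eq_intros d)
      then show ?thesis by simp
    qed
    show "continuous_on UNIV (\<lambda>x. - h' (- x))"
      by (intro continuous_intros continuous_on_compose2[OF c]) auto
    show "integrable lborel (\<lambda>x. h (- x))" "integrable lborel (\<lambda>x. - h' (- x))"
      using lborel_integrable_real_affine[OF h, of "-1" 0] lborel_integrable_real_affine[OF h', of "-1" 0] by auto
  qed
  have "((\<lambda>x. LINT t|lborel. indicator {-x..x} t *\<^sub>R h' t) \<longlongrightarrow> (LINT t|lborel. h' t)) at_top"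
  proof (rule integral_dominated_convergence_at_top[where w="\<lambda>t. \<bar>h' t\<bar>"])
    have "((\<lambda>x. indicator {-x..x} t *\<^sub>R h' t) \<longlongrightarrow> h' t) at_top" for t
      by (rule tendsto_eventually, use eventually_ge_at_top[of "\<bar>t\<bar>"] in eventually_elim) (auto simp: indicator_def)
    then show "AE t in lborel. ((\<lambda>x. indicator {-x..x} t *\<^sub>R h' t) \<longlongrightarrow> h' t) at_top" by simp
  qed (use h' in \<open>auto simp: indicator_def\<close>)
  then have "((\<lambda>x. h x - h (- x)) \<longlongrightarrow> (LINT t|lborel. h' t)) at_top"
    by (rule Lim_transform_eventually) (use eventually_ge_at_top[of 0] in eventually_elim, rule LINT_indicator_FTC[OF _ d c], simp)
  moreover have "((\<lambda>x. h x - h (- x)) \<longlongrightarrow> 0 - 0) at_top" by (intro tendsto_diff 1 2)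
  ultimately show "(LINT x|lborel. h' x) = 0" using tendsto_unique[OF trivial_limit_at_top_linorder] by fastforce
qed

lemma square_integrable_mult:
  assumes "square_integrable f" "square_integrable g"
  shows "integrable lborel (\<lambda>x. f x * g x)"
proof -
  have i: "integrable lborel (\<lambda>x. (norm (f x))\<^sup>2 + (norm (g x))\<^sup>2)"
    and [measurable]: "f \<in> borel_measurable borel" "g \<in> borel_measurable borel"
    using assms unfolding square_integrable_def by auto
  have "norm (f x * g x) \<le> (norm (f x))\<^sup>2 + (norm (g x))\<^sup>2" for x
  proof -
    have "0 \<le> norm (f x) * norm (g x)" by simp
    then show ?thesis
      using sum_squares_bound[of "norm (f x)" "norm (g x)"] unfolding norm_mult by linarith
  qed
  then show ?thesis by (intro Bochner_Integration.integrable_bound[OF i]) auto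
qed

lemma square_integrable_cnj: "square_integrable f \<Longrightarrow> square_integrable (\<lambda>x. cnj (f x))"
  unfolding square_integrable_def by (auto intro: borel_measurable_cnj)

lemma cmod_sq_has_vector_derivative:
  assumes "(f has_vector_derivative f') (at x within S)"
  shows "((\<lambda>x. (norm (f x))\<^sup>2) has_vector_derivative 2 * Re (f' * cnj (f x))) (at x within S)"
proof -
  have A: "((\<lambda>x. Re (f x)) has_real_derivative Re f') (at x within S)" and B: "((\<lambda>x. Im (f x)) has_real_derivative Im f') (at x within S)"
    using assms unfolding has_real_derivative_iff_has_vector_derivative
    by (auto intro: bounded_linear.has_vector_derivative[OF bounded_linear_Re] bounded_linear.has_vector_derivative[OF bounded_linear_Im])
  have "((\<lambda>x. (Re (f x))\<^sup>2 + (Im (f x))\<^sup>2) has_vector_derivative 2 * Re f' * Re (f x) + 2 * Im f' * Im (f x)) (at x within S)"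
    unfolding has_real_derivative_iff_has_vector_derivative[symmetric]
    using DERIV_add[OF DERIV_power[OF A, of 2] DERIV_power[OF B, of 2]] by (simp add: mult_ac)
  then show ?thesis by (simp add: cmod_power2 algebra_simps)
qed

text \<open>The one-dimensional Sobolev embedding. The derivative of |f|^2 is twice the real part of
  f' times the conjugate of f, which is integrable and bounded by |f|^2 + |f'|^2; integrating it
  from x to infinity gives the bound with constant 1.\<close>

lemma L2_C1_facts:
  assumes f: "cont_L2 f" and f': "cont_L2 f'" and d: "\<And>x. (f has_vector_derivative f' x) (at x)"
  shows "(f \<longlongrightarrow> 0) at_top" "((\<lambda>x. f (- x)) \<longlongrightarrow> 0) at_top"
    and "(norm (f x))\<^sup>2 \<le> (LINT x|lborel. (norm (f x))\<^sup>2) + (LINT x|lborel. (norm (f' x))\<^sup>2)"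
proof -
  let ?h = "\<lambda>x. (norm (f x))\<^sup>2" and ?h' = "\<lambda>x. 2 * Re (f' x * cnj (f x))"
  have s: "square_integrable f" "square_integrable f'" and cc: "continuous_on UNIV f" "continuous_on UNIV f'"
    using f f' by (auto simp: cont_L2_def)
  have dh: "(?h has_vector_derivative ?h' x) (at x)" for x by (rule cmod_sq_has_vector_derivative[OF d])
  have ch: "continuous_on UNIV ?h'" by (intro continuous_intros cc)
  have ih: "integrable lborel ?h" "integrable lborel (\<lambda>x. (norm (f' x))\<^sup>2)" using s by (auto simp: square_integrable_def)
  have ih': "integrable lborel ?h'"
    using square_integrable_mult[OF s(2) square_integrable_cnj[OF s(1)]] by (intro integrable_mult_right integrable_Re) auto
  note lims = integrable_C1_limits_0[OF dh ch ih(1) ih']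
  have "((\<lambda>x. sqrt (?h x)) \<longlongrightarrow> sqrt 0) at_top" "((\<lambda>x. sqrt (?h (-x))) \<longlongrightarrow> sqrt 0) at_top"
    by (rule tendsto_real_sqrt[OF lims(1)], rule tendsto_real_sqrt[OF lims(2)])
  then show "(f \<longlongrightarrow> 0) at_top" "((\<lambda>x. f (- x)) \<longlongrightarrow> 0) at_top"
    by (simp_all add: tendsto_norm_zero_iff)
  have b: "?h x \<le> ?h y + ((LINT x|lborel. (norm (f x))\<^sup>2) + (LINT x|lborel. (norm (f' x))\<^sup>2))" if "x \<le> y" for x y
  proof -
    have "\<bar>?h' t\<bar> \<le> (norm (f t))\<^sup>2 + (norm (f' t))\<^sup>2" for t
      using sum_squares_bound[of "norm (f t)" "norm (f' t)"] abs_Re_le_cmod[of "f' t * cnj (f t)"]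
      by (auto simp: norm_mult mult_ac)
    moreover have ii: "integrable lborel (\<lambda>t. indicator {x..y} t *\<^sub>R ?h' t)"
      by (rule integrable_mult_indicator[OF _ ih']) simp
    ultimately have "norm (LINT t|lborel. indicator {x..y} t *\<^sub>R ?h' t) \<le> (LINT t|lborel. (norm (f t))\<^sup>2 + (norm (f' t))\<^sup>2)"
      by (intro Bochner_Integration.integral_norm_bound_integral ii Bochner_Integration.integrable_add ih)
        (auto simp: indicator_def)
    then show ?thesis using LINT_indicator_FTC[OF that dh ch] ih by simp
  qed
  have "((\<lambda>y. ?h y + ((LINT x|lborel. (norm (f x))\<^sup>2) + (LINT x|lborel. (norm (f' x))\<^sup>2))) \<longlongrightarrow> 0 + ((LINT x|lborel. (norm (f x))\<^sup>2) + (LINT x|lborel. (norm (f' x))\<^sup>2))) at_top"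
    by (intro tendsto_add lims tendsto_const)
  then have "?h x \<le> 0 + ((LINT x|lborel. (norm (f x))\<^sup>2) + (LINT x|lborel. (norm (f' x))\<^sup>2))"
    by (rule tendsto_lowerbound, intro eventually_mono[OF eventually_ge_at_top[of x]] b) auto
  then show "?h x \<le> (LINT x|lborel. (norm (f x))\<^sup>2) + (LINT x|lborel. (norm (f' x))\<^sup>2)" by simp
qed

section \<open>Derivatives and inner products on the Fourier side\<close>

lemma truncated_fourier_derivative:
  assumes d: "\<And>x. (f has_vector_derivative f' x) (at x)" and c: "continuous_on UNIV f'" and R: "R \<ge> 0"
  shows "truncated_fourier R f' \<xi> = complex_of_real (1 / sqrt (2 * pi)) *
      (exp (- \<i> * complex_of_real (R * \<xi>)) * f R - exp (\<i> * complex_of_real (R * \<xi>)) * f (- R))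
      + \<i> * \<xi> * truncated_fourier R f \<xi>"
proof -
  have cf: "continuous_on UNIV f"
    using d by (auto intro!: continuous_at_imp_continuous_on intro: has_vector_derivative_continuous)
  let ?e = "\<lambda>x. exp (- \<i> * complex_of_real (x * \<xi>))"
  have de: "(?e has_vector_derivative (- \<i> * \<xi>) * ?e x) (at x)" for x
  proof -
    have "((\<lambda>z. exp (- \<i> * z * \<xi>)) has_field_derivative (- \<i> * \<xi>) * exp (- \<i> * complex_of_real x * \<xi>)) (at (complex_of_real x))"
      by (auto intro!: derivative_eq_intros)
    from has_vector_derivative_real_field[OF this] show ?thesis by (simp add: mult_ac)
  qed
  have dk: "((\<lambda>x. ?e x * f x) has_vector_derivative (?e x * f' x + (- \<i> * \<xi>) * (?e x * f x))) (at x)" for x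
    using has_vector_derivative_mult[OF de d, of x] by (simp add: mult_ac)
  have "(LINT x|lborel. indicator {-R..R} x *\<^sub>R (?e x * f' x + (- \<i> * \<xi>) * (?e x * f x))) = ?e R * f R - ?e (-R) * f (-R)"
    by (rule LINT_indicator_FTC[OF _ dk]) (use R in \<open>auto intro!: continuous_intros c cf\<close>)
  moreover have "(LINT x|lborel. indicator {-R..R} x *\<^sub>R (?e x * f' x + (- \<i> * \<xi>) * (?e x * f x)))
    = (LINT x|lborel. ?e x * cutoff (-R) R f' x + (- \<i> * \<xi>) * (?e x * cutoff (-R) R f x))"
    by (intro Bochner_Integration.integral_cong refl) (simp add: cutoff_def scaleR_add_right scaleR_diff_right)
  moreover have "\<dots> = (LINT x|lborel. ?e x * cutoff (-R) R f' x) + (- \<i> * \<xi>) * (LINT x|lborel. ?e x * cutoff (-R) R f x)"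
    by (subst Bochner_Integration.integral_add, (intro integrable_iexp_mult bdd_ae_cont_integrable cutoff_bdd_ae_cont c cf integrable_mult_right)+)
        (simp only: integral_mult_right_zero)
  ultimately have "(LINT x|lborel. ?e x * cutoff (-R) R f' x) + (- \<i> * \<xi>) * (LINT x|lborel. ?e x * cutoff (-R) R f x) = ?e R * f R - ?e (-R) * f (-R)"
    by (simp only:)
  moreover have "X = P - Q + \<i> * z * Y" if "X + (- \<i> * z) * Y = P - Q" for X Y P Q z :: complex
    using that by (simp add: algebra_simps)
  ultimately have "(LINT x|lborel. ?e x * cutoff (-R) R f' x) = ?e R * f R - ?e (-R) * f (-R) + \<i> * \<xi> * (LINT x|lborel. ?e x * cutoff (-R) R f x)"
    by blast
  moreover have "?e (- R) = exp (\<i> * complex_of_real (R * \<xi>))" by simp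
  ultimately have e: "(LINT x|lborel. ?e x * cutoff (-R) R f' x) = ?e R * f R - exp (\<i> * complex_of_real (R * \<xi>)) * f (-R) + \<i> * \<xi> * (LINT x|lborel. ?e x * cutoff (-R) R f x)"
    by (simp only:)
  show ?thesis
    unfolding truncated_fourier_eq ft1_def e by (simp only: distrib_left mult_ac)
qed

text \<open>Integration by parts on [-R, R] leaves boundary values of \<open>f\<close>, and these
  tend to 0. Since both transforms are only L2 limits, the identity is read off pointwise along a
  common subsequence of radii.\<close>

lemma is_fourier_transform_derivative:
  assumes f: "cont_L2 f" and f': "cont_L2 f'" and d: "\<And>x. (f has_vector_derivative f' x) (at x)"
    and F: "is_fourier_transform f F" and F': "is_fourier_transform f' F'"
  shows "AE \<xi> in lborel. F' \<xi> = \<i> * \<xi> * F \<xi>"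
proof -
  obtain r where r: "strict_mono r" and A: "AE \<xi> in lborel. (\<lambda>n. truncated_fourier (real (r n)) f \<xi>) \<longlonglongrightarrow> F \<xi>"
    using is_fourier_transform_AE_subseq[OF f F strict_mono_id] by (auto simp: id_def)
  obtain s where s: "strict_mono s" and B: "AE \<xi> in lborel. (\<lambda>n. truncated_fourier (real (r (s n))) f' \<xi>) \<longlonglongrightarrow> F' \<xi>"
    using is_fourier_transform_AE_subseq[OF f' F' r] by auto
  define R where "R n = real (r (s n))" for n
  have R: "filterlim R at_top sequentially" unfolding R_def
    by (rule filterlim_compose[OF filterlim_real_sequentially filterlim_compose[OF filterlim_subseq[OF r] filterlim_subseq[OF s]]])
  have c: "continuous_on UNIV f'" using f' by (simp add: cont_L2_def)
  note lims = L2_C1_facts(1,2)[OF f f' d]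
  have f0: "(\<lambda>n. f (R n)) \<longlonglongrightarrow> 0" "(\<lambda>n. f (- R n)) \<longlonglongrightarrow> 0"
    using filterlim_compose[OF lims(1) R] filterlim_compose[OF lims(2) R] by auto
  show ?thesis using A B
  proof eventually_elim
    fix \<xi> assume a: "(\<lambda>n. truncated_fourier (real (r n)) f \<xi>) \<longlonglongrightarrow> F \<xi>"
      and b: "(\<lambda>n. truncated_fourier (real (r (s n))) f' \<xi>) \<longlonglongrightarrow> F' \<xi>"
    have a': "(\<lambda>n. truncated_fourier (R n) f \<xi>) \<longlonglongrightarrow> F \<xi>" unfolding R_def
      using LIMSEQ_subseq_LIMSEQ[OF a s] by (simp add: o_def)
    have z: "(\<lambda>n. exp (- \<i> * complex_of_real (R n * \<xi>)) * f (R n)) \<longlonglongrightarrow> 0"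
      "(\<lambda>n. exp (\<i> * complex_of_real (R n * \<xi>)) * f (- R n)) \<longlonglongrightarrow> 0"
      by (rule tendsto_norm_zero_cancel, use tendsto_norm_zero[OF f0(1)] in \<open>simp add: norm_mult del: of_real_mult\<close>,
        rule tendsto_norm_zero_cancel, use tendsto_norm_zero[OF f0(2)] in \<open>simp add: norm_mult del: of_real_mult\<close>)
    have "(\<lambda>n. complex_of_real (1 / sqrt (2 * pi)) *
      (exp (- \<i> * complex_of_real (R n * \<xi>)) * f (R n) - exp (\<i> * complex_of_real (R n * \<xi>)) * f (- R n))
      + \<i> * \<xi> * truncated_fourier (R n) f \<xi>) \<longlonglongrightarrow> complex_of_real (1 / sqrt (2 * pi)) * (0 - 0) + \<i> * \<xi> * F \<xi>"
      by (intro tendsto_intros a' z)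
    moreover have "truncated_fourier (R n) f' \<xi> = complex_of_real (1 / sqrt (2 * pi)) *
      (exp (- \<i> * complex_of_real (R n * \<xi>)) * f (R n) - exp (\<i> * complex_of_real (R n * \<xi>)) * f (- R n))
      + \<i> * \<xi> * truncated_fourier (R n) f \<xi>" for n
      by (rule truncated_fourier_derivative[OF d c]) (simp add: R_def)
    ultimately have "(\<lambda>n. truncated_fourier (R n) f' \<xi>) \<longlonglongrightarrow> \<i> * \<xi> * F \<xi>" by simp
    then show "F' \<xi> = \<i> * \<xi> * F \<xi>" using b unfolding R_def by (rule LIMSEQ_unique[symmetric])
  qed
qed

text \<open>Polarisation: the squared norm of u + i v exceeds the sum of the squared norms of u and
  v by twice the imaginary part of u times the conjugate of v. Each of the three norms is
  preserved.\<close>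

lemma parseval_Im:
  assumes f: "cont_L2 f" and g: "cont_L2 g" and F: "is_fourier_transform f F" and G: "is_fourier_transform g G"
  shows "(LINT x|lborel. Im (f x * cnj (g x))) = (LINT x|lborel. Im (F x * cnj (G x)))"
proof -
  have *: "(LINT x|lborel. Im (u x * cnj (v x))) =
      ((LINT x|lborel. (norm (u x + \<i> * v x))\<^sup>2) - (LINT x|lborel. (norm (u x))\<^sup>2) - (LINT x|lborel. (norm (v x))\<^sup>2)) / 2"
    if u: "square_integrable u" and v: "square_integrable v" for u v
  proof -
    have i: "integrable lborel (\<lambda>x. Im (u x * cnj (v x)))"
      by (intro integrable_Im square_integrable_mult square_integrable_cnj u v)
    have "(LINT x|lborel. (norm (u x + \<i> * v x))\<^sup>2) = (LINT x|lborel. (norm (u x))\<^sup>2 + (norm (v x))\<^sup>2 + 2 * Im (u x * cnj (v x)))"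
      by (intro Bochner_Integration.integral_cong refl) (simp only: cmod_power2, simp add: power2_eq_square algebra_simps)
    also have "\<dots> = (LINT x|lborel. (norm (u x))\<^sup>2) + (LINT x|lborel. (norm (v x))\<^sup>2) + 2 * (LINT x|lborel. Im (u x * cnj (v x)))"
    proof -
      define k where "k x = Im (u x * cnj (v x))" for x
      have "integrable lborel k" using i by (simp add: k_def[abs_def])
      then have "(LINT x|lborel. (norm (u x))\<^sup>2 + (norm (v x))\<^sup>2 + 2 * k x) = (LINT x|lborel. (norm (u x))\<^sup>2) + (LINT x|lborel. (norm (v x))\<^sup>2) + 2 * (LINT x|lborel. k x)"
        using u v by (simp add: square_integrable_def)
      then show ?thesis by (simp only: k_def)
    qed
    finally show ?thesis by simp
  qed
  have P: "(LINT x|lborel. (norm (u x))\<^sup>2) = (LINT x|lborel. (norm (U x))\<^sup>2)"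
    if "cont_L2 u" "is_fourier_transform u U" for u U
  proof -
    have s: "square_integrable u" "square_integrable U" using that by (auto simp: cont_L2_def is_fourier_transform_def)
    have "ennreal (LINT x|lborel. (norm (u x))\<^sup>2) = ennreal (LINT x|lborel. (norm (U x))\<^sup>2)"
      unfolding sq_nn_eq_LINT[OF s(1), symmetric] sq_nn_eq_LINT[OF s(2), symmetric] by (rule plancherel[symmetric, OF that])
    then show ?thesis by (subst (asm) ennreal_inj) auto
  qed
  have s: "square_integrable f" "square_integrable g" "square_integrable F" "square_integrable G"
    using f g F G by (auto simp: cont_L2_def is_fourier_transform_def)
  show ?thesis
    unfolding *[OF s(1,2)] *[OF s(3,4)]
      P[OF f F] P[OF g G] P[OF cont_L2_add[OF f g] is_fourier_transform_add[OF f g F G]] ..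
qed

section \<open>Difference quotients and the consequences of an H2 bound\<close>

lemma fourier_transform_is:
  "cont_L2 f \<Longrightarrow> is_fourier_transform f (fourier_transform f)"
  using is_fourier_transform_exists[of f] unfolding fourier_transform_def by (simp add: someI_ex)

lemma cont_L2_shift:
  assumes "cont_L2 f" shows "cont_L2 (\<lambda>x. f (x + h))"
proof -
  have "continuous_on UNIV (\<lambda>x. f (x + h))"
    using assms unfolding cont_L2_def by (auto intro!: continuous_on_compose2[of UNIV f] continuous_intros)
  moreover have "integrable lborel (\<lambda>x. (norm (f (h + 1 * x)))\<^sup>2)"
    using assms unfolding cont_L2_def square_integrable_def
    by (intro lborel_integrable_real_affine[of "\<lambda>x. (norm (f x))\<^sup>2"]) auto
  ultimately show ?thesis
    unfolding cont_L2_def square_integrable_def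
    by (auto simp: add.commute intro!: borel_measurable_continuous_onI)
qed

text \<open>The difference quotient of step \<open>1 / (n + 1)\<close>; its Fourier multiplier is dominated by \<open>\<xi>\<close>,
  so the square norm of the derivative is controlled by Plancherel and Fatou.\<close>

definition dquot :: "nat \<Rightarrow> (real \<Rightarrow> complex) \<Rightarrow> real \<Rightarrow> complex" where
  "dquot n f x = of_nat (Suc n) * f (x + 1 / real (Suc n)) + (- of_nat (Suc n)) * f x"

definition dmult :: "nat \<Rightarrow> real \<Rightarrow> complex" where
  "dmult n \<xi> = of_nat (Suc n) * exp (\<i> * complex_of_real (1 / real (Suc n) * \<xi>)) - of_nat (Suc n)"

lemma norm_dmult_le: "norm (dmult n \<xi>) \<le> \<bar>\<xi>\<bar>"
proof -
  have "norm (exp (\<i> * complex_of_real (\<xi> / real (Suc n))) - 1) \<le> \<bar>\<xi> / real (Suc n)\<bar>"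
    using iexp_approx1[of "\<xi> / real (Suc n)" 0] by simp
  then have "real (Suc n) * norm (exp (\<i> * complex_of_real (\<xi> / real (Suc n))) - 1) \<le> \<bar>\<xi>\<bar>"
    by (simp add: field_simps abs_divide)
  moreover have "dmult n \<xi> = of_nat (Suc n) * (exp (\<i> * complex_of_real (\<xi> / real (Suc n))) - 1)"
    unfolding dmult_def by (simp add: algebra_simps del: of_nat_Suc)
  ultimately show ?thesis by (simp add: norm_mult del: of_nat_Suc)
qed

lemma cont_L2_dquot:
  assumes "cont_L2 f" shows "cont_L2 (dquot n f)"
proof -
  \<comment> \<open>The translate plus n times itself, where n + 1 is the reciprocal of the step:
    this is how the multiple is expressed through \<open>cont_L2_add\<close>.\<close>
  have 1: "cont_L2 (\<lambda>x. f (x + 1 / real (Suc n)) + (of_nat (Suc n) - 1) * f (x + 1 / real (Suc n)))"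
    by (intro cont_L2_add cont_L2_shift assms)
  have "cont_L2 (\<lambda>x. (f (x + 1 / real (Suc n)) + (of_nat (Suc n) - 1) * f (x + 1 / real (Suc n))) + (- of_nat (Suc n)) * f x)"
    by (rule cont_L2_add[OF 1 assms])
  then show ?thesis unfolding dquot_def[abs_def] by (simp add: algebra_simps)
qed

lemma is_fourier_transform_dquot:
  assumes f: "cont_L2 f" and F: "is_fourier_transform f F"
  shows "is_fourier_transform (dquot n f) (\<lambda>\<xi>. dmult n \<xi> * F \<xi>)"
proof -
  let ?h = "1 / real (Suc n)"
  note s = cont_L2_shift[OF f, of ?h] and S = is_fourier_transform_shift[OF f F, of ?h]
  have 1: "cont_L2 (\<lambda>x. f (x + ?h) + (of_nat (Suc n) - 1) * f (x + ?h))"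
    by (intro cont_L2_add s)
  have "is_fourier_transform (\<lambda>x. (f (x + ?h) + (of_nat (Suc n) - 1) * f (x + ?h)) + (- of_nat (Suc n)) * f x)
    (\<lambda>\<xi>. (exp (\<i> * complex_of_real (?h * \<xi>)) * F \<xi> + (of_nat (Suc n) - 1) * (exp (\<i> * complex_of_real (?h * \<xi>)) * F \<xi>)) + (- of_nat (Suc n)) * F \<xi>)"
    by (rule is_fourier_transform_add[OF 1 f is_fourier_transform_add[OF s s S S] F])
  moreover have "dquot n f = (\<lambda>x. (f (x + ?h) + (of_nat (Suc n) - 1) * f (x + ?h)) + (- of_nat (Suc n)) * f x)"
    by (simp add: dquot_def[abs_def] algebra_simps)
  moreover have "(\<lambda>\<xi>. dmult n \<xi> * F \<xi>) = (\<lambda>\<xi>. (exp (\<i> * complex_of_real (?h * \<xi>)) * F \<xi> + (of_nat (Suc n) - 1) * (exp (\<i> * complex_of_real (?h * \<xi>)) * F \<xi>)) + (- of_nat (Suc n)) * F \<xi>)"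
    by (rule ext) (simp add: dmult_def algebra_simps)
  ultimately show ?thesis by simp
qed

lemma dquot_lim:
  assumes d: "(f has_vector_derivative f') (at x)"
  shows "(\<lambda>n. dquot n f x) \<longlonglongrightarrow> f'"
proof -
  have "((\<lambda>h. norm (f (x + h) - f x - h *\<^sub>R f') / norm h) \<longlongrightarrow> 0) (at 0)"
    using d by (simp add: has_vector_derivative_def has_derivative_at)
  moreover have "filterlim (\<lambda>n. 1 / real (Suc n)) (at 0) sequentially"
    by (rule filterlim_atI) (use LIMSEQ_Suc[OF lim_1_over_n] in auto)
  ultimately have "(\<lambda>n. norm (f (x + 1 / real (Suc n)) - f x - (1 / real (Suc n)) *\<^sub>R f') / norm (1 / real (Suc n))) \<longlonglongrightarrow> 0"
    by (rule filterlim_compose)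
  moreover have "norm (f (x + 1 / real (Suc n)) - f x - (1 / real (Suc n)) *\<^sub>R f') / norm (1 / real (Suc n)) = norm (dquot n f x - f')" for n
  proof -
    have "dquot n f x - f' = of_nat (Suc n) * (f (x + 1 / real (Suc n)) - f x - (1 / real (Suc n)) *\<^sub>R f')"
      by (simp add: dquot_def scaleR_conv_of_real algebra_simps del: of_nat_Suc)
    then show ?thesis by (simp add: norm_mult del: of_nat_Suc)
  qed
  ultimately have "(\<lambda>n. norm (dquot n f x - f')) \<longlonglongrightarrow> 0" by simp
  then show ?thesis using LIM_zero_cancel tendsto_norm_zero_iff by blast
qed

lemma dquot_has_vector_derivative:
  assumes "\<And>x. (f has_vector_derivative f' x) (at x)"
  shows "(dquot n f has_vector_derivative dquot n f' x) (at x)"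
proof -
  have "((\<lambda>x. f (x + 1 / real (Suc n))) has_vector_derivative 1 *\<^sub>R f' (x + 1 / real (Suc n))) (at x)"
    by (rule vector_diff_chain_at[of "\<lambda>x. x + 1 / real (Suc n)" 1 x f, unfolded o_def]) (auto intro!: derivative_eq_intros assms)
  then show ?thesis
    unfolding dquot_def[abs_def]
    by (intro has_vector_derivative_add has_vector_derivative_mult_right assms) simp
qed

text \<open>The derivative is classical and not yet known to lie in L2, which rules out the rule for
  transforms of derivatives; its difference quotients do lie in L2.\<close>

lemma derivative_sq_nn_le:
  assumes f: "cont_L2 f" and F: "is_fourier_transform f F"
    and d: "\<And>x. (f has_vector_derivative f' x) (at x)"
    and C: "sq_nn (\<lambda>\<xi>. complex_of_real \<xi> * F \<xi>) \<le> C"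
  shows "sq_nn f' \<le> C"
proof (rule sq_nn_fatou)
  show "dquot n f \<in> borel_measurable borel" for n by (rule cont_L2_measurable[OF cont_L2_dquot[OF f]])
  show "AE x in lborel. (\<lambda>n. dquot n f x) \<longlonglongrightarrow> f' x" by (intro always_eventually allI dquot_lim d)
  fix n
  have "sq_nn (dquot n f) = sq_nn (\<lambda>\<xi>. dmult n \<xi> * F \<xi>)"
    by (rule plancherel[symmetric, OF cont_L2_dquot[OF f] is_fourier_transform_dquot[OF f F]])
  also have "\<dots> \<le> sq_nn (\<lambda>\<xi>. complex_of_real \<xi> * F \<xi>)"
    unfolding sq_nn_def norm_mult norm_of_real
    by (intro nn_integral_mono ennreal_leI power_mono mult_right_mono norm_dmult_le) auto
  finally show "sq_nn (dquot n f) \<le> C" using C by simp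
qed

text \<open>A difference quotient of \<open>f\<close> has the corresponding quotient of
  \<open>f'\<close> as its derivative, so the first-order bound applies to it; the multiplier
  contributes the second power of the frequency.\<close>

lemma derivative2_sq_nn_le:
  assumes f: "cont_L2 f" and F: "is_fourier_transform f F"
    and d: "\<And>x. (f has_vector_derivative f' x) (at x)" and d': "\<And>x. (f' has_vector_derivative f'' x) (at x)"
    and C: "sq_nn (\<lambda>\<xi>. complex_of_real (\<xi>\<^sup>2) * F \<xi>) \<le> C"
  shows "sq_nn f'' \<le> C"
proof (rule sq_nn_fatou)
  have "continuous_on UNIV f'"
    using d' by (auto intro!: continuous_at_imp_continuous_on intro: has_vector_derivative_continuous)
  then have [measurable]: "f' \<in> borel_measurable borel" by (rule borel_measurable_continuous_onI)
  show "dquot n f' \<in> borel_measurable borel" for n unfolding dquot_def[abs_def] by measurable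
  show "AE x in lborel. (\<lambda>n. dquot n f' x) \<longlonglongrightarrow> f'' x" by (intro always_eventually allI dquot_lim d')
  fix n
  show "sq_nn (dquot n f') \<le> C"
  proof (rule derivative_sq_nn_le[OF cont_L2_dquot[OF f] is_fourier_transform_dquot[OF f F]])
    show "(dquot n f has_vector_derivative dquot n f' x) (at x)" for x by (rule dquot_has_vector_derivative[OF d])
    have "sq_nn (\<lambda>\<xi>. complex_of_real \<xi> * (dmult n \<xi> * F \<xi>)) \<le> sq_nn (\<lambda>\<xi>. complex_of_real (\<xi>\<^sup>2) * F \<xi>)"
      unfolding sq_nn_def norm_mult norm_of_real power2_eq_square[of "_ :: real" for x] abs_mult mult.assoc[symmetric]
      by (intro nn_integral_mono ennreal_leI mult_mono mult_right_mono mult_left_mono norm_dmult_le) (auto intro!: norm_dmult_le)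
    then show "sq_nn (\<lambda>\<xi>. complex_of_real \<xi> * (dmult n \<xi> * F \<xi>)) \<le> C" using C by simp
  qed
qed

lemma sobolev_2_bounds:
  assumes f: "f \<in> sobolev_space 2" and B: "sobolev_norm 2 f \<le> C"
    and d: "\<And>x. (f has_vector_derivative f' x) (at x)" and d': "\<And>x. (f' has_vector_derivative f'' x) (at x)"
  shows "sq_nn f \<le> ennreal (C\<^sup>2)" "sq_nn f' \<le> ennreal (C\<^sup>2)" "sq_nn f'' \<le> ennreal (C\<^sup>2)"
proof -
  have "continuous_on UNIV f"
    using d by (auto intro!: continuous_at_imp_continuous_on intro: has_vector_derivative_continuous)
  then have c: "cont_L2 f" using f by (simp add: cont_L2_def sobolev_space_def)
  note F = fourier_transform_is[OF c]
  have sw: "sobolev_weighted 2 f \<xi> = complex_of_real (1 + \<xi>\<^sup>2) * fourier_transform f \<xi>" for \<xi>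
    by (simp add: sobolev_weighted_def add_nonneg_pos powr_one sum_power2_gt_zero_iff)
  have s: "square_integrable (sobolev_weighted 2 f)" using f by (simp add: sobolev_space_def)
  have "sq_nn (sobolev_weighted 2 f) = ennreal ((sobolev_norm 2 f)\<^sup>2)"
    unfolding sq_nn_eq_LINT[OF s] sobolev_norm_def L2_norm_def by simp
  also have "\<dots> \<le> ennreal (C\<^sup>2)"
    using B by (intro ennreal_leI power_mono) (auto simp: sobolev_norm_def L2_norm_def)
  finally have S: "sq_nn (sobolev_weighted 2 f) \<le> ennreal (C\<^sup>2)" .
  \<comment> \<open>The weight 1 + \<xi>^2 dominates 1, |\<xi>| and \<xi>^2, so one estimate serves
    the function and both derivatives.\<close>
  have w: "sq_nn (\<lambda>\<xi>. k \<xi> * fourier_transform f \<xi>) \<le> ennreal (C\<^sup>2)" if k: "\<And>\<xi>. norm (k \<xi>) \<le> 1 + \<xi>\<^sup>2" for k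
  proof -
    have "sq_nn (\<lambda>\<xi>. k \<xi> * fourier_transform f \<xi>) \<le> sq_nn (sobolev_weighted 2 f)"
      unfolding sq_nn_def sw norm_mult norm_of_real
      by (intro nn_integral_mono ennreal_leI power_mono mult_right_mono order_trans[OF k]) auto
    then show ?thesis using S by simp
  qed
  show "sq_nn f \<le> ennreal (C\<^sup>2)" using w[of "\<lambda>_. 1"] plancherel[OF c F] by simp
  have "\<bar>\<xi>\<bar> \<le> 1 + \<xi>\<^sup>2" for \<xi> :: real
    using sum_squares_bound[of 1 "\<bar>\<xi>\<bar>"] by (simp add: power2_eq_square abs_mult_self_eq)
  then show "sq_nn f' \<le> ennreal (C\<^sup>2)" by (intro derivative_sq_nn_le[OF c F d] w) simp
  show "sq_nn f'' \<le> ennreal (C\<^sup>2)" by (intro derivative2_sq_nn_le[OF c F d d'] w) (simp add: norm_power)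
qed

section \<open>One-sided spectrum and the half-norm\<close>

lemma AE_reflect_vanish:
  assumes [measurable]: "F \<in> borel_measurable borel" and z: "AE \<xi>::real in lborel. \<xi> > 0 \<longrightarrow> F \<xi> = (0 :: complex)"
  shows "AE \<xi> in lborel. \<xi> < 0 \<longrightarrow> F (- \<xi>) = 0"
proof -
  define k where "k \<xi> = indicator {0<..} \<xi> *\<^sub>R F \<xi>" for \<xi> :: real
  have [measurable]: "k \<in> borel_measurable borel" unfolding k_def by measurable
  have "AE \<xi> in lborel. k \<xi> = 0" using z by eventually_elim (simp add: k_def indicator_def)
  then have "sq_nn k = sq_nn (\<lambda>_. 0)" by (rule sq_nn_cong_AE)
  then have "sq_nn (\<lambda>\<xi>. k (- \<xi>) - 0) = 0" using sq_nn_reflect[of k] by (simp add: sq_nn_def)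
  then have "AE \<xi> in lborel. k (- \<xi>) = 0" by (intro sq_nn_0_AE) auto
  then show ?thesis by eventually_elim (auto simp: k_def indicator_def)
qed

text \<open>A pointwise limit of the truncated transforms must agree with their L2 limit, because a
  subsequence also converges to the latter almost everywhere.\<close>

lemma is_fourier_transform_vanish:
  assumes f: "cont_L2 f" and F: "is_fourier_transform f F"
    and lim: "\<And>\<xi>. \<xi> > 0 \<Longrightarrow> ((\<lambda>R. truncated_fourier R f \<xi>) \<longlongrightarrow> 0) at_top"
  shows "AE \<xi> in lborel. \<xi> > 0 \<longrightarrow> F \<xi> = 0"
proof -
  obtain r where r: "strict_mono r" and A: "AE \<xi> in lborel. (\<lambda>n. truncated_fourier (real (r n)) f \<xi>) \<longlonglongrightarrow> F \<xi>"
    using is_fourier_transform_AE_subseq[OF f F strict_mono_id] by (auto simp: id_def)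
  have R: "filterlim (\<lambda>n. real (r n)) at_top sequentially"
    by (rule filterlim_compose[OF filterlim_real_sequentially filterlim_subseq[OF r]])
  show ?thesis using A
  proof eventually_elim
    fix \<xi> assume a: "(\<lambda>n. truncated_fourier (real (r n)) f \<xi>) \<longlonglongrightarrow> F \<xi>"
    show "\<xi> > 0 \<longrightarrow> F \<xi> = 0"
      using LIMSEQ_unique[OF a filterlim_compose[OF lim R]] by blast
  qed
qed

text \<open>A function without positive frequencies is determined by its imaginary part \<open>g\<close>, whose
  spectrum consists of two mirror images of half the spectrum of \<open>L\<close>.\<close>

lemma Hdot_half_norm_Im:
  fixes L L' :: "real \<Rightarrow> complex"
  assumes L: "cont_L2 L" and L': "cont_L2 L'" and d: "\<And>x. (L has_vector_derivative L' x) (at x)"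
    and lim: "\<And>\<xi>. \<xi> > 0 \<Longrightarrow> ((\<lambda>R. truncated_fourier R L \<xi>) \<longlongrightarrow> 0) at_top"
  defines "g \<equiv> (\<lambda>x. complex_of_real (Im (L x)))"
  shows "square_integrable (half_weighted g)"
    and "(Hdot_half_norm g)\<^sup>2 = (LINT x|lborel. Im (L x) * Re (L' x))"
proof -
  define \<Lambda> where "\<Lambda> = fourier_transform L"
  define \<Lambda>' where "\<Lambda>' = fourier_transform L'"
  have \<Lambda>: "is_fourier_transform L \<Lambda>" and \<Lambda>': "is_fourier_transform L' \<Lambda>'"
    unfolding \<Lambda>_def \<Lambda>'_def by (rule fourier_transform_is[OF L], rule fourier_transform_is[OF L'])
  have [measurable]: "\<Lambda> \<in> borel_measurable borel" by (rule is_fourier_transform_measurable[OF \<Lambda>])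
  have v: "AE \<xi> in lborel. \<xi> > 0 \<longrightarrow> \<Lambda> \<xi> = 0" by (rule is_fourier_transform_vanish[OF L \<Lambda> lim])
  have v': "AE \<xi> in lborel. \<xi> < 0 \<longrightarrow> \<Lambda> (- \<xi>) = 0" by (rule AE_reflect_vanish[OF _ v]) measurable
  have D: "AE \<xi> in lborel. \<Lambda>' \<xi> = \<i> * \<xi> * \<Lambda> \<xi>" by (rule is_fourier_transform_derivative[OF L L' d \<Lambda> \<Lambda>'])
  have Lc: "cont_L2 (\<lambda>x. cnj (L x))"
    using L unfolding cont_L2_def by (auto intro: square_integrable_cnj continuous_intros)
  \<comment> \<open>Twice i times the imaginary part of \<open>L\<close>. Its transform superposes
    the spectrum of \<open>L\<close> and the reflected conjugate spectrum.\<close>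
  define u where "u x = L x + (-1) * cnj (L x)" for x
  define U where "U \<xi> = \<Lambda> \<xi> + (-1) * cnj (\<Lambda> (- \<xi>))" for \<xi>
  have u: "cont_L2 u" unfolding u_def[abs_def] by (rule cont_L2_add[OF L Lc])
  have U: "is_fourier_transform u U" unfolding u_def[abs_def] U_def[abs_def]
    by (rule is_fourier_transform_add[OF L Lc \<Lambda> is_fourier_transform_cnj[OF L \<Lambda>]])
  \<comment> \<open>That is, g = u / (2 i), in the form demanded by the rule for linear
    combinations.\<close>
  have ge: "g = (\<lambda>x. u x + (1 / (2 * \<i>) - 1) * u x)"
  proof
    fix x
    have "u x = complex_of_real (2 * Im (L x)) * \<i>" by (simp add: u_def complex_diff_cnj)
    then show "g x = u x + (1 / (2 * \<i>) - 1) * u x" by (simp add: g_def algebra_simps)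
  qed
  have g: "cont_L2 g" unfolding ge by (rule cont_L2_add[OF u u])
  define G where "G = fourier_transform g"
  have G: "is_fourier_transform g G" unfolding G_def by (rule fourier_transform_is[OF g])
  have G': "is_fourier_transform g (\<lambda>\<xi>. U \<xi> + (1 / (2 * \<i>) - 1) * U \<xi>)"
    unfolding ge by (rule is_fourier_transform_add[OF u u U U])
  have [measurable]: "G \<in> borel_measurable borel" by (rule is_fourier_transform_measurable[OF G])
  have GA: "AE \<xi> in lborel. G \<xi> = U \<xi> + (1 / (2 * \<i>) - 1) * U \<xi>"
    by (rule is_fourier_transform_unique[OF g G G'])
  define E where "E \<xi> = \<bar>\<xi>\<bar> * (norm (\<Lambda> \<xi>))\<^sup>2" for \<xi> :: real
  \<comment> \<open>At every nonzero frequency one of the two mirror spectra vanishes, so no cross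
    term appears; at frequency 0 the weight vanishes. The divisor 4 is the square of |2 i|.\<close>
  have hw: "AE \<xi> in lborel. (norm (half_weighted g \<xi>))\<^sup>2 = (E \<xi> + E (- \<xi>)) / 4"
    using GA v v'
  proof eventually_elim
    fix \<xi> assume a: "G \<xi> = U \<xi> + (1 / (2 * \<i>) - 1) * U \<xi>" "0 < \<xi> \<longrightarrow> \<Lambda> \<xi> = 0" "\<xi> < 0 \<longrightarrow> \<Lambda> (- \<xi>) = 0"
    have nU: "norm (U \<xi>) = 2 * norm (G \<xi>)"
    proof -
      have "G \<xi> = U \<xi> / (2 * \<i>)" using a(1) by (simp add: algebra_simps)
      then show ?thesis by (simp add: norm_divide norm_mult)
    qed
    have "(norm (half_weighted g \<xi>))\<^sup>2 = \<bar>\<xi>\<bar> * (norm (U \<xi>))\<^sup>2 / 4"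
      unfolding half_weighted_def G_def[symmetric]
      by (simp add: nU norm_mult power_mult_distrib powr_half_sqrt)
    also have "\<bar>\<xi>\<bar> * (norm (U \<xi>))\<^sup>2 = E \<xi> + E (- \<xi>)"
      using a(2,3) by (cases \<xi> "0 :: real" rule: linorder_cases) (simp_all add: U_def E_def)
    finally show "(norm (half_weighted g \<xi>))\<^sup>2 = (E \<xi> + E (- \<xi>)) / 4" .
  qed
  \<comment> \<open>On the support of \<open>\<Lambda>\<close> the frequency is not positive, so
    -\<xi> equals |\<xi>|. This is the place where the sign of the half-norm identity is
    decided.\<close>
  have EI: "AE \<xi> in lborel. - Im (\<Lambda>' \<xi> * cnj (\<Lambda> \<xi>)) = E \<xi>"
    using v D
  proof eventually_elim
    fix \<xi> assume a: "0 < \<xi> \<longrightarrow> \<Lambda> \<xi> = 0" "\<Lambda>' \<xi> = \<i> * \<xi> * \<Lambda> \<xi>"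
    have "\<Lambda>' \<xi> * cnj (\<Lambda> \<xi>) = \<i> * \<xi> * complex_of_real ((norm (\<Lambda> \<xi>))\<^sup>2)"
      unfolding a(2) complex_norm_square by (simp add: mult_ac)
    then have "- Im (\<Lambda>' \<xi> * cnj (\<Lambda> \<xi>)) = - \<xi> * (norm (\<Lambda> \<xi>))\<^sup>2" by simp
    then show "- Im (\<Lambda>' \<xi> * cnj (\<Lambda> \<xi>)) = E \<xi>" using a(1) by (cases "\<xi> > 0") (auto simp: E_def)
  qed
  have iI: "integrable lborel (\<lambda>\<xi>. - Im (\<Lambda>' \<xi> * cnj (\<Lambda> \<xi>)))"
    using \<Lambda> \<Lambda>' unfolding is_fourier_transform_def
    by (intro integrable_minus integrable_Im square_integrable_mult square_integrable_cnj) auto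
  have Em[measurable]: "E \<in> borel_measurable borel" unfolding E_def by measurable
  have iE: "integrable lborel E" using iI by (rule integrable_cong_AE_imp) (use EI in auto)
  have iE': "integrable lborel (\<lambda>\<xi>. E (- \<xi>))"
    using lborel_integrable_real_affine[OF iE, of "-1" 0] by simp
  have rE: "(LINT \<xi>|lborel. E (- \<xi>)) = (LINT \<xi>|lborel. E \<xi>)"
    using lborel_integral_real_affine[of "-1" E 0] by simp
  have hm[measurable]: "half_weighted g \<in> borel_measurable borel"
    unfolding half_weighted_def[abs_def] G_def[symmetric] by measurable
  have ihw: "integrable lborel (\<lambda>\<xi>. (norm (half_weighted g \<xi>))\<^sup>2)"
    by (rule integrable_cong_AE_imp[of _ "\<lambda>\<xi>. (E \<xi> + E (- \<xi>)) / 4"]) (use iE iE' hw in auto)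
  show "square_integrable (half_weighted g)" unfolding square_integrable_def using ihw by simp
  have "(Hdot_half_norm g)\<^sup>2 = (LINT \<xi>|lborel. (norm (half_weighted g \<xi>))\<^sup>2)"
    unfolding Hdot_half_norm_def L2_norm_def by (subst real_sqrt_pow2) auto
  also have "\<dots> = (LINT \<xi>|lborel. (E \<xi> + E (- \<xi>)) / 4)"
    by (rule integral_cong_AE) (use hw in auto)
  also have "\<dots> = (LINT \<xi>|lborel. E \<xi>) / 2" using iE iE' rE by simp
  also have "(LINT \<xi>|lborel. E \<xi>) = (LINT \<xi>|lborel. - Im (\<Lambda>' \<xi> * cnj (\<Lambda> \<xi>)))"
    by (rule integral_cong_AE) (use EI iI in \<open>auto dest: borel_measurable_integrable\<close>)
  also have "\<dots> = - (LINT x|lborel. Im (L' x * cnj (L x)))"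
    unfolding parseval_Im[OF L' L \<Lambda>' \<Lambda>] by (rule Bochner_Integration.integral_minus)
  \<comment> \<open>The imaginary part of L' times the conjugate of L is Re L Im L' - Im L Re L'. As
    Re L Im L is a total derivative up to integration, the two products have opposite
    integrals.\<close>
  also have "(LINT x|lborel. Im (L' x * cnj (L x))) = - 2 * (LINT x|lborel. Im (L x) * Re (L' x))"
  proof -
    have sL: "square_integrable L" "square_integrable L'" and cL: "continuous_on UNIV L" "continuous_on UNIV L'"
      using L L' by (auto simp: cont_L2_def)
    have ir: "integrable lborel (\<lambda>x. Im (L' x * cnj (L x)))" "integrable lborel (\<lambda>x. Re (L' x * cnj (L x)))"
      "integrable lborel (\<lambda>x. Im (L' x * L x))" "integrable lborel (\<lambda>x. Im (L x * L x))"
      by (intro integrable_Im integrable_Re square_integrable_mult square_integrable_cnj sL)+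
    have dR: "((\<lambda>x. Re (L x)) has_vector_derivative Re (L' x)) (at x)" and dI: "((\<lambda>x. Im (L x)) has_vector_derivative Im (L' x)) (at x)" for x
      using d by (auto intro: bounded_linear.has_vector_derivative[OF bounded_linear_Re] bounded_linear.has_vector_derivative[OF bounded_linear_Im])
    have "(LINT x|lborel. Re (L x) * Im (L' x) + Re (L' x) * Im (L x)) = 0"
    proof (rule integrable_C1_limits_0(3))
      show "((\<lambda>x. Re (L x) * Im (L x)) has_vector_derivative Re (L x) * Im (L' x) + Re (L' x) * Im (L x)) (at x)" for x
        by (rule has_vector_derivative_mult[OF dR dI])
      show "continuous_on UNIV (\<lambda>x. Re (L x) * Im (L' x) + Re (L' x) * Im (L x))" by (intro continuous_intros cL)
      have "integrable lborel (\<lambda>x. Im (L x * L x) / 2)" using ir(4) by simp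
      then show "integrable lborel (\<lambda>x. Re (L x) * Im (L x))" by (simp add: mult.commute)
      have "Im (L' x * L x) = Re (L x) * Im (L' x) + Re (L' x) * Im (L x)" for x by simp
      note this[symmetric]
      then show "integrable lborel (\<lambda>x. Re (L x) * Im (L' x) + Re (L' x) * Im (L x))" using ir(3) by (simp only:)
    qed
    moreover have "integrable lborel (\<lambda>x. Im (L x) * Re (L' x))"
    proof -
      have "integrable lborel (\<lambda>x. (Im (L' x * L x) - Im (L' x * cnj (L x))) / 2)"
        by (intro integrable_divide Bochner_Integration.integrable_diff ir)
      moreover have "(Im (L' x * L x) - Im (L' x * cnj (L x))) / 2 = Im (L x) * Re (L' x)" for x by simp
      ultimately show ?thesis by (simp only:)
    qed
    moreover have "(LINT x|lborel. Im (L' x * cnj (L x)))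
       = (LINT x|lborel. (Re (L x) * Im (L' x) + Re (L' x) * Im (L x)) - 2 * (Im (L x) * Re (L' x)))"
      by (intro Bochner_Integration.integral_cong refl) (simp add: algebra_simps)
    moreover have "integrable lborel (\<lambda>x. Re (L x) * Im (L' x) + Re (L' x) * Im (L x))"
    proof -
      have "Im (L' x * L x) = Re (L x) * Im (L' x) + Re (L' x) * Im (L x)" for x by simp
      note this[symmetric]
      then show ?thesis using ir(3) by (simp only:)
    qed
    ultimately show ?thesis
      by (simp only: Bochner_Integration.integral_diff integrable_mult_right integral_mult_right_zero)
  qed
  finally show "(Hdot_half_norm g)\<^sup>2 = (LINT x|lborel. Im (L x) * Re (L' x))" by simp
qed

section \<open>The Hilbert transform of differentiable functions\<close>

lemma nn_Cauchy_Schwarz: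
  fixes f g :: "real \<Rightarrow> real"
  assumes [measurable]: "f \<in> borel_measurable borel" "g \<in> borel_measurable borel"
    and nn: "\<And>x. f x \<ge> 0" "\<And>x. g x \<ge> 0"
    and a: "(\<integral>\<^sup>+x. ennreal ((f x)\<^sup>2) \<partial>lborel) \<le> ennreal a" and b: "(\<integral>\<^sup>+x. ennreal ((g x)\<^sup>2) \<partial>lborel) \<le> ennreal b"
    and ab: "a \<ge> 0" "b \<ge> 0"
  shows "(\<integral>\<^sup>+x. ennreal (f x * g x) \<partial>lborel) \<le> ennreal (sqrt (a * b))"
proof -
  let ?X = "\<integral>\<^sup>+x. ennreal (f x * g x) \<partial>lborel"
  have "?X = (\<integral>\<^sup>+x. ennreal (f x) * ennreal (g x) \<partial>lborel)" using nn by (simp add: ennreal_mult)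
  then have "?X\<^sup>2 \<le> (\<integral>\<^sup>+x. (ennreal (f x))\<^sup>2 \<partial>lborel) * (\<integral>\<^sup>+x. (ennreal (g x))\<^sup>2 \<partial>lborel)"
    using Cauchy_Schwarz_nn_integral[of "\<lambda>x. ennreal (f x)" lborel "\<lambda>x. ennreal (g x)"] by simp
  also have "\<dots> = (\<integral>\<^sup>+x. ennreal ((f x)\<^sup>2) \<partial>lborel) * (\<integral>\<^sup>+x. ennreal ((g x)\<^sup>2) \<partial>lborel)"
    using nn by (simp add: ennreal_power)
  also have "\<dots> \<le> ennreal a * ennreal b" by (intro mult_mono a b) auto
  finally have X2: "?X\<^sup>2 \<le> ennreal (a * b)" using ab by (simp add: ennreal_mult)
  have "?X \<noteq> \<top>"
  proof
    assume "?X = \<top>"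
    then show False using X2 by (simp add: power2_eq_square top_unique)
  qed
  then obtain r where r: "?X = ennreal r" "r \<ge> 0" by (cases ?X rule: ennreal_cases) auto
  have "r\<^sup>2 \<le> a * b" using X2 r ab by (simp add: ennreal_power ennreal_le_iff)
  then show ?thesis unfolding r(1) by (intro ennreal_leI real_le_rsqrt)
qed

lemma sq_nn_le_imp:
  assumes "sq_nn f \<le> ennreal A" shows "(\<integral>\<^sup>+x. ennreal ((norm (f x))\<^sup>2) \<partial>lborel) \<le> ennreal A"
  using assms by (simp add: sq_nn_def)

text \<open>Cauchy-Schwarz of the derivative against the indicator of [a, b]. The resulting Hoelder
  exponent 1/2 is what makes the paired Hilbert kernel integrable at the singularity.\<close>

lemma norm_increment_le:
  assumes d: "\<And>x. (v has_vector_derivative v' x) (at x)" and c: "continuous_on UNIV v'"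
    and A: "sq_nn v' \<le> ennreal A" "A \<ge> 0" and ab: "a \<le> b"
  shows "norm (v b - v a) \<le> sqrt ((b - a) * A)"
proof -
  have [measurable]: "v' \<in> borel_measurable borel" by (rule borel_measurable_continuous_onI[OF c])
  have i: "integrable lborel (\<lambda>t. indicator {a..b} t *\<^sub>R v' t)"
    by (intro borel_integrable_compact continuous_on_subset[OF c]) auto
  have inn: "integrable lborel (\<lambda>t. indicator {a..b} t * norm (v' t))" using integrable_norm[OF i] by simp
  have "(\<integral>\<^sup>+x. ennreal ((indicator {a..b} x)\<^sup>2) \<partial>lborel) = (\<integral>\<^sup>+x. indicator {a..b} x \<partial>lborel)"
    by (intro nn_integral_cong) (auto simp: indicator_def)
  also have "\<dots> = ennreal (b - a)" using ab by simp
  finally have i1: "(\<integral>\<^sup>+x. ennreal ((indicator {a..b} x)\<^sup>2) \<partial>lborel) \<le> ennreal (b - a)" by simp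
  have "ennreal (norm (v b - v a)) \<le> ennreal (LINT t|lborel. norm (indicator {a..b} t *\<^sub>R v' t))"
    unfolding LINT_indicator_FTC[OF ab d c, symmetric] by (intro ennreal_leI integral_norm_bound)
  also have "\<dots> = (\<integral>\<^sup>+t. ennreal (indicator {a..b} t * norm (v' t)) \<partial>lborel)"
    using inn by (subst nn_integral_eq_integral) auto
  also have "\<dots> \<le> ennreal (sqrt ((b - a) * A))"
    by (rule nn_Cauchy_Schwarz[OF _ _ _ _ i1 sq_nn_le_imp[OF A(1)]]) (use ab A in auto)
  finally show ?thesis using ab A by (subst (asm) ennreal_le_iff) auto
qed

text \<open>The principal value with the points \<open>\<alpha> - y\<close> and \<open>\<alpha> + y\<close> paired, which makes it an absolutely
  convergent integral.\<close>

definition hil_kernel :: "(real \<Rightarrow> complex) \<Rightarrow> real \<Rightarrow> real \<Rightarrow> complex" where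
  "hil_kernel v \<alpha> y = (v (\<alpha> - y) - v (\<alpha> + y)) / complex_of_real y"

definition hil :: "(real \<Rightarrow> complex) \<Rightarrow> real \<Rightarrow> complex" where
  "hil v \<alpha> = (LINT y|lborel. indicator {0<..} y *\<^sub>R hil_kernel v \<alpha> y)"

section \<open>The paired principal value for functions with an H1 bound\<close>

lemma hil_kernel_measurable [measurable]:
  assumes [measurable]: "v \<in> borel_measurable borel"
  shows "hil_kernel v \<alpha> \<in> borel_measurable borel"
  unfolding hil_kernel_def[abs_def] by measurable

text \<open>The constant is an explicit argument so that every estimate depends on the function
  through it alone; uniformity in space and time is then automatic.\<close>

definition H1_bound :: "(real \<Rightarrow> complex) \<Rightarrow> (real \<Rightarrow> complex) \<Rightarrow> real \<Rightarrow> bool" where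
  "H1_bound v v' A \<longleftrightarrow> (\<forall>x. (v has_vector_derivative v' x) (at x)) \<and> continuous_on UNIV v' \<and>
     A \<ge> 0 \<and> sq_nn v \<le> ennreal A \<and> sq_nn v' \<le> ennreal A"

lemma H1_bound_cont:
  assumes "H1_bound v v' A" shows "continuous_on UNIV v" "continuous_on UNIV v'"
  using assms unfolding H1_bound_def
  by (auto intro!: continuous_at_imp_continuous_on intro: has_vector_derivative_continuous)

lemma H1_bound_cont_L2:
  assumes "H1_bound v v' A" shows "cont_L2 v" "cont_L2 v'"
  using assms H1_bound_cont[OF assms] unfolding H1_bound_def cont_L2_def square_integrable_iff
  by (auto intro: borel_measurable_continuous_onI le_less_trans)

text \<open>The increment across 2 y is at most sqrt(2 y A), so the kernel is at most sqrt(2 A)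
  y^(-1/2). Integration gives 2 sqrt 2 times sqrt A sqrt \<epsilon>, and 2 sqrt 2 is below
  3.\<close>

lemma hil_kernel_near:
  assumes v: "H1_bound v v' A" and e: "\<epsilon> \<ge> 0"
  shows "(\<integral>\<^sup>+y. ennreal (indicator {0<..\<epsilon>} y * norm (hil_kernel v \<alpha> y)) \<partial>lborel) \<le> ennreal (3 * sqrt A * sqrt \<epsilon>)"
proof -
  have A: "A \<ge> 0" using v by (simp add: H1_bound_def)
  have b: "norm (hil_kernel v \<alpha> y) \<le> sqrt (2 * A) * (y powr (-1/2))" if "y > 0" for y
  proof -
    have "norm (v (\<alpha> + y) - v (\<alpha> - y)) \<le> sqrt ((\<alpha> + y - (\<alpha> - y)) * A)"
      using that v by (intro norm_increment_le[of v v']) (auto simp: H1_bound_def)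
    then have "norm (v (\<alpha> - y) - v (\<alpha> + y)) \<le> sqrt (2 * A) * sqrt y"
      by (simp add: norm_minus_commute real_sqrt_mult[symmetric] mult_ac)
    then have "norm (hil_kernel v \<alpha> y) \<le> sqrt (2 * A) * sqrt y / y"
      using that by (simp add: hil_kernel_def norm_divide divide_right_mono)
    also have "\<dots> = sqrt (2 * A) * (sqrt y / y)" by simp
    also have "sqrt y / y = y powr (-1/2)"
      using that by (simp add: powr_minus powr_half_sqrt real_div_sqrt field_simps)
    finally show ?thesis .
  qed
  have "(\<integral>\<^sup>+y. ennreal (indicator {0<..\<epsilon>} y * norm (hil_kernel v \<alpha> y)) \<partial>lborel)
    \<le> (\<integral>\<^sup>+y. ennreal (sqrt (2 * A)) * (ennreal (indicator {0..\<epsilon>} y * (y powr (-1/2)))) \<partial>lborel)"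
    using A b by (intro nn_integral_mono) (auto simp: indicator_def ennreal_mult[symmetric] intro!: ennreal_leI)
  also have "\<dots> = ennreal (sqrt (2 * A)) * (\<integral>\<^sup>+y. (ennreal (indicator {0..\<epsilon>} y * (y powr (-1/2)))) \<partial>lborel)"
    by (rule nn_integral_cmult) measurable
  also have "(\<integral>\<^sup>+y. (ennreal (indicator {0..\<epsilon>} y * (y powr (-1/2)))) \<partial>lborel) = ennreal (\<epsilon> powr (-1/2+1) / (-1/2+1))"
    by (rule nn_integral_has_integral_lebesgue[OF _ has_integral_powr_from_0]) (use e in auto)
  also have "\<epsilon> powr (-1/2+1) / (-1/2+1) = 2 * sqrt \<epsilon>" using e by (simp add: powr_half_sqrt)
  also have "ennreal (sqrt (2 * A)) * ennreal (2 * sqrt \<epsilon>) = ennreal (sqrt (2 * A) * (2 * sqrt \<epsilon>))"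
    using A e by (simp add: ennreal_mult)
  also have "\<dots> \<le> ennreal (3 * sqrt A * sqrt \<epsilon>)"
  proof (rule ennreal_leI)
    have "sqrt 2 \<le> 3 / 2" by (rule real_le_lsqrt) (auto simp: power2_eq_square)
    then have "sqrt 2 * 2 \<le> 3" by simp
    then have "(sqrt 2 * 2) * (sqrt A * sqrt \<epsilon>) \<le> 3 * (sqrt A * sqrt \<epsilon>)" using A e by (intro mult_right_mono) auto
    then show "sqrt (2 * A) * (2 * sqrt \<epsilon>) \<le> 3 * sqrt A * sqrt \<epsilon>" by (simp add: real_sqrt_mult mult_ac)
  qed
  finally show ?thesis .
qed

lemma nn_integral_inverse_sq:
  assumes "R > 0"
  shows "(\<integral>\<^sup>+y. ennreal ((indicator {R..} y * (1 / y))\<^sup>2) \<partial>lborel) = ennreal (1 / R)"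
proof -
  have "(\<integral>\<^sup>+y. ennreal ((indicator {R..} y * (1 / y))\<^sup>2) \<partial>lborel) = (\<integral>\<^sup>+y. ennreal (1 / y\<^sup>2) * indicator {R..} y \<partial>lborel)"
    by (intro nn_integral_cong) (auto simp: indicator_def power_divide)
  also have "\<dots> = ennreal (0 - (- (1 / R)))"
  proof (rule nn_integral_FTC_atLeast)
    show "((\<lambda>y. - (1 / y)) has_real_derivative 1 / y\<^sup>2) (at y)" if "R \<le> y" for y
      using that assms by (auto intro!: derivative_eq_intros simp: power2_eq_square)
    show "((\<lambda>y :: real. - (1 / y)) \<longlongrightarrow> 0) at_top" by real_asymp
  qed auto
  finally show ?thesis by simp
qed

text \<open>Here there is no cancellation: 1 / y has squared L2 norm 1 / R beyond R, and
  Cauchy-Schwarz is applied to each of the two translates of \<open>v\<close>.\<close>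

lemma hil_kernel_far:
  assumes v: "H1_bound v v' A" and R: "R > 0"
  shows "(\<integral>\<^sup>+y. ennreal (indicator {R..} y * norm (hil_kernel v \<alpha> y)) \<partial>lborel) \<le> ennreal (2 * sqrt A / sqrt R)"
proof -
  have A: "A \<ge> 0" using v by (simp add: H1_bound_def)
  have [measurable]: "v \<in> borel_measurable borel" by (rule borel_measurable_continuous_onI[OF H1_bound_cont(1)[OF v]])
  have one: "(\<integral>\<^sup>+y. ennreal ((indicator {R..} y * (1 / y)) * norm (v (\<alpha> + c * y))) \<partial>lborel) \<le> ennreal (sqrt A / sqrt R)"
    if c: "c = 1 \<or> c = -1" for c :: real
  proof -
    have "(\<integral>\<^sup>+x. ennreal ((norm (v x))\<^sup>2) \<partial>lborel) = ennreal \<bar>c\<bar> * (\<integral>\<^sup>+y. ennreal ((norm (v (\<alpha> + c * y)))\<^sup>2) \<partial>lborel)"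
      using c by (intro nn_integral_real_affine) auto
    moreover have "sq_nn v \<le> ennreal A" using v by (simp add: H1_bound_def)
    ultimately have b: "(\<integral>\<^sup>+y. ennreal ((norm (v (\<alpha> + c * y)))\<^sup>2) \<partial>lborel) \<le> ennreal A"
      using c by (auto simp: sq_nn_def)
    have "(\<integral>\<^sup>+y. ennreal ((indicator {R..} y * (1 / y)) * norm (v (\<alpha> + c * y))) \<partial>lborel) \<le> ennreal (sqrt ((1 / R) * A))"
      by (rule nn_Cauchy_Schwarz) (use A R nn_integral_inverse_sq[OF R] b in \<open>auto simp: indicator_def\<close>)
    then show ?thesis by (simp add: real_sqrt_mult real_sqrt_divide)
  qed
  have "(\<integral>\<^sup>+y. ennreal (indicator {R..} y * norm (hil_kernel v \<alpha> y)) \<partial>lborel)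
    \<le> (\<integral>\<^sup>+y. ennreal ((indicator {R..} y * (1 / y)) * norm (v (\<alpha> + (-1) * y))) + ennreal ((indicator {R..} y * (1 / y)) * norm (v (\<alpha> + 1 * y))) \<partial>lborel)"
  proof (rule nn_integral_mono)
    fix y :: real
    have "indicator {R..} y * norm (hil_kernel v \<alpha> y) \<le> (indicator {R..} y * (1 / y)) * norm (v (\<alpha> + (-1) * y)) + (indicator {R..} y * (1 / y)) * norm (v (\<alpha> + 1 * y))"
      using R norm_triangle_ineq4[of "v (\<alpha> - y)" "v (\<alpha> + y)"]
      by (auto simp: indicator_def hil_kernel_def norm_divide field_simps)
    then have "ennreal (indicator {R..} y * norm (hil_kernel v \<alpha> y)) \<le> ennreal ((indicator {R..} y * (1 / y)) * norm (v (\<alpha> + (-1) * y)) + (indicator {R..} y * (1 / y)) * norm (v (\<alpha> + 1 * y)))"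
      by (rule ennreal_leI)
    then show "ennreal (indicator {R..} y * norm (hil_kernel v \<alpha> y)) \<le> ennreal ((indicator {R..} y * (1 / y)) * norm (v (\<alpha> + (-1) * y))) + ennreal ((indicator {R..} y * (1 / y)) * norm (v (\<alpha> + 1 * y)))"
      using R by (subst (asm) ennreal_plus) (auto simp: indicator_def)
  qed
  also have "\<dots> = (\<integral>\<^sup>+y. ennreal ((indicator {R..} y * (1 / y)) * norm (v (\<alpha> + (-1) * y))) \<partial>lborel) + (\<integral>\<^sup>+y. ennreal ((indicator {R..} y * (1 / y)) * norm (v (\<alpha> + 1 * y))) \<partial>lborel)"
    by (rule nn_integral_add) measurable
  also have "\<dots> \<le> ennreal (sqrt A / sqrt R) + ennreal (sqrt A / sqrt R)" by (intro add_mono one) auto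
  also have "\<dots> = ennreal (2 * sqrt A / sqrt R)" using A R by (subst ennreal_plus[symmetric]) auto
  finally show ?thesis .
qed

lemma hil_kernel_integrable:
  assumes v: "H1_bound v v' A"
  shows "integrable lborel (\<lambda>y. indicator {0<..} y *\<^sub>R hil_kernel v \<alpha> y)"
    and "norm (hil v \<alpha>) \<le> 5 * sqrt A"
proof -
  have A: "A \<ge> 0" using v by (simp add: H1_bound_def)
  have [measurable]: "v \<in> borel_measurable borel" by (rule borel_measurable_continuous_onI[OF H1_bound_cont(1)[OF v]])
  \<comment> \<open>Splitting at y = 1 gives the constant 5 as 3 from the near part plus 2 from the
    far part.\<close>
  have "(\<integral>\<^sup>+y. ennreal (norm (indicator {0<..} y *\<^sub>R hil_kernel v \<alpha> y)) \<partial>lborel) \<le>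
    (\<integral>\<^sup>+y. ennreal (indicator {0<..1} y * norm (hil_kernel v \<alpha> y)) + ennreal (indicator {1..} y * norm (hil_kernel v \<alpha> y)) \<partial>lborel)"
    by (intro nn_integral_mono) (auto simp: indicator_def)
  also have "\<dots> = (\<integral>\<^sup>+y. ennreal (indicator {0<..1} y * norm (hil_kernel v \<alpha> y)) \<partial>lborel) + (\<integral>\<^sup>+y. ennreal (indicator {1..} y * norm (hil_kernel v \<alpha> y)) \<partial>lborel)"
    by (rule nn_integral_add) measurable
  also have "\<dots> \<le> ennreal (3 * sqrt A * sqrt 1) + ennreal (2 * sqrt A / sqrt 1)"
    by (intro add_mono hil_kernel_near[OF v] hil_kernel_far[OF v]) auto
  also have "\<dots> = ennreal (5 * sqrt A)" using A by (subst ennreal_plus[symmetric]) auto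
  finally have *: "(\<integral>\<^sup>+y. ennreal (norm (indicator {0<..} y *\<^sub>R hil_kernel v \<alpha> y)) \<partial>lborel) \<le> ennreal (5 * sqrt A)" .
  show i: "integrable lborel (\<lambda>y. indicator {0<..} y *\<^sub>R hil_kernel v \<alpha> y)"
    by (rule integrableI_bounded) (use * in \<open>measurable, auto intro: le_less_trans\<close>)
  have "norm (hil v \<alpha>) \<le> (LINT y|lborel. norm (indicator {0<..} y *\<^sub>R hil_kernel v \<alpha> y))"
    unfolding hil_def by (rule integral_norm_bound)
  also have "\<dots> \<le> 5 * sqrt A"
    using * A by (subst (asm) nn_integral_eq_integral[OF integrable_norm[OF i]]) (auto simp: ennreal_le_iff)
  finally show "norm (hil v \<alpha>) \<le> 5 * sqrt A" .
qed

text \<open>The two discarded pieces are exactly those estimated above. The error does not involve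
  \<alpha>, which gives the uniform convergence needed for differentiation.\<close>

lemma hil_truncation:
  assumes v: "H1_bound v v' A" and e: "\<epsilon> > 0" "\<epsilon> \<le> R"
  shows "norm (hil v \<alpha> - (LINT y|lborel. indicator {\<epsilon>..R} y *\<^sub>R hil_kernel v \<alpha> y)) \<le> 3 * sqrt A * sqrt \<epsilon> + 2 * sqrt A / sqrt R"
proof -
  have A: "A \<ge> 0" using v by (simp add: H1_bound_def)
  have [measurable]: "v \<in> borel_measurable borel" by (rule borel_measurable_continuous_onI[OF H1_bound_cont(1)[OF v]])
  note i = hil_kernel_integrable(1)[OF v, of \<alpha>]
  have i2: "integrable lborel (\<lambda>y. indicator {\<epsilon>..R} y *\<^sub>R hil_kernel v \<alpha> y)"
    by (rule Bochner_Integration.integrable_bound[OF i]) (use e in \<open>auto simp: indicator_def\<close>)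
  note i3 = Bochner_Integration.integrable_diff[OF i i2]
  let ?d = "\<lambda>y. indicator {0<..} y *\<^sub>R hil_kernel v \<alpha> y - indicator {\<epsilon>..R} y *\<^sub>R hil_kernel v \<alpha> y"
  have "ennreal (norm (hil v \<alpha> - (LINT y|lborel. indicator {\<epsilon>..R} y *\<^sub>R hil_kernel v \<alpha> y))) = ennreal (norm (LINT y|lborel. ?d y))"
    unfolding hil_def using i i2 by simp
  also have "\<dots> \<le> ennreal (LINT y|lborel. norm (?d y))" by (intro ennreal_leI integral_norm_bound)
  also have "\<dots> = (\<integral>\<^sup>+y. ennreal (norm (?d y)) \<partial>lborel)"
    by (rule nn_integral_eq_integral[OF integrable_norm[OF i3], symmetric]) auto
  also have "\<dots> \<le> (\<integral>\<^sup>+y. ennreal (indicator {0<..\<epsilon>} y * norm (hil_kernel v \<alpha> y)) + ennreal (indicator {R..} y * norm (hil_kernel v \<alpha> y)) \<partial>lborel)"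
    using e by (intro nn_integral_mono) (auto simp: indicator_def)
  also have "\<dots> = (\<integral>\<^sup>+y. ennreal (indicator {0<..\<epsilon>} y * norm (hil_kernel v \<alpha> y)) \<partial>lborel) + (\<integral>\<^sup>+y. ennreal (indicator {R..} y * norm (hil_kernel v \<alpha> y)) \<partial>lborel)"
    by (rule nn_integral_add) measurable
  also have "\<dots> \<le> ennreal (3 * sqrt A * sqrt \<epsilon>) + ennreal (2 * sqrt A / sqrt R)"
    by (intro add_mono hil_kernel_near[OF v] hil_kernel_far[OF v]) (use e in auto)
  also have "\<dots> = ennreal (3 * sqrt A * sqrt \<epsilon> + 2 * sqrt A / sqrt R)" using A e by (subst ennreal_plus[symmetric]) auto
  finally show ?thesis using A e by (subst (asm) ennreal_le_iff) auto
qed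

section \<open>Agreement of the principal value with the paired integral\<close>

lemma hil_kernel_integrable_Icc:
  assumes c: "continuous_on UNIV v" and e: "0 < \<epsilon>"
  shows "integrable lborel (\<lambda>y. indicator {\<epsilon>..R} y *\<^sub>R (v (\<alpha> + s * y) / complex_of_real y))"
  by (intro borel_integrable_compact continuous_intros continuous_on_compose2[OF c]) (use e in auto)

text \<open>The truncated region has two components; substituting \<alpha> - y in the left one and
  \<alpha> + y in the right one folds them onto the same interval of y.\<close>

lemma hilbert_truncation_eq:
  assumes c: "continuous_on UNIV v" and e: "0 < \<epsilon>"
  shows "(LINT \<beta>:{\<beta>. \<epsilon> < \<bar>\<alpha> - \<beta>\<bar> \<and> \<bar>\<alpha> - \<beta>\<bar> < R}|lborel. v \<beta> / complex_of_real (\<alpha> - \<beta>))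
    = (LINT y|lborel. indicator {\<epsilon><..<R} y *\<^sub>R hil_kernel v \<alpha> y)"
proof -
  have [measurable]: "v \<in> borel_measurable borel" by (rule borel_measurable_continuous_onI[OF c])
  let ?l = "\<lambda>\<beta>. indicator {\<epsilon><..<R} (\<alpha> - \<beta>) *\<^sub>R (v \<beta> / complex_of_real (\<alpha> - \<beta>))"
  let ?r = "\<lambda>\<beta>. indicator {\<epsilon><..<R} (\<beta> - \<alpha>) *\<^sub>R (v \<beta> / complex_of_real (\<alpha> - \<beta>))"
  have i: "integrable lborel (\<lambda>y. indicator {\<epsilon><..<R} y *\<^sub>R (v (\<alpha> + s * y) / complex_of_real y))" for s
    by (rule Bochner_Integration.integrable_bound[OF hil_kernel_integrable_Icc[OF c e, of R \<alpha> s]])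
      (auto simp: indicator_def)
  have il: "integrable lborel (\<lambda>y. ?l (\<alpha> + (-1) * y))" using i[of "-1"] by simp
  have ir: "integrable lborel (\<lambda>y. ?r (\<alpha> + 1 * y))" using integrable_minus[OF i[of 1]] by simp
  have il': "integrable lborel ?l" using il by (subst (asm) lborel_integrable_real_affine_iff) auto
  have ir': "integrable lborel ?r" using ir by (subst (asm) lborel_integrable_real_affine_iff) auto
  have "(LINT \<beta>:{\<beta>. \<epsilon> < \<bar>\<alpha> - \<beta>\<bar> \<and> \<bar>\<alpha> - \<beta>\<bar> < R}|lborel. v \<beta> / complex_of_real (\<alpha> - \<beta>)) = (LINT \<beta>|lborel. ?l \<beta> + ?r \<beta>)"
    unfolding set_lebesgue_integral_def using e
    by (intro Bochner_Integration.integral_cong refl) (auto simp: indicator_def)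
  also have "\<dots> = (LINT \<beta>|lborel. ?l \<beta>) + (LINT \<beta>|lborel. ?r \<beta>)"
    by (rule Bochner_Integration.integral_add[OF il' ir'])
  also have "(LINT \<beta>|lborel. ?l \<beta>) = \<bar>-1\<bar> *\<^sub>R (LINT y|lborel. ?l (\<alpha> + (-1) * y))" by (rule lborel_integral_real_affine) simp
  also have "(LINT \<beta>|lborel. ?r \<beta>) = \<bar>1\<bar> *\<^sub>R (LINT y|lborel. ?r (\<alpha> + 1 * y))" by (rule lborel_integral_real_affine) simp
  also have "\<bar>-1\<bar> *\<^sub>R (LINT y|lborel. ?l (\<alpha> + (-1) * y)) + \<bar>1\<bar> *\<^sub>R (LINT y|lborel. ?r (\<alpha> + 1 * y)) = (LINT y|lborel. ?l (\<alpha> + (-1) * y) + ?r (\<alpha> + 1 * y))"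
    by (subst Bochner_Integration.integral_add[OF il ir]) simp
  also have "\<dots> = (LINT y|lborel. indicator {\<epsilon><..<R} y *\<^sub>R hil_kernel v \<alpha> y)"
    by (intro Bochner_Integration.integral_cong refl) (auto simp: hil_kernel_def indicator_def diff_divide_distrib)
  finally show ?thesis .
qed

text \<open>The truncation error is bounded by a function of \<epsilon> plus a function of R, each
  tending to 0, so the limit exists along the product filter.\<close>

lemma hilbert_eq_hil:
  assumes c: "continuous_on UNIV v" and i: "integrable lborel (\<lambda>y. indicator {0<..} y *\<^sub>R hil_kernel v \<alpha> y)"
  shows "hilbert v \<alpha> = 1 / (\<i> * complex_of_real pi) * hil v \<alpha>"
proof -
  have [measurable]: "v \<in> borel_measurable borel" by (rule borel_measurable_continuous_onI[OF c])
  let ?k = "hil_kernel v \<alpha>"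
  define X where "X \<epsilon> = (LINT y|lborel. indicator {0<..\<epsilon>} y * norm (?k y))" for \<epsilon>
  \<comment> \<open>The indicator of the positive axis keeps this integral finite also for
    \<open>R\<close> not positive, so the error bound holds for every \<open>R\<close>, with no
    relation between \<open>\<epsilon>\<close> and \<open>R\<close>.\<close>
  define Y where "Y R = (LINT y|lborel. indicator {0<..} y * (indicator {R..} y * norm (?k y)))" for R
  have ia: "integrable lborel (\<lambda>y. indicator {0<..} y * norm (?k y))" using integrable_norm[OF i] by simp
  have iX: "integrable lborel (\<lambda>y. indicator {0<..\<epsilon>} y * norm (?k y))" for \<epsilon>
    by (rule Bochner_Integration.integrable_bound[OF ia]) (auto simp: indicator_def)
  have iY: "integrable lborel (\<lambda>y. indicator {0<..} y * (indicator {R..} y * norm (?k y)))" for R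
    by (rule Bochner_Integration.integrable_bound[OF ia]) (auto simp: indicator_def)
  have X0: "(X \<longlongrightarrow> 0) (at_right 0)"
    unfolding filterlim_at_right_to_top X_def
  proof -
    have "((\<lambda>x. LINT y|lborel. indicator {0<..inverse x} y * norm (?k y)) \<longlongrightarrow> (LINT y::real|lborel. 0)) at_top"
    proof (rule integral_dominated_convergence_at_top[where w="\<lambda>y. indicator {0<..} y * norm (?k y)"])
      have "((\<lambda>x. indicator {0<..inverse x} y * norm (?k y)) \<longlongrightarrow> 0) at_top" for y
      proof (rule tendsto_eventually)
        show "\<forall>\<^sub>F x in at_top. indicator {0<..inverse x} y * norm (?k y) = 0"
          using eventually_gt_at_top[of "inverse y"] eventually_gt_at_top[of 0]
        proof eventually_elim
          fix x :: real assume "inverse y < x" "0 < x"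
          then have "\<not> (0 < y \<and> y \<le> inverse x)" by (metis inverse_inverse_eq inverse_le_imp_le inverse_positive_iff_positive linorder_not_less)
          then show "indicator {0<..inverse x} y * norm (?k y) = 0" by (auto simp: indicator_def)
        qed
      qed
      then show "AE y in lborel. ((\<lambda>x. indicator {0<..inverse x} y * norm (?k y)) \<longlongrightarrow> 0) at_top" by simp
    qed (use ia in \<open>auto simp: indicator_def\<close>)
    then show "((\<lambda>x. LINT y|lborel. indicator {0<..inverse x} y * norm (?k y)) \<longlongrightarrow> 0) at_top" by simp
  qed
  have Y0: "(Y \<longlongrightarrow> 0) at_top"
  proof -
    have "((\<lambda>R. LINT y|lborel. indicator {0<..} y * (indicator {R..} y * norm (?k y))) \<longlongrightarrow> (LINT y::real|lborel. 0)) at_top"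
    proof (rule integral_dominated_convergence_at_top[where w="\<lambda>y. indicator {0<..} y * norm (?k y)"])
      have "((\<lambda>R. indicator {0<..} y * (indicator {R..} y * norm (?k y))) \<longlongrightarrow> 0) at_top" for y
        by (rule tendsto_eventually, use eventually_gt_at_top[of y] in eventually_elim) (auto simp: indicator_def)
      then show "AE y in lborel. ((\<lambda>R. indicator {0<..} y * (indicator {R..} y * norm (?k y))) \<longlongrightarrow> 0) at_top" by simp
    qed (use ia in \<open>auto simp: indicator_def\<close>)
    then show ?thesis by (simp add: Y_def[abs_def])
  qed
  let ?F = "at_right (0::real) \<times>\<^sub>F (at_top :: real filter)"
  let ?T = "\<lambda>(\<epsilon>, R). LINT \<beta>:{\<beta>. \<epsilon> < \<bar>\<alpha> - \<beta>\<bar> \<and> \<bar>\<alpha> - \<beta>\<bar> < R}|lborel. v \<beta> / complex_of_real (\<alpha> - \<beta>)"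
  have b: "norm (?T (\<epsilon>, R) - hil v \<alpha>) \<le> X \<epsilon> + Y R" if e: "0 < \<epsilon>" for \<epsilon> R
  proof -
    have i2: "integrable lborel (\<lambda>y. indicator {\<epsilon><..<R} y *\<^sub>R ?k y)"
      by (rule Bochner_Integration.integrable_bound[OF i]) (use e in \<open>auto simp: indicator_def\<close>)
    have eq: "?T (\<epsilon>, R) - hil v \<alpha> = (LINT y|lborel. indicator {\<epsilon><..<R} y *\<^sub>R ?k y - indicator {0<..} y *\<^sub>R ?k y)"
      unfolding prod.case hilbert_truncation_eq[OF c e] hil_def
      by (rule Bochner_Integration.integral_diff[OF i2 i, symmetric])
    have "norm (LINT y|lborel. indicator {\<epsilon><..<R} y *\<^sub>R ?k y - indicator {0<..} y *\<^sub>R ?k y) \<le> (LINT y|lborel. indicator {0<..\<epsilon>} y * norm (?k y) + indicator {0<..} y * (indicator {R..} y * norm (?k y)))"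
    proof (intro Bochner_Integration.integral_norm_bound_integral Bochner_Integration.integrable_diff i i2 Bochner_Integration.integrable_add iX iY)
      fix y
      show "norm (indicator {\<epsilon><..<R} y *\<^sub>R ?k y - indicator {0<..} y *\<^sub>R ?k y)
        \<le> indicator {0<..\<epsilon>} y * norm (?k y) + indicator {0<..} y * (indicator {R..} y * norm (?k y))"
      proof (cases "0 < y")
        case True
        then show ?thesis by (cases "y \<le> \<epsilon>"; cases "y < R") simp_all
      next
        case False
        then have "\<not> \<epsilon> < y" using e by linarith
        then show ?thesis using False by simp
      qed
    qed
    also have "\<dots> = (LINT y|lborel. indicator {0<..\<epsilon>} y * norm (?k y)) + (LINT y|lborel. indicator {0<..} y * (indicator {R..} y * norm (?k y)))"
      by (rule Bochner_Integration.integral_add[OF iX[of \<epsilon>] iY[of R]])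
    finally show ?thesis unfolding eq X_def Y_def .
  qed
  have "((\<lambda>p. X (fst p) + Y (snd p)) \<longlongrightarrow> 0 + 0) ?F"
    by (rule tendsto_add[OF filterlim_compose[OF X0 filterlim_fst] filterlim_compose[OF Y0 filterlim_snd]])
  then have z: "((\<lambda>p. X (fst p) + Y (snd p)) \<longlongrightarrow> 0) ?F" by simp
  have ev: "\<forall>\<^sub>F p in ?F. 0 < fst p"
    by (rule eventually_compose_filterlim[OF eventually_at_right_less[of "0 :: real"] filterlim_fst])
  have "((\<lambda>p. ?T p - hil v \<alpha>) \<longlongrightarrow> 0) ?F"
  proof (rule Lim_null_comparison[OF _ z])
    show "\<forall>\<^sub>F p in ?F. norm (?T p - hil v \<alpha>) \<le> X (fst p) + Y (snd p)"
      using ev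
    proof eventually_elim
      fix p :: "real \<times> real" assume "0 < fst p"
      then show "norm (?T p - hil v \<alpha>) \<le> X (fst p) + Y (snd p)" using b[of "fst p" "snd p"] by (cases p) simp
    qed
  qed
  then have "(?T \<longlongrightarrow> hil v \<alpha>) ?F" by (simp add: LIM_zero_iff)
  then have "Lim ?F ?T = hil v \<alpha>"
    by (intro tendsto_Lim) (auto simp: prod_filter_eq_bot)
  then show ?thesis unfolding hilbert_def by simp
qed

text \<open>On [1 / (n + 1), n + 1] the kernel has no singularity and Leibniz' rule applies. The
  truncated derivatives converge uniformly on the whole line by \<open>hil_truncation\<close> for
  \<open>v'\<close>, so the limit may be differentiated.\<close>

lemma hil_has_vector_derivative:
  assumes v: "H1_bound v v' A" and v': "H1_bound v' v'' A"
  shows "(hil v has_vector_derivative hil v' \<alpha>) (at \<alpha>)"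
proof -
  have A: "A \<ge> 0" using v by (simp add: H1_bound_def)
  note cv = H1_bound_cont[OF v] and cv' = H1_bound_cont[OF v']
  define a where "a n = 1 / real (Suc n)" for n
  define f where "f n x = integral {a n..real (Suc n)} (hil_kernel v x)" for n x
  define f' where "f' n x = integral {a n..real (Suc n)} (hil_kernel v' x)" for n x
  have a: "0 < a n" "a n \<le> real (Suc n)" for n by (auto simp: a_def field_simps)
  have ck: "continuous_on (UNIV \<times> {a n..real (Suc n)}) (\<lambda>(x, t). hil_kernel w x t)" if "continuous_on UNIV w" for w n
    unfolding hil_kernel_def case_prod_beta using a[of n]
    by (intro continuous_intros continuous_on_compose2[OF that]) auto
  have ck1: "continuous_on {a n..real (Suc n)} (hil_kernel w x)" if "continuous_on UNIV w" for w n x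
    unfolding hil_kernel_def using a[of n] by (intro continuous_intros continuous_on_compose2[OF that]) auto
  have eqf: "integral {a n..real (Suc n)} (hil_kernel w x) = (LINT y|lborel. indicator {a n..real (Suc n)} y *\<^sub>R hil_kernel w x y)" if "continuous_on UNIV w" for w n x
  proof -
    have "set_integrable lborel {a n..real (Suc n)} (hil_kernel w x)" by (rule borel_integrable_atLeastAtMost'[OF ck1[OF that]])
    from set_borel_integral_eq_integral(2)[OF this] show ?thesis by (simp add: set_lebesgue_integral_def)
  qed
  have df: "(f n has_vector_derivative f' n x) (at x)" for n x
  proof -
    have "((\<lambda>x. integral (cbox (a n) (real (Suc n))) (hil_kernel v x)) has_vector_derivative
        integral (cbox (a n) (real (Suc n))) (hil_kernel v' x)) (at x within UNIV)"
    proof (rule leibniz_rule_vector_derivative)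
      fix x t :: real
      have 1: "((\<lambda>x. v (x - t)) has_vector_derivative 1 *\<^sub>R v' (x - t)) (at x)"
        by (rule vector_diff_chain_at[of "\<lambda>x. x - t" 1 x v, unfolded o_def]) (use v in \<open>auto intro!: derivative_eq_intros simp: H1_bound_def\<close>)
      have 2: "((\<lambda>x. v (x + t)) has_vector_derivative 1 *\<^sub>R v' (x + t)) (at x)"
        by (rule vector_diff_chain_at[of "\<lambda>x. x + t" 1 x v, unfolded o_def]) (use v in \<open>auto intro!: derivative_eq_intros simp: H1_bound_def\<close>)
      show "((\<lambda>x. hil_kernel v x t) has_vector_derivative hil_kernel v' x t) (at x within UNIV)"
        unfolding hil_kernel_def using has_vector_derivative_divide[OF has_vector_derivative_diff[OF 1 2]] by simp
    next
      show "hil_kernel v x integrable_on cbox (a n) (real (Suc n))" for x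
        unfolding cbox_interval by (rule integrable_continuous_real[OF ck1[OF cv(1)]])
      show "continuous_on (UNIV \<times> cbox (a n) (real (Suc n))) (\<lambda>(x, t). hil_kernel v' x t)"
        unfolding cbox_interval by (rule ck[OF cv'(1)])
    qed auto
    then show ?thesis unfolding f_def f'_def cbox_interval by simp
  qed
  have lim0: "(\<lambda>n. 3 * sqrt A * sqrt (a n) + 2 * sqrt A / sqrt (real (Suc n))) \<longlonglongrightarrow> 0"
    unfolding a_def by real_asymp
  have conv: "(\<lambda>n. f n x) \<longlonglongrightarrow> hil v x" for x
  proof -
    have "(\<lambda>n. hil v x - f n x) \<longlonglongrightarrow> 0"
    proof (rule Lim_null_comparison[OF _ lim0], intro always_eventually allI)
      show "norm (hil v x - f n x) \<le> 3 * sqrt A * sqrt (a n) + 2 * sqrt A / sqrt (real (Suc n))" for n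
        unfolding f_def eqf[OF cv(1)] by (rule hil_truncation[OF v a])
    qed
    then have "(\<lambda>n. hil v x - (hil v x - f n x)) \<longlonglongrightarrow> hil v x - 0" by (intro tendsto_diff tendsto_const)
    then show ?thesis by simp
  qed
  have "\<exists>g. \<forall>x\<in>UNIV. (\<lambda>n. f n x) \<longlonglongrightarrow> g x \<and> (g has_derivative (\<lambda>h. h *\<^sub>R hil v' x)) (at x within UNIV)"
  proof (rule has_derivative_sequence[where f'="\<lambda>n x h. h *\<^sub>R f' n x"])
    show "(f n has_derivative (\<lambda>h. h *\<^sub>R f' n x)) (at x within UNIV)" for n x
      using df by (simp add: has_vector_derivative_def)
    show "(\<lambda>n. f n 0) \<longlonglongrightarrow> hil v 0" by (rule conv)
    fix e :: real assume "0 < e"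
    then have "\<forall>\<^sub>F n in sequentially. 3 * sqrt A * sqrt (a n) + 2 * sqrt A / sqrt (real (Suc n)) < e"
      by (rule order_tendstoD(2)[OF lim0])
    then show "\<forall>\<^sub>F n in sequentially. \<forall>x\<in>UNIV. \<forall>h. norm (h *\<^sub>R f' n x - h *\<^sub>R hil v' x) \<le> e * norm h"
    proof eventually_elim
      fix n assume n: "3 * sqrt A * sqrt (a n) + 2 * sqrt A / sqrt (real (Suc n)) < e"
      have "norm (f' n x - hil v' x) \<le> e" for x
      proof -
        have "norm (f' n x - hil v' x) = norm (hil v' x - f' n x)" by (rule norm_minus_commute)
        also have "\<dots> \<le> 3 * sqrt A * sqrt (a n) + 2 * sqrt A / sqrt (real (Suc n))"
          unfolding f'_def eqf[OF cv'(1)] by (rule hil_truncation[OF v' a])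
        finally show ?thesis using n by linarith
      qed
      then show "\<forall>x\<in>UNIV. \<forall>h. norm (h *\<^sub>R f' n x - h *\<^sub>R hil v' x) \<le> e * norm h"
        by (auto simp: scaleR_diff_right[symmetric] mult.commute[of e] mult_left_mono)
    qed
  qed auto
  then obtain g where g: "\<And>x. (\<lambda>n. f n x) \<longlonglongrightarrow> g x" "\<And>x. (g has_derivative (\<lambda>h. h *\<^sub>R hil v' x)) (at x)" by auto
  have "g = hil v" using LIMSEQ_unique[OF g(1) conv] by auto
  then show ?thesis using g(2) by (simp add: has_vector_derivative_def)
qed

section \<open>Boundary values from the lower half-plane\<close>

definition lower :: "complex set" where "lower = {z. Im z \<le> 0}"

text \<open>In the coordinate \<open>w = ln (z - \<alpha>)\<close> the indented half-plane becomes a convex strip, on which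
  a function continuous up to the boundary has a primitive.\<close>

lemma hil_boundary_value:
  assumes cont: "continuous_on lower Q" and hol: "Q holomorphic_on P_minus"
    and inf: "\<And>e. e > 0 \<Longrightarrow> \<exists>c. \<forall>z\<in>lower. norm z \<ge> c \<longrightarrow> norm (Q z) \<le> e"
    and int: "integrable lborel (\<lambda>y. indicator {0<..} y *\<^sub>R hil_kernel (\<lambda>x. Q (complex_of_real x)) \<alpha> y)"
  shows "hil (\<lambda>x. Q (complex_of_real x)) \<alpha> = \<i> * pi * Q (complex_of_real \<alpha>)"
proof -
  \<comment> \<open>Under w -> \<alpha> + exp w the upper edge of the strip becomes the ray to the
    right of \<alpha> and the lower edge the ray to its left.\<close>
  define S where "S = {w. - pi \<le> Im w \<and> Im w \<le> 0}"
  have Scv: "convex S"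
  proof -
    have "S = {w. Im w \<ge> - pi} \<inter> {w. Im w \<le> 0}" by (auto simp: S_def)
    then show ?thesis by (simp add: convex_Int convex_halfspace_Im_ge convex_halfspace_Im_le)
  qed
  define E where "E w = complex_of_real \<alpha> + exp w" for w
  have Em: "E w \<in> lower" if w: "w \<in> S" for w
  proof -
    have w: "- pi \<le> Im w" "Im w \<le> 0" using that by (simp_all add: S_def)
    have "0 \<le> sin (- Im w)" by (rule sin_ge_zero) (use w in linarith)+
    then have "sin (Im w) \<le> 0" unfolding sin_minus by linarith
    then have "exp (Re w) * sin (Im w) \<le> 0" by (rule mult_nonneg_nonpos[OF exp_ge_zero])
    then show ?thesis unfolding E_def lower_def by (simp add: Im_exp)
  qed
  have Ei: "E w \<in> P_minus" if w: "w \<in> interior S" for w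
  proof -
    obtain e where e: "e > 0" "ball w e \<subseteq> S" using w unfolding mem_interior by blast
    have "w + of_real (e/2) * \<i> \<in> S" "w - of_real (e/2) * \<i> \<in> S"
      using e by (auto intro!: subsetD[OF e(2)] simp: dist_norm norm_mult)
    then have "- pi < Im w" "Im w < 0" using e(1) by (auto simp: S_def)
    then have "sin (- Im w) > 0" by (intro sin_gt_zero) auto
    then show ?thesis by (simp add: E_def P_minus_def Im_exp mult_pos_neg)
  qed
  have oP: "open P_minus" unfolding P_minus_def by (simp add: open_halfspace_Im_lt)
  have cE: "continuous_on S (\<lambda>w. Q (E w))"
    by (rule continuous_on_compose2[OF cont]) (use Em in \<open>auto simp: E_def intro!: continuous_intros\<close>)
  have dE: "(\<lambda>w. Q (E w)) field_differentiable at w" if "w \<in> interior S - {}" for w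
  proof -
    have "Q field_differentiable at (E w)" using hol Ei that oP by (auto simp: holomorphic_on_open field_differentiable_def)
    moreover have "E field_differentiable at w" unfolding E_def[abs_def] by (intro field_differentiable_add field_differentiable_const field_differentiable_within_exp)
    ultimately show ?thesis using field_differentiable_compose[of E w Q] by (simp add: o_def)
  qed
  obtain F where F: "\<And>w. w \<in> S \<Longrightarrow> (F has_field_derivative Q (E w)) (at w within S)"
    using holomorphic_convex_primitive[OF Scv _ cE dE] by blast
  \<comment> \<open>The integral of i Q over the half-circle of radius exp c around \<alpha>. It
    tends to i pi Q(\<alpha>) as the radius shrinks and to 0 as it grows.\<close>
  define J where "J c = F (complex_of_real c) - F (complex_of_real c - \<i> * pi)" for c :: real
  have J: "((\<lambda>\<theta>. \<i> * Q (E (complex_of_real c + \<i> * complex_of_real \<theta>))) has_integral J c) {- pi..0}" for c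
  proof -
    have "((\<lambda>\<theta>. \<i> * Q (E (complex_of_real c + \<i> * complex_of_real \<theta>))) has_integral
       (F \<circ> (\<lambda>\<theta>. complex_of_real c + \<i> * complex_of_real \<theta>)) 0 - (F \<circ> (\<lambda>\<theta>. complex_of_real c + \<i> * complex_of_real \<theta>)) (- pi)) {- pi..0}"
    proof (rule fundamental_theorem_of_calculus)
      fix \<theta> :: real assume t: "\<theta> \<in> {- pi..0}"
      have "((\<lambda>\<theta>. complex_of_real c + \<i> * complex_of_real \<theta>) has_vector_derivative \<i>) (at \<theta> within {- pi..0})"
        by (auto intro!: derivative_eq_intros)
      moreover have "(F has_field_derivative Q (E (complex_of_real c + \<i> * complex_of_real \<theta>))) (at (complex_of_real c + \<i> * complex_of_real \<theta>) within (\<lambda>\<theta>. complex_of_real c + \<i> * complex_of_real \<theta>) ` {- pi..0})"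
        by (rule DERIV_subset[OF F]) (use t in \<open>auto simp: S_def\<close>)
      ultimately show "((F \<circ> (\<lambda>\<theta>. complex_of_real c + \<i> * complex_of_real \<theta>)) has_vector_derivative \<i> * Q (E (complex_of_real c + \<i> * complex_of_real \<theta>))) (at \<theta> within {- pi..0})"
        by (rule field_vector_diff_chain_within)
    qed auto
    then show ?thesis by (simp add: J_def)
  qed
  \<comment> \<open>The half-circle has angular length pi, so a deviation of Q from q by at most B
    costs B pi. Later tolerances e / 4 rely on pi < 4.\<close>
  have Jb: "norm (J c - \<i> * pi * q) \<le> B * pi" if B: "\<And>\<theta>. \<theta> \<in> {- pi..0} \<Longrightarrow> norm (Q (E (complex_of_real c + \<i> * complex_of_real \<theta>)) - q) \<le> B" and B0: "B \<ge> 0" for c q B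
  proof -
    have "((\<lambda>\<theta>. \<i> * q) has_integral pi *\<^sub>R (\<i> * q)) {- pi..0}"
      using has_integral_const_real[of "\<i> * q" "- pi" 0] by simp
    from has_integral_diff[OF J[of c] this] have "((\<lambda>\<theta>. \<i> * (Q (E (complex_of_real c + \<i> * complex_of_real \<theta>)) - q)) has_integral J c - \<i> * pi * q) {- pi..0}"
      by (simp add: algebra_simps scaleR_conv_of_real)
    from has_integral_bound_real[OF B0, where S="{}", OF _ this] show ?thesis using B by (simp add: norm_mult)
  qed
  have Jinf: "(J \<longlongrightarrow> 0) at_top"
  proof (rule tendstoI)
    fix e :: real assume e: "e > 0"
    obtain c where c: "\<And>z. z \<in> lower \<Longrightarrow> norm z \<ge> c \<Longrightarrow> norm (Q z) \<le> e / 4" using inf[of "e/4"] e by auto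
    have "\<forall>\<^sub>F x in at_top. exp x \<ge> c + \<bar>\<alpha>\<bar>"
      using exp_at_top unfolding filterlim_at_top by blast
    then show "\<forall>\<^sub>F x in at_top. dist (J x) 0 < e"
    proof eventually_elim
      fix x :: real assume x: "exp x \<ge> c + \<bar>\<alpha>\<bar>"
      have "norm (J x - \<i> * pi * 0) \<le> (e/4) * pi"
      proof (rule Jb)
        fix \<theta> :: real assume t: "\<theta> \<in> {- pi..0}"
        have "norm (E (complex_of_real x + \<i> * complex_of_real \<theta>)) \<ge> norm (exp (complex_of_real x + \<i> * complex_of_real \<theta>)) - \<bar>\<alpha>\<bar>"
          unfolding E_def using norm_diff_ineq[of "exp (complex_of_real x + \<i> * complex_of_real \<theta>)" "complex_of_real \<alpha>"] by (simp add: add.commute)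
        then have "norm (E (complex_of_real x + \<i> * complex_of_real \<theta>)) \<ge> c" using x by simp
        then show "norm (Q (E (complex_of_real x + \<i> * complex_of_real \<theta>)) - 0) \<le> e/4"
          using c Em[of "complex_of_real x + \<i> * complex_of_real \<theta>"] t by (simp add: S_def)
      qed (use e in auto)
      also have "(e/4) * pi < (e/4) * 4" using e pi_less_4 by (intro mult_strict_left_mono) auto
      finally show "dist (J x) 0 < e" by simp
    qed
  qed
  have J0: "(J \<longlongrightarrow> \<i> * pi * Q (complex_of_real \<alpha>)) at_bot"
  proof (rule tendstoI)
    fix e :: real assume e: "e > 0"
    have "complex_of_real \<alpha> \<in> lower" by (simp add: lower_def)
    then obtain d where d: "d > 0" "\<And>z. z \<in> lower \<Longrightarrow> dist z (complex_of_real \<alpha>) < d \<Longrightarrow> dist (Q z) (Q (complex_of_real \<alpha>)) < e / 4"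
      using cont e unfolding continuous_on_iff by (metis divide_pos_pos zero_less_numeral)
    have "\<forall>\<^sub>F x in at_bot. exp x < d"
      by (rule order_tendstoD(2)[OF exp_at_bot d(1)])
    then show "\<forall>\<^sub>F x in at_bot. dist (J x) (\<i> * pi * Q (complex_of_real \<alpha>)) < e"
    proof eventually_elim
      fix x :: real assume x: "exp x < d"
      have "norm (J x - \<i> * pi * Q (complex_of_real \<alpha>)) \<le> (e/4) * pi"
      proof (rule Jb)
        fix \<theta> :: real assume t: "\<theta> \<in> {- pi..0}"
        have "dist (E (complex_of_real x + \<i> * complex_of_real \<theta>)) (complex_of_real \<alpha>) < d"
          using x by (simp add: E_def dist_norm)
        then show "norm (Q (E (complex_of_real x + \<i> * complex_of_real \<theta>)) - Q (complex_of_real \<alpha>)) \<le> e/4"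
          using d(2) Em[of "complex_of_real x + \<i> * complex_of_real \<theta>"] t by (fastforce simp: S_def dist_norm)
      qed (use e in auto)
      also have "(e/4) * pi < (e/4) * 4" using e pi_less_4 by (intro mult_strict_left_mono) auto
      finally show "dist (J x) (\<i> * pi * Q (complex_of_real \<alpha>)) < e" by (simp add: dist_norm)
    qed
  qed
  let ?k = "hil_kernel (\<lambda>x. Q (complex_of_real x)) \<alpha>"
  \<comment> \<open>Cauchy's theorem on the half-annulus, expressed through the primitive: the two
    radial segments carry the paired kernel, the two half-circles carry \<open>J\<close>.\<close>
  have T: "(LINT y|lborel. indicator {a..b} y *\<^sub>R ?k y) = J (ln a) - J (ln b)" if ab: "0 < a" "a \<le> b" for a b
  proof -
    have ch: "((F \<circ> (\<lambda>y. complex_of_real (ln y) + c)) has_vector_derivative complex_of_real (1 / y) * Q (E (complex_of_real (ln y) + c))) (at y within {a..b})"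
      if y: "y \<in> {a..b}" and c: "c = 0 \<or> c = - (\<i> * pi)" for y c
    proof (rule field_vector_diff_chain_within)
      have "((\<lambda>y. complex_of_real (ln y)) has_vector_derivative complex_of_real (1 / y)) (at y within {a..b})"
        by (rule has_vector_derivative_of_real) (use y ab in \<open>auto intro!: derivative_eq_intros\<close>)
      from has_vector_derivative_add[OF this has_vector_derivative_const[of c]]
      show "((\<lambda>y. complex_of_real (ln y) + c) has_vector_derivative complex_of_real (1 / y)) (at y within {a..b})"
        by simp
      show "(F has_field_derivative Q (E (complex_of_real (ln y) + c))) (at (complex_of_real (ln y) + c) within (\<lambda>y. complex_of_real (ln y) + c) ` {a..b})"
        by (rule DERIV_subset[OF F]) (use c in \<open>auto simp: S_def\<close>)
    qed
    have kc: "continuous_on {a..b} ?k" unfolding hil_kernel_def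
      by (intro continuous_intros continuous_on_compose2[OF cont]) (use ab in \<open>auto simp: lower_def\<close>)
    have si: "set_integrable lborel {a..b} ?k" by (rule borel_integrable_atLeastAtMost'[OF kc])
    have "(?k has_integral ((F \<circ> (\<lambda>y. complex_of_real (ln y) + (- (\<i> * pi)))) b - (F \<circ> (\<lambda>y. complex_of_real (ln y) + 0)) b)
        - ((F \<circ> (\<lambda>y. complex_of_real (ln y) + (- (\<i> * pi)))) a - (F \<circ> (\<lambda>y. complex_of_real (ln y) + 0)) a)) {a..b}"
    proof (rule fundamental_theorem_of_calculus[OF ab(2)])
      fix y assume y: "y \<in> {a..b}"
      have "E (complex_of_real (ln y) + (- (\<i> * pi))) = complex_of_real (\<alpha> - y)" "E (complex_of_real (ln y) + 0) = complex_of_real (\<alpha> + y)"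
        using y ab by (auto simp: E_def exp_diff exp_of_real simp flip: diff_conv_add_uminus)
      then have "?k y = complex_of_real (1 / y) * Q (E (complex_of_real (ln y) + (- (\<i> * pi)))) - complex_of_real (1 / y) * Q (E (complex_of_real (ln y) + 0))"
        by (simp add: hil_kernel_def diff_divide_distrib)
      then show "((\<lambda>y. (F \<circ> (\<lambda>y. complex_of_real (ln y) + (- (\<i> * pi)))) y - (F \<circ> (\<lambda>y. complex_of_real (ln y) + 0)) y) has_vector_derivative ?k y) (at y within {a..b})"
        using has_vector_derivative_diff[OF ch[OF y, of "- (\<i> * pi)"] ch[OF y, of 0]] by simp
    qed
    then have "integral {a..b} ?k = J (ln a) - J (ln b)" by (simp add: integral_unique J_def)
    then show ?thesis using set_borel_integral_eq_integral(2)[OF si] by (simp add: set_lebesgue_integral_def)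
  qed
  have l1: "(\<lambda>n. LINT y|lborel. indicator {1 / real (Suc n)..real (Suc n)} y *\<^sub>R ?k y) \<longlonglongrightarrow> \<i> * pi * Q (complex_of_real \<alpha>) - 0"
  proof -
    have t1: "filterlim (\<lambda>n. ln (real (Suc n))) at_top sequentially" by real_asymp
    have t2: "filterlim (\<lambda>n. ln (1 / real (Suc n))) at_bot sequentially" by real_asymp
    have "(\<lambda>n. J (ln (1 / real (Suc n))) - J (ln (real (Suc n)))) \<longlonglongrightarrow> \<i> * pi * Q (complex_of_real \<alpha>) - 0"
      by (intro tendsto_diff filterlim_compose[OF J0 t2] filterlim_compose[OF Jinf t1])
    moreover have "J (ln (1 / real (Suc n))) - J (ln (real (Suc n))) = (LINT y|lborel. indicator {1 / real (Suc n)..real (Suc n)} y *\<^sub>R ?k y)" for n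
      by (rule T[symmetric]) (auto simp: field_simps)
    ultimately show ?thesis by simp
  qed
  have l2: "(\<lambda>n. LINT y|lborel. indicator {1 / real (Suc n)..real (Suc n)} y *\<^sub>R ?k y) \<longlonglongrightarrow> hil (\<lambda>x. Q (complex_of_real x)) \<alpha>"
    unfolding hil_def
  proof (rule integral_dominated_convergence[where w="\<lambda>y. norm (indicator {0<..} y *\<^sub>R ?k y)"])
    have "(\<lambda>n. indicator {1 / real (Suc n)..real (Suc n)} y *\<^sub>R ?k y) \<longlonglongrightarrow> indicator {0<..} y *\<^sub>R ?k y" for y
    proof (cases "y > 0")
      case True
      have "\<forall>\<^sub>F n in sequentially. 1 / real (Suc n) < y" by (rule order_tendstoD(2)[OF _ True]) real_asymp
      moreover have "\<forall>\<^sub>F n in sequentially. y \<le> real (Suc n)" by real_asymp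
      ultimately have "\<forall>\<^sub>F n in sequentially. indicator {1 / real (Suc n)..real (Suc n)} y *\<^sub>R ?k y = indicator {0<..} y *\<^sub>R ?k y"
        by eventually_elim (use True in \<open>auto simp: indicator_def\<close>)
      then show ?thesis by (rule tendsto_eventually)
    next
      case False
      have "\<not> 1 / real (Suc n) \<le> y" for n using False by (smt (verit) of_nat_0_less_iff zero_less_Suc divide_pos_pos)
      then show ?thesis using False by (auto simp: indicator_def)
    qed
    then show "AE y in lborel. (\<lambda>n. indicator {1 / real (Suc n)..real (Suc n)} y *\<^sub>R ?k y) \<longlonglongrightarrow> indicator {0<..} y *\<^sub>R ?k y" by simp
    have "norm (indicator {1 / real (Suc n)..real (Suc n)} y *\<^sub>R ?k y) \<le> norm (indicator {0<..} y *\<^sub>R ?k y)" for n y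
    proof -
      have "y > 0" if "1 / real (Suc n) \<le> y" using that by (smt (verit) of_nat_0_less_iff zero_less_Suc divide_pos_pos)
      then show ?thesis by (auto simp: indicator_def)
    qed
    then show "AE y in lborel. norm (indicator {1 / real (Suc n)..real (Suc n)} y *\<^sub>R ?k y) \<le> norm (indicator {0<..} y *\<^sub>R ?k y)" for n by simp
    have cq: "continuous_on UNIV (\<lambda>x. Q (complex_of_real x))"
      by (rule continuous_on_compose2[OF cont]) (auto simp: lower_def intro!: continuous_intros)
    have [measurable]: "(\<lambda>x. Q (complex_of_real x)) \<in> borel_measurable borel" by (rule borel_measurable_continuous_onI[OF cq])
    show "(\<lambda>y. indicator {1 / real (Suc n)..real (Suc n)} y *\<^sub>R ?k y) \<in> borel_measurable lborel" for n by measurable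
    show "(\<lambda>y. indicator {0<..} y *\<^sub>R ?k y) \<in> borel_measurable lborel" by measurable
    show "integrable lborel (\<lambda>y. norm (indicator {0<..} y *\<^sub>R ?k y))" by (rule integrable_norm[OF int])
  qed
  show ?thesis using LIMSEQ_unique[OF l2 l1] by simp
qed

lemma truncated_fourier_eq_integral:
  assumes c: "continuous_on UNIV f"
  shows "truncated_fourier R f \<xi> = complex_of_real (1 / sqrt (2 * pi)) * integral {-R..R} (\<lambda>x. exp (- \<i> * complex_of_real (x * \<xi>)) * f x)"
proof -
  have "set_integrable lborel {-R..R} (\<lambda>x. exp (- \<i> * complex_of_real (x * \<xi>)) * f x)"
    by (rule borel_integrable_atLeastAtMost') (intro continuous_intros continuous_on_subset[OF c] subset_UNIV)
  from set_borel_integral_eq_integral(2)[OF this] show ?thesis unfolding truncated_fourier_def by simp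
qed

text \<open>Moving the segment \<open>[-R, R]\<close> down to \<open>Im z = - R\<close>: the integrand gains the factor
  \<open>exp (\<xi> Im z)\<close> on the lower and vertical sides.\<close>

lemma truncated_fourier_boundary_value:
  assumes cont: "continuous_on lower L" and hol: "L holomorphic_on P_minus"
    and inf: "\<And>e. e > 0 \<Longrightarrow> \<exists>c. \<forall>z\<in>lower. norm z \<ge> c \<longrightarrow> norm (L z) \<le> e"
    and \<xi>: "\<xi> > 0"
  shows "((\<lambda>R. truncated_fourier R (\<lambda>x. L (complex_of_real x)) \<xi>) \<longlongrightarrow> 0) at_top"
proof -
  \<comment> \<open>For positive \<xi> the modulus of the exponential is exp(\<xi> Im z), which
    decays downwards; this fixes the half-plane in which the contour is moved.\<close>
  define h where "h z = exp (- \<i> * z * complex_of_real \<xi>) * L z" for z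
  have hn: "norm (h z) = exp (\<xi> * Im z) * norm (L z)" for z by (simp add: h_def norm_mult mult.commute)
  have cv: "convex lower" unfolding lower_def by (rule convex_halfspace_Im_le)
  have int: "interior lower \<subseteq> P_minus"
  proof
    fix z assume "z \<in> interior lower"
    then obtain e where e: "e > 0" "ball z e \<subseteq> lower" unfolding mem_interior by blast
    have "z + of_real (e/2) * \<i> \<in> lower"
      using e by (auto intro!: subsetD[OF e(2)] simp: dist_norm norm_mult)
    then show "z \<in> P_minus" using e(1) by (simp add: lower_def P_minus_def)
  qed
  have oP: "open P_minus" unfolding P_minus_def by (simp add: open_halfspace_Im_lt)
  have ch: "continuous_on lower h" unfolding h_def by (intro continuous_intros cont)
  have hh: "h holomorphic_on P_minus" unfolding h_def by (intro holomorphic_intros hol)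
  have dh: "h field_differentiable at z" if z: "z \<in> interior lower - {}" for z
    using hh int z oP by (auto simp: holomorphic_on_open field_differentiable_def)
  obtain F where F: "\<And>z. z \<in> lower \<Longrightarrow> (F has_field_derivative h z) (at z within lower)"
    using holomorphic_convex_primitive[OF cv _ ch dh] by blast
  have seg: "((\<lambda>s. d * h (z0 + of_real s * d)) has_integral F (z0 + of_real b * d) - F (z0 + of_real a * d)) {a..b}"
    if ab: "a \<le> b" and low: "\<And>s. s \<in> {a..b} \<Longrightarrow> z0 + of_real s * d \<in> lower" for a b :: real and z0 d
  proof -
    have "((\<lambda>s. d * h (z0 + of_real s * d)) has_integral (F \<circ> (\<lambda>s. z0 + of_real s * d)) b - (F \<circ> (\<lambda>s. z0 + of_real s * d)) a) {a..b}"
    proof (rule fundamental_theorem_of_calculus[OF ab])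
      fix s assume s: "s \<in> {a..b}"
      have "((\<lambda>s. z0 + of_real s * d) has_vector_derivative d) (at s within {a..b})"
        by (auto intro!: derivative_eq_intros)
      moreover have "(F has_field_derivative h (z0 + of_real s * d)) (at (z0 + of_real s * d) within (\<lambda>s. z0 + of_real s * d) ` {a..b})"
        by (rule DERIV_subset[OF F]) (use low s in auto)
      ultimately show "((F \<circ> (\<lambda>s. z0 + of_real s * d)) has_vector_derivative d * h (z0 + of_real s * d)) (at s within {a..b})"
        by (rule field_vector_diff_chain_within)
    qed
    then show ?thesis by simp
  qed
  have cL: "continuous_on UNIV (\<lambda>x. L (complex_of_real x))"
    by (rule continuous_on_compose2[OF cont]) (auto simp: lower_def intro!: continuous_intros)
  show ?thesis
  proof (rule tendstoI)
    fix e :: real assume e: "e > 0"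
    \<comment> \<open>The three moved sides contribute at most 4 \<eta> / \<xi> in total, which is e
      / 2.\<close>
    define \<eta> where "\<eta> = e * \<xi> / 8"
    have \<eta>: "\<eta> > 0" using e \<xi> by (simp add: \<eta>_def)
    obtain c where c: "\<And>z. z \<in> lower \<Longrightarrow> norm z \<ge> c \<Longrightarrow> norm (L z) \<le> \<eta>" using inf[OF \<eta>] by auto
    show "\<forall>\<^sub>F R in at_top. dist (truncated_fourier R (\<lambda>x. L (complex_of_real x)) \<xi>) 0 < e"
      using eventually_ge_at_top[of "max c 1"]
    proof eventually_elim
      fix R assume "max c 1 \<le> R"
      then have R: "c \<le> R" "1 \<le> R" by auto
      \<comment> \<open>The decay integrates to at most 1 / \<xi> over any depth, so smallness of L
        at distance R is enough.\<close>
      have vert: "norm (F (complex_of_real x) - F (complex_of_real x - \<i> * R)) \<le> \<eta> / \<xi>" if x: "\<bar>x\<bar> = R" for x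
      proof -
        have I: "((\<lambda>s. \<i> * h (complex_of_real x + of_real s * \<i>)) has_integral F (complex_of_real x + of_real 0 * \<i>) - F (complex_of_real x + of_real (- R) * \<i>)) {- R..0}"
          by (rule seg) (use R in \<open>auto simp: lower_def\<close>)
        have J: "((\<lambda>s. \<eta> * exp (\<xi> * s)) has_integral \<eta> * exp (\<xi> * 0) / \<xi> - \<eta> * exp (\<xi> * (- R)) / \<xi>) {- R..0}"
        proof (rule fundamental_theorem_of_calculus)
          show "((\<lambda>s. \<eta> * exp (\<xi> * s) / \<xi>) has_vector_derivative \<eta> * exp (\<xi> * s)) (at s within {- R..0})" for s
            unfolding has_real_derivative_iff_has_vector_derivative[symmetric]
            using \<xi> by (auto intro!: derivative_eq_intros)
        qed (use R in auto)
        have "norm (integral {- R..0} (\<lambda>s. \<i> * h (complex_of_real x + of_real s * \<i>))) \<le> integral {- R..0} (\<lambda>s. \<eta> * exp (\<xi> * s))"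
        proof (rule Henstock_Kurzweil_Integration.integral_norm_bound_integral)
          fix s assume s: "s \<in> {- R..0}"
          have "R \<le> norm (complex_of_real x + of_real s * \<i>)" using abs_Re_le_cmod[of "complex_of_real x + of_real s * \<i>"] x by simp
          then have "norm (L (complex_of_real x + of_real s * \<i>)) \<le> \<eta>" using s R by (intro c) (auto simp: lower_def)
          then show "norm (\<i> * h (complex_of_real x + of_real s * \<i>)) \<le> \<eta> * exp (\<xi> * s)"
            by (simp add: norm_mult hn mult.commute[of \<eta>])
        qed (use I J in \<open>auto simp: has_integral_integrable\<close>)
        also have "\<dots> \<le> \<eta> / \<xi>" unfolding integral_unique[OF J] using \<eta> \<xi> by simp
        finally show ?thesis unfolding integral_unique[OF I] by (simp add: mult.commute)
      qed
      \<comment> \<open>The side has length 2 R, compensated by the factor exp(-\<xi> R) through R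
        exp(-\<xi> R) \<le> 1 / \<xi>.\<close>
      have hor: "norm (F (complex_of_real R - \<i> * R) - F (complex_of_real (- R) - \<i> * R)) \<le> 2 * \<eta> / \<xi>"
      proof -
        have I: "((\<lambda>s. 1 * h (- \<i> * R + of_real s * 1)) has_integral F (- \<i> * R + of_real R * 1) - F (- \<i> * R + of_real (- R) * 1)) {- R..R}"
          by (rule seg) (use R in \<open>auto simp: lower_def\<close>)
        have "norm (F (- \<i> * R + of_real R * 1) - F (- \<i> * R + of_real (- R) * 1)) \<le> (exp (- (\<xi> * R)) * \<eta>) * measure lborel {- R..R}"
        proof (rule has_integral_bound_real[where S="{}", OF _ _ I])
          fix s assume "s \<in> {- R..R} - {}"
          have "R \<le> norm (- \<i> * R + of_real s * 1)" using abs_Im_le_cmod[of "- \<i> * R + of_real s * 1"] R by simp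
          then have "norm (L (- \<i> * R + of_real s * 1)) \<le> \<eta>" using R by (intro c) (auto simp: lower_def)
          then show "norm (1 * h (- \<i> * R + of_real s * 1)) \<le> exp (- (\<xi> * R)) * \<eta>" by (simp add: hn)
        qed (use \<eta> in auto)
        also have "\<dots> = 2 * \<eta> * (R * exp (- (\<xi> * R)))" using R by simp
        also have "R * exp (- (\<xi> * R)) \<le> 1 / \<xi>"
        proof -
          have "\<xi> * R \<le> exp (\<xi> * R)" using exp_ge_add_one_self[of "\<xi> * R"] by linarith
          then show ?thesis using \<xi> by (simp add: exp_minus field_simps)
        qed
        finally show ?thesis using \<eta> by (simp add: algebra_simps)
      qed
      have I: "((\<lambda>s. 1 * h (0 + of_real s * 1)) has_integral F (0 + of_real R * 1) - F (0 + of_real (- R) * 1)) {- R..R}"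
        by (rule seg) (use R in \<open>auto simp: lower_def\<close>)
      have "integral {- R..R} (\<lambda>x. exp (- \<i> * complex_of_real (x * \<xi>)) * L (complex_of_real x)) = F (of_real R) - F (of_real (- R))"
        using integral_unique[OF I] by (simp add: h_def mult.assoc)
      then have "truncated_fourier R (\<lambda>x. L (complex_of_real x)) \<xi> = complex_of_real (1 / sqrt (2 * pi)) * (F (of_real R) - F (of_real (- R)))"
        unfolding truncated_fourier_eq_integral[OF cL] by simp
      moreover have "norm (complex_of_real (1 / sqrt (2 * pi))) \<le> 1"
      proof -
        have "1 \<le> sqrt (2 * pi)" using pi_gt3 by (simp add: real_le_rsqrt)
        then show ?thesis unfolding norm_of_real by (simp add: abs_divide divide_le_eq)
      qed
      moreover have "norm (F (of_real R) - F (of_real (- R))) \<le> 4 * \<eta> / \<xi>"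
      proof -
        have "F (of_real R) - F (of_real (- R)) = (F (of_real R) - F (of_real R - \<i> * R)) + (F (of_real R - \<i> * R) - F (of_real (- R) - \<i> * R)) - (F (of_real (- R)) - F (of_real (- R) - \<i> * R))" by simp
        also have "norm \<dots> \<le> norm (F (of_real R) - F (of_real R - \<i> * R)) + norm (F (of_real R - \<i> * R) - F (of_real (- R) - \<i> * R)) + norm (F (of_real (- R)) - F (of_real (- R) - \<i> * R))"
          by (intro order_trans[OF norm_triangle_ineq4] add_mono norm_triangle_ineq order_refl)
        also have "\<dots> \<le> \<eta> / \<xi> + 2 * \<eta> / \<xi> + \<eta> / \<xi>" by (intro add_mono vert hor) (use R in auto)
        finally show ?thesis by simp
      qed
      ultimately have "norm (truncated_fourier R (\<lambda>x. L (complex_of_real x)) \<xi>) \<le> 1 * (4 * \<eta> / \<xi>)"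
        unfolding norm_mult by (simp only: norm_mult) (intro mult_mono, auto)
      also have "\<dots> < e" using e \<xi> by (simp add: \<eta>_def)
      finally show "dist (truncated_fourier R (\<lambda>x. L (complex_of_real x)) \<xi>) 0 < e" by simp
    qed
  qed
qed

section \<open>The Poisson extension up to the boundary\<close>

lemma cauchy_density:
  "integrable lborel (\<lambda>s :: real. 1 / (pi * (1 + s\<^sup>2)))" "(LINT s|lborel. 1 / (pi * (1 + (s :: real)\<^sup>2))) = 1"
proof -
  have i: "integrable lborel (\<lambda>s :: real. inverse (1 + s\<^sup>2))"
    using integrable_inverse_1_plus_square by (simp add: set_integrable_def)
  have e: "(LINT s|lborel. inverse (1 + (s :: real)\<^sup>2)) = pi"
    using LBINT_inverse_1_plus_square by (simp add: interval_lebesgue_integral_def set_lebesgue_integral_def)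
  have "(\<lambda>s :: real. 1 / (pi * (1 + s\<^sup>2))) = (\<lambda>s. (1 / pi) * inverse (1 + s\<^sup>2))" by (simp add: field_simps)
  then show "integrable lborel (\<lambda>s :: real. 1 / (pi * (1 + s\<^sup>2)))" "(LINT s|lborel. 1 / (pi * (1 + (s :: real)\<^sup>2))) = 1"
    using i e by (simp_all only: integrable_mult_right integral_mult_right_zero) simp
qed

text \<open>Rescaling by the distance to the boundary moves all dependence on \<open>z\<close> into
  the argument of \<open>f\<close>, leaving a fixed probability density.\<close>

lemma poisson_extension_eq:
  assumes "Im z < 0"
  shows "poisson_extension f z = (LINT s|lborel. complex_of_real (1 / (pi * (1 + s\<^sup>2))) * f (Re z - Im z * s))"
proof -
  define y where "y = - Im z"
  have y: "y > 0" using assms by (simp add: y_def)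
  have "poisson_extension f z = \<bar>y\<bar> *\<^sub>R (LINT s|lborel. complex_of_real (- Im z / (pi * ((Re z - (Re z + y * s))\<^sup>2 + (Im z)\<^sup>2))) * f (Re z + y * s))"
    unfolding poisson_extension_def by (rule lborel_integral_real_affine) (use y in simp)
  also have "\<dots> = (LINT s|lborel. complex_of_real y * (complex_of_real (- Im z / (pi * ((Re z - (Re z + y * s))\<^sup>2 + (Im z)\<^sup>2))) * f (Re z + y * s)))"
    using y by (simp only: integral_mult_right_zero scaleR_conv_of_real) simp
  also have "\<dots> = (LINT s|lborel. complex_of_real (1 / (pi * (1 + s\<^sup>2))) * f (Re z - Im z * s))"
  proof (intro Bochner_Integration.integral_cong refl)
    fix s
    have "y * (- Im z / (pi * ((Re z - (Re z + y * s))\<^sup>2 + (Im z)\<^sup>2))) = y * y / (y * y * (pi * (1 + s\<^sup>2)))"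
      by (simp add: y_def power2_eq_square algebra_simps)
    also have "\<dots> = 1 / (pi * (1 + s\<^sup>2))" using y by simp
    finally have "complex_of_real y * complex_of_real (- Im z / (pi * ((Re z - (Re z + y * s))\<^sup>2 + (Im z)\<^sup>2))) = complex_of_real (1 / (pi * (1 + s\<^sup>2)))"
      by (simp only: of_real_mult[symmetric])
    moreover have "Re z + y * s = Re z - Im z * s" by (simp add: y_def)
    ultimately show "complex_of_real y * (complex_of_real (- Im z / (pi * ((Re z - (Re z + y * s))\<^sup>2 + (Im z)\<^sup>2))) * f (Re z + y * s))
      = complex_of_real (1 / (pi * (1 + s\<^sup>2))) * f (Re z - Im z * s)"
      by (simp only: mult.assoc[symmetric])
  qed
  finally show ?thesis .
qed

text \<open>In rescaled form this is dominated convergence against the Cauchy density, for any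
  approach to the boundary point within the half-plane.\<close>

lemma poisson_extension_tendsto:
  assumes c: "continuous_on UNIV f" and B: "\<And>x. norm (f x) \<le> B"
  shows "(poisson_extension f \<longlongrightarrow> f \<alpha>) (at (complex_of_real \<alpha>) within P_minus)"
  unfolding tendsto_at_iff_sequentially
proof (intro allI impI)
  fix X :: "nat \<Rightarrow> complex"
  assume XP: "\<forall>i. X i \<in> P_minus - {complex_of_real \<alpha>}" and X: "X \<longlonglongrightarrow> complex_of_real \<alpha>"
  have [measurable]: "f \<in> borel_measurable borel" by (rule borel_measurable_continuous_onI[OF c])
  have Re: "(\<lambda>n. Re (X n)) \<longlonglongrightarrow> \<alpha>" and Im: "(\<lambda>n. Im (X n)) \<longlonglongrightarrow> 0"
    using tendsto_Re[OF X] tendsto_Im[OF X] by auto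
  have "(\<lambda>n. LINT s|lborel. complex_of_real (1 / (pi * (1 + s\<^sup>2))) * f (Re (X n) - Im (X n) * s)) \<longlonglongrightarrow>
    (LINT s|lborel. complex_of_real (1 / (pi * (1 + s\<^sup>2))) * f \<alpha>)"
  proof (rule integral_dominated_convergence[where w="\<lambda>s. B * (1 / (pi * (1 + s\<^sup>2)))"])
    show "integrable lborel (\<lambda>s. B * (1 / (pi * (1 + s\<^sup>2))))" by (intro integrable_mult_right cauchy_density)
    have "(\<lambda>n. f (Re (X n) - Im (X n) * s)) \<longlonglongrightarrow> f (\<alpha> - 0 * s)" for s
    proof (rule isCont_tendsto_compose[where g=f])
      show "isCont f (\<alpha> - 0 * s)" using c by (simp add: continuous_on_eq_continuous_at)
      show "(\<lambda>n. Re (X n) - Im (X n) * s) \<longlonglongrightarrow> \<alpha> - 0 * s" by (intro tendsto_intros Re Im)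
    qed
    then show "AE s in lborel. (\<lambda>n. complex_of_real (1 / (pi * (1 + s\<^sup>2))) * f (Re (X n) - Im (X n) * s)) \<longlonglongrightarrow> complex_of_real (1 / (pi * (1 + s\<^sup>2))) * f \<alpha>"
      by (intro always_eventually allI tendsto_mult tendsto_const) simp
    have "norm (complex_of_real (1 / (pi * (1 + s\<^sup>2))) * f (Re (X n) - Im (X n) * s)) \<le> B * (1 / (pi * (1 + s\<^sup>2)))" for n s
    proof -
      have p: "1 / (pi * (1 + s\<^sup>2)) \<ge> 0" by simp
      have "norm (complex_of_real (1 / (pi * (1 + s\<^sup>2))) * f (Re (X n) - Im (X n) * s)) = (1 / (pi * (1 + s\<^sup>2))) * norm (f (Re (X n) - Im (X n) * s))"
        unfolding norm_mult norm_of_real abs_of_nonneg[OF p] ..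
      also have "\<dots> \<le> (1 / (pi * (1 + s\<^sup>2))) * B" by (rule mult_left_mono[OF B p])
      finally show ?thesis by (simp only: mult.commute)
    qed
    then show "AE s in lborel. norm (complex_of_real (1 / (pi * (1 + s\<^sup>2))) * f (Re (X n) - Im (X n) * s)) \<le> B * (1 / (pi * (1 + s\<^sup>2)))" for n
      by (intro always_eventually allI)
  qed measurable
  moreover have "(LINT s|lborel. complex_of_real (1 / (pi * (1 + s\<^sup>2))) * f \<alpha>) = f \<alpha>"
  proof -
    have "(LINT s|lborel. complex_of_real (1 / (pi * (1 + s\<^sup>2))) * f \<alpha>) = (LINT s|lborel. complex_of_real (1 / (pi * (1 + s\<^sup>2)))) * f \<alpha>"
      by (rule integral_mult_left_zero)
    also have "(LINT s|lborel. complex_of_real (1 / (pi * (1 + s\<^sup>2)))) = 1"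
      unfolding integral_complex_of_real cauchy_density(2) by simp
    finally show ?thesis by simp
  qed
  moreover have "poisson_extension f (X n) = (LINT s|lborel. complex_of_real (1 / (pi * (1 + s\<^sup>2))) * f (Re (X n) - Im (X n) * s))" for n
    by (rule poisson_extension_eq) (use XP in \<open>auto simp: P_minus_def\<close>)
  ultimately show "(poisson_extension f \<circ> X) \<longlonglongrightarrow> f \<alpha>" by (simp only: o_def)
qed

section \<open>Continuous logarithms and the branch normalised at infinity\<close>

lemma exp_eq_1_constant:
  fixes h :: "'a::topological_space \<Rightarrow> complex"
  assumes S: "connected S" and c: "continuous_on S h" and e: "\<And>x. x \<in> S \<Longrightarrow> exp (h x) = 1"
  shows "h constant_on S"
\<comment> \<open>Logarithms of 1 are the integer multiples of 2 pi i, so distinct values lie at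
  least 2 pi apart. This settles all later comparisons of two logarithms of the same
  function.\<close>
proof (rule continuous_discrete_range_constant[OF S c])
  fix x assume x: "x \<in> S"
  show "\<exists>e>0. \<forall>y. y \<in> S \<and> h y \<noteq> h x \<longrightarrow> e \<le> norm (h y - h x)"
  proof (intro exI[of _ "2 * pi"] conjI allI impI)
    fix y assume y: "y \<in> S \<and> h y \<noteq> h x"
    obtain n m :: int where n: "Re (h y) = 0" "Im (h y) = of_int (2 * n) * pi" and m: "Re (h x) = 0" "Im (h x) = of_int (2 * m) * pi"
      using e[OF x] e[of y] y unfolding exp_eq_1 by blast
    have "n \<noteq> m" using y n m by (auto simp: complex_eq_iff)
    then have "1 \<le> \<bar>real_of_int (n - m)\<bar>" by linarith
    then have "2 * pi * 1 \<le> 2 * pi * \<bar>real_of_int (n - m)\<bar>" by (intro mult_left_mono) auto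
    also have "\<dots> = \<bar>Im (h y - h x)\<bar>"
    proof -
      have "Im (h y - h x) = 2 * pi * real_of_int (n - m)" using n m by (simp add: algebra_simps)
      then show ?thesis by (simp add: abs_mult)
    qed
    also have "\<dots> \<le> norm (h y - h x)" by (rule abs_Im_le_cmod)
    finally show "2 * pi \<le> norm (h y - h x)" by simp
  qed simp
qed

text \<open>Polar coordinates exhibit the set as a continuous image of a rectangle. Connectedness
  near infinity is needed to compare a logarithm with the principal one there.\<close>

lemma connected_lower_exterior:
  assumes "c > 0" shows "connected {z \<in> lower. c \<le> norm z}"
proof -
  have "{z \<in> lower. c \<le> norm z} = (\<lambda>(r, \<theta>). complex_of_real r * cis \<theta>) ` ({c..} \<times> {- pi..0})" (is "?A = ?f ` ?B")
  proof
    show "?A \<subseteq> ?f ` ?B"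
    proof
      fix z assume z: "z \<in> ?A"
      then have z0: "z \<noteq> 0" using assms by auto
      \<comment> \<open>The principal argument of a negative real number is pi, outside the range
        used here; it is replaced by -pi.\<close>
      define t where "t = (if Arg z = pi then - pi else Arg z)"
      have "z = complex_of_real (norm z) * cis (Arg z)" by (simp add: cis_conv_exp Arg_eq z0)
      moreover have "cis t = cis (Arg z)" by (auto simp: t_def cis.ctr)
      ultimately have "z = complex_of_real (norm z) * cis t" by simp
      moreover have "t \<in> {- pi..0}"
      proof -
        have b: "- pi < Arg z" "Arg z \<le> pi" by (auto simp: mpi_less_Arg Arg_le_pi)
        have "Arg z \<le> 0 \<or> Arg z = pi"
        proof (rule ccontr)
          assume "\<not> ?thesis"
          then have "0 < Arg z" "Arg z < pi" using b by auto
          then have "Im z > 0" using Arg_lt_pi by blast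
          then show False using z by (simp add: lower_def)
        qed
        then show ?thesis using b by (auto simp: t_def)
      qed
      ultimately show "z \<in> ?f ` ?B" using z by (intro image_eqI[of _ _ "(norm z, t)"]) auto
    qed
    show "?f ` ?B \<subseteq> ?A"
    proof
      fix z assume "z \<in> ?f ` ?B"
      then obtain r t where z: "z = complex_of_real r * cis t" and r: "c \<le> r" and t: "- pi \<le> t" "t \<le> 0" by auto
      have "0 \<le> sin (- t)" by (rule sin_ge_zero) (use t in linarith)+
      then have "sin t \<le> 0" unfolding sin_minus by linarith
      then have "r * sin t \<le> 0" by (intro mult_nonneg_nonpos) (use r assms in linarith)+
      moreover have "norm z = r" using r assms unfolding z norm_mult by simp
      ultimately show "z \<in> ?A" using r by (simp add: z lower_def)
    qed
  qed
  moreover have "connected (?f ` ?B)"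
  proof (rule connected_continuous_image)
    show "continuous_on ?B ?f" unfolding case_prod_beta by (intro continuous_intros)
    show "connected ?B" by (intro connected_Times) auto
  qed
  ultimately show ?thesis by simp
qed

lemma P_minus_facts:
  "open P_minus" "convex P_minus" "connected P_minus" "P_minus \<subseteq> lower"
  unfolding P_minus_def lower_def
  by (auto simp: open_halfspace_Im_lt convex_halfspace_Im_lt intro: convex_connected convex_halfspace_Im_lt)

lemma boundary_islimpt: "complex_of_real \<alpha> islimpt P_minus"
  unfolding islimpt_approachable
proof (intro allI impI)
  fix e :: real assume e: "e > 0"
  have "complex_of_real \<alpha> - \<i> * of_real (e/2) \<in> P_minus" using e by (simp add: P_minus_def)
  moreover have "complex_of_real \<alpha> - \<i> * of_real (e/2) \<noteq> complex_of_real \<alpha>" using e by simp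
  moreover have "dist (complex_of_real \<alpha> - \<i> * of_real (e/2)) (complex_of_real \<alpha>) < e"
    using e by (simp add: dist_norm norm_mult norm_divide)
  ultimately show "\<exists>x'\<in>P_minus. x' \<noteq> complex_of_real \<alpha> \<and> dist x' (complex_of_real \<alpha>) < e" by blast
qed

lemma infinity_in_P_minus_iff:
  "(f \<longlongrightarrow> (l::complex)) infinity_in_P_minus \<longleftrightarrow> (\<forall>e>0. \<exists>c. \<forall>z\<in>P_minus. c \<le> norm z \<longrightarrow> dist (f z) l < e)"
  unfolding infinity_in_P_minus_def tendsto_iff eventually_inf_principal eventually_at_infinity by blast

text \<open>A neighbourhood of a boundary point splits into interior points, governed by the limit
  of F, and boundary points, governed by continuity of f.\<close>

lemma boundary_extension_continuous:
  fixes F :: "complex \<Rightarrow> complex"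
  assumes hol: "continuous_on P_minus F" and f: "continuous_on UNIV f"
    and lim: "\<And>\<alpha>. (F \<longlongrightarrow> f \<alpha>) (at (complex_of_real \<alpha>) within P_minus)"
  shows "continuous_on lower (\<lambda>z. if Im z < 0 then F z else f (Re z))"
  unfolding continuous_on_def
proof
  fix a assume a: "a \<in> lower"
  let ?G = "\<lambda>z. if Im z < 0 then F z else f (Re z)"
  show "(?G \<longlongrightarrow> ?G a) (at a within lower)"
  proof (cases "Im a < 0")
    case True
    then have aP: "a \<in> P_minus" by (simp add: P_minus_def)
    have ev: "\<forall>\<^sub>F z in at a. z \<in> P_minus"
      using eventually_at_in_open'[OF P_minus_facts(1) aP] .
    have "(F \<longlongrightarrow> F a) (at a)"
      using hol aP unfolding continuous_on_def by (metis P_minus_facts(1) at_within_open)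
    then have "(?G \<longlongrightarrow> F a) (at a)"
      by (rule Lim_transform_eventually) (use ev in eventually_elim, auto simp: P_minus_def)
    then have "(?G \<longlongrightarrow> F a) (at a within lower)" by (rule tendsto_within_subset) simp
    then show ?thesis using True by simp
  next
    case False
    then have a0: "Im a = 0" "complex_of_real (Re a) = a" using a by (auto simp: lower_def complex_eq_iff)
    show ?thesis
    proof (rule tendstoI)
      fix e :: real assume e: "e > 0"
      have "\<forall>\<^sub>F z in at a within P_minus. dist (F z) (f (Re a)) < e"
        using tendstoD[OF lim[of "Re a"] e] a0 by simp
      then obtain d1 where d1: "d1 > 0" "\<And>z. z \<in> P_minus \<Longrightarrow> z \<noteq> a \<Longrightarrow> dist z a < d1 \<Longrightarrow> dist (F z) (f (Re a)) < e"
        unfolding eventually_at by blast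
      obtain d2 where d2: "d2 > 0" "\<And>x. dist x (Re a) < d2 \<Longrightarrow> dist (f x) (f (Re a)) < e"
        using f e unfolding continuous_on_iff by (metis UNIV_I)
      show "\<forall>\<^sub>F z in at a within lower. dist (?G z) (?G a) < e"
        unfolding eventually_at
      proof (intro exI[of _ "min d1 d2"] conjI ballI impI)
        fix z assume z: "z \<in> lower" "z \<noteq> a \<and> dist z a < min d1 d2"
        have "dist (Re z) (Re a) < d2" using z abs_Re_le_cmod[of "z - a"] by (simp add: dist_norm)
        then show "dist (?G z) (?G a) < e"
          using d1(2)[of z] d2(2)[of "Re z"] z a0 by (auto simp: P_minus_def)
      qed (use d1 d2 in auto)
    qed
  qed
qed

text \<open>The logarithm is taken on the closed half-plane, which is contractible, so it is
  continuous up to the boundary at once; the normalisation at infinity then identifies it with the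
  arbitrarily chosen branch in \<open>boundary_log\<close>.\<close>

lemma log_extension:
  assumes hol: "F holomorphic_on P_minus" and nz: "\<And>z. z \<in> P_minus \<Longrightarrow> F z \<noteq> 0"
    and f: "continuous_on UNIV f" "\<And>\<alpha>. f \<alpha> \<noteq> 0"
    and lim: "\<And>\<alpha>. (F \<longlongrightarrow> f \<alpha>) (at (complex_of_real \<alpha>) within P_minus)"
    and inf: "\<And>e. e > 0 \<Longrightarrow> \<exists>c. \<forall>z\<in>P_minus. norm z \<ge> c \<longrightarrow> norm (F z - 1) \<le> e"
  obtains L where "continuous_on lower L" "L holomorphic_on P_minus"
    "\<And>z. z \<in> P_minus \<Longrightarrow> exp (L z) = F z" "\<And>\<alpha>. exp (L (complex_of_real \<alpha>)) = f \<alpha>"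
    "\<And>e. e > 0 \<Longrightarrow> \<exists>c. \<forall>z\<in>lower. norm z \<ge> c \<longrightarrow> norm (L z) \<le> e"
    "\<And>\<alpha>. boundary_log F \<alpha> = L (complex_of_real \<alpha>)"
proof -
  define G where "G z = (if Im z < 0 then F z else f (Re z))" for z
  have cF: "continuous_on P_minus F" by (rule holomorphic_on_imp_continuous_on[OF hol])
  have cG: "continuous_on lower G" unfolding G_def by (rule boundary_extension_continuous[OF cF f(1) lim])
  have nG: "G z \<noteq> 0" if z: "z \<in> lower" for z using nz[of z] f(2) by (auto simp: G_def P_minus_def)
  have ctr: "contractible lower"
    unfolding lower_def by (intro convex_imp_contractible convex_halfspace_Im_le)
  obtain g where cg: "continuous_on lower g" and g: "\<And>z. z \<in> lower \<Longrightarrow> G z = exp (g z)"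
    using continuous_logarithm_on_contractible[OF cG ctr nG] by metis
  have Ginf: "\<exists>c. \<forall>z\<in>lower. norm z \<ge> c \<longrightarrow> norm (G z - 1) \<le> e" if e: "e > 0" for e
  proof -
    obtain c where c: "\<And>z. z \<in> P_minus \<Longrightarrow> norm z \<ge> c \<Longrightarrow> norm (F z - 1) \<le> e" using inf[OF e] by blast
    have "norm (G z - 1) \<le> e" if z: "z \<in> lower" "norm z \<ge> c" for z
    proof (cases "Im z < 0")
      case True
      then show ?thesis using c[of z] z by (simp add: G_def P_minus_def)
    next
      case False
      then have z0: "Im z = 0" "complex_of_real (Re z) = z" using z by (auto simp: lower_def complex_eq_iff)
      have l: "((\<lambda>n. F (z - \<i> * of_real (1 / real (Suc n)))) \<longlonglongrightarrow> f (Re z))"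
      proof (rule filterlim_compose[OF lim[of "Re z", unfolded z0(2)]])
        have "(\<lambda>n. z - \<i> * of_real (1 / real (Suc n))) \<longlonglongrightarrow> z - \<i> * of_real 0"
          by (intro tendsto_intros LIMSEQ_Suc[OF lim_1_over_n])
        then have l: "(\<lambda>n. z - \<i> * of_real (1 / real (Suc n))) \<longlonglongrightarrow> z" by simp
        show "filterlim (\<lambda>n. z - \<i> * of_real (1 / real (Suc n))) (at z within P_minus) sequentially"
          unfolding filterlim_at
        proof (rule conjI[OF always_eventually l], rule allI)
          fix n
          show "z - \<i> * of_real (1 / real (Suc n)) \<in> P_minus \<and> z - \<i> * of_real (1 / real (Suc n)) \<noteq> z"
          proof -
            have "Im (z - \<i> * of_real (1 / real (Suc n))) < 0" using z0 by simp
            then show ?thesis using z0(1) by (metis P_minus_def less_irrefl mem_Collect_eq)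
          qed
        qed
      qed
      have "norm (f (Re z) - 1) \<le> e"
      proof (rule tendsto_upperbound[OF tendsto_norm[OF tendsto_diff[OF l tendsto_const]]])
        have "norm (F (z - \<i> * of_real (1 / real (Suc n))) - 1) \<le> e" for n
        proof (rule c)
          show "z - \<i> * of_real (1 / real (Suc n)) \<in> P_minus" using z0 by (simp add: P_minus_def)
          \<comment> \<open>Descending vertically from a real point does not decrease the modulus,
            so the approximating points stay where the bound on \<open>F\<close> is
            available.\<close>
          have "norm z = \<bar>Re z\<bar>" using z0 by (metis norm_of_real)
          also have "\<dots> \<le> norm (z - \<i> * of_real (1 / real (Suc n)))"
            using abs_Re_le_cmod[of "z - \<i> * of_real (1 / real (Suc n))"] by simp
          finally show "c \<le> norm (z - \<i> * of_real (1 / real (Suc n)))" using z(2) by linarith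
        qed
        then show "\<forall>\<^sub>F n in sequentially. norm (F (z - \<i> * of_real (1 / real (Suc n))) - 1) \<le> e" by simp
      qed simp
      then show ?thesis using False by (simp add: G_def)
    qed
    then show ?thesis by blast
  qed
  obtain c0 where c0: "\<And>z. z \<in> lower \<Longrightarrow> norm z \<ge> c0 \<Longrightarrow> norm (G z - 1) \<le> 1/2" using Ginf[of "1/2"] by auto
  define c1 where "c1 = max c0 1"
  \<comment> \<open>Far out the function lies within 1/2 of 1, hence in the right half-plane, where
    the principal logarithm is continuous and small.\<close>
  define W where "W = {z \<in> lower. c1 \<le> norm z}"
  have W: "connected W" unfolding W_def by (rule connected_lower_exterior) (simp add: c1_def)
  have WG: "G z \<notin> \<real>\<^sub>\<le>\<^sub>0" if z: "z \<in> W" for z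
  proof -
    have "norm (G z - 1) \<le> 1/2" using c0 z by (auto simp: W_def c1_def)
    then have "\<bar>Re (G z - 1)\<bar> \<le> 1/2" using abs_Re_le_cmod order_trans by blast
    then have "Re (G z) > 0" unfolding minus_complex.simps one_complex.simps by linarith
    then show ?thesis by (auto simp: complex_nonpos_Reals_iff)
  qed
  have "(\<lambda>z. g z - Ln (G z)) constant_on W"
  proof (rule exp_eq_1_constant[OF W])
    show "continuous_on W (\<lambda>z. g z - Ln (G z))"
      by (intro continuous_intros continuous_on_subset[OF cg] continuous_on_subset[OF cG] WG) (auto simp: W_def)
    show "exp (g z - Ln (G z)) = 1" if z: "z \<in> W" for z
    proof -
      have zl: "z \<in> lower" using z by (simp add: W_def)
      show ?thesis using g[OF zl] nG[OF zl] by (simp add: exp_diff exp_Ln)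
    qed
  qed
  then obtain k where k: "\<And>z. z \<in> W \<Longrightarrow> g z - Ln (G z) = k" unfolding constant_on_def by blast
  have ek: "exp k = 1"
  proof -
    have zW: "complex_of_real c1 \<in> W" by (simp add: W_def lower_def c1_def)
    then have zl: "complex_of_real c1 \<in> lower" by (simp add: W_def)
    show ?thesis unfolding k[OF zW, symmetric] using g[OF zl] nG[OF zl] by (simp add: exp_diff exp_Ln)
  qed
  define L where "L z = g z - k" for z
  have cL: "continuous_on lower L" unfolding L_def by (intro continuous_intros cg)
  have eL: "exp (L z) = G z" if "z \<in> lower" for z using g[OF that] ek by (simp add: L_def exp_diff)
  have LLn: "L z = Ln (G z)" if "z \<in> W" for z using k[OF that] by (simp add: L_def algebra_simps)
  have Linf: "\<exists>c. \<forall>z\<in>lower. norm z \<ge> c \<longrightarrow> norm (L z) \<le> e" if e: "e > 0" for e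
  proof -
    have "isCont Ln 1" by (rule continuous_at_Ln) (auto simp: complex_nonpos_Reals_iff)
    then obtain d where d: "d > 0" "\<And>w. dist w 1 < d \<Longrightarrow> dist (Ln w) (Ln 1) < e"
      using e unfolding continuous_at_eps_delta by metis
    obtain c where c: "\<And>z. z \<in> lower \<Longrightarrow> norm z \<ge> c \<Longrightarrow> norm (G z - 1) \<le> d/2" using Ginf[of "d/2"] d by auto
    have "norm (L z) \<le> e" if z: "z \<in> lower" "norm z \<ge> max c c1" for z
    proof -
      have "dist (G z) 1 < d" using c[of z] z d(1) by (simp add: dist_norm)
      from d(2)[OF this] have "norm (Ln (G z)) < e" by (simp add: dist_norm)
      then show ?thesis using LLn[of z] z by (simp add: W_def)
    qed
    then show ?thesis by blast
  qed
  have sub: "P_minus \<subseteq> lower" by (rule P_minus_facts)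
  have eLP: "exp (L z) = F z" if z: "z \<in> P_minus" for z
    using eL[of z] z sub by (auto simp: G_def P_minus_def)
  \<comment> \<open>Continuity of \<open>L\<close> alone does not give holomorphy; it is inherited
    from a holomorphic logarithm, from which \<open>L\<close> differs by a constant.\<close>
  have "simply_connected P_minus" by (rule convex_imp_simply_connected[OF P_minus_facts(2)])
  then obtain l where hl: "l holomorphic_on P_minus" and l: "\<And>z. z \<in> P_minus \<Longrightarrow> F z = exp (l z)"
    using hol nz unfolding simply_connected_eq_holomorphic_log[OF P_minus_facts(1)] by metis
  have "(\<lambda>z. L z - l z) constant_on P_minus"
  proof (rule exp_eq_1_constant[OF P_minus_facts(3)])
    show "continuous_on P_minus (\<lambda>z. L z - l z)"
      by (intro continuous_intros continuous_on_subset[OF cL sub] holomorphic_on_imp_continuous_on[OF hl])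
    show "exp (L z - l z) = 1" if z: "z \<in> P_minus" for z
      using eLP[OF z] l[OF z] by (simp add: exp_diff)
  qed
  then obtain k' where k': "\<And>z. z \<in> P_minus \<Longrightarrow> L z - l z = k'" unfolding constant_on_def by blast
  have hL: "L holomorphic_on P_minus"
  proof (rule holomorphic_transform)
    show "(\<lambda>z. l z + k') holomorphic_on P_minus" by (intro holomorphic_intros hl)
    show "l z + k' = L z" if z: "z \<in> P_minus" for z using k'[OF z] by (simp add: algebra_simps)
  qed
  have LI: "(L \<longlongrightarrow> 0) infinity_in_P_minus"
    unfolding infinity_in_P_minus_iff
  proof (intro allI impI)
    fix e :: real assume e: "e > 0"
    obtain c where c: "\<And>z. z \<in> lower \<Longrightarrow> norm z \<ge> c \<Longrightarrow> norm (L z) \<le> e/2" using Linf[of "e/2"] e by auto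
    show "\<exists>c. \<forall>z\<in>P_minus. c \<le> norm z \<longrightarrow> dist (L z) 0 < e"
    proof (intro exI[of _ c] ballI impI)
      fix z assume "z \<in> P_minus" "c \<le> norm z"
      then show "dist (L z) 0 < e" using c[of z] sub e by auto
    qed
  qed
  have Lbranch: "is_log_branch F L"
    unfolding is_log_branch_def using continuous_on_subset[OF cL sub] eLP LI by blast
  \<comment> \<open>The branch picked by the definition. It differs from \<open>L\<close> by a
    constant, and both tend to 0 at infinity.\<close>
  define M where "M = (SOME L. is_log_branch F L)"
  have M: "is_log_branch F M" unfolding M_def by (rule someI[of "is_log_branch F", OF Lbranch])
  have "(\<lambda>z. M z - L z) constant_on P_minus"
  proof (rule exp_eq_1_constant[OF P_minus_facts(3)])
    show "continuous_on P_minus (\<lambda>z. M z - L z)"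
      using M unfolding is_log_branch_def by (intro continuous_intros continuous_on_subset[OF cL sub]) auto
    show "exp (M z - L z) = 1" if z: "z \<in> P_minus" for z
      using eLP[OF z] nz[OF z] M z unfolding is_log_branch_def by (simp add: exp_diff)
  qed
  then obtain m where m: "\<And>z. z \<in> P_minus \<Longrightarrow> M z - L z = m" unfolding constant_on_def by blast
  have "m = 0"
  proof (rule ccontr)
    assume m0: "m \<noteq> 0"
    have "((\<lambda>z. M z - L z) \<longlongrightarrow> 0 - 0) infinity_in_P_minus"
      using M unfolding is_log_branch_def by (intro tendsto_diff LI) auto
    then have "((\<lambda>z. M z - L z) \<longlongrightarrow> 0) infinity_in_P_minus" by simp
    then obtain c where c: "\<And>z. z \<in> P_minus \<Longrightarrow> c \<le> norm z \<Longrightarrow> dist (M z - L z) 0 < norm m"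
      unfolding infinity_in_P_minus_iff using m0 by (metis zero_less_norm_iff)
    have zP: "- \<i> * of_real (\<bar>c\<bar> + 1) \<in> P_minus" by (simp add: P_minus_def)
    have "c \<le> norm (- \<i> * of_real (\<bar>c\<bar> + 1))" unfolding norm_mult norm_of_real by simp
    from c[OF zP this] show False unfolding m[OF zP] by simp
  qed
  then have MeqL: "M z = L z" if "z \<in> P_minus" for z using m[OF that] by simp
  have bl: "boundary_log F \<alpha> = L (complex_of_real \<alpha>)" for \<alpha>
    unfolding boundary_log_def M_def[symmetric]
  proof (rule tendsto_Lim)
    show "\<not> trivial_limit (at (complex_of_real \<alpha>) within P_minus)"
      using boundary_islimpt by (simp add: trivial_limit_within)
    have "(L \<longlongrightarrow> L (complex_of_real \<alpha>)) (at (complex_of_real \<alpha>) within lower)"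
      using cL by (auto simp: continuous_on_def lower_def)
    then have "(L \<longlongrightarrow> L (complex_of_real \<alpha>)) (at (complex_of_real \<alpha>) within P_minus)"
      by (rule tendsto_within_subset[OF _ sub])
    then show "(M \<longlongrightarrow> L (complex_of_real \<alpha>)) (at (complex_of_real \<alpha>) within P_minus)"
      by (rule Lim_transform_eventually) (auto simp: eventually_at_filter MeqL)
  qed
  have ef: "exp (L (complex_of_real \<alpha>)) = f \<alpha>" for \<alpha>
    using eL[of "complex_of_real \<alpha>"] by (simp add: lower_def G_def)
  show ?thesis by (rule that[OF cL hL eLP ef Linf bl])
qed

section \<open>Bounds that are uniform in time\<close>

text \<open>Measurability is part of the notion so that the rules for sums and products chain
  without side conditions; one constant serves all times.\<close>

definition uL2 :: "'t set \<Rightarrow> ('t \<Rightarrow> real \<Rightarrow> complex) \<Rightarrow> bool" where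
  "uL2 I u \<longleftrightarrow> (\<exists>A\<ge>0. \<forall>t\<in>I. u t \<in> borel_measurable borel \<and> sq_nn (u t) \<le> ennreal A)"

definition uLinf :: "'t set \<Rightarrow> ('t \<Rightarrow> real \<Rightarrow> complex) \<Rightarrow> bool" where
  "uLinf I u \<longleftrightarrow> (\<exists>M. \<forall>t\<in>I. u t \<in> borel_measurable borel \<and> (\<forall>x. norm (u t x) \<le> M))"

lemma uL2_cong: "uL2 I u \<Longrightarrow> (\<And>t x. t \<in> I \<Longrightarrow> v t x = u t x) \<Longrightarrow> uL2 I v"
  unfolding uL2_def by (metis (no_types, lifting) ext)

lemma uLinf_cong: "uLinf I u \<Longrightarrow> (\<And>t x. t \<in> I \<Longrightarrow> v t x = u t x) \<Longrightarrow> uLinf I v"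
  unfolding uLinf_def by (metis (no_types, lifting) ext)

lemma uL2_add:
  assumes "uL2 I u" "uL2 I v" shows "uL2 I (\<lambda>t x. u t x + v t x)"
proof -
  obtain A B where A: "A \<ge> 0" "\<And>t. t \<in> I \<Longrightarrow> u t \<in> borel_measurable borel \<and> sq_nn (u t) \<le> ennreal A"
    and B: "B \<ge> 0" "\<And>t. t \<in> I \<Longrightarrow> v t \<in> borel_measurable borel \<and> sq_nn (v t) \<le> ennreal B"
    using assms unfolding uL2_def by blast
  show ?thesis unfolding uL2_def
  proof (intro exI[of _ "2 * A + 2 * B"] conjI ballI)
    fix t assume t: "t \<in> I"
    have [measurable]: "u t \<in> borel_measurable borel" "v t \<in> borel_measurable borel" using A B t by auto
    show "(\<lambda>x. u t x + v t x) \<in> borel_measurable borel" by measurable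
    have "sq_nn (\<lambda>x. u t x + v t x) \<le> ennreal (1 + 1) * sq_nn (u t) + ennreal (1 + 1 / 1) * sq_nn (v t)"
      by (rule sq_nn_add_le) auto
    also have "\<dots> \<le> ennreal 2 * ennreal A + ennreal 2 * ennreal B"
      using A(2)[OF t] B(2)[OF t] by (intro add_mono mult_mono) auto
    also have "\<dots> = ennreal (2 * A + 2 * B)" using A(1) B(1) by (simp add: ennreal_mult)
    finally show "sq_nn (\<lambda>x. u t x + v t x) \<le> ennreal (2 * A + 2 * B)" .
  qed (use A(1) B(1) in auto)
qed

lemma uL2_mult:
  assumes "uL2 I u" "uLinf I v" shows "uL2 I (\<lambda>t x. u t x * v t x)"
proof -
  obtain A where A: "A \<ge> 0" "\<And>t. t \<in> I \<Longrightarrow> u t \<in> borel_measurable borel \<and> sq_nn (u t) \<le> ennreal A"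
    using assms unfolding uL2_def by blast
  obtain M where M: "\<And>t. t \<in> I \<Longrightarrow> v t \<in> borel_measurable borel" "\<And>t x. t \<in> I \<Longrightarrow> norm (v t x) \<le> M"
    using assms unfolding uLinf_def by blast
  show ?thesis unfolding uL2_def
  proof (intro exI[of _ "M\<^sup>2 * A"] conjI ballI)
    fix t assume t: "t \<in> I"
    have [measurable]: "u t \<in> borel_measurable borel" "v t \<in> borel_measurable borel" using A M t by auto
    show "(\<lambda>x. u t x * v t x) \<in> borel_measurable borel" by measurable
    have "sq_nn (\<lambda>x. u t x * v t x) \<le> (\<integral>\<^sup>+x. ennreal (M\<^sup>2) * ennreal ((norm (u t x))\<^sup>2) \<partial>lborel)"
      unfolding sq_nn_def
    proof (rule nn_integral_mono)
      fix x
      have "(norm (v t x))\<^sup>2 \<le> M\<^sup>2" by (rule power_mono[OF M(2)[OF t]]) simp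
      then have "(norm (u t x * v t x))\<^sup>2 \<le> M\<^sup>2 * (norm (u t x))\<^sup>2"
        by (simp add: norm_mult power_mult_distrib mult.commute[of "M\<^sup>2"] mult_left_mono)
      then show "ennreal ((norm (u t x * v t x))\<^sup>2) \<le> ennreal (M\<^sup>2) * ennreal ((norm (u t x))\<^sup>2)"
        by (simp add: ennreal_mult[symmetric] ennreal_leI)
    qed
    also have "\<dots> = ennreal (M\<^sup>2) * sq_nn (u t)" unfolding sq_nn_def by (rule nn_integral_cmult) measurable
    also have "\<dots> \<le> ennreal (M\<^sup>2) * ennreal A" using A(2)[OF t] by (intro mult_left_mono) auto
    also have "\<dots> = ennreal (M\<^sup>2 * A)" using A(1) by (simp add: ennreal_mult)
    finally show "sq_nn (\<lambda>x. u t x * v t x) \<le> ennreal (M\<^sup>2 * A)" .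
  qed (use A(1) in auto)
qed

lemma uL2_mono:
  assumes "uL2 I u" "\<And>t. t \<in> I \<Longrightarrow> v t \<in> borel_measurable borel" "\<And>t x. t \<in> I \<Longrightarrow> norm (v t x) \<le> norm (u t x)"
  shows "uL2 I v"
proof -
  have "sq_nn (v t) \<le> sq_nn (u t)" if "t \<in> I" for t
    unfolding sq_nn_def by (intro nn_integral_mono ennreal_leI power_mono assms(3)[OF that]) auto
  then show ?thesis using assms(1,2) unfolding uL2_def by (meson order_trans)
qed

lemma uLinf_add:
  assumes "uLinf I u" "uLinf I v" shows "uLinf I (\<lambda>t x. u t x + v t x)"
proof -
  obtain A B where A: "\<And>t. t \<in> I \<Longrightarrow> u t \<in> borel_measurable borel" "\<And>t x. t \<in> I \<Longrightarrow> norm (u t x) \<le> A"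
    and B: "\<And>t. t \<in> I \<Longrightarrow> v t \<in> borel_measurable borel" "\<And>t x. t \<in> I \<Longrightarrow> norm (v t x) \<le> B"
    using assms unfolding uLinf_def by blast
  show ?thesis unfolding uLinf_def
    by (intro exI[of _ "A + B"] ballI conjI allI norm_triangle_le add_mono A B borel_measurable_add)
qed

lemma uLinf_mult:
  assumes "uLinf I u" "uLinf I v" shows "uLinf I (\<lambda>t x. u t x * v t x)"
proof -
  obtain A B where A: "\<And>t. t \<in> I \<Longrightarrow> u t \<in> borel_measurable borel" "\<And>t x. t \<in> I \<Longrightarrow> norm (u t x) \<le> A"
    and B: "\<And>t. t \<in> I \<Longrightarrow> v t \<in> borel_measurable borel" "\<And>t x. t \<in> I \<Longrightarrow> norm (v t x) \<le> B"
    using assms unfolding uLinf_def by blast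
  show ?thesis unfolding uLinf_def
  proof (intro exI[of _ "\<bar>A\<bar> * \<bar>B\<bar>"] ballI conjI allI)
    fix t x assume t: "t \<in> I"
    show "(\<lambda>x. u t x * v t x) \<in> borel_measurable borel" using A(1)[OF t] B(1)[OF t] by (rule borel_measurable_times)
    have "norm (u t x) \<le> \<bar>A\<bar>" "norm (v t x) \<le> \<bar>B\<bar>" using A(2)[OF t, of x] B(2)[OF t, of x] by linarith+
    then show "norm (u t x * v t x) \<le> \<bar>A\<bar> * \<bar>B\<bar>" unfolding norm_mult by (intro mult_mono) auto
  qed
qed

lemma uLinf_mono:
  assumes "uLinf I u" "\<And>t. t \<in> I \<Longrightarrow> v t \<in> borel_measurable borel" "\<And>t x. t \<in> I \<Longrightarrow> norm (v t x) \<le> norm (u t x)"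
  shows "uLinf I v"
  using assms unfolding uLinf_def by (meson order_trans)

lemma uLinf_const: "uLinf I (\<lambda>t x. c)"
  unfolding uLinf_def by (intro exI[of _ "norm c"]) auto

lemma uL2_cnj: "uL2 I u \<Longrightarrow> uL2 I (\<lambda>t x. cnj (u t x))"
  by (rule uL2_mono[of I u]) (auto simp: uL2_def intro: borel_measurable_cnj)

lemma uLinf_cnj: "uLinf I u \<Longrightarrow> uLinf I (\<lambda>t x. cnj (u t x))"
  by (rule uLinf_mono[of I u]) (auto simp: uLinf_def intro: borel_measurable_cnj)

lemma borel_measurable_complex_Re_Im:
  assumes [measurable]: "f \<in> borel_measurable borel"
  shows "(\<lambda>x. complex_of_real (Re (f x))) \<in> borel_measurable borel" "(\<lambda>x. complex_of_real (Im (f x))) \<in> borel_measurable borel"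
  by measurable

lemma uL2_Re: "uL2 I u \<Longrightarrow> uL2 I (\<lambda>t x. complex_of_real (Re (u t x)))"
  by (rule uL2_mono[of I u]) (auto simp: uL2_def abs_Re_le_cmod intro: borel_measurable_complex_Re_Im)

lemma uL2_Im: "uL2 I u \<Longrightarrow> uL2 I (\<lambda>t x. complex_of_real (Im (u t x)))"
  by (rule uL2_mono[of I u]) (auto simp: uL2_def abs_Im_le_cmod intro: borel_measurable_complex_Re_Im)

definition uH1 :: "'t set \<Rightarrow> ('t \<Rightarrow> real \<Rightarrow> complex) \<Rightarrow> ('t \<Rightarrow> real \<Rightarrow> complex) \<Rightarrow> bool" where
  "uH1 I u u' \<longleftrightarrow> (\<exists>A. \<forall>t\<in>I. H1_bound (u t) (u' t) A)"

lemma uH1_I: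
  assumes u: "uL2 I u" and u': "uL2 I u'"
    and d: "\<And>t x. t \<in> I \<Longrightarrow> (u t has_vector_derivative u' t x) (at x)"
    and c: "\<And>t. t \<in> I \<Longrightarrow> continuous_on UNIV (u' t)"
  shows "uH1 I u u'"
proof -
  obtain A B where A: "A \<ge> 0" "\<And>t. t \<in> I \<Longrightarrow> sq_nn (u t) \<le> ennreal A"
    and B: "B \<ge> 0" "\<And>t. t \<in> I \<Longrightarrow> sq_nn (u' t) \<le> ennreal B"
    using u u' unfolding uL2_def by blast
  have "sq_nn (u t) \<le> ennreal (max A B)" "sq_nn (u' t) \<le> ennreal (max A B)" if "t \<in> I" for t
    by (rule order_trans[OF A(2)[OF that]], simp add: ennreal_leI) (rule order_trans[OF B(2)[OF that]], simp add: ennreal_leI)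
  then show ?thesis unfolding uH1_def H1_bound_def using d c A(1)
    by (intro exI[of _ "max A B"]) auto
qed

text \<open>The Sobolev embedding \<open>L2_C1_facts\<close> with the constant independent of time;
  2 A is the sum of the two squared norms.\<close>

lemma uH1_uLinf:
  assumes "uH1 I u u'" shows "uLinf I u"
proof -
  obtain A where A: "\<And>t. t \<in> I \<Longrightarrow> H1_bound (u t) (u' t) A" using assms unfolding uH1_def by blast
  show ?thesis unfolding uLinf_def
  proof (intro exI[of _ "sqrt (2 * A)"] ballI conjI allI)
    fix t x assume t: "t \<in> I"
    note H = A[OF t]
    show "u t \<in> borel_measurable borel" by (rule borel_measurable_continuous_onI[OF H1_bound_cont(1)[OF H]])
    have A0: "A \<ge> 0" using H by (simp add: H1_bound_def)
    have s: "square_integrable (u t)" "square_integrable (u' t)" using H1_bound_cont_L2[OF H] by (auto simp: cont_L2_def)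
    have "(LINT x|lborel. (norm (u t x))\<^sup>2) \<le> A" "(LINT x|lborel. (norm (u' t x))\<^sup>2) \<le> A"
      using H A0 unfolding H1_bound_def sq_nn_eq_LINT[OF s(1)] sq_nn_eq_LINT[OF s(2)] by (auto simp: ennreal_le_iff)
    moreover have "(norm (u t x))\<^sup>2 \<le> (LINT x|lborel. (norm (u t x))\<^sup>2) + (LINT x|lborel. (norm (u' t x))\<^sup>2)"
      by (rule L2_C1_facts(3)[OF H1_bound_cont_L2[OF H]]) (use H in \<open>simp add: H1_bound_def\<close>)
    ultimately have "(norm (u t x))\<^sup>2 \<le> 2 * A" by linarith
    then show "norm (u t x) \<le> sqrt (2 * A)" by (rule real_le_rsqrt)
  qed
qed

section \<open>From almost every time to every time\<close>

lemma AE_interval_approx: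
  assumes P: "AE t in lborel. t \<in> {0..T} \<longrightarrow> P t" and T: "T > 0" and t: "t \<in> {0..T}"
  obtains X :: "nat \<Rightarrow> real" where "\<And>n. X n \<in> {0..T}" "\<And>n. P (X n)" "X \<longlonglongrightarrow> t"
proof -
  obtain N where N: "N \<in> null_sets lborel" "\<And>t. t \<in> {0..T} \<Longrightarrow> t \<notin> N \<Longrightarrow> P t"
    using P by (auto elim!: AE_E3)
  have "\<exists>x. x \<in> {0..T} \<and> P x \<and> \<bar>x - t\<bar> \<le> 1 / real (Suc n)" for n
  proof -
    define a b where "a = max 0 (t - 1 / real (Suc n))" and "b = min T (t + 1 / real (Suc n))"
    define p where "p = 1 / real (Suc n)"
    have p: "p > 0" by (simp add: p_def)
    have ab: "a < b" using t T p unfolding a_def b_def p_def[symmetric] by auto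
    \<comment> \<open>Clipping the neighbourhood of \<open>t\<close> to the time interval leaves
      positive length even at the end points, so it is not contained in a null set.\<close>
    have "\<not> {a..b} \<subseteq> N"
    proof
      assume "{a..b} \<subseteq> N"
      then have "emeasure lborel {a..b} \<le> emeasure lborel N" using N(1) by (intro emeasure_mono) auto
      then have "ennreal (b - a) = 0" using N(1) ab by auto
      then show False using ab by simp
    qed
    then obtain x where x: "x \<in> {a..b}" "x \<notin> N" by blast
    then have "x \<in> {0..T}" "\<bar>x - t\<bar> \<le> 1 / real (Suc n)" unfolding a_def b_def by auto
    then show ?thesis using N(2) x by blast
  qed
  then obtain X where X: "\<And>n. X n \<in> {0..T}" "\<And>n. P (X n)" "\<And>n. \<bar>X n - t\<bar> \<le> 1 / real (Suc n)" by metis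
  have "(\<lambda>n. X n - t) \<longlonglongrightarrow> 0"
    by (rule Lim_null_comparison[OF _ LIMSEQ_Suc[OF lim_1_over_n]]) (use X(3) in auto)
  then have "X \<longlonglongrightarrow> t" by (simp add: LIM_zero_iff)
  then show ?thesis by (rule that[OF X(1,2)])
qed

text \<open>The Sobolev bound holds only for almost every time; by Fatou the bounds on the derivatives
  extend to all times.\<close>

lemma Linf_sobolev_uL2:
  assumes T: "T > 0" and H: "Linf_sobolev T 2 u"
    and eq: "\<And>t x. t \<in> {0..T} \<Longrightarrow> u t x = u0 t x"
    and d1: "\<And>t x. t \<in> {0..T} \<Longrightarrow> (u0 t has_vector_derivative u1 t x) (at x)"
    and d2: "\<And>t x. t \<in> {0..T} \<Longrightarrow> (u1 t has_vector_derivative u2 t x) (at x)"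
    and c2: "\<And>t. t \<in> {0..T} \<Longrightarrow> continuous_on UNIV (u2 t)"
    and t: "\<And>x. continuous_on {0..T} (\<lambda>t. u0 t x)" "\<And>x. continuous_on {0..T} (\<lambda>t. u1 t x)" "\<And>x. continuous_on {0..T} (\<lambda>t. u2 t x)"
  shows "uL2 {0..T} u0" "uL2 {0..T} u1" "uL2 {0..T} u2"
proof -
  obtain C where C: "AE t in lborel. t \<in> {0..T} \<longrightarrow> u t \<in> sobolev_space 2 \<and> sobolev_norm 2 (u t) \<le> C"
    using H unfolding Linf_sobolev_def by blast
  have c: "continuous_on UNIV (u0 t)" "continuous_on UNIV (u1 t)" if "t \<in> {0..T}" for t
    using d1[OF that] d2[OF that] by (auto intro!: continuous_at_imp_continuous_on intro: has_vector_derivative_continuous)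
  have m: "u0 t \<in> borel_measurable borel" "u1 t \<in> borel_measurable borel" "u2 t \<in> borel_measurable borel" if "t \<in> {0..T}" for t
    using c[OF that] c2[OF that] by (auto intro: borel_measurable_continuous_onI)
  have good: "sq_nn (u0 t) \<le> ennreal (C\<^sup>2) \<and> sq_nn (u1 t) \<le> ennreal (C\<^sup>2) \<and> sq_nn (u2 t) \<le> ennreal (C\<^sup>2)"
    if tI: "t \<in> {0..T}" and "u t \<in> sobolev_space 2 \<and> sobolev_norm 2 (u t) \<le> C" for t
  proof -
    have "u t = u0 t" using eq[OF tI] by auto
    then show ?thesis using sobolev_2_bounds[of "u0 t" C "u1 t" "u2 t"] that d1[OF tI] d2[OF tI] by auto
  qed
  have "sq_nn (u0 t) \<le> ennreal (C\<^sup>2) \<and> sq_nn (u1 t) \<le> ennreal (C\<^sup>2) \<and> sq_nn (u2 t) \<le> ennreal (C\<^sup>2)" if tI: "t \<in> {0..T}" for t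
  proof -
    obtain X where X: "\<And>n. X n \<in> {0..T}" "\<And>n. u (X n) \<in> sobolev_space 2 \<and> sobolev_norm 2 (u (X n)) \<le> C" "X \<longlonglongrightarrow> t"
      using AE_interval_approx[OF C T tI] by blast
    note g = good[OF X(1) X(2)]
    have lim: "(\<lambda>n. v (X n) x) \<longlonglongrightarrow> v t x" if "continuous_on {0..T} (\<lambda>t. v t x)" for v :: "real \<Rightarrow> real \<Rightarrow> complex" and x
      using continuous_on_tendsto_compose[OF that X(3) tI] X(1) by auto
    have "sq_nn (u0 t) \<le> ennreal (C\<^sup>2)"
      by (rule sq_nn_fatou[of "\<lambda>n. u0 (X n)"]) (use g m X(1) lim[where v=u0, OF t(1)] in auto)
    moreover have "sq_nn (u1 t) \<le> ennreal (C\<^sup>2)"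
      by (rule sq_nn_fatou[of "\<lambda>n. u1 (X n)"]) (use g m X(1) lim[where v=u1, OF t(2)] in auto)
    moreover have "sq_nn (u2 t) \<le> ennreal (C\<^sup>2)"
      by (rule sq_nn_fatou[of "\<lambda>n. u2 (X n)"]) (use g m X(1) lim[where v=u2, OF t(3)] in auto)
    ultimately show ?thesis by blast
  qed
  then show "uL2 {0..T} u0" "uL2 {0..T} u1" "uL2 {0..T} u2"
    unfolding uL2_def using m by (meson zero_le_power2)+
qed

section \<open>The coefficients of the system\<close>

text \<open>Constants cancel in the paired kernel; this is how H 1 = 0 enters, and it allows
  functions that tend to 1 at infinity.\<close>

lemma hil_kernel_add_const:
  "hil_kernel (\<lambda>x. v x + c) = hil_kernel v"
  by (intro ext) (simp add: hil_kernel_def)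

lemma hilbert_H1:
  assumes v: "H1_bound v v' A"
  shows "hilbert (\<lambda>x. v x + c) \<alpha> = 1 / (\<i> * complex_of_real pi) * hil v \<alpha>"
proof -
  have "hilbert (\<lambda>x. v x + c) \<alpha> = 1 / (\<i> * complex_of_real pi) * hil (\<lambda>x. v x + c) \<alpha>"
  proof (rule hilbert_eq_hil)
    show "continuous_on UNIV (\<lambda>x. v x + c)" by (intro continuous_intros H1_bound_cont(1)[OF v])
    show "integrable lborel (\<lambda>y. indicator {0<..} y *\<^sub>R hil_kernel (\<lambda>x. v x + c) \<alpha> y)"
      unfolding hil_kernel_add_const by (rule hil_kernel_integrable(1)[OF v])
  qed
  then show ?thesis by (simp add: hil_def hil_kernel_add_const)
qed

lemma H1_bound_cnj:
  assumes v: "H1_bound v v' A" shows "H1_bound (\<lambda>x. cnj (v x)) (\<lambda>x. cnj (v' x)) A"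
proof -
  have "sq_nn (\<lambda>x. cnj (w x)) = sq_nn w" for w by (simp add: sq_nn_def)
  moreover have "((\<lambda>x. cnj (v x)) has_vector_derivative cnj (v' x)) (at x)" for x
    using v by (intro bounded_linear.has_vector_derivative[OF bounded_linear_cnj]) (simp add: H1_bound_def)
  moreover have "continuous_on UNIV (\<lambda>x. cnj (v' x))" using v by (intro continuous_intros) (simp add: H1_bound_def)
  ultimately show ?thesis using v by (simp add: H1_bound_def)
qed

lemma hil_cnj: "hil (\<lambda>x. cnj (v x)) \<alpha> = cnj (hil v \<alpha>)"
proof -
  have "indicator {0<..} y *\<^sub>R hil_kernel (\<lambda>x. cnj (v x)) \<alpha> y = cnj (indicator {0<..} y *\<^sub>R hil_kernel v \<alpha> y)" for y
    by (simp add: hil_kernel_def)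
  then show ?thesis unfolding hil_def by (simp only: Bochner_Integration.integral_cnj)
qed

lemma hil_add:
  assumes "H1_bound v v' A" "H1_bound w w' B"
  shows "hil (\<lambda>x. v x + w x) \<alpha> = hil v \<alpha> + hil w \<alpha>"
proof -
  have "indicator {0<..} y *\<^sub>R hil_kernel (\<lambda>x. v x + w x) \<alpha> y = indicator {0<..} y *\<^sub>R hil_kernel v \<alpha> y + indicator {0<..} y *\<^sub>R hil_kernel w \<alpha> y" for y
    by (simp add: hil_kernel_def scaleR_add_right[symmetric] add_divide_distrib[symmetric])
  then show ?thesis unfolding hil_def
    using hil_kernel_integrable(1)[OF assms(1), of \<alpha>] hil_kernel_integrable(1)[OF assms(2), of \<alpha>]
    by (simp only: Bochner_Integration.integral_add)
qed

text \<open>With \<open>p = 1 / Z'\<close>, \<open>b\<close> is the Hilbert transform of \<open>V = |p|\<^sup>2 - 1\<close>, and \<open>H p' = p'\<close> because \<open>p - 1\<close> is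
  the boundary value of a holomorphic function that vanishes at infinity.\<close>

lemma muskat_coefficients:
  fixes Zt :: "real \<Rightarrow> complex"
  assumes p: "\<And>x. 1 / d_space Zt x = p x" and p1: "d_space (inv_Z' Zt) = p'"
    and hp: "H1_bound (\<lambda>x. p x - 1) p' A" and hp': "H1_bound p' p'' A"
    and hX: "H1_bound (\<lambda>x. cnj (p x) * p' x) (\<lambda>x. cnj (p' x) * p' x + cnj (p x) * p'' x) A"
    and hV: "H1_bound (\<lambda>x. p x * cnj (p x) - 1) (\<lambda>x. cnj (p x) * p' x + cnj (cnj (p x) * p' x)) A"
    and hV': "H1_bound (\<lambda>x. cnj (p x) * p' x + cnj (cnj (p x) * p' x)) V'' A"
    and L: "continuous_on lower L" "L holomorphic_on P_minus" "\<And>x. exp (- L (complex_of_real x)) = p x"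
    and Linf: "\<And>e. e > 0 \<Longrightarrow> \<exists>c. \<forall>z\<in>lower. norm z \<ge> c \<longrightarrow> norm (L z) \<le> e"
  shows "muskat_b Zt \<alpha> = complex_of_real (- Re (hil (\<lambda>x. p x * cnj (p x) - 1) \<alpha>) / pi)"
    and "muskat_B1 Zt \<alpha> = - 2 * Im (cnj (p \<alpha>) * p' \<alpha>) - 2 / pi * Re (hil (\<lambda>x. cnj (p x) * p' x) \<alpha>)"
    and "((\<lambda>x. - Re (hil (\<lambda>x. p x * cnj (p x) - 1) x) / pi) has_vector_derivative
          muskat_B1 Zt \<alpha> + 2 * Im (cnj (p \<alpha>) * p' \<alpha>)) (at \<alpha>)"
proof -
  define V where "V = (\<lambda>x. p x * cnj (p x) - 1)"
  define X where "X = (\<lambda>x. cnj (p x) * p' x)"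
  have hp0: "hil (\<lambda>x. p x - 1) x = \<i> * pi * (p x - 1)" for x
  proof -
    \<comment> \<open>The holomorphic extension of p - 1. Writing it through the logarithm gives
      continuity up to the boundary and decay at infinity together.\<close>
    define Q where "Q z = exp (- L z) - 1" for z
    have Qp: "(\<lambda>x. Q (complex_of_real x)) = (\<lambda>x. p x - 1)" by (simp add: Q_def L(3))
    have "hil (\<lambda>x. Q (complex_of_real x)) x = \<i> * pi * Q (complex_of_real x)"
    proof (rule hil_boundary_value)
      show "continuous_on lower Q" unfolding Q_def by (intro continuous_intros L)
      show "Q holomorphic_on P_minus" unfolding Q_def by (intro holomorphic_intros L)
      show "integrable lborel (\<lambda>y. indicator {0<..} y *\<^sub>R hil_kernel (\<lambda>x. Q (complex_of_real x)) x y)"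
        unfolding Qp by (rule hil_kernel_integrable(1)[OF hp])
      fix e :: real assume e: "e > 0"
      have "isCont (\<lambda>w :: complex. exp (- w) - 1) 0" by (intro continuous_intros)
      then obtain d where d: "d > 0" "\<And>w :: complex. dist w 0 < d \<Longrightarrow> dist (exp (- w) - 1) (exp (- 0) - 1) < e"
        using e unfolding continuous_at_eps_delta by metis
      obtain c where c: "\<And>z. z \<in> lower \<Longrightarrow> norm z \<ge> c \<Longrightarrow> norm (L z) \<le> d / 2" using Linf[of "d/2"] d(1) by auto
      have "norm (Q z) \<le> e" if "z \<in> lower" "norm z \<ge> c" for z
        using d(2)[of "L z"] c[OF that] d(1) by (simp add: Q_def)
      then show "\<exists>c. \<forall>z\<in>lower. norm z \<ge> c \<longrightarrow> norm (Q z) \<le> e" by blast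
    qed
    then show ?thesis unfolding Qp using fun_cong[OF Qp, of x] by simp
  qed
  \<comment> \<open>Obtained by differentiating the relation for p - 1, since the Hilbert integral
    commutes with differentiation under H1 bounds.\<close>
  have hilp': "hil p' x = \<i> * pi * p' x" for x
  proof -
    have "hil (\<lambda>x. p x - 1) = (\<lambda>x. \<i> * pi * (p x - 1))" using hp0 by auto
    then have "((\<lambda>x. \<i> * pi * (p x - 1)) has_vector_derivative hil p' x) (at x)"
      using hil_has_vector_derivative[OF hp hp', of x] by simp
    moreover have "((\<lambda>x. \<i> * pi * (p x - 1)) has_vector_derivative \<i> * pi * p' x) (at x)"
      using hp by (intro has_vector_derivative_mult_right) (simp add: H1_bound_def)
    ultimately show ?thesis by (rule vector_derivative_unique_at)
  qed
  have Hp': "hilbert p' x = p' x" for x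
    using hilbert_H1[OF hp', of 0 x] by (simp add: hilp')
  have HX: "hilbert X x = 1 / (\<i> * complex_of_real pi) * hil X x" for x
    using hilbert_H1[OF hX, of 0 x] by (simp add: X_def)
  have cp: "1 / cnj (d_space Zt x) = cnj (p x)" for x unfolding p[symmetric] by simp
  \<comment> \<open>Because p' is fixed by the Hilbert transform, the commutator reduces to X - H
    X.\<close>
  have "commutator (mult_op (\<lambda>\<beta>. 1 / cnj (d_space Zt \<beta>))) hilbert p' \<alpha> = X \<alpha> - hilbert X \<alpha>"
    unfolding commutator_def mult_op_def cp Hp' by (simp add: X_def)
  then have "muskat_B1 Zt \<alpha> = - 2 * Im (X \<alpha> - 1 / (\<i> * complex_of_real pi) * hil X \<alpha>)"
    unfolding muskat_B1_def p1 HX by simp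
  also have "1 / (\<i> * complex_of_real pi) * hil X \<alpha> = - \<i> * hil X \<alpha> / complex_of_real pi"
    by (simp add: field_simps)
  finally have B1: "muskat_B1 Zt \<alpha> = - 2 * Im (X \<alpha>) - 2 / pi * Re (hil X \<alpha>)"
    by (simp add: Im_divide_of_real algebra_simps)
  then show "muskat_B1 Zt \<alpha> = - 2 * Im (cnj (p \<alpha>) * p' \<alpha>) - 2 / pi * Re (hil (\<lambda>x. cnj (p x) * p' x) \<alpha>)"
    by (simp add: X_def)
  \<comment> \<open>V is real and the paired integral has a real kernel, so \<open>b\<close> is
    real.\<close>
  have Vreal: "cnj (hil V x) = hil V x" for x
    unfolding hil_cnj[symmetric] by (simp add: V_def mult.commute)
  have eV: "(\<lambda>\<beta>. complex_of_real (1 / (norm (d_space Zt \<beta>))\<^sup>2)) = (\<lambda>x. V x + 1)"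
  proof
    fix x
    have "1 / (norm (d_space Zt x))\<^sup>2 = (norm (p x))\<^sup>2" unfolding p[symmetric] by (simp add: norm_divide power_divide)
    then show "complex_of_real (1 / (norm (d_space Zt x))\<^sup>2) = V x + 1"
      unfolding V_def by (simp only: complex_norm_square diff_add_cancel)
  qed
  have "muskat_b Zt \<alpha> = - \<i> * (1 / (\<i> * complex_of_real pi) * hil V \<alpha>)"
    unfolding muskat_b_def eV using hilbert_H1[OF hV, of 1 \<alpha>] by (simp add: V_def)
  also have "\<dots> = - (hil V \<alpha> / complex_of_real pi)" by (simp add: field_simps)
  also have "hil V \<alpha> = complex_of_real (Re (hil V \<alpha>))"
    using Vreal[of \<alpha>] by (simp add: complex_eq_iff)
  finally show "muskat_b Zt \<alpha> = complex_of_real (- Re (hil (\<lambda>x. p x * cnj (p x) - 1) \<alpha>) / pi)"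
    unfolding V_def by simp
  have hXc: "H1_bound (\<lambda>x. cnj (cnj (p x) * p' x)) (\<lambda>x. cnj (cnj (p' x) * p' x + cnj (p x) * p'' x)) A"
    by (rule H1_bound_cnj[OF hX])
  have "hil (\<lambda>x. cnj (p x) * p' x + cnj (cnj (p x) * p' x)) \<alpha> = hil X \<alpha> + cnj (hil X \<alpha>)"
    using hil_add[OF hX hXc, of \<alpha>] hil_cnj[of "\<lambda>x. cnj (p x) * p' x" \<alpha>] by (simp add: X_def)
  then have "(hil V has_vector_derivative hil X \<alpha> + cnj (hil X \<alpha>)) (at \<alpha>)"
    using hil_has_vector_derivative[OF hV hV', of \<alpha>] by (simp add: V_def)
  then have "((\<lambda>x. Re (hil V x)) has_vector_derivative Re (hil X \<alpha> + cnj (hil X \<alpha>))) (at \<alpha>)"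
    by (rule bounded_linear.has_vector_derivative[OF bounded_linear_Re])
  from has_vector_derivative_divide[OF has_vector_derivative_minus[OF this], of pi]
  have "((\<lambda>x. - Re (hil V x) / pi) has_vector_derivative - (2 * Re (hil X \<alpha>)) / pi) (at \<alpha>)" by simp
  \<comment> \<open>Since V' = X + cnj X, the derivative of \<open>b\<close> is -2 / pi times Re
    (hil X), which is the nonlocal part of B1; the local part of B1 is what remains.\<close>
  moreover have "- (2 * Re (hil X \<alpha>)) / pi = muskat_B1 Zt \<alpha> + 2 * Im (cnj (p \<alpha>) * p' \<alpha>)"
    unfolding B1 by (simp add: X_def)
  ultimately show "((\<lambda>x. - Re (hil (\<lambda>x. p x * cnj (p x) - 1) x) / pi) has_vector_derivative
          muskat_B1 Zt \<alpha> + 2 * Im (cnj (p \<alpha>) * p' \<alpha>)) (at \<alpha>)"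
    unfolding V_def by simp
qed

lemma has_vector_derivative_inverse_cx:
  fixes f :: "real \<Rightarrow> complex"
  assumes f: "(f has_vector_derivative f') (at x within S)" and nz: "f x \<noteq> 0"
  shows "((\<lambda>x. 1 / f x) has_vector_derivative - (f' / (f x)\<^sup>2)) (at x within S)"
proof -
  have "(inverse has_field_derivative - ((inverse (f x))\<^sup>2)) (at (f x) within f ` S)"
    using has_field_derivative_at_within[OF DERIV_inverse[OF nz]] by (simp add: numeral_2_eq_2)
  from field_vector_diff_chain_within[OF f this] show ?thesis
    by (simp add: o_def divide_inverse power_inverse)
qed

lemma H1_bound_mono: "H1_bound v v' C \<Longrightarrow> C \<le> D \<Longrightarrow> H1_bound v v' D"
  unfolding H1_bound_def by (auto intro: order_trans[OF _ ennreal_leI])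

section \<open>The conservation law and the energy identity\<close>

text \<open>The family \<open>D\<close> is a witness of smoothness. Fixing it turns the derivatives
  into functions with joint continuity, in place of choices made by the derivative
  operators.\<close>

locale muskat_strip =
  fixes T :: real and Z :: "real \<Rightarrow> real \<Rightarrow> complex" and \<Psi> :: "real \<Rightarrow> complex \<Rightarrow> complex"
    and D :: "nat \<Rightarrow> nat \<Rightarrow> real \<Rightarrow> real \<Rightarrow> complex"
  assumes T: "T > 0"
    and D00: "\<And>t \<alpha>. t \<in> {0..T} \<Longrightarrow> D 0 0 t \<alpha> = Z t \<alpha>"
    and Dcont: "\<And>j k. continuous_on ({0..T} \<times> UNIV) (\<lambda>(t, \<alpha>). D j k t \<alpha>)"
    and Dtime: "\<And>j k t \<alpha>. t \<in> {0..T} \<Longrightarrow> ((\<lambda>\<tau>. D j k \<tau> \<alpha>) has_vector_derivative D (Suc j) k t \<alpha>) (at t within {0..T})"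
    and Dspace: "\<And>j k t \<alpha>. t \<in> {0..T} \<Longrightarrow> (D j k t has_vector_derivative D j (Suc k) t \<alpha>) (at \<alpha>)"
    and sol: "muskat_solution T Z \<Psi>"
    and reg: "Linf_sobolev T 2 (\<lambda>t \<alpha>. d_space (Z t) \<alpha> - 1)" "Linf_sobolev T 2 (\<lambda>t \<alpha>. 1 / d_space (Z t) \<alpha> - 1)"
begin

section \<open>Z', its reciprocal and their bounds uniform in time\<close>

abbreviation "I \<equiv> {0..T}"
definition "\<zeta> = D 0 1"
definition "\<zeta>1 = D 0 2"
definition "\<zeta>2 = D 0 3"
definition "\<zeta>t = D 1 1"
definition "p t x = 1 / \<zeta> t x"
definition "p1 t x = - (\<zeta>1 t x / (\<zeta> t x)\<^sup>2)"
definition "p2 t x = - (\<zeta>2 t x / (\<zeta> t x)\<^sup>2) + 2 * (\<zeta>1 t x)\<^sup>2 / (\<zeta> t x)^3"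
definition "w t x = \<zeta>1 t x / \<zeta> t x"

lemma cont_slice:
  assumes "continuous_on (I \<times> UNIV) (\<lambda>(t, x). u t x)"
  shows "t \<in> I \<Longrightarrow> continuous_on UNIV (u t)" "continuous_on I (\<lambda>t. u t x)"
proof -
  assume t: "t \<in> I"
  have "continuous_on UNIV (\<lambda>x. (\<lambda>(t, x). u t x) (t, x))"
    by (rule continuous_on_compose2[OF assms]) (use t in \<open>auto intro!: continuous_intros\<close>)
  then show "continuous_on UNIV (u t)" by simp
next
  have "continuous_on I (\<lambda>t. (\<lambda>(t, x). u t x) (t, x))"
    by (rule continuous_on_compose2[OF assms]) (auto intro!: continuous_intros)
  then show "continuous_on I (\<lambda>t. u t x)" by simp
qed

lemma joint_cont:
  "continuous_on (I \<times> UNIV) (\<lambda>(t, x). \<zeta> t x)" "continuous_on (I \<times> UNIV) (\<lambda>(t, x). \<zeta>1 t x)"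
  "continuous_on (I \<times> UNIV) (\<lambda>(t, x). \<zeta>2 t x)" "continuous_on (I \<times> UNIV) (\<lambda>(t, x). \<zeta>t t x)"
  unfolding \<zeta>_def \<zeta>1_def \<zeta>2_def \<zeta>t_def by (rule Dcont)+

lemma d_space_Z: assumes t: "t \<in> I" shows "d_space (Z t) = \<zeta> t"
proof
  fix x
  have "Z t = D 0 0 t" using D00[OF t] by auto
  then show "d_space (Z t) x = \<zeta> t x"
    using vector_derivative_at[OF Dspace[OF t, of 0 0 x]] by (simp add: d_space_def \<zeta>_def)
qed

lemma \<zeta>_nz: "t \<in> I \<Longrightarrow> \<zeta> t x \<noteq> 0"
  using sol unfolding muskat_solution_def d_space_Z[symmetric] by blast

lemma \<zeta>_deriv:
  assumes t: "t \<in> I"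
  shows "(\<zeta> t has_vector_derivative \<zeta>1 t x) (at x)" "(\<zeta>1 t has_vector_derivative \<zeta>2 t x) (at x)"
    "((\<lambda>\<tau>. \<zeta> \<tau> x) has_vector_derivative \<zeta>t t x) (at t within I)"
  using Dspace[OF t, of 0 1 x] Dspace[OF t, of 0 2 x] Dtime[OF t, of 0 1 x]
  by (simp_all add: \<zeta>_def \<zeta>1_def \<zeta>2_def \<zeta>t_def numeral_2_eq_2 numeral_3_eq_3)

lemma p_deriv:
  assumes t: "t \<in> I"
  shows "(p t has_vector_derivative p1 t x) (at x)" "(p1 t has_vector_derivative p2 t x) (at x)"
proof -
  have d: "((\<lambda>x. 1 / \<zeta> t x) has_vector_derivative p1 t x) (at x)" for x
    unfolding p1_def by (rule has_vector_derivative_inverse_cx[OF \<zeta>_deriv(1)[OF t] \<zeta>_nz[OF t]])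
  then show "(p t has_vector_derivative p1 t x) (at x)" by (simp add: p_def[abs_def])
  have e: "p1 t = (\<lambda>x. - (\<zeta>1 t x * ((1 / \<zeta> t x) * (1 / \<zeta> t x))))" by (rule ext) (simp add: p1_def power2_eq_square)
  have "((\<lambda>x. - (\<zeta>1 t x * ((1 / \<zeta> t x) * (1 / \<zeta> t x)))) has_vector_derivative
     - (\<zeta>1 t x * ((1 / \<zeta> t x) * p1 t x + p1 t x * (1 / \<zeta> t x)) + \<zeta>2 t x * ((1 / \<zeta> t x) * (1 / \<zeta> t x)))) (at x)"
    by (intro has_vector_derivative_minus has_vector_derivative_mult d \<zeta>_deriv[OF t])
  moreover have "- (\<zeta>1 t x * ((1 / \<zeta> t x) * p1 t x + p1 t x * (1 / \<zeta> t x)) + \<zeta>2 t x * ((1 / \<zeta> t x) * (1 / \<zeta> t x))) = p2 t x"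
    using \<zeta>_nz[OF t, of x] by (simp add: p1_def p2_def field_simps power2_eq_square power3_eq_cube)
  ultimately show "(p1 t has_vector_derivative p2 t x) (at x)" unfolding e by simp
qed

lemma joint_cont_p:
  "continuous_on (I \<times> UNIV) (\<lambda>(t, x). p t x)" "continuous_on (I \<times> UNIV) (\<lambda>(t, x). p1 t x)"
  "continuous_on (I \<times> UNIV) (\<lambda>(t, x). p2 t x)" "continuous_on (I \<times> UNIV) (\<lambda>(t, x). w t x)"
proof -
  note j = joint_cont[unfolded case_prod_beta]
  have nz: "\<forall>z\<in>I \<times> UNIV. \<zeta> (fst z) (snd z) \<noteq> 0" "\<forall>z\<in>I \<times> UNIV. (\<zeta> (fst z) (snd z))\<^sup>2 \<noteq> 0" "\<forall>z\<in>I \<times> UNIV. (\<zeta> (fst z) (snd z))^3 \<noteq> 0"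
    using \<zeta>_nz by auto
  show "continuous_on (I \<times> UNIV) (\<lambda>(t, x). p t x)" "continuous_on (I \<times> UNIV) (\<lambda>(t, x). p1 t x)"
  "continuous_on (I \<times> UNIV) (\<lambda>(t, x). p2 t x)" "continuous_on (I \<times> UNIV) (\<lambda>(t, x). w t x)"
    unfolding case_prod_beta p_def p1_def p2_def w_def
    by (intro continuous_intros j nz)+
qed

lemma uL2_\<zeta>: "uL2 I (\<lambda>t x. \<zeta> t x - 1)" "uL2 I \<zeta>1" "uL2 I \<zeta>2"
proof -
  show "uL2 I (\<lambda>t x. \<zeta> t x - 1)" "uL2 I \<zeta>1" "uL2 I \<zeta>2"
  proof (rule_tac [!] Linf_sobolev_uL2[OF T reg(1), of "\<lambda>t x. \<zeta> t x - 1" \<zeta>1 \<zeta>2])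
  qed (auto simp: d_space_Z intro!: cont_slice[OF joint_cont(2)] cont_slice[OF joint_cont(3)] \<zeta>_deriv(2)
      continuous_on_diff cont_slice(2)[OF joint_cont(1)] has_vector_derivative_diff_const[THEN iffD2] \<zeta>_deriv(1))
qed

lemma uL2_p: "uL2 I (\<lambda>t x. p t x - 1)" "uL2 I p1" "uL2 I p2"
proof -
  show "uL2 I (\<lambda>t x. p t x - 1)" "uL2 I p1" "uL2 I p2"
  proof (rule_tac [!] Linf_sobolev_uL2[OF T reg(2), of "\<lambda>t x. p t x - 1" p1 p2])
  qed (auto simp: d_space_Z p_def[symmetric] intro!: cont_slice[OF joint_cont_p(2)] cont_slice[OF joint_cont_p(3)] p_deriv(2)
      continuous_on_diff cont_slice(2)[OF joint_cont_p(1)] has_vector_derivative_diff_const[THEN iffD2] p_deriv(1))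
qed

lemma uH1_basic: "uH1 I (\<lambda>t x. \<zeta> t x - 1) \<zeta>1" "uH1 I (\<lambda>t x. p t x - 1) p1" "uH1 I p1 p2"
  by (auto intro!: uH1_I uL2_\<zeta> uL2_p cont_slice[OF joint_cont(2)] cont_slice[OF joint_cont_p(2)] cont_slice[OF joint_cont_p(3)]
      has_vector_derivative_diff_const[THEN iffD2] \<zeta>_deriv(1) p_deriv)

lemma uLinf_basic: "uLinf I \<zeta>" "uLinf I p" "uLinf I p1"
proof -
  have "uLinf I (\<lambda>t x. (\<zeta> t x - 1) + 1)" by (intro uLinf_add uLinf_const uH1_uLinf[OF uH1_basic(1)])
  then show "uLinf I \<zeta>" by simp
  have "uLinf I (\<lambda>t x. (p t x - 1) + 1)" by (intro uLinf_add uLinf_const uH1_uLinf[OF uH1_basic(2)])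
  then show "uLinf I p" by simp
  show "uLinf I p1" by (rule uH1_uLinf[OF uH1_basic(3)])
qed

lemma uL2_w: "uL2 I w"
  by (rule uL2_cong[OF uL2_mult[OF uL2_\<zeta>(2) uLinf_basic(2)]]) (simp add: w_def p_def)

section \<open>The quadratic quantities |p|^2 - 1 and conj(p) p'\<close>

definition "X t x = cnj (p t x) * p1 t x"
definition "X1 t x = cnj (p1 t x) * p1 t x + cnj (p t x) * p2 t x"
definition "V t x = p t x * cnj (p t x) - 1"

lemma cont_X:
  assumes t: "t \<in> I" shows "continuous_on UNIV (X t)" "continuous_on UNIV (X1 t)"
  unfolding X_def[abs_def] X1_def[abs_def]
  by (intro continuous_intros cont_slice(1)[OF joint_cont_p(1) t] cont_slice(1)[OF joint_cont_p(2) t] cont_slice(1)[OF joint_cont_p(3) t])+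

lemma X_deriv:
  assumes t: "t \<in> I"
  shows "(X t has_vector_derivative X1 t x) (at x)" "(V t has_vector_derivative X t x + cnj (X t x)) (at x)"
proof -
  have c: "((\<lambda>x. cnj (p t x)) has_vector_derivative cnj (p1 t x)) (at x)" for x
    by (rule bounded_linear.has_vector_derivative[OF bounded_linear_cnj p_deriv(1)[OF t]])
  show "(X t has_vector_derivative X1 t x) (at x)"
    unfolding X_def[abs_def] X1_def using has_vector_derivative_mult[OF c p_deriv(2)[OF t], of x] by (simp add: add.commute)
  have "((\<lambda>x. p t x * cnj (p t x)) has_vector_derivative p t x * cnj (p1 t x) + p1 t x * cnj (p t x)) (at x)"
    by (rule has_vector_derivative_mult[OF p_deriv(1)[OF t] c])
  then show "(V t has_vector_derivative X t x + cnj (X t x)) (at x)"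
    unfolding V_def[abs_def] X_def by (simp add: has_vector_derivative_diff_const ac_simps)
qed

lemma uH1_X: "uH1 I X X1" "uH1 I V (\<lambda>t x. X t x + cnj (X t x))" "uH1 I (\<lambda>t x. X t x + cnj (X t x)) (\<lambda>t x. X1 t x + cnj (X1 t x))"
proof -
  have X: "uL2 I X" by (rule uL2_cong[OF uL2_mult[OF uL2_p(2) uLinf_cnj[OF uLinf_basic(2)]]]) (simp add: X_def)
  have X1: "uL2 I X1"
    by (rule uL2_cong[OF uL2_add[OF uL2_mult[OF uL2_p(2) uLinf_cnj[OF uLinf_basic(3)]] uL2_mult[OF uL2_p(3) uLinf_cnj[OF uLinf_basic(2)]]]]) (simp add: X1_def)
  \<comment> \<open>Decomposed as (p - 1) times the conjugate of p, plus the conjugate of p - 1: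
    each term has a square-integrable factor.\<close>
  have V: "uL2 I V"
    by (rule uL2_cong[OF uL2_add[OF uL2_mult[OF uL2_p(1) uLinf_cnj[OF uLinf_basic(2)]] uL2_cnj[OF uL2_p(1)]]]) (simp add: V_def algebra_simps)
  show "uH1 I X X1" by (rule uH1_I[OF X X1 X_deriv(1) cont_X(2)])
  show "uH1 I V (\<lambda>t x. X t x + cnj (X t x))"
    by (rule uH1_I[OF V uL2_add[OF X uL2_cnj[OF X]] X_deriv(2)]) (auto intro!: continuous_intros cont_X)
  show "uH1 I (\<lambda>t x. X t x + cnj (X t x)) (\<lambda>t x. X1 t x + cnj (X1 t x))"
    by (rule uH1_I[OF uL2_add[OF X uL2_cnj[OF X]] uL2_add[OF X1 uL2_cnj[OF X1]]])
      (auto intro!: has_vector_derivative_add bounded_linear.has_vector_derivative[OF bounded_linear_cnj] X_deriv(1) continuous_intros cont_X)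
qed

text \<open>The five bounds are merged into one constant because \<open>muskat_coefficients\<close>
  takes a single one.\<close>

lemma all_H1_bounds:
  "\<exists>A. \<forall>t\<in>I. H1_bound (\<lambda>x. p t x - 1) (p1 t) A \<and> H1_bound (p1 t) (p2 t) A \<and> H1_bound (X t) (X1 t) A \<and>
    H1_bound (V t) (\<lambda>x. X t x + cnj (X t x)) A \<and> H1_bound (\<lambda>x. X t x + cnj (X t x)) (\<lambda>x. X1 t x + cnj (X1 t x)) A"
proof -
  obtain A1 A2 A3 A4 A5 where A: "\<forall>t\<in>I. H1_bound (\<lambda>x. p t x - 1) (p1 t) A1" "\<forall>t\<in>I. H1_bound (p1 t) (p2 t) A2"
    "\<forall>t\<in>I. H1_bound (X t) (X1 t) A3" "\<forall>t\<in>I. H1_bound (V t) (\<lambda>x. X t x + cnj (X t x)) A4"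
    "\<forall>t\<in>I. H1_bound (\<lambda>x. X t x + cnj (X t x)) (\<lambda>x. X1 t x + cnj (X1 t x)) A5"
    using uH1_basic(2,3) uH1_X unfolding uH1_def by blast
  define M where "M = max A1 (max A2 (max A3 (max A4 A5)))"
  have M: "A1 \<le> M" "A2 \<le> M" "A3 \<le> M" "A4 \<le> M" "A5 \<le> M" unfolding M_def by auto
  show ?thesis
    by (intro exI[of _ M] ballI conjI H1_bound_mono[OF bspec[OF A(1)] M(1)] H1_bound_mono[OF bspec[OF A(2)] M(2)]
        H1_bound_mono[OF bspec[OF A(3)] M(3)] H1_bound_mono[OF bspec[OF A(4)] M(4)] H1_bound_mono[OF bspec[OF A(5)] M(5)])
qed

section \<open>The logarithm of Z' at a fixed time\<close>

lemma log_exists: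
  assumes t: "t \<in> I"
  shows "\<exists>L. continuous_on lower L \<and> L holomorphic_on P_minus \<and> (\<forall>\<alpha>. exp (L (complex_of_real \<alpha>)) = \<zeta> t \<alpha>) \<and>
    (\<forall>e>0. \<exists>c. \<forall>z\<in>lower. norm z \<ge> c \<longrightarrow> norm (L z) \<le> e) \<and>
    (\<forall>\<alpha>. boundary_log (deriv (\<Psi> t)) \<alpha> = L (complex_of_real \<alpha>))"
proof -
  have s: "\<Psi> t holomorphic_on P_minus" "\<And>z. z \<in> P_minus \<Longrightarrow> deriv (\<Psi> t) z = poisson_extension (d_space (Z t)) z"
    "((\<lambda>c. SUP z\<in>{z \<in> P_minus. norm z \<ge> c}. ennreal (norm (deriv (\<Psi> t) z - 1))) \<longlongrightarrow> 0) at_top"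
    "\<And>z. z \<in> P_minus \<Longrightarrow> deriv (\<Psi> t) z \<noteq> 0"
    using sol t unfolding muskat_solution_def by blast+
  have hol: "deriv (\<Psi> t) holomorphic_on P_minus" by (rule holomorphic_deriv[OF s(1) P_minus_facts(1)])
  have c: "continuous_on UNIV (\<zeta> t)" by (rule cont_slice(1)[OF joint_cont(1) t])
  obtain M where M: "\<And>x. norm (\<zeta> t x) \<le> M" using uLinf_basic(1) t unfolding uLinf_def by blast
  \<comment> \<open>The boundary values of the derivative come from its Poisson representation,
    using that Z' is continuous and bounded.\<close>
  have lim: "(deriv (\<Psi> t) \<longlongrightarrow> \<zeta> t \<alpha>) (at (complex_of_real \<alpha>) within P_minus)" for \<alpha>
    by (rule Lim_transform_eventually[OF poisson_extension_tendsto[OF c M]])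
      (auto simp: eventually_at_filter s(2) d_space_Z[OF t])
  have inf: "\<exists>c. \<forall>z\<in>P_minus. norm z \<ge> c \<longrightarrow> norm (deriv (\<Psi> t) z - 1) \<le> e" if e: "e > 0" for e
  proof -
    have "\<forall>\<^sub>F c in at_top. (SUP z\<in>{z \<in> P_minus. norm z \<ge> c}. ennreal (norm (deriv (\<Psi> t) z - 1))) < ennreal e"
      by (rule order_tendstoD(2)[OF s(3)]) (use e in simp)
    then obtain c where c: "(SUP z\<in>{z \<in> P_minus. norm z \<ge> c}. ennreal (norm (deriv (\<Psi> t) z - 1))) < ennreal e"
      using eventually_happens by fastforce
    have "norm (deriv (\<Psi> t) z - 1) \<le> e" if z: "z \<in> P_minus" "norm z \<ge> c" for z
    proof -
      have "ennreal (norm (deriv (\<Psi> t) z - 1)) \<le> (SUP z\<in>{z \<in> P_minus. norm z \<ge> c}. ennreal (norm (deriv (\<Psi> t) z - 1)))"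
        by (rule SUP_upper) (use z in simp)
      then have "ennreal (norm (deriv (\<Psi> t) z - 1)) \<le> ennreal e" using c by (meson le_less_trans less_imp_le)
      then show ?thesis using e by (simp add: ennreal_le_iff)
    qed
    then show ?thesis by blast
  qed
  show ?thesis
    by (rule log_extension[OF hol s(4) c \<zeta>_nz[OF t] lim inf]) blast+
qed

text \<open>Chosen anew at every time; nothing is known yet about its dependence on time, which is
  settled only in \<open>g_time\<close>.\<close>

definition "Lz t = (SOME L. continuous_on lower L \<and> L holomorphic_on P_minus \<and> (\<forall>\<alpha>. exp (L (complex_of_real \<alpha>)) = \<zeta> t \<alpha>) \<and>
    (\<forall>e>0. \<exists>c. \<forall>z\<in>lower. norm z \<ge> c \<longrightarrow> norm (L z) \<le> e) \<and>
    (\<forall>\<alpha>. boundary_log (deriv (\<Psi> t)) \<alpha> = L (complex_of_real \<alpha>)))"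
definition "L t x = Lz t (complex_of_real x)"
definition "g t x = Im (boundary_log (deriv (\<Psi> t)) x)"

lemma Lz_facts:
  assumes t: "t \<in> I"
  shows "continuous_on lower (Lz t)" "Lz t holomorphic_on P_minus" "exp (L t x) = \<zeta> t x"
    "\<And>e. e > 0 \<Longrightarrow> \<exists>c. \<forall>z\<in>lower. norm z \<ge> c \<longrightarrow> norm (Lz t z) \<le> e" "g t x = Im (L t x)"
  using someI_ex[OF log_exists[OF t], folded Lz_def] by (auto simp: L_def g_def)

lemma cont_L: assumes t: "t \<in> I" shows "continuous_on UNIV (L t)"
  unfolding L_def[abs_def] by (rule continuous_on_compose2[OF Lz_facts(1)[OF t]]) (auto simp: lower_def intro!: continuous_intros)

text \<open>While L(y) stays within pi of L(x), the difference is the principal logarithm of the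
  quotient of the values of Z', and that can be differentiated.\<close>

lemma L_deriv:
  assumes t: "t \<in> I" shows "(L t has_vector_derivative w t x) (at x)"
proof -
  define S where "S = {y. norm (L t y - L t x) < pi}"
  have oS: "open S" unfolding S_def by (intro open_Collect_less continuous_intros cont_L[OF t])
  have xS: "x \<in> S" by (simp add: S_def)
  have eq: "L t x + Ln (\<zeta> t y / \<zeta> t x) = L t y" if y: "y \<in> S" for y
  proof -
    have "\<zeta> t y / \<zeta> t x = exp (L t y - L t x)" by (simp add: exp_diff Lz_facts(3)[OF t])
    moreover have "\<bar>Im (L t y - L t x)\<bar> < pi" using y abs_Im_le_cmod[of "L t y - L t x"] by (simp add: S_def)
    ultimately show ?thesis by (simp add: abs_less_iff)
  qed
  have 1: "((\<lambda>y. \<zeta> t y / \<zeta> t x) has_vector_derivative \<zeta>1 t x / \<zeta> t x) (at x)"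
    by (rule has_vector_derivative_divide[OF \<zeta>_deriv(1)[OF t]])
  have nz: "\<zeta> t x \<noteq> 0" by (rule \<zeta>_nz[OF t])
  have 2: "(Ln has_field_derivative inverse (\<zeta> t x / \<zeta> t x)) (at (\<zeta> t x / \<zeta> t x))"
    by (rule has_field_derivative_Ln) (use nz in \<open>simp add: complex_nonpos_Reals_iff\<close>)
  have "((\<lambda>y. Ln (\<zeta> t y / \<zeta> t x)) has_vector_derivative w t x) (at x)"
    using field_vector_diff_chain_at[OF 1 2] nz by (simp add: o_def w_def)
  then have "((\<lambda>y. L t x + Ln (\<zeta> t y / \<zeta> t x)) has_vector_derivative 0 + w t x) (at x)"
    by (intro has_vector_derivative_add has_vector_derivative_const)
  then have "(L t has_vector_derivative 0 + w t x) (at x)"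
    by (rule has_vector_derivative_transform_within_open[OF _ oS xS eq])
  then show ?thesis by simp
qed

lemma cont_w: "t \<in> I \<Longrightarrow> continuous_on UNIV (w t)"
  by (rule cont_slice(1)[OF joint_cont_p(4)])

lemma cont_L2_w: assumes t: "t \<in> I" shows "cont_L2 (w t)"
proof -
  obtain A where A: "w t \<in> borel_measurable borel" "sq_nn (w t) \<le> ennreal A"
    using uL2_w t unfolding uL2_def by blast
  show ?thesis using le_less_trans[OF A(2) ennreal_less_top] A(1) cont_w[OF t]
    by (simp add: cont_L2_def square_integrable_iff)
qed

text \<open>Near infinity L is small, hence comparable to Z' - 1, which is square integrable; on the
  remaining compact interval continuity suffices.\<close>

lemma cont_L2_L: assumes t: "t \<in> I" shows "cont_L2 (L t)"
proof -
  have m[measurable]: "L t \<in> borel_measurable borel" by (rule borel_measurable_continuous_onI[OF cont_L[OF t]])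
  obtain A where A: "sq_nn (\<lambda>x. \<zeta> t x - 1) \<le> ennreal A" and zm[measurable]: "(\<lambda>x. \<zeta> t x - 1) \<in> borel_measurable borel"
    using uL2_\<zeta>(1) t unfolding uL2_def by blast
  have "isCont (\<lambda>z :: complex. exp z - 1) 0" by (intro continuous_intros)
  then obtain d where d: "d > 0" "\<And>z :: complex. dist z 0 < d \<Longrightarrow> dist (exp z - 1) (exp 0 - 1) < 1/2"
    unfolding continuous_at_eps_delta by (metis half_gt_zero_iff zero_less_one)
  \<comment> \<open>The bound \<open>d / 2\<close> keeps |Z' - 1| below 1/2, where |Ln(1 + z)| \<le>
    2 |z|; the bound 1 < pi makes L the principal logarithm of Z'.\<close>
  define e where "e = min (d / 2) 1"
  have e: "e > 0" using d(1) by (simp add: e_def)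
  obtain c where c: "\<And>z. z \<in> lower \<Longrightarrow> norm z \<ge> c \<Longrightarrow> norm (Lz t z) \<le> e" using Lz_facts(4)[OF t e] by blast
  have far: "norm (L t x) \<le> 2 * norm (\<zeta> t x - 1)" if x: "\<bar>x\<bar> \<ge> c" for x
  proof -
    have l: "norm (L t x) \<le> e" using c[of "complex_of_real x"] x by (simp add: L_def lower_def)
    then have "norm (\<zeta> t x - 1) < 1/2" using d(2)[of "L t x"] d(1) by (simp add: e_def Lz_facts(3)[OF t])
    then have n: "norm (Ln (1 + (\<zeta> t x - 1))) \<le> 2 * norm (\<zeta> t x - 1)" by (rule norm_Ln_le)
    have "\<bar>Im (L t x)\<bar> \<le> 1" using l abs_Im_le_cmod[of "L t x"] by (simp add: e_def)
    then have "- pi < Im (L t x)" "Im (L t x) \<le> pi" using pi_gt3 by linarith+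
    then have "Ln (exp (L t x)) = L t x" by (rule Ln_exp)
    then show ?thesis using n by (simp add: Lz_facts(3)[OF t])
  qed
  have "bounded (L t ` {-\<bar>c\<bar>..\<bar>c\<bar>})"
    by (intro compact_imp_bounded compact_continuous_image continuous_on_subset[OF cont_L[OF t]]) auto
  then obtain M where M: "\<And>x. x \<in> {-\<bar>c\<bar>..\<bar>c\<bar>} \<Longrightarrow> norm (L t x) \<le> M" unfolding bounded_iff by blast
  have le: "(norm (L t x))\<^sup>2 \<le> 4 * (norm (\<zeta> t x - 1))\<^sup>2 + M\<^sup>2 * indicator {-\<bar>c\<bar>..\<bar>c\<bar>} x" for x
  proof (cases "\<bar>x\<bar> \<le> \<bar>c\<bar>")
    case True
    then have "(norm (L t x))\<^sup>2 \<le> M\<^sup>2" by (intro power_mono M) auto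
    then show ?thesis using True by (auto simp: indicator_def intro: order_trans)
  next
    case False
    then have "(norm (L t x))\<^sup>2 \<le> (2 * norm (\<zeta> t x - 1))\<^sup>2" by (intro power_mono far) auto
    moreover have "x \<notin> {-\<bar>c\<bar>..\<bar>c\<bar>}" using False by auto
    ultimately show ?thesis by (simp add: power_mult_distrib)
  qed
  have "sq_nn (L t) \<le> (\<integral>\<^sup>+x. ennreal 4 * ennreal ((norm (\<zeta> t x - 1))\<^sup>2) + ennreal (M\<^sup>2) * indicator {-\<bar>c\<bar>..\<bar>c\<bar>} x \<partial>lborel)"
    unfolding sq_nn_def
  proof (rule nn_integral_mono)
    fix x
    have "ennreal ((norm (L t x))\<^sup>2) \<le> ennreal (4 * (norm (\<zeta> t x - 1))\<^sup>2 + M\<^sup>2 * indicator {-\<bar>c\<bar>..\<bar>c\<bar>} x)"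
      by (rule ennreal_leI[OF le])
    also have "\<dots> = ennreal 4 * ennreal ((norm (\<zeta> t x - 1))\<^sup>2) + ennreal (M\<^sup>2) * indicator {-\<bar>c\<bar>..\<bar>c\<bar>} x"
      by (subst ennreal_plus) (auto simp: ennreal_mult indicator_def)
    finally show "ennreal ((norm (L t x))\<^sup>2) \<le> ennreal 4 * ennreal ((norm (\<zeta> t x - 1))\<^sup>2) + ennreal (M\<^sup>2) * indicator {-\<bar>c\<bar>..\<bar>c\<bar>} x" .
  qed
  also have "\<dots> = ennreal 4 * sq_nn (\<lambda>x. \<zeta> t x - 1) + ennreal (M\<^sup>2) * emeasure lborel {-\<bar>c\<bar>..\<bar>c\<bar>}"
    unfolding sq_nn_def by (subst nn_integral_add) (auto simp: nn_integral_cmult)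
  also have "\<dots> < \<infinity>" using le_less_trans[OF A ennreal_less_top] by (simp add: ennreal_mult_less_top)
  finally show ?thesis using cont_L[OF t] by (simp add: cont_L2_def square_integrable_iff)
qed

lemma Hdot_identity:
  assumes t: "t \<in> I"
  shows "square_integrable (half_weighted (\<lambda>\<alpha>. complex_of_real (g t \<alpha>)))"
    "(Hdot_half_norm (\<lambda>\<alpha>. complex_of_real (g t \<alpha>)))\<^sup>2 = (LINT x|lborel. g t x * Re (w t x))"
proof -
  have lim: "((\<lambda>R. truncated_fourier R (L t) \<xi>) \<longlongrightarrow> 0) at_top" if "\<xi> > 0" for \<xi>
    using truncated_fourier_boundary_value[OF Lz_facts(1,2)[OF t] Lz_facts(4)[OF t] that] by (simp add: L_def[abs_def])
  note H = Hdot_half_norm_Im[OF cont_L2_L[OF t] cont_L2_w[OF t] L_deriv[OF t] lim]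
  show "square_integrable (half_weighted (\<lambda>\<alpha>. complex_of_real (g t \<alpha>)))"
    using H(1) by (simp add: Lz_facts(5)[OF t])
  show "(Hdot_half_norm (\<lambda>\<alpha>. complex_of_real (g t \<alpha>)))\<^sup>2 = (LINT x|lborel. g t x * Re (w t x))"
    using H(2) by (simp add: Lz_facts(5)[OF t])
qed

lemma g_facts:
  assumes t: "t \<in> I"
  shows "continuous_on UNIV (g t)" "square_integrable (\<lambda>x. complex_of_real (g t x))"
    "(g t has_vector_derivative Im (w t x)) (at x)"
proof -
  have e: "g t = (\<lambda>x. Im (L t x))" using Lz_facts(5)[OF t] by auto
  show "continuous_on UNIV (g t)" unfolding e by (intro continuous_intros cont_L[OF t])
  have "square_integrable (L t)" using cont_L2_L[OF t] by (simp add: cont_L2_def)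
  then have i: "integrable lborel (\<lambda>x. (norm (L t x))\<^sup>2)" and [measurable]: "L t \<in> borel_measurable borel"
    by (auto simp: square_integrable_def)
  have "(Im (L t x))\<^sup>2 \<le> (norm (L t x))\<^sup>2" for x by (simp add: cmod_power2)
  then show "square_integrable (\<lambda>x. complex_of_real (g t x))"
    unfolding square_integrable_def e
    by (intro conjI Bochner_Integration.integrable_bound[OF i]) auto
  show "(g t has_vector_derivative Im (w t x)) (at x)"
    unfolding e by (rule bounded_linear.has_vector_derivative[OF bounded_linear_Im L_deriv[OF t]])
qed

section \<open>The coefficients and the equation for log Z'\<close>

definition "\<beta> t x = - Re (hil (V t) x) / pi"
definition "B1 t x = muskat_B1 (Z t) x"

lemma inv_Z'_eq: "t \<in> I \<Longrightarrow> inv_Z' (Z t) = p t"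
  by (rule ext) (simp add: inv_Z'_def p_def d_space_Z)

lemma d_space_inv_Z': assumes t: "t \<in> I" shows "d_space (inv_Z' (Z t)) = p1 t"
  unfolding inv_Z'_eq[OF t] d_space_def by (intro ext vector_derivative_at p_deriv(1)[OF t])

lemma coeffs:
  assumes t: "t \<in> I"
  shows "muskat_b (Z t) x = complex_of_real (\<beta> t x)"
    "B1 t x = - 2 * Im (X t x) - 2 / pi * Re (hil (X t) x)"
    "(\<beta> t has_vector_derivative B1 t x + 2 * Im (X t x)) (at x)"
proof -
  obtain A where "\<forall>t\<in>I. H1_bound (\<lambda>x. p t x - 1) (p1 t) A \<and> H1_bound (p1 t) (p2 t) A \<and> H1_bound (X t) (X1 t) A \<and>
    H1_bound (V t) (\<lambda>x. X t x + cnj (X t x)) A \<and> H1_bound (\<lambda>x. X t x + cnj (X t x)) (\<lambda>x. X1 t x + cnj (X1 t x)) A"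
    using all_H1_bounds by (rule exE)
  from bspec[OF this t] have A: "H1_bound (\<lambda>x. p t x - 1) (p1 t) A" "H1_bound (p1 t) (p2 t) A"
    "H1_bound (X t) (X1 t) A" "H1_bound (V t) (\<lambda>x. X t x + cnj (X t x)) A"
    "H1_bound (\<lambda>x. X t x + cnj (X t x)) (\<lambda>x. X1 t x + cnj (X1 t x)) A" by blast+
  have p: "1 / d_space (Z t) x = p t x" for x by (simp add: p_def d_space_Z[OF t])
  have e: "exp (- Lz t (complex_of_real x)) = p t x" for x
    using Lz_facts(3)[OF t, of x] by (simp add: L_def exp_minus p_def inverse_eq_divide)
  note M = muskat_coefficients[OF p d_space_inv_Z'[OF t] A(1,2) A(3)[unfolded X_def[abs_def] X1_def[abs_def]]
      A(4)[unfolded X_def[abs_def] V_def[abs_def]] A(5)[unfolded X_def[abs_def]] Lz_facts(1,2)[OF t] e Lz_facts(4)[OF t], of x,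
      folded X_def V_def]
  show "muskat_b (Z t) x = complex_of_real (\<beta> t x)" using M(1) by (simp add: \<beta>_def)
  show "B1 t x = - 2 * Im (X t x) - 2 / pi * Re (hil (X t) x)" using M(2) by (simp add: B1_def)
  show "(\<beta> t has_vector_derivative B1 t x + 2 * Im (X t x)) (at x)" using M(3) by (simp add: B1_def \<beta>_def[abs_def])
qed

text \<open>From p' = - p w it follows that X = - |p|^2 w; this links the derivative of
  \<open>b\<close> to the terms of the evolution equation.\<close>

lemma X_eq: "t \<in> I \<Longrightarrow> Im (X t x) = - ((norm (p t x))\<^sup>2 * Im (w t x))"
proof -
  assume t: "t \<in> I"
  have "p1 t x = - p t x * w t x" using \<zeta>_nz[OF t, of x] by (simp add: p1_def p_def w_def power2_eq_square)
  then have "X t x = - (complex_of_real ((norm (p t x))\<^sup>2) * w t x)"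
    unfolding X_def complex_norm_square by (simp add: mult_ac)
  then show ?thesis by simp
qed

text \<open>Multiplying the equation for 1 / Z' by - Z' turns it into an equation for the time
  derivative of log Z'; as b, B1 and |p|^2 are real, its real and imaginary parts separate.\<close>

lemma pde:
  assumes t: "t \<in> I"
  shows "Re (\<zeta>t t x / \<zeta> t x) = - \<beta> t x * Re (w t x) + (norm (p t x))\<^sup>2 * Im (w t x) - B1 t x"
    "Im (\<zeta>t t x / \<zeta> t x) = - \<beta> t x * Im (w t x) - (norm (p t x))\<^sup>2 * Re (w t x)"
proof -
  have nz: "\<zeta> t x \<noteq> 0" by (rule \<zeta>_nz[OF t])
  have "((\<lambda>\<tau>. 1 / \<zeta> \<tau> x) has_vector_derivative - (\<zeta>t t x / (\<zeta> t x)\<^sup>2)) (at t within I)"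
    by (rule has_vector_derivative_inverse_cx[OF \<zeta>_deriv(3)[OF t] nz])
  then have "((\<lambda>\<tau>. inv_Z' (Z \<tau>) x) has_vector_derivative - (\<zeta>t t x / (\<zeta> t x)\<^sup>2)) (at t within I)"
    by (rule has_vector_derivative_transform[OF t, rotated]) (simp add: inv_Z'_eq p_def)
  then have dt: "d_time T (\<lambda>\<tau>. inv_Z' (Z \<tau>) x) t = - (\<zeta>t t x / (\<zeta> t x)\<^sup>2)"
    unfolding d_time_def by (intro vector_derivative_within_closed_interval[OF T t])
  have "d_time T (\<lambda>\<tau>. inv_Z' (Z \<tau>) x) t + muskat_b (Z t) x * d_space (inv_Z' (Z t)) x =
          - \<i> / complex_of_real ((norm (d_space (Z t) x))\<^sup>2) * d_space (inv_Z' (Z t)) x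
          + complex_of_real (muskat_B1 (Z t) x) / d_space (Z t) x"
    using sol t unfolding muskat_solution_def by blast
  then have E: "- (\<zeta>t t x / (\<zeta> t x)\<^sup>2) + complex_of_real (\<beta> t x) * p1 t x =
      - \<i> / complex_of_real ((norm (\<zeta> t x))\<^sup>2) * p1 t x + complex_of_real (B1 t x) / \<zeta> t x"
    unfolding dt coeffs(1)[OF t] d_space_inv_Z'[OF t] d_space_Z[OF t] B1_def .
  have n: "1 / complex_of_real ((norm (\<zeta> t x))\<^sup>2) = complex_of_real ((norm (p t x))\<^sup>2)"
    by (simp add: p_def norm_divide power_divide)
  have p1: "p1 t x = - (w t x / \<zeta> t x)" by (simp add: p1_def w_def power2_eq_square)
  have "\<zeta>t t x / \<zeta> t x = - \<zeta> t x * (- (\<zeta>t t x / (\<zeta> t x)\<^sup>2))" using nz by (simp add: power2_eq_square)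
  also have "- (\<zeta>t t x / (\<zeta> t x)\<^sup>2) = - complex_of_real (\<beta> t x) * p1 t x - \<i> * (1 / complex_of_real ((norm (\<zeta> t x))\<^sup>2)) * p1 t x + complex_of_real (B1 t x) / \<zeta> t x"
    using E by (simp add: algebra_simps)
  also have "- \<zeta> t x * (- complex_of_real (\<beta> t x) * p1 t x - \<i> * (1 / complex_of_real ((norm (\<zeta> t x))\<^sup>2)) * p1 t x + complex_of_real (B1 t x) / \<zeta> t x)
    = - complex_of_real (\<beta> t x) * w t x - \<i> * complex_of_real ((norm (p t x))\<^sup>2) * w t x - complex_of_real (B1 t x)"
    unfolding n p1 using nz by (simp add: algebra_simps)
  finally have F: "\<zeta>t t x / \<zeta> t x = - complex_of_real (\<beta> t x) * w t x - \<i> * complex_of_real ((norm (p t x))\<^sup>2) * w t x - complex_of_real (B1 t x)" .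
  show "Re (\<zeta>t t x / \<zeta> t x) = - \<beta> t x * Re (w t x) + (norm (p t x))\<^sup>2 * Im (w t x) - B1 t x"
    "Im (\<zeta>t t x / \<zeta> t x) = - \<beta> t x * Im (w t x) - (norm (p t x))\<^sup>2 * Re (w t x)"
    unfolding F by simp_all
qed

lemma cont_\<beta>: "t \<in> I \<Longrightarrow> continuous_on UNIV (\<beta> t)"
  using coeffs(3) by (auto intro!: continuous_at_imp_continuous_on intro: has_vector_derivative_continuous)

text \<open>Solving the evolution equation for B1 expresses it through functions already known to be
  continuous, which avoids a regularity statement for the Hilbert integral of X.\<close>

lemma cont_B1: assumes t: "t \<in> I" shows "continuous_on UNIV (B1 t)"
proof -
  have e: "B1 t = (\<lambda>x. - \<beta> t x * Re (w t x) + (norm (p t x))\<^sup>2 * Im (w t x) - Re (\<zeta>t t x / \<zeta> t x))"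
    using pde(1)[OF t] by (auto simp: fun_eq_iff)
  show ?thesis unfolding e
    by (intro continuous_intros cont_\<beta>[OF t] cont_w[OF t] cont_slice(1)[OF joint_cont_p(1) t] cont_slice(1)[OF joint_cont(1) t] cont_slice(1)[OF joint_cont(4) t])
      (use \<zeta>_nz[OF t] in auto)
qed

text \<open>The sup bound of the paired integral, 5 sqrt A, depends only on the H1 bounds of V and
  X, which are uniform in time.\<close>

lemma uLinf_coeffs: "uLinf I (\<lambda>t x. complex_of_real (\<beta> t x))" "uLinf I (\<lambda>t x. complex_of_real (B1 t x))"
proof -
  obtain A where A: "\<And>t. t \<in> I \<Longrightarrow> H1_bound (X t) (X1 t) A" "\<And>t. t \<in> I \<Longrightarrow> H1_bound (V t) (\<lambda>x. X t x + cnj (X t x)) A"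
    using all_H1_bounds by blast
  show "uLinf I (\<lambda>t x. complex_of_real (\<beta> t x))"
    unfolding uLinf_def
  proof (intro exI[of _ "5 * sqrt A / pi"] ballI conjI allI)
    fix t x assume t: "t \<in> I"
    show "(\<lambda>x. complex_of_real (\<beta> t x)) \<in> borel_measurable borel"
      by (intro borel_measurable_continuous_onI continuous_intros cont_\<beta>[OF t])
    have "\<bar>Re (hil (V t) x)\<bar> \<le> 5 * sqrt A"
      using hil_kernel_integrable(2)[OF A(2)[OF t], of x] abs_Re_le_cmod[of "hil (V t) x"] by linarith
    then show "norm (complex_of_real (\<beta> t x)) \<le> 5 * sqrt A / pi"
      unfolding \<beta>_def norm_of_real by (simp add: abs_divide divide_right_mono)
  qed
  obtain M where M: "\<And>t x. t \<in> I \<Longrightarrow> norm (X t x) \<le> M"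
    using uH1_uLinf[OF uH1_X(1)] unfolding uLinf_def by blast
  show "uLinf I (\<lambda>t x. complex_of_real (B1 t x))"
    unfolding uLinf_def
  proof (intro exI[of _ "2 * M + 2 / pi * (5 * sqrt A)"] ballI conjI allI)
    fix t x assume t: "t \<in> I"
    show "(\<lambda>x. complex_of_real (B1 t x)) \<in> borel_measurable borel"
      by (intro borel_measurable_continuous_onI continuous_intros cont_B1[OF t])
    have 1: "\<bar>Re (hil (X t) x)\<bar> \<le> 5 * sqrt A"
      using hil_kernel_integrable(2)[OF A(1)[OF t], of x] abs_Re_le_cmod[of "hil (X t) x"] by linarith
    have 2: "\<bar>Im (X t x)\<bar> \<le> M" using M[OF t, of x] abs_Im_le_cmod[of "X t x"] by linarith
    have "\<bar>2 / pi * Re (hil (X t) x)\<bar> \<le> 2 / pi * (5 * sqrt A)"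
      unfolding abs_mult using 1 by (intro mult_mono) auto
    then have "\<bar>B1 t x\<bar> \<le> 2 * M + 2 / pi * (5 * sqrt A)"
      unfolding coeffs(2)[OF t] using 2 by linarith
    then show "norm (complex_of_real (B1 t x)) \<le> 2 * M + 2 / pi * (5 * sqrt A)" by simp
  qed
qed

end

text \<open>A substitute for dominated convergence: the dominating product \<open>a n * c n\<close> has one factor that
  converges in L2 and one that is merely bounded there.  Clamping at \<open>K * a0\<^sup>2\<close> leaves an error \<open>C / (4 * K)\<close>.\<close>

lemma integral_convergence_L2_product:
  fixes h a c :: "nat \<Rightarrow> real \<Rightarrow> real" and h0 a0 c0 :: "real \<Rightarrow> real" and \<delta> :: "nat \<Rightarrow> real"
  assumes int: "\<And>n. integrable lborel (h n)" "integrable lborel h0"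
    and am[measurable]: "\<And>n. a n \<in> borel_measurable borel" "a0 \<in> borel_measurable borel"
    and cm[measurable]: "\<And>n. c n \<in> borel_measurable borel" "c0 \<in> borel_measurable borel"
    and le: "\<And>n x. \<bar>h n x\<bar> \<le> \<bar>a n x\<bar> * \<bar>c n x\<bar>" "\<And>x. \<bar>h0 x\<bar> \<le> \<bar>a0 x\<bar> * \<bar>c0 x\<bar>"
    and lim: "\<And>x. (\<lambda>n. h n x) \<longlonglongrightarrow> h0 x"
    and \<delta>: "\<And>n. (\<integral>\<^sup>+x. ennreal (\<bar>a n x - a0 x\<bar>\<^sup>2) \<partial>lborel) \<le> ennreal (\<delta> n)" "\<And>n. \<delta> n \<ge> 0" "\<delta> \<longlonglongrightarrow> 0"
    and C: "\<And>n. (\<integral>\<^sup>+x. ennreal (\<bar>c n x\<bar>\<^sup>2) \<partial>lborel) \<le> ennreal C" "(\<integral>\<^sup>+x. ennreal (\<bar>c0 x\<bar>\<^sup>2) \<partial>lborel) \<le> ennreal C" "C \<ge> 0"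
    and a0: "integrable lborel (\<lambda>x. (a0 x)\<^sup>2)"
  shows "(\<lambda>n. LINT x|lborel. h n x) \<longlonglongrightarrow> (LINT x|lborel. h0 x)"
proof (rule LIMSEQ_I)
  fix e :: real assume e: "e > 0"
  \<comment> \<open>Chosen so that the clamping error C / (4 K) is at most e / 4; adding 1 keeps K
    positive when C = 0.\<close>
  define K where "K = (C + 1) / e"
  have K: "K > 0" using C(3) e by (simp add: K_def)
  have CK: "C / (4 * K) \<le> e / 4"
  proof -
    have "C * e \<le> e * (C + 1)" using e by (simp add: algebra_simps)
    then show ?thesis using C(3) e by (simp add: K_def field_simps)
  qed
  have [measurable]: "h n \<in> borel_measurable borel" "h0 \<in> borel_measurable borel" for n using int by auto
  define cl where "cl b x = max (- (K * (a0 x)\<^sup>2)) (min (K * (a0 x)\<^sup>2) b)" for b x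
  have Ka: "K * (a0 x)\<^sup>2 \<ge> 0" for x using K by simp
  have clb: "\<bar>cl b x\<bar> \<le> K * (a0 x)\<^sup>2" for b x using Ka[of x] by (auto simp: cl_def)
  have ik: "integrable lborel (\<lambda>x. K * (a0 x)\<^sup>2)" using a0 by simp
  have icl: "integrable lborel (\<lambda>x. cl (u x) x)" if [measurable]: "u \<in> borel_measurable borel" for u
  proof (rule Bochner_Integration.integrable_bound[OF ik])
    show "(\<lambda>x. cl (u x) x) \<in> borel_measurable lborel" unfolding cl_def by measurable
    show "AE x in lborel. norm (cl (u x) x) \<le> norm (K * (a0 x)\<^sup>2)" using clb Ka by simp
  qed
  have R: "(\<lambda>n. LINT x|lborel. cl (h n x) x) \<longlonglongrightarrow> (LINT x|lborel. cl (h0 x) x)"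
  proof (rule integral_dominated_convergence[OF _ _ ik])
    have "(\<lambda>n. cl (h n x) x) \<longlonglongrightarrow> cl (h0 x) x" for x
      unfolding cl_def by (intro tendsto_max tendsto_min tendsto_const lim)
    then show "AE x in lborel. (\<lambda>n. cl (h n x) x) \<longlonglongrightarrow> cl (h0 x) x" by simp
    show "AE x in lborel. norm (cl (h n x) x) \<le> K * (a0 x)\<^sup>2" for n using clb by simp
  qed (use icl in auto)
  have young: "\<bar>a0 x\<bar> * \<bar>y\<bar> \<le> K * (a0 x)\<^sup>2 + \<bar>y\<bar>\<^sup>2 / (4 * K)" for x y
  proof -
    have "0 \<le> (sqrt K * \<bar>a0 x\<bar> - \<bar>y\<bar> / (2 * sqrt K))\<^sup>2" by simp
    also have "\<dots> = K * (a0 x)\<^sup>2 + \<bar>y\<bar>\<^sup>2 / (4 * K) - \<bar>a0 x\<bar> * \<bar>y\<bar>"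
      using K by (simp add: power2_diff power_mult_distrib power_divide)
    finally show ?thesis by simp
  qed
  have main: "norm ((LINT x|lborel. u x) - (LINT x|lborel. cl (u x) x)) \<le> sqrt (d * C) + C / (4 * K)"
    if iu: "integrable lborel u" and [measurable]: "b \<in> borel_measurable borel" "y \<in> borel_measurable borel"
      and ub: "\<And>x. \<bar>u x\<bar> \<le> \<bar>b x\<bar> * \<bar>y x\<bar>" and d: "(\<integral>\<^sup>+x. ennreal (\<bar>b x - a0 x\<bar>\<^sup>2) \<partial>lborel) \<le> ennreal d" "d \<ge> 0"
      and y: "(\<integral>\<^sup>+x. ennreal (\<bar>y x\<bar>\<^sup>2) \<partial>lborel) \<le> ennreal C" for u b y d
  proof -
    have [measurable]: "u \<in> borel_measurable borel" using iu by auto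
    have ic: "integrable lborel (\<lambda>x. cl (u x) x)" by (rule icl) measurable
    \<comment> \<open>Clamping removes only the excess of |u| over K a0^2. Young's inequality for
      |a0| |y| absorbs that level, leaving the L2-small difference b - a0 and the term of size 1 /
      (4 K).\<close>
    have pt: "\<bar>u x - cl (u x) x\<bar> \<le> \<bar>b x - a0 x\<bar> * \<bar>y x\<bar> + \<bar>y x\<bar>\<^sup>2 / (4 * K)" for x
    proof -
      have "\<bar>u x - cl (u x) x\<bar> \<le> max 0 (\<bar>u x\<bar> - K * (a0 x)\<^sup>2)" using Ka[of x] by (auto simp: cl_def)
      moreover have "\<bar>b x\<bar> * \<bar>y x\<bar> \<le> (\<bar>b x - a0 x\<bar> + \<bar>a0 x\<bar>) * \<bar>y x\<bar>" by (intro mult_right_mono) auto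
      moreover have "0 \<le> \<bar>b x - a0 x\<bar> * \<bar>y x\<bar>" "0 \<le> \<bar>y x\<bar>\<^sup>2 / (4 * K)" using K by simp_all
      ultimately show ?thesis using ub[of x] young[of x "y x"] unfolding distrib_right by linarith
    qed
    have "ennreal (norm ((LINT x|lborel. u x) - (LINT x|lborel. cl (u x) x))) = ennreal (norm (LINT x|lborel. u x - cl (u x) x))"
      using iu ic by simp
    also have "\<dots> \<le> ennreal (LINT x|lborel. norm (u x - cl (u x) x))" by (intro ennreal_leI integral_norm_bound)
    also have "\<dots> = (\<integral>\<^sup>+x. ennreal (norm (u x - cl (u x) x)) \<partial>lborel)"
      by (rule nn_integral_eq_integral[symmetric]) (use iu ic in auto)
    also have "\<dots> \<le> (\<integral>\<^sup>+x. ennreal (\<bar>b x - a0 x\<bar> * \<bar>y x\<bar>) + ennreal (1 / (4 * K)) * ennreal (\<bar>y x\<bar>\<^sup>2) \<partial>lborel)"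
    proof (rule nn_integral_mono)
      fix x
      have "ennreal (norm (u x - cl (u x) x)) \<le> ennreal (\<bar>b x - a0 x\<bar> * \<bar>y x\<bar> + 1 / (4 * K) * \<bar>y x\<bar>\<^sup>2)"
        using pt[of x] by (intro ennreal_leI) simp
      also have "\<dots> = ennreal (\<bar>b x - a0 x\<bar> * \<bar>y x\<bar>) + ennreal (1 / (4 * K) * \<bar>y x\<bar>\<^sup>2)"
        by (rule ennreal_plus) (use K in auto)
      also have "ennreal (1 / (4 * K) * \<bar>y x\<bar>\<^sup>2) = ennreal (1 / (4 * K)) * ennreal (\<bar>y x\<bar>\<^sup>2)"
        by (rule ennreal_mult) (use K in auto)
      finally show "ennreal (norm (u x - cl (u x) x)) \<le> ennreal (\<bar>b x - a0 x\<bar> * \<bar>y x\<bar>) + ennreal (1 / (4 * K)) * ennreal (\<bar>y x\<bar>\<^sup>2)" .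
    qed
    also have "\<dots> = (\<integral>\<^sup>+x. ennreal (\<bar>b x - a0 x\<bar> * \<bar>y x\<bar>) \<partial>lborel) + ennreal (1 / (4 * K)) * (\<integral>\<^sup>+x. ennreal (\<bar>y x\<bar>\<^sup>2) \<partial>lborel)"
      by (subst nn_integral_add) (auto simp: nn_integral_cmult)
    also have "\<dots> \<le> ennreal (sqrt (d * C)) + ennreal (1 / (4 * K)) * ennreal C"
      by (intro add_mono mult_left_mono y nn_Cauchy_Schwarz[OF _ _ _ _ d(1) y d(2) C(3)]) auto
    also have "\<dots> = ennreal (sqrt (d * C) + C / (4 * K))"
      using K C(3) d(2) by (simp add: ennreal_mult[symmetric] ennreal_plus[symmetric] del: ennreal_plus)
    finally show ?thesis using K C(3) d(2) by (subst (asm) ennreal_le_iff) auto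
  qed
  have "(\<lambda>n. sqrt (\<delta> n * C)) \<longlonglongrightarrow> sqrt (0 * C)" by (intro tendsto_intros \<delta>(3))
  then have s0: "(\<lambda>n. sqrt (\<delta> n * C)) \<longlonglongrightarrow> 0" by simp
  have "\<forall>\<^sub>F n in sequentially. sqrt (\<delta> n * C) < e / 8" by (rule order_tendstoD(2)[OF s0]) (use e in simp)
  moreover have "\<forall>\<^sub>F n in sequentially. dist (LINT x|lborel. cl (h n x) x) (LINT x|lborel. cl (h0 x) x) < e / 8"
    by (rule tendstoD[OF R]) (use e in simp)
  ultimately have "\<forall>\<^sub>F n in sequentially. norm ((LINT x|lborel. h n x) - (LINT x|lborel. h0 x)) < e"
  proof eventually_elim
    fix n assume n: "sqrt (\<delta> n * C) < e / 8" "dist (LINT x|lborel. cl (h n x) x) (LINT x|lborel. cl (h0 x) x) < e / 8"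
    have m1: "norm ((LINT x|lborel. h n x) - (LINT x|lborel. cl (h n x) x)) \<le> sqrt (\<delta> n * C) + C / (4 * K)"
      by (rule main[OF int(1) am(1) cm(1) le(1) \<delta>(1) \<delta>(2) C(1)])
    have m2: "norm ((LINT x|lborel. h0 x) - (LINT x|lborel. cl (h0 x) x)) \<le> sqrt (0 * C) + C / (4 * K)"
      by (rule main[OF int(2) am(2) cm(2) le(2) _ _ C(2)]) auto
    \<comment> \<open>Budget: e / 8 + e / 4 for the n-th function, e / 4 for the limit function,
      whose difference term is 0, and e / 8 for the clamped integrals.\<close>
    show "norm ((LINT x|lborel. h n x) - (LINT x|lborel. h0 x)) < e"
      using m1 m2 n CK e unfolding dist_real_def real_norm_def by (simp, linarith)
  qed
  then show "\<exists>no. \<forall>n\<ge>no. norm ((LINT x|lborel. h n x) - (LINT x|lborel. h0 x)) < e"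
    by (simp add: eventually_sequentially)
qed

section \<open>Integration in time: Cauchy-Schwarz and joint measurability\<close>

lemma integral_sq_le:
  fixes q :: "real \<Rightarrow> real"
  assumes c: "continuous_on {a..b} q" and ab: "a \<le> b"
  shows "ennreal ((integral {a..b} q)\<^sup>2) \<le> ennreal (b - a) * (\<integral>\<^sup>+\<tau>. ennreal (indicator {a..b} \<tau> * (q \<tau>)\<^sup>2) \<partial>lborel)"
proof -
  define k where "k \<tau> = indicator {a..b} \<tau> * q \<tau>" for \<tau>
  have ik: "integrable lborel k" unfolding k_def using borel_integrable_compact[OF _ c] by simp
  have [measurable]: "k \<in> borel_measurable borel" using ik by auto
  have ic: "integrable lborel (\<lambda>\<tau>. (k \<tau>)\<^sup>2)"
  proof -
    have "integrable lborel (\<lambda>\<tau>. indicator {a..b} \<tau> *\<^sub>R (q \<tau>)\<^sup>2)"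
      by (intro borel_integrable_compact continuous_intros c) auto
    moreover have "(k \<tau>)\<^sup>2 = indicator {a..b} \<tau> *\<^sub>R (q \<tau>)\<^sup>2" for \<tau> by (simp add: k_def indicator_def)
    ultimately show ?thesis by (simp only:)
  qed
  define S where "S = (LINT \<tau>|lborel. (k \<tau>)\<^sup>2)"
  have S: "(\<integral>\<^sup>+\<tau>. ennreal (\<bar>k \<tau>\<bar>\<^sup>2) \<partial>lborel) = ennreal S" "S \<ge> 0"
    unfolding S_def using ic by (simp_all add: nn_integral_eq_integral)
  have I: "integral {a..b} q = (LINT \<tau>|lborel. k \<tau>)"
    using set_borel_integral_eq_integral(2)[OF borel_integrable_atLeastAtMost'[OF c]]
    by (simp add: set_lebesgue_integral_def k_def)
  have one: "(\<integral>\<^sup>+\<tau>. ennreal ((indicator {a..b} \<tau>)\<^sup>2) \<partial>lborel) \<le> ennreal (b - a)"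
  proof -
    have "(\<integral>\<^sup>+\<tau>. ennreal ((indicator {a..b} \<tau>)\<^sup>2) \<partial>lborel) = (\<integral>\<^sup>+\<tau>. indicator {a..b} \<tau> \<partial>lborel)"
      by (intro nn_integral_cong) (auto simp: indicator_def)
    then show ?thesis using ab by simp
  qed
  have "ennreal \<bar>integral {a..b} q\<bar> \<le> ennreal (LINT \<tau>|lborel. \<bar>k \<tau>\<bar>)"
    unfolding I using integral_norm_bound[of lborel k] by (intro ennreal_leI) simp
  also have "\<dots> = (\<integral>\<^sup>+\<tau>. ennreal (\<bar>k \<tau>\<bar>) \<partial>lborel)"
    by (rule nn_integral_eq_integral[symmetric]) (use ik in auto)
  also have "\<dots> = (\<integral>\<^sup>+\<tau>. ennreal (indicator {a..b} \<tau> * \<bar>k \<tau>\<bar>) \<partial>lborel)"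
    by (intro nn_integral_cong) (simp add: k_def indicator_def)
  also have "\<dots> \<le> ennreal (sqrt ((b - a) * S))"
    by (rule nn_Cauchy_Schwarz[OF _ _ _ _ one]) (use S ab in auto)
  finally have "\<bar>integral {a..b} q\<bar> \<le> sqrt ((b - a) * S)" using ab S(2) by (subst (asm) ennreal_le_iff) auto
  then have "\<bar>integral {a..b} q\<bar>\<^sup>2 \<le> (sqrt ((b - a) * S))\<^sup>2" by (intro power_mono) auto
  then have "(integral {a..b} q)\<^sup>2 \<le> (b - a) * S" using ab S(2) by simp
  then have "ennreal ((integral {a..b} q)\<^sup>2) \<le> ennreal (b - a) * ennreal S"
    using ab S(2) by (simp add: ennreal_mult[symmetric] ennreal_leI)
  also have "ennreal S = (\<integral>\<^sup>+\<tau>. ennreal (indicator {a..b} \<tau> * (q \<tau>)\<^sup>2) \<partial>lborel)"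
    unfolding S(1)[symmetric] by (intro nn_integral_cong) (simp add: k_def indicator_def)
  finally show ?thesis .
qed

text \<open>Continuity is available only on the closed strip; the indicator extends the function to
  the plane in the form that Fubini's theorem requires.\<close>

lemma strip_measurable:
  fixes u :: "real \<Rightarrow> real \<Rightarrow> real"
  assumes c: "continuous_on ({0..T} \<times> UNIV) (\<lambda>(t, x). u t x)" and ab: "0 \<le> a" "b \<le> T"
  shows "(\<lambda>(t, x). indicator {a..b} t * u t x) \<in> borel_measurable (lborel \<Otimes>\<^sub>M lborel)"
proof -
  have "(\<lambda>z. indicator ({a..b} \<times> UNIV) z *\<^sub>R (case z of (t, x) \<Rightarrow> u t x)) \<in> borel_measurable (borel :: (real \<times> real) measure)"
  proof (rule borel_measurable_continuous_on_indicator)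
    show "{a..b} \<times> (UNIV :: real set) \<in> sets borel" by (intro borel_closed closed_Times) auto
    show "continuous_on ({a..b} \<times> UNIV) (\<lambda>(t, x). u t x)" by (rule continuous_on_subset[OF c]) (use ab in auto)
  qed
  then have "(\<lambda>z. indicator ({a..b} \<times> UNIV) z *\<^sub>R (case z of (t, x) \<Rightarrow> u t x)) \<in> borel_measurable (lborel \<Otimes>\<^sub>M lborel)"
    by (simp add: lborel_prod)
  moreover have "(\<lambda>z. indicator ({a..b} \<times> UNIV) z *\<^sub>R (case z of (t, x) \<Rightarrow> u t x)) = (\<lambda>(t, x). indicator {a..b} t * u t x)"
    by (auto simp: fun_eq_iff indicator_def)
  ultimately show ?thesis by simp
qed

context muskat_strip
begin

section \<open>Time dependence of g\<close>

definition "r t x = \<zeta>t t x / \<zeta> t x"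
text \<open>Formally the time derivative of g, as \<open>r\<close> is that of log Z';
  \<open>g_time_deriv\<close> makes this rigorous. Likewise \<open>\<kappa>\<close> is the rate of
  change of log |Z'|.\<close>

definition "q t x = Im (r t x)"
definition "\<kappa> t x = Re (r t x)"

lemma joint_cont_r:
  "continuous_on (I \<times> UNIV) (\<lambda>(t, x). r t x)" "continuous_on (I \<times> UNIV) (\<lambda>(t, x). q t x)" "continuous_on (I \<times> UNIV) (\<lambda>(t, x). \<kappa> t x)"
proof -
  note j = joint_cont[unfolded case_prod_beta]
  have nz: "\<forall>z\<in>I \<times> UNIV. \<zeta> (fst z) (snd z) \<noteq> 0" using \<zeta>_nz by auto
  show "continuous_on (I \<times> UNIV) (\<lambda>(t, x). r t x)" "continuous_on (I \<times> UNIV) (\<lambda>(t, x). q t x)" "continuous_on (I \<times> UNIV) (\<lambda>(t, x). \<kappa> t x)"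
    unfolding case_prod_beta q_def \<kappa>_def r_def by (intro continuous_intros j nz)+
qed

lemma slice_r:
  "continuous_on I (\<lambda>t. r t x)" "continuous_on I (\<lambda>t. q t x)"
  "t \<in> I \<Longrightarrow> continuous_on UNIV (\<lambda>x. q t x)" "t \<in> I \<Longrightarrow> continuous_on UNIV (\<lambda>x. \<kappa> t x)"
proof -
  show "continuous_on I (\<lambda>t. r t x)" by (rule cont_slice(2)[OF joint_cont_r(1)])
  then show "continuous_on I (\<lambda>t. q t x)" unfolding q_def by (intro continuous_intros)
  assume t: "t \<in> I"
  have "continuous_on UNIV (r t)" by (rule cont_slice(1)[OF joint_cont_r(1) t])
  then show "continuous_on UNIV (\<lambda>x. q t x)" "continuous_on UNIV (\<lambda>x. \<kappa> t x)" unfolding q_def \<kappa>_def by (intro continuous_intros; assumption)+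
qed

lemma uLinf_w: "uLinf I w"
proof -
  have "uH1 I \<zeta>1 \<zeta>2" by (rule uH1_I[OF uL2_\<zeta>(2,3) \<zeta>_deriv(2) cont_slice(1)[OF joint_cont(3)]])
  from uLinf_mult[OF uH1_uLinf[OF this] uLinf_basic(2)] show ?thesis
    by (rule uLinf_cong) (simp add: w_def p_def)
qed

lemma uLinf_Re: "uLinf J u \<Longrightarrow> uLinf J (\<lambda>t x. complex_of_real (Re (u t x)))"
  by (rule uLinf_mono[of J u]) (auto simp: uLinf_def abs_Re_le_cmod intro: borel_measurable_complex_Re_Im)

lemma uLinf_Im: "uLinf J u \<Longrightarrow> uLinf J (\<lambda>t x. complex_of_real (Im (u t x)))"
  by (rule uLinf_mono[of J u]) (auto simp: uLinf_def abs_Im_le_cmod intro: borel_measurable_complex_Re_Im)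

lemma uLinf_p2: "uLinf I (\<lambda>t x. complex_of_real ((norm (p t x))\<^sup>2))"
  by (rule uLinf_cong[OF uLinf_mult[OF uLinf_basic(2) uLinf_cnj[OF uLinf_basic(2)]]]) (simp only: complex_norm_square)

lemma uLinf_\<zeta>2: "uLinf I (\<lambda>t x. complex_of_real ((norm (\<zeta> t x))\<^sup>2))"
  by (rule uLinf_cong[OF uLinf_mult[OF uLinf_basic(1) uLinf_cnj[OF uLinf_basic(1)]]]) (simp only: complex_norm_square)

text \<open>By the evolution equation \<open>q\<close> contains no bare B1: every term carries a
  factor w, which is both square integrable and bounded. The L2 bound controls increments of g in
  the mean, the sup bound controls them pointwise.\<close>

lemma uL2_q: "uL2 I (\<lambda>t x. complex_of_real (q t x))" "uLinf I (\<lambda>t x. complex_of_real (q t x))"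
proof -
  have e: "complex_of_real (q t x) = complex_of_real (Im (w t x)) * ((-1) * complex_of_real (\<beta> t x)) + complex_of_real (Re (w t x)) * ((-1) * complex_of_real ((norm (p t x))\<^sup>2))"
    if "t \<in> I" for t x
  proof -
    have "q t x = Im (w t x) * ((-1) * \<beta> t x) + Re (w t x) * ((-1) * (norm (p t x))\<^sup>2)"
      unfolding q_def r_def pde(2)[OF that] by simp
    then show ?thesis by (simp only: of_real_mult of_real_add of_real_minus of_real_1)
  qed
  note a = uLinf_mult[OF uLinf_const[of I "-1"] uLinf_coeffs(1)] and b = uLinf_mult[OF uLinf_const[of I "-1"] uLinf_p2]
  show "uL2 I (\<lambda>t x. complex_of_real (q t x))"
    by (rule uL2_cong[OF uL2_add[OF uL2_mult[OF uL2_Im[OF uL2_w] a] uL2_mult[OF uL2_Re[OF uL2_w] b]] e])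
  show "uLinf I (\<lambda>t x. complex_of_real (q t x))"
    by (rule uLinf_cong[OF uLinf_add[OF uLinf_mult[OF uLinf_Im[OF uLinf_w] a] uLinf_mult[OF uLinf_Re[OF uLinf_w] b]] e])
qed

text \<open>Cauchy-Schwarz in time followed by Tonelli: one factor t - s comes from each, so the
  time integral of \<open>q\<close> is Lipschitz with values in L2.\<close>

lemma increment_sq_nn:
  obtains A where "A \<ge> 0" "\<And>s t. 0 \<le> s \<Longrightarrow> s \<le> t \<Longrightarrow> t \<le> T \<Longrightarrow>
      (\<integral>\<^sup>+x. ennreal ((integral {s..t} (\<lambda>\<tau>. q \<tau> x))\<^sup>2) \<partial>lborel) \<le> ennreal ((t - s)\<^sup>2 * A)"
proof -
  obtain A where A: "A \<ge> 0" "\<And>t. t \<in> I \<Longrightarrow> sq_nn (\<lambda>x. complex_of_real (q t x)) \<le> ennreal A"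
    using uL2_q(1) unfolding uL2_def by blast
  have "(\<integral>\<^sup>+x. ennreal ((integral {s..t} (\<lambda>\<tau>. q \<tau> x))\<^sup>2) \<partial>lborel) \<le> ennreal ((t - s)\<^sup>2 * A)"
    if st: "0 \<le> s" "s \<le> t" "t \<le> T" for s t
  proof -
    have "continuous_on (I \<times> UNIV) (\<lambda>(t, x). (q t x)\<^sup>2)"
      using joint_cont_r(2) unfolding case_prod_beta by (intro continuous_intros)
    note m = strip_measurable[OF this st(1,3)]
    have m': "(\<lambda>(\<tau>, x). ennreal (indicator {s..t} \<tau> * (q \<tau> x)\<^sup>2)) \<in> borel_measurable (lborel \<Otimes>\<^sub>M lborel)"
      using measurable_compose[OF m measurable_ennreal] by (simp add: case_prod_beta)
    have inner: "(\<integral>\<^sup>+x. ennreal (indicator {s..t} \<tau> * (q \<tau> x)\<^sup>2) \<partial>lborel) \<le> ennreal A * indicator {s..t} \<tau>" for \<tau>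
      using A(2)[of \<tau>] st by (cases "\<tau> \<in> {s..t}") (auto simp: sq_nn_def)
    have "(\<integral>\<^sup>+x. ennreal ((integral {s..t} (\<lambda>\<tau>. q \<tau> x))\<^sup>2) \<partial>lborel)
      \<le> (\<integral>\<^sup>+x. ennreal (t - s) * (\<integral>\<^sup>+\<tau>. ennreal (indicator {s..t} \<tau> * (q \<tau> x)\<^sup>2) \<partial>lborel) \<partial>lborel)"
      by (intro nn_integral_mono integral_sq_le continuous_on_subset[OF slice_r(2)]) (use st in auto)
    also have "\<dots> = ennreal (t - s) * (\<integral>\<^sup>+x. (\<integral>\<^sup>+\<tau>. ennreal (indicator {s..t} \<tau> * (q \<tau> x)\<^sup>2) \<partial>lborel) \<partial>lborel)"
      by (rule nn_integral_cmult) (use lborel.borel_measurable_nn_integral_fst[OF measurable_pair_swap[OF m']] in simp)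
    finally have le1: "(\<integral>\<^sup>+x. ennreal ((integral {s..t} (\<lambda>\<tau>. q \<tau> x))\<^sup>2) \<partial>lborel)
      \<le> ennreal (t - s) * (\<integral>\<^sup>+x. (\<integral>\<^sup>+\<tau>. ennreal (indicator {s..t} \<tau> * (q \<tau> x)\<^sup>2) \<partial>lborel) \<partial>lborel)" .
    have "(\<integral>\<^sup>+x. (\<integral>\<^sup>+\<tau>. ennreal (indicator {s..t} \<tau> * (q \<tau> x)\<^sup>2) \<partial>lborel) \<partial>lborel)
       = (\<integral>\<^sup>+\<tau>. (\<integral>\<^sup>+x. ennreal (indicator {s..t} \<tau> * (q \<tau> x)\<^sup>2) \<partial>lborel) \<partial>lborel)"
      using lborel_pair.Fubini[OF m'] by simp
    also have "\<dots> \<le> (\<integral>\<^sup>+\<tau>. ennreal A * indicator {s..t} \<tau> \<partial>lborel)" by (rule nn_integral_mono[OF inner])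
    also have "\<dots> = ennreal A * ennreal (t - s)" using st by (subst nn_integral_cmult_indicator) auto
    finally have le2: "(\<integral>\<^sup>+x. (\<integral>\<^sup>+\<tau>. ennreal (indicator {s..t} \<tau> * (q \<tau> x)\<^sup>2) \<partial>lborel) \<partial>lborel) \<le> ennreal A * ennreal (t - s)" .
    have "ennreal (t - s) * (ennreal A * ennreal (t - s)) = ennreal ((t - s)\<^sup>2 * A)"
      using st A(1) by (simp add: ennreal_mult[symmetric] power2_eq_square mult_ac)
    with order_trans[OF le1 mult_left_mono[OF le2]] show ?thesis by simp
  qed
  with A(1) show ?thesis by (rule that)
qed

text \<open>Integrating \<open>r\<close> in time from the logarithm at time 0 gives a second
  logarithm of Z'. At each time it differs from the chosen one by a constant in space, and the
  imaginary part of that constant is square integrable over the line, hence 0.\<close>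

lemma g_time:
  assumes t: "t \<in> I" shows "g t x = g 0 x + integral {0..t} (\<lambda>\<tau>. q \<tau> x)"
proof -
  have t0: "0 \<in> I" using T by simp
  define \<Lambda> where "\<Lambda> s x = L 0 x + integral {0..s} (\<lambda>\<tau>. r \<tau> x)" for s x
  have d\<Lambda>: "((\<lambda>s. \<Lambda> s x) has_vector_derivative r s x) (at s within I)" if s: "s \<in> I" for s x
    unfolding \<Lambda>_def using has_vector_derivative_add[OF has_vector_derivative_const integral_has_vector_derivative[OF slice_r(1) s]] by simp
  have e\<Lambda>: "exp (\<Lambda> s x) = \<zeta> s x" if s: "s \<in> I" for s x
  proof -
    \<comment> \<open>That the time integral is a logarithm is shown through \<zeta>
      exp(-\<Lambda>), whose time derivative vanishes, so no branch has to be followed in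
      time.\<close>
    have d: "((\<lambda>s. \<zeta> s x * exp (- \<Lambda> s x)) has_vector_derivative 0) (at s within I)" if s: "s \<in> I" for s
    proof -
      have "((\<lambda>s. exp (- \<Lambda> s x)) has_vector_derivative (- r s x) * exp (- \<Lambda> s x)) (at s within I)"
        using field_vector_diff_chain_within[OF has_vector_derivative_minus[OF d\<Lambda>[OF s]] has_field_derivative_at_within[OF DERIV_exp]] by (simp add: o_def)
      note H = has_vector_derivative_mult[OF \<zeta>_deriv(3)[OF s, of x] this]
      have "\<zeta> s x * ((- r s x) * exp (- \<Lambda> s x)) + \<zeta>t s x * exp (- \<Lambda> s x) = 0"
        using \<zeta>_nz[OF s, of x] by (simp add: r_def)
      with H show ?thesis by (simp only:)
    qed
    have "\<exists>c. \<forall>s\<in>I. \<zeta> s x * exp (- \<Lambda> s x) = c"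
      by (rule has_vector_derivative_zero_constant[of I "\<lambda>s. \<zeta> s x * exp (- \<Lambda> s x)"]) (use d in auto)
    then obtain c where c: "\<And>s. s \<in> I \<Longrightarrow> \<zeta> s x * exp (- \<Lambda> s x) = c" by blast
    have "c = 1" unfolding c[OF t0, symmetric] \<Lambda>_def Lz_facts(3)[OF t0, symmetric] by (simp add: exp_minus)
    then show ?thesis using c[OF s] by (simp add: exp_minus field_simps)
  qed
  have c\<Lambda>: "continuous_on UNIV (\<Lambda> t)"
  proof -
    have "continuous_on (UNIV \<times> cbox 0 t) (\<lambda>z. (\<lambda>(\<tau>, x). r \<tau> x) (snd z, fst z))"
      by (rule continuous_on_compose2[OF joint_cont_r(1)]) (use t in \<open>auto intro!: continuous_intros\<close>)
    then have "continuous_on (UNIV \<times> cbox 0 t) (\<lambda>(x, \<tau>). r \<tau> x)" by (simp add: case_prod_beta)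
    from integral_continuous_on_param[OF this] show ?thesis
      unfolding \<Lambda>_def[abs_def] by (intro continuous_intros cont_L[OF t0]) (simp add: cbox_interval)
  qed
  \<comment> \<open>At fixed time both are continuous in space with the same exponential, so the
    difference cannot jump between multiples of 2 pi i.\<close>
  have "(\<lambda>x. L t x - \<Lambda> t x) constant_on UNIV"
    by (rule exp_eq_1_constant) (use e\<Lambda>[OF t] Lz_facts(3)[OF t] \<zeta>_nz[OF t] in \<open>auto intro!: continuous_intros cont_L[OF t] c\<Lambda> simp: exp_diff\<close>)
  then obtain k where k: "\<And>x. L t x - \<Lambda> t x = k" unfolding constant_on_def by blast
  define G where "G x = integral {0..t} (\<lambda>\<tau>. q \<tau> x)" for x
  have Im\<Lambda>: "Im (\<Lambda> t x) = g 0 x + G x" for x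
  proof -
    have "(\<lambda>\<tau>. r \<tau> x) integrable_on {0..t}"
      by (rule integrable_continuous_real[OF continuous_on_subset[OF slice_r(1)]]) (use t in auto)
    from integral_linear[OF this bounded_linear_Im] have "Im (integral {0..t} (\<lambda>\<tau>. r \<tau> x)) = G x"
      by (simp add: G_def q_def o_def)
    then show ?thesis by (simp add: \<Lambda>_def Lz_facts(5)[OF t0])
  qed
  have gk: "g t x = g 0 x + G x + Im k" for x
    using arg_cong[OF k[of x], of Im] Im\<Lambda>[of x] Lz_facts(5)[OF t, of x] by simp
  \<comment> \<open>The constant is g at time t minus g at time 0 minus the time integral of
    \<open>q\<close>; all three lie in L2, and a nonzero constant does not.\<close>
  have "Im k = 0"
  proof (rule ccontr)
    assume k0: "Im k \<noteq> 0"
    have ct: "continuous_on UNIV (g t)" "continuous_on UNIV (g 0)" by (rule g_facts(1)[OF t], rule g_facts(1)[OF t0])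
    have Geq: "G = (\<lambda>x. g t x - g 0 x - Im k)" using gk by (auto simp: fun_eq_iff)
    have cG: "continuous_on UNIV G" unfolding Geq by (intro continuous_intros ct)
    have m[measurable]: "g t \<in> borel_measurable borel" "g 0 \<in> borel_measurable borel" "G \<in> borel_measurable borel"
      using ct cG by (auto intro: borel_measurable_continuous_onI)
    obtain A where A: "A \<ge> 0" "\<And>s t. 0 \<le> s \<Longrightarrow> s \<le> t \<Longrightarrow> t \<le> T \<Longrightarrow>
      (\<integral>\<^sup>+x. ennreal ((integral {s..t} (\<lambda>\<tau>. q \<tau> x))\<^sup>2) \<partial>lborel) \<le> ennreal ((t - s)\<^sup>2 * A)" using increment_sq_nn by metis
    have "sq_nn (\<lambda>x. complex_of_real (G x)) \<le> ennreal ((t - 0)\<^sup>2 * A)"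
      using A(2)[of 0 t] t by (simp add: sq_nn_def G_def)
    from le_less_trans[OF this ennreal_less_top] have G: "sq_nn (\<lambda>x. complex_of_real (G x)) < \<infinity>" by simp
    have g2: "sq_nn (\<lambda>x. complex_of_real (g t x)) < \<infinity>" "sq_nn (\<lambda>x. complex_of_real (g 0 x)) < \<infinity>"
      using g_facts(2)[OF t] g_facts(2)[OF t0] unfolding square_integrable_iff by blast+
    define z where "z x = complex_of_real (g 0 x) + complex_of_real (G x)" for x
    have zm[measurable]: "z \<in> borel_measurable borel" unfolding z_def by measurable
    have z0: "sq_nn (\<lambda>x. 0 - z x) = sq_nn z" by (simp add: sq_nn_def)
    have z1: "sq_nn z \<le> ennreal (1 + 1) * sq_nn (\<lambda>x. complex_of_real (g 0 x)) + ennreal (1 + 1 / 1) * sq_nn (\<lambda>x. complex_of_real (G x))"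
      unfolding z_def[abs_def] by (rule sq_nn_add_le) auto
    have "complex_of_real (Im k) = complex_of_real (g t x) - z x" for x
      using gk[of x] by (simp add: z_def)
    then have "sq_nn (\<lambda>x. complex_of_real (Im k)) = sq_nn (\<lambda>x. complex_of_real (g t x) - z x)" by (simp add: sq_nn_def)
    also have "\<dots> \<le> 2 * sq_nn (\<lambda>x. complex_of_real (g t x) - 0) + 2 * sq_nn (\<lambda>x. 0 - z x)"
      by (rule sq_nn_diff_le) measurable
    also have "\<dots> < \<infinity>"
    proof -
      have "ennreal (1 + 1) * sq_nn (\<lambda>x. complex_of_real (g 0 x)) + ennreal (1 + 1 / 1) * sq_nn (\<lambda>x. complex_of_real (G x)) < \<infinity>"
        using G g2 by (simp add: ennreal_mult_less_top)
      with z1 have "sq_nn z < \<infinity>" by (rule le_less_trans)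
      then show ?thesis unfolding z0 using g2 by (simp add: ennreal_mult_less_top)
    qed
    finally have "sq_nn (\<lambda>x. complex_of_real (Im k)) < \<infinity>" .
    then show False using k0 by (simp add: sq_nn_def ennreal_mult_less_top)
  qed
  then show ?thesis using gk[of x] by (simp add: G_def)
qed

lemma g_time_deriv: assumes t: "t \<in> I" shows "((\<lambda>\<tau>. g \<tau> x) has_vector_derivative q t x) (at t within I)"
proof (rule has_vector_derivative_transform[OF t])
  show "g \<tau> x = g 0 x + integral {0..\<tau>} (\<lambda>\<tau>. q \<tau> x)" if "\<tau> \<in> I" for \<tau> by (rule g_time[OF that])
  show "((\<lambda>\<tau>. g 0 x + integral {0..\<tau>} (\<lambda>\<tau>. q \<tau> x)) has_vector_derivative q t x) (at t within I)"
    using has_vector_derivative_add[OF has_vector_derivative_const integral_has_vector_derivative[OF slice_r(2) t]] by simp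
qed

lemma g_increment_sq:
  obtains A where "A \<ge> 0" "\<And>s t. s \<in> I \<Longrightarrow> t \<in> I \<Longrightarrow>
      (\<integral>\<^sup>+x. ennreal (\<bar>g t x - g s x\<bar>\<^sup>2) \<partial>lborel) \<le> ennreal ((t - s)\<^sup>2 * A)"
proof -
  obtain A where A: "A \<ge> 0" "\<And>s t. 0 \<le> s \<Longrightarrow> s \<le> t \<Longrightarrow> t \<le> T \<Longrightarrow>
      (\<integral>\<^sup>+x. ennreal ((integral {s..t} (\<lambda>\<tau>. q \<tau> x))\<^sup>2) \<partial>lborel) \<le> ennreal ((t - s)\<^sup>2 * A)" using increment_sq_nn by metis
  have d: "g t x - g s x = integral {s..t} (\<lambda>\<tau>. q \<tau> x)" if "s \<in> I" "t \<in> I" "s \<le> t" for s t x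
  proof -
    have "integral {0..s} (\<lambda>\<tau>. q \<tau> x) + integral {s..t} (\<lambda>\<tau>. q \<tau> x) = integral {0..t} (\<lambda>\<tau>. q \<tau> x)"
      by (rule Henstock_Kurzweil_Integration.integral_combine)
        (use that in \<open>auto intro!: integrable_continuous_real continuous_on_subset[OF slice_r(2)]\<close>)
    then show ?thesis using g_time[OF that(1)] g_time[OF that(2)] by simp
  qed
  have 1: "(\<integral>\<^sup>+x. ennreal (\<bar>g t x - g s x\<bar>\<^sup>2) \<partial>lborel) \<le> ennreal ((t - s)\<^sup>2 * A)" if "s \<in> I" "t \<in> I" "s \<le> t" for s t
    using A(2)[of s t] that by (simp add: d)
  have "(\<integral>\<^sup>+x. ennreal (\<bar>g t x - g s x\<bar>\<^sup>2) \<partial>lborel) \<le> ennreal ((t - s)\<^sup>2 * A)" if "s \<in> I" "t \<in> I" for s t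
  proof (cases "s \<le> t")
    case True
    then show ?thesis by (rule 1[OF that])
  next
    case False
    then show ?thesis using 1[OF that(2,1)] by (simp add: abs_minus_commute power2_commute)
  qed
  with A(1) show ?thesis by (rule that)
qed

text \<open>Membership of L in L2 was obtained at each time with constants depending on that time;
  uniformity comes from the value at time 0 and the Lipschitz bound.\<close>

lemma uL2_g: "uL2 I (\<lambda>t x. complex_of_real (g t x))"
proof -
  have t0: "0 \<in> I" using T by simp
  obtain A where A: "A \<ge> 0" "\<And>s t. s \<in> I \<Longrightarrow> t \<in> I \<Longrightarrow>
      (\<integral>\<^sup>+x. ennreal (\<bar>g t x - g s x\<bar>\<^sup>2) \<partial>lborel) \<le> ennreal ((t - s)\<^sup>2 * A)" using g_increment_sq by metis
  have m: "(\<lambda>x. complex_of_real (g t x)) \<in> borel_measurable borel" if "t \<in> I" for t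
    by (intro borel_measurable_continuous_onI continuous_intros g_facts(1)[OF that])
  have a: "uL2 I (\<lambda>t x. complex_of_real (g t x) - complex_of_real (g 0 x))"
    unfolding uL2_def
  proof (intro exI[of _ "T\<^sup>2 * A"] conjI ballI)
    fix t assume t: "t \<in> I"
    show "(\<lambda>x. complex_of_real (g t x) - complex_of_real (g 0 x)) \<in> borel_measurable borel"
      by (intro borel_measurable_diff m t t0)
    have "sq_nn (\<lambda>x. complex_of_real (g t x) - complex_of_real (g 0 x)) \<le> ennreal ((t - 0)\<^sup>2 * A)"
      using A(2)[OF t0 t] by (simp add: sq_nn_def flip: of_real_diff)
    also have "\<dots> \<le> ennreal (T\<^sup>2 * A)" using t A(1) by (intro ennreal_leI mult_right_mono power_mono) auto
    finally show "sq_nn (\<lambda>x. complex_of_real (g t x) - complex_of_real (g 0 x)) \<le> ennreal (T\<^sup>2 * A)" .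
  qed (use A(1) in simp)
  have b: "uL2 I (\<lambda>t x. complex_of_real (g 0 x))"
    using g_facts(2)[OF t0] m[OF t0] unfolding uL2_def
    by (intro exI[of _ "LINT x|lborel. (norm (complex_of_real (g 0 x)))\<^sup>2"]) (auto simp: sq_nn_eq_LINT)
  show ?thesis by (rule uL2_cong[OF uL2_add[OF a b]]) simp
qed

lemma uLinf_g: "uLinf I (\<lambda>t x. complex_of_real (g t x))"
proof (rule uH1_uLinf)
  show "uH1 I (\<lambda>t x. complex_of_real (g t x)) (\<lambda>t x. complex_of_real (Im (w t x)))"
  proof (rule uH1_I[OF uL2_g uL2_Im[OF uL2_w]])
    fix t x assume t: "t \<in> I"
    show "((\<lambda>x. complex_of_real (g t x)) has_vector_derivative complex_of_real (Im (w t x))) (at x)"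
      by (rule bounded_linear.has_vector_derivative[OF bounded_linear_of_real g_facts(3)[OF t]])
  next
    fix t assume t: "t \<in> I"
    show "continuous_on UNIV (\<lambda>x. complex_of_real (Im (w t x)))" by (intro continuous_intros cont_w[OF t])
  qed
qed

section \<open>The energy density and its time derivative\<close>

definition "f t x = (norm (\<zeta> t x))\<^sup>2 * (g t x)\<^sup>2"
text \<open>The time derivative of \<open>f\<close> is factored as g times \<open>c\<close> on
  purpose: g converges in L2 as time varies, whereas for \<open>c\<close> only a bound in L2 is
  used.\<close>

definition "c t x = 2 * (norm (\<zeta> t x))\<^sup>2 * (g t x * \<kappa> t x + q t x)"
definition "ft t x = g t x * c t x"

text \<open>Both partial derivatives, Im w in space and \<open>q\<close> in time, are bounded
  uniformly, so g is Lipschitz on the strip although it was defined one time at a time.\<close>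

lemma joint_cont_g: "continuous_on (I \<times> UNIV) (\<lambda>(t, x). g t x)"
proof -
  obtain Mq where "\<And>t x. t \<in> I \<Longrightarrow> norm (complex_of_real (q t x)) \<le> Mq" using uL2_q(2) unfolding uLinf_def by blast
  then have Mq: "\<bar>q t x\<bar> \<le> Mq" if "t \<in> I" for t x using that by simp
  obtain Mw where Mw: "\<And>t x. t \<in> I \<Longrightarrow> norm (w t x) \<le> Mw" using uLinf_w unfolding uLinf_def by blast
  have t0: "0 \<in> I" using T by simp
  have "\<bar>q 0 0\<bar> \<le> Mq" "norm (w 0 0) \<le> Mw" by (rule Mq[OF t0], rule Mw[OF t0])
  then have M0: "Mq \<ge> 0" "Mw \<ge> 0" by (meson abs_ge_zero norm_ge_zero order_trans)+
  have sp: "\<bar>g t x - g t y\<bar> \<le> Mw * \<bar>x - y\<bar>" if t: "t \<in> I" for t x y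
  proof -
    have "norm (g t x - g t y) \<le> Mw * norm (x - y)"
    proof (rule field_differentiable_bound[of UNIV])
      show "(g t has_field_derivative Im (w t z)) (at z within UNIV)" for z
        using g_facts(3)[OF t, of z] by (simp add: has_real_derivative_iff_has_vector_derivative)
      show "norm (Im (w t z)) \<le> Mw" for z
        using Mw[OF t, of z] abs_Im_le_cmod[of "w t z"] by simp
    qed auto
    then show ?thesis by simp
  qed
  have ti: "\<bar>g t y - g s y\<bar> \<le> Mq * \<bar>t - s\<bar>" if t: "t \<in> I" "s \<in> I" for t s y
  proof -
    have "norm (g t y - g s y) \<le> Mq * norm (t - s)"
    proof (rule field_differentiable_bound[of I "\<lambda>\<tau>. g \<tau> y" "\<lambda>\<tau>. q \<tau> y"])
      show "((\<lambda>\<tau>. g \<tau> y) has_field_derivative q z y) (at z within I)" if "z \<in> I" for z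
        using g_time_deriv[OF that, of y] by (simp add: has_real_derivative_iff_has_vector_derivative)
    qed (use Mq t in auto)
    then show ?thesis by simp
  qed
  have "(Mw + Mq)-lipschitz_on (I \<times> UNIV) (\<lambda>(t, x). g t x)"
  proof (rule lipschitz_onI)
    fix z z' :: "real \<times> real" assume z: "z \<in> I \<times> UNIV" "z' \<in> I \<times> UNIV"
    obtain t x s y where zz: "z = (t, x)" "z' = (s, y)" "t \<in> I" "s \<in> I" using z by auto
    have d: "\<bar>t - s\<bar> \<le> dist z z'" "\<bar>x - y\<bar> \<le> dist z z'"
      using dist_fst_le[of z z'] dist_snd_le[of z z'] by (auto simp: zz dist_real_def)
    have "\<bar>g t x - g s y\<bar> \<le> \<bar>g t x - g t y\<bar> + \<bar>g t y - g s y\<bar>" by linarith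
    also have "\<dots> \<le> Mw * \<bar>x - y\<bar> + Mq * \<bar>t - s\<bar>" by (intro add_mono sp ti zz)
    also have "\<dots> \<le> Mw * dist z z' + Mq * dist z z'" by (intro add_mono mult_left_mono d M0)
    finally show "dist (case z of (t, x) \<Rightarrow> g t x) (case z' of (t, x) \<Rightarrow> g t x) \<le> (Mw + Mq) * dist z z'"
      by (simp add: zz dist_real_def distrib_right)
  qed (use M0 in simp)
  then show ?thesis by (rule lipschitz_on_continuous_on)
qed

lemma joint_cont_f:
  "continuous_on (I \<times> UNIV) (\<lambda>(t, x). f t x)" "continuous_on (I \<times> UNIV) (\<lambda>(t, x). c t x)" "continuous_on (I \<times> UNIV) (\<lambda>(t, x). ft t x)"
proof -
  note j = joint_cont(1)[unfolded case_prod_beta] joint_cont_g[unfolded case_prod_beta] joint_cont_r(2,3)[unfolded case_prod_beta]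
  show "continuous_on (I \<times> UNIV) (\<lambda>(t, x). f t x)" "continuous_on (I \<times> UNIV) (\<lambda>(t, x). c t x)" "continuous_on (I \<times> UNIV) (\<lambda>(t, x). ft t x)"
    unfolding case_prod_beta f_def c_def ft_def by (intro continuous_intros j)+
qed

lemma cont_slice_real:
  fixes u :: "real \<Rightarrow> real \<Rightarrow> real"
  assumes "continuous_on (I \<times> UNIV) (\<lambda>(t, x). u t x)"
  shows "t \<in> I \<Longrightarrow> continuous_on UNIV (u t)" "continuous_on I (\<lambda>t. u t x)"
proof -
  assume t: "t \<in> I"
  have "continuous_on UNIV (\<lambda>x. (\<lambda>(t, x). u t x) (t, x))"
    by (rule continuous_on_compose2[OF assms]) (use t in \<open>auto intro!: continuous_intros\<close>)
  then show "continuous_on UNIV (u t)" by simp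
next
  have "continuous_on I (\<lambda>t. (\<lambda>(t, x). u t x) (t, x))"
    by (rule continuous_on_compose2[OF assms]) (auto intro!: continuous_intros)
  then show "continuous_on I (\<lambda>t. u t x)" by simp
qed

lemma f_time_deriv:
  assumes t: "t \<in> I" shows "((\<lambda>\<tau>. f \<tau> x) has_vector_derivative ft t x) (at t within I)"
proof -
  have 1: "((\<lambda>\<tau>. (norm (\<zeta> \<tau> x))\<^sup>2) has_vector_derivative 2 * Re (\<zeta>t t x * cnj (\<zeta> t x))) (at t within I)"
    by (rule cmod_sq_has_vector_derivative[OF \<zeta>_deriv(3)[OF t]])
  have 2: "((\<lambda>\<tau>. g \<tau> x * g \<tau> x) has_vector_derivative g t x * q t x + q t x * g t x) (at t within I)"
    by (rule has_vector_derivative_mult[OF g_time_deriv[OF t] g_time_deriv[OF t]])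
  have "\<zeta>t t x * cnj (\<zeta> t x) = r t x * complex_of_real ((norm (\<zeta> t x))\<^sup>2)"
    unfolding complex_norm_square r_def using \<zeta>_nz[OF t, of x] by simp
  then have e: "Re (\<zeta>t t x * cnj (\<zeta> t x)) = \<kappa> t x * (norm (\<zeta> t x))\<^sup>2" by (simp add: \<kappa>_def)
  have "(norm (\<zeta> t x))\<^sup>2 * (g t x * q t x + q t x * g t x) + 2 * Re (\<zeta>t t x * cnj (\<zeta> t x)) * (g t x * g t x) = ft t x"
    unfolding e ft_def c_def by (simp add: algebra_simps)
  then show ?thesis
    using has_vector_derivative_mult[OF 1 2] by (simp add: f_def power2_eq_square[of "g _ _"])
qed

text \<open>The rate \<open>\<kappa>\<close> contains B1 by itself, for which only a sup bound is
  available here; multiplication by g makes that term square integrable, and the other terms carry w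
  or \<open>q\<close>.\<close>

lemma uL2_c: "uL2 I (\<lambda>t x. complex_of_real (c t x))"
proof -
  have e: "complex_of_real (c t x) = (complex_of_real (Re (w t x)) * (complex_of_real (g t x) * ((-1) * complex_of_real (\<beta> t x)))
      + complex_of_real (Im (w t x)) * (complex_of_real (g t x) * complex_of_real ((norm (p t x))\<^sup>2))
      + complex_of_real (g t x) * ((-1) * complex_of_real (B1 t x)) + complex_of_real (q t x)) * (2 * complex_of_real ((norm (\<zeta> t x))\<^sup>2))"
    if "t \<in> I" for t x
  proof -
    have "c t x = (Re (w t x) * (g t x * ((-1) * \<beta> t x)) + Im (w t x) * (g t x * (norm (p t x))\<^sup>2) + g t x * ((-1) * B1 t x) + q t x) * (2 * (norm (\<zeta> t x))\<^sup>2)"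
      unfolding c_def \<kappa>_def r_def pde(1)[OF that] by (simp add: algebra_simps)
    then show ?thesis by (simp only: of_real_mult of_real_add of_real_minus of_real_1 of_real_numeral)
  qed
  show ?thesis
    by (rule uL2_cong[OF uL2_mult[OF uL2_add[OF uL2_add[OF uL2_add[OF
          uL2_mult[OF uL2_Re[OF uL2_w] uLinf_mult[OF uLinf_g uLinf_mult[OF uLinf_const[of I "-1"] uLinf_coeffs(1)]]]
          uL2_mult[OF uL2_Im[OF uL2_w] uLinf_mult[OF uLinf_g uLinf_p2]]]
          uL2_mult[OF uL2_g uLinf_mult[OF uLinf_const[of I "-1"] uLinf_coeffs(2)]]] uL2_q(1)]
        uLinf_mult[OF uLinf_const[of I 2] uLinf_\<zeta>2]] e])
qed

lemma sq_bounds: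
  assumes "uL2 I (\<lambda>t x. complex_of_real (u t x))"
  obtains A where "A \<ge> 0" "\<And>t. t \<in> I \<Longrightarrow> u t \<in> borel_measurable borel"
    "\<And>t. t \<in> I \<Longrightarrow> (\<integral>\<^sup>+x. ennreal ((u t x)\<^sup>2) \<partial>lborel) \<le> ennreal A"
    "\<And>t. t \<in> I \<Longrightarrow> integrable lborel (\<lambda>x. (u t x)\<^sup>2)"
proof -
  obtain A where A: "A \<ge> 0" "\<And>t. t \<in> I \<Longrightarrow> (\<lambda>x. complex_of_real (u t x)) \<in> borel_measurable borel"
    "\<And>t. t \<in> I \<Longrightarrow> sq_nn (\<lambda>x. complex_of_real (u t x)) \<le> ennreal A"
    using assms unfolding uL2_def by blast
  have m: "u t \<in> borel_measurable borel" if t: "t \<in> I" for t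
  proof -
    have "(\<lambda>x. Re (complex_of_real (u t x))) \<in> borel_measurable borel"
      using A(2)[OF t] by measurable
    then show ?thesis by simp
  qed
  have b: "(\<integral>\<^sup>+x. ennreal ((u t x)\<^sup>2) \<partial>lborel) \<le> ennreal A" if "t \<in> I" for t
    using A(3)[OF that] by (simp add: sq_nn_def)
  have "integrable lborel (\<lambda>x. (u t x)\<^sup>2)" if t: "t \<in> I" for t
  proof (rule integrableI_bounded)
    have [measurable]: "u t \<in> borel_measurable borel" by (rule m[OF t])
    show "(\<lambda>x. (u t x)\<^sup>2) \<in> borel_measurable lborel" by measurable
    show "(\<integral>\<^sup>+x. ennreal (norm ((u t x)\<^sup>2)) \<partial>lborel) < \<infinity>" using le_less_trans[OF b[OF t] ennreal_less_top] by simp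
  qed
  with A(1) m b show ?thesis by (rule that)
qed

lemma integrable_sq_mult:
  fixes u v :: "real \<Rightarrow> real"
  assumes "integrable lborel (\<lambda>x. (u x)\<^sup>2)" "integrable lborel (\<lambda>x. (v x)\<^sup>2)"
    and [measurable]: "u \<in> borel_measurable borel" "v \<in> borel_measurable borel"
  shows "integrable lborel (\<lambda>x. u x * v x)"
proof (rule Bochner_Integration.integrable_bound)
  show "integrable lborel (\<lambda>x. (u x)\<^sup>2 + (v x)\<^sup>2)" using assms(1,2) by simp
  have "\<bar>u x * v x\<bar> \<le> (u x)\<^sup>2 + (v x)\<^sup>2" for x
    using sum_squares_bound[of "\<bar>u x\<bar>" "\<bar>v x\<bar>"] abs_ge_zero[of "u x * v x"] unfolding abs_mult power2_abs by linarith
  then show "AE x in lborel. norm (u x * v x) \<le> norm ((u x)\<^sup>2 + (v x)\<^sup>2)" by simp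
qed measurable

lemma integrable_bounded_mult:
  fixes u v :: "real \<Rightarrow> real"
  assumes u: "integrable lborel u" and v: "v \<in> borel_measurable borel" "\<And>x. \<bar>v x\<bar> \<le> M"
  shows "integrable lborel (\<lambda>x. u x * v x)"
proof (rule Bochner_Integration.integrable_bound)
  show "integrable lborel (\<lambda>x. M * u x)" using u by simp
  have [measurable]: "u \<in> borel_measurable borel" "v \<in> borel_measurable borel" using u v by auto
  show "(\<lambda>x. u x * v x) \<in> borel_measurable lborel" by measurable
  have "\<bar>u x * v x\<bar> \<le> \<bar>M * u x\<bar>" for x
  proof -
    have "\<bar>v x\<bar> \<le> \<bar>M\<bar>" using v(2)[of x] by linarith
    then have "\<bar>u x\<bar> * \<bar>v x\<bar> \<le> \<bar>u x\<bar> * \<bar>M\<bar>" by (rule mult_left_mono) simp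
    then show ?thesis by (simp add: abs_mult mult.commute)
  qed
  then show "AE x in lborel. norm (u x * v x) \<le> norm (M * u x)" by simp
qed

lemma integrable_facts:
  assumes t: "t \<in> I"
  shows "integrable lborel (f t)" "integrable lborel (ft t)" "integrable lborel (\<lambda>x. f t x * B1 t x)"
    "integrable lborel (\<lambda>x. g t x * Re (w t x))"
proof -
  obtain G where G: "g t \<in> borel_measurable borel" "integrable lborel (\<lambda>x. (g t x)\<^sup>2)"
    using sq_bounds[OF uL2_g] t by metis
  obtain A where C: "c t \<in> borel_measurable borel" "integrable lborel (\<lambda>x. (c t x)\<^sup>2)"
    using sq_bounds[OF uL2_c] t by metis
  obtain B where W: "(\<lambda>x. Re (w t x)) \<in> borel_measurable borel" "integrable lborel (\<lambda>x. (Re (w t x))\<^sup>2)"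
    using sq_bounds[OF uL2_Re[OF uL2_w]] t by metis
  show "integrable lborel (ft t)" unfolding ft_def[abs_def] by (rule integrable_sq_mult[OF G(2) C(2) G(1) C(1)])
  show "integrable lborel (\<lambda>x. g t x * Re (w t x))" by (rule integrable_sq_mult[OF G(2) W(2) G(1) W(1)])
  obtain M where M: "\<And>x. norm (\<zeta> t x) \<le> M" using uLinf_basic(1) t unfolding uLinf_def by blast
  have "integrable lborel (\<lambda>x. (g t x)\<^sup>2 * (norm (\<zeta> t x))\<^sup>2)"
  proof (rule integrable_bounded_mult[OF G(2)])
    show "(\<lambda>x. (norm (\<zeta> t x))\<^sup>2) \<in> borel_measurable borel"
      by (intro borel_measurable_continuous_onI continuous_intros cont_slice(1)[OF joint_cont(1) t])
    show "\<bar>(norm (\<zeta> t x))\<^sup>2\<bar> \<le> M\<^sup>2" for x using power_mono[OF M[of x], of 2] by simp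
  qed
  then show fi: "integrable lborel (f t)" unfolding f_def[abs_def] by (simp add: mult.commute)
  obtain MB where "\<And>x. norm (complex_of_real (B1 t x)) \<le> MB" using uLinf_coeffs(2) t unfolding uLinf_def by blast
  then have MB: "\<bar>B1 t x\<bar> \<le> MB" for x by simp
  show "integrable lborel (\<lambda>x. f t x * B1 t x)"
    by (rule integrable_bounded_mult[OF fi borel_measurable_continuous_onI[OF cont_B1[OF t]] MB])
qed

section \<open>The conservation law and the energy identity\<close>

lemma f_space_deriv:
  assumes t: "t \<in> I"
  shows "(f t has_vector_derivative 2 * f t x * Re (w t x) + 2 * (norm (\<zeta> t x))\<^sup>2 * g t x * Im (w t x)) (at x)"
proof -
  have 1: "((\<lambda>x. (norm (\<zeta> t x))\<^sup>2) has_vector_derivative 2 * Re (\<zeta>1 t x * cnj (\<zeta> t x))) (at x)"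
    by (rule cmod_sq_has_vector_derivative[OF \<zeta>_deriv(1)[OF t]])
  have 2: "((\<lambda>x. g t x * g t x) has_vector_derivative g t x * Im (w t x) + Im (w t x) * g t x) (at x)"
    by (rule has_vector_derivative_mult[OF g_facts(3)[OF t] g_facts(3)[OF t]])
  have "\<zeta>1 t x * cnj (\<zeta> t x) = w t x * complex_of_real ((norm (\<zeta> t x))\<^sup>2)"
    unfolding complex_norm_square w_def using \<zeta>_nz[OF t, of x] by simp
  then have e: "Re (\<zeta>1 t x * cnj (\<zeta> t x)) = Re (w t x) * (norm (\<zeta> t x))\<^sup>2" by simp
  have EQ: "(norm (\<zeta> t x))\<^sup>2 * (g t x * Im (w t x) + Im (w t x) * g t x) + 2 * Re (\<zeta>1 t x * cnj (\<zeta> t x)) * (g t x * g t x)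
    = 2 * f t x * Re (w t x) + 2 * (norm (\<zeta> t x))\<^sup>2 * g t x * Im (w t x)"
    unfolding e f_def by (simp add: algebra_simps power2_eq_square)
  have "f t = (\<lambda>x. (norm (\<zeta> t x))\<^sup>2 * (g t x * g t x))" by (simp add: fun_eq_iff f_def power2_eq_square)
  then show ?thesis using has_vector_derivative_mult[OF 1 2] unfolding EQ by simp
qed

text \<open>The flux \<beta> f is integrable together with its derivative, so the derivative
  integrates to 0; the remaining terms are the claim.\<close>

lemma integral_ft:
  assumes t: "t \<in> I"
  shows "(LINT x|lborel. ft t x) = - (LINT x|lborel. f t x * B1 t x) - 2 * (LINT x|lborel. g t x * Re (w t x))"
proof -
  note i = integrable_facts[OF t]
  \<comment> \<open>The derivative of the flux as predicted by the conservation law; the computation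
    below confirms it.\<close>
  define h' where "h' x = - ft t x - f t x * B1 t x - 2 * (g t x * Re (w t x))" for x
  have ih': "integrable lborel h'" unfolding h'_def using i by simp
  obtain M where "\<And>x. norm (complex_of_real (\<beta> t x)) \<le> M" using uLinf_coeffs(1) t unfolding uLinf_def by blast
  then have M: "\<bar>\<beta> t x\<bar> \<le> M" for x by simp
  have "(LINT x|lborel. h' x) = 0"
  proof (rule integrable_C1_limits_0(3)[OF _ _ _ ih'])
    fix x
    have "((\<lambda>x. \<beta> t x * f t x) has_vector_derivative
      \<beta> t x * (2 * f t x * Re (w t x) + 2 * (norm (\<zeta> t x))\<^sup>2 * g t x * Im (w t x)) + (B1 t x + 2 * Im (X t x)) * f t x) (at x)"
      by (rule has_vector_derivative_mult[OF coeffs(3)[OF t] f_space_deriv[OF t]])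
    moreover have "\<beta> t x * (2 * f t x * Re (w t x) + 2 * (norm (\<zeta> t x))\<^sup>2 * g t x * Im (w t x)) + (B1 t x + 2 * Im (X t x)) * f t x = h' x"
    proof -
      \<comment> \<open>As |p|^2 |Z'|^2 = 1, the weight disappears from the terms containing |p|^2.
        The two contributions g^2 Im w, from the time derivative and from the derivative of b,
        agree, and g Re w is left without a weight.\<close>
      have pz: "(norm (p t x))\<^sup>2 * (norm (\<zeta> t x))\<^sup>2 = 1"
        using \<zeta>_nz[OF t, of x] by (simp add: p_def norm_divide power_divide)
      define Z2 P2 where "Z2 = (norm (\<zeta> t x))\<^sup>2" and "P2 = (norm (p t x))\<^sup>2"
      have a1: "P2 * Z2 = 1" using pz by (simp add: Z2_def P2_def)
      have k: "\<kappa> t x = - \<beta> t x * Re (w t x) + P2 * Im (w t x) - B1 t x" "q t x = - \<beta> t x * Im (w t x) - P2 * Re (w t x)"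
        using pde[OF t, of x] by (simp_all add: \<kappa>_def q_def r_def P2_def)
      have fe: "f t x = Z2 * (g t x)\<^sup>2" by (simp add: f_def Z2_def)
      have X: "Im (X t x) = - (P2 * Im (w t x))" using X_eq[OF t, of x] by (simp add: P2_def)
      have fte: "ft t x = g t x * (2 * Z2 * (g t x * \<kappa> t x + q t x))" by (simp add: ft_def c_def Z2_def)
      have "g t x * (2 * Z2 * (g t x * (P2 * Im (w t x)))) = 2 * (g t x)\<^sup>2 * Im (w t x) * (P2 * Z2)" by (simp add: power2_eq_square)
      then have b1: "g t x * (2 * Z2 * (g t x * (P2 * Im (w t x)))) = 2 * (g t x)\<^sup>2 * Im (w t x)" using a1 by simp
      have "g t x * (2 * Z2 * (P2 * Re (w t x))) = 2 * (g t x * Re (w t x)) * (P2 * Z2)" by simp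
      then have b2: "g t x * (2 * Z2 * (P2 * Re (w t x))) = 2 * (g t x * Re (w t x))" using a1 by simp
      have "P2 * Im (w t x) * (Z2 * (g t x)\<^sup>2) = (g t x)\<^sup>2 * Im (w t x) * (P2 * Z2)" by simp
      then have b3: "P2 * Im (w t x) * (Z2 * (g t x)\<^sup>2) = (g t x)\<^sup>2 * Im (w t x)" using a1 by simp
      have s1: "ft t x = - \<beta> t x * (2 * Z2 * (g t x)\<^sup>2 * Re (w t x) + 2 * Z2 * g t x * Im (w t x))
          + g t x * (2 * Z2 * (g t x * (P2 * Im (w t x)))) - 2 * (Z2 * (g t x)\<^sup>2) * B1 t x - g t x * (2 * Z2 * (P2 * Re (w t x)))"
        unfolding fte k by (simp add: algebra_simps power2_eq_square)
      have s2: "(B1 t x + 2 * Im (X t x)) * f t x = B1 t x * (Z2 * (g t x)\<^sup>2) - 2 * (P2 * Im (w t x) * (Z2 * (g t x)\<^sup>2))"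
        unfolding X fe by (simp add: algebra_simps)
      show ?thesis
        unfolding h'_def s2 s1 b1 b2 b3 unfolding fe Z2_def[symmetric] by (simp add: algebra_simps)
    qed
    ultimately show "((\<lambda>x. \<beta> t x * f t x) has_vector_derivative h' x) (at x)" by simp
  next
    show "continuous_on UNIV h'" unfolding h'_def
      by (intro continuous_intros cont_slice_real(1)[OF joint_cont_f(3) t] cont_slice_real(1)[OF joint_cont_f(1) t] cont_B1[OF t] g_facts(1)[OF t] cont_w[OF t])
    show "integrable lborel (\<lambda>x. \<beta> t x * f t x)"
      using integrable_bounded_mult[OF i(1) borel_measurable_continuous_onI[OF cont_\<beta>[OF t]] M] by (simp add: mult.commute)
  qed
  moreover have "(LINT x|lborel. h' x) = - (LINT x|lborel. ft t x) - (LINT x|lborel. f t x * B1 t x) - 2 * (LINT x|lborel. g t x * Re (w t x))"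
    unfolding h'_def using i by simp
  ultimately show ?thesis by linarith
qed

text \<open>Continuity in time is what permits differentiating the time integral of this function at
  every time, end points included.\<close>

lemma integral_ft_continuous: "continuous_on I (\<lambda>t. LINT x|lborel. ft t x)"
  unfolding continuous_on_sequentially
proof (intro allI ballI impI)
  fix S :: "nat \<Rightarrow> real" and t assume t: "t \<in> I" and "(\<forall>n. S n \<in> I) \<and> S \<longlonglongrightarrow> t"
  then have S: "\<And>n. S n \<in> I" "S \<longlonglongrightarrow> t" by auto
  obtain G where G: "\<And>t. t \<in> I \<Longrightarrow> g t \<in> borel_measurable borel" "\<And>t. t \<in> I \<Longrightarrow> integrable lborel (\<lambda>x. (g t x)\<^sup>2)"
    using sq_bounds[OF uL2_g] by metis
  obtain C where C: "C \<ge> 0" "\<And>t. t \<in> I \<Longrightarrow> c t \<in> borel_measurable borel"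
    "\<And>t. t \<in> I \<Longrightarrow> (\<integral>\<^sup>+x. ennreal ((c t x)\<^sup>2) \<partial>lborel) \<le> ennreal C"
    using sq_bounds[OF uL2_c] by metis
  obtain A where A: "A \<ge> 0" "\<And>s t. s \<in> I \<Longrightarrow> t \<in> I \<Longrightarrow>
      (\<integral>\<^sup>+x. ennreal (\<bar>g t x - g s x\<bar>\<^sup>2) \<partial>lborel) \<le> ennreal ((t - s)\<^sup>2 * A)" using g_increment_sq by metis
  have "(\<lambda>n. LINT x|lborel. ft (S n) x) \<longlonglongrightarrow> (LINT x|lborel. ft t x)"
  proof (rule integral_convergence_L2_product[where a="\<lambda>n. g (S n)" and ?a0.0="g t" and c="\<lambda>n. c (S n)" and ?c0.0="c t" and C=C and \<delta>="\<lambda>n. (S n - t)\<^sup>2 * A"])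
    show "(\<lambda>n. ft (S n) x) \<longlonglongrightarrow> ft t x" for x
      by (rule continuous_on_tendsto_compose[OF cont_slice_real(2)[OF joint_cont_f(3)] S(2) t]) (use S in simp)
    have "(\<lambda>n. (S n - t)\<^sup>2 * A) \<longlonglongrightarrow> (t - t)\<^sup>2 * A" by (intro tendsto_intros S)
    then show "(\<lambda>n. (S n - t)\<^sup>2 * A) \<longlonglongrightarrow> 0" by simp
    show "(\<integral>\<^sup>+x. ennreal (\<bar>g (S n) x - g t x\<bar>\<^sup>2) \<partial>lborel) \<le> ennreal ((S n - t)\<^sup>2 * A)" for n by (rule A(2)[OF t S(1)])
    show "integrable lborel (\<lambda>x. ft (S n) x)" for n by (rule integrable_facts(2)[OF S(1)])
    show "integrable lborel (\<lambda>x. ft t x)" by (rule integrable_facts(2)[OF t])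
  qed (use S t G C A in \<open>auto simp: ft_def abs_mult\<close>)
  then show "((\<lambda>t. LINT x|lborel. ft t x) \<circ> S) \<longlonglongrightarrow> (LINT x|lborel. ft t x)" by (simp add: o_def)
qed

text \<open>The fundamental theorem of calculus is used in time at each fixed point of space, and
  the two integrations are interchanged. This needs only a bound on the spatial integral of |ft|,
  not a majorant uniform in time.\<close>

lemma energy_formula:
  assumes t: "t \<in> I"
  shows "(LINT x|lborel. f t x) = (LINT x|lborel. f 0 x) + integral {0..t} (\<lambda>\<tau>. LINT x|lborel. ft \<tau> x)"
proof -
  have t0: "0 \<in> I" using T by simp
  have tt: "0 \<le> t" "t \<le> T" using t by auto
  define h where "h \<tau> x = indicator {0..t} \<tau> * ft \<tau> x" for \<tau> x
  have hm: "(\<lambda>(\<tau>, x). h \<tau> x) \<in> borel_measurable (lborel \<Otimes>\<^sub>M lborel)"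
    unfolding h_def by (rule strip_measurable[OF joint_cont_f(3) _ tt(2)]) simp
  obtain A where G: "A \<ge> 0" "\<And>t. t \<in> I \<Longrightarrow> g t \<in> borel_measurable borel"
    "\<And>t. t \<in> I \<Longrightarrow> (\<integral>\<^sup>+x. ennreal ((g t x)\<^sup>2) \<partial>lborel) \<le> ennreal A"
    using sq_bounds[OF uL2_g] by metis
  obtain C where C: "C \<ge> 0" "\<And>t. t \<in> I \<Longrightarrow> c t \<in> borel_measurable borel"
    "\<And>t. t \<in> I \<Longrightarrow> (\<integral>\<^sup>+x. ennreal ((c t x)\<^sup>2) \<partial>lborel) \<le> ennreal C"
    using sq_bounds[OF uL2_c] by metis
  \<comment> \<open>Cauchy-Schwarz on the factorisation ft = g c, with both L2 bounds independent of
    time.\<close>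
  have inner: "(\<integral>\<^sup>+x. ennreal (norm (h \<tau> x)) \<partial>lborel) \<le> ennreal (sqrt (A * C)) * indicator {0..t} \<tau>" for \<tau>
  proof (cases "\<tau> \<in> {0..t}")
    case True
    then have ti: "\<tau> \<in> I" using tt by auto
    have "(\<integral>\<^sup>+x. ennreal (\<bar>g \<tau> x\<bar> * \<bar>c \<tau> x\<bar>) \<partial>lborel) \<le> ennreal (sqrt (A * C))"
      by (rule nn_Cauchy_Schwarz) (use G C ti in auto)
    then show ?thesis using True by (simp add: h_def ft_def abs_mult)
  qed (simp add: h_def)
  have int: "integrable (lborel \<Otimes>\<^sub>M lborel) (\<lambda>(\<tau>, x). h \<tau> x)"
  proof (rule integrableI_bounded[OF hm])
    have m: "(\<lambda>z. ennreal (norm (case z of (\<tau>, x) \<Rightarrow> h \<tau> x))) \<in> borel_measurable (lborel \<Otimes>\<^sub>M lborel)"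
      using hm by measurable
    have "(\<integral>\<^sup>+z. ennreal (norm (case z of (\<tau>, x) \<Rightarrow> h \<tau> x)) \<partial>(lborel \<Otimes>\<^sub>M lborel))
       = (\<integral>\<^sup>+\<tau>. \<integral>\<^sup>+x. ennreal (norm (h \<tau> x)) \<partial>lborel \<partial>lborel)"
      using lborel.nn_integral_fst[OF m] by simp
    also have "\<dots> \<le> (\<integral>\<^sup>+\<tau>. ennreal (sqrt (A * C)) * indicator {0..t} \<tau> \<partial>lborel)" by (rule nn_integral_mono[OF inner])
    also have "\<dots> = ennreal (sqrt (A * C)) * ennreal t" using tt by (subst nn_integral_cmult_indicator) auto
    also have "\<dots> < \<infinity>" by (simp add: ennreal_mult_less_top)
    finally show "(\<integral>\<^sup>+z. ennreal (norm (case z of (\<tau>, x) \<Rightarrow> h \<tau> x)) \<partial>(lborel \<Otimes>\<^sub>M lborel)) < \<infinity>" .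
  qed
  have pt: "(LINT \<tau>|lborel. h \<tau> x) = f t x - f 0 x" for x
  proof -
    have cs: "continuous_on {0..t} (\<lambda>\<tau>. ft \<tau> x)"
      by (rule continuous_on_subset[OF cont_slice_real(2)[OF joint_cont_f(3)]]) (use tt in auto)
    have "(LINT \<tau>|lborel. h \<tau> x) = integral {0..t} (\<lambda>\<tau>. ft \<tau> x)"
      using set_borel_integral_eq_integral(2)[OF borel_integrable_atLeastAtMost'[OF cs]]
      by (simp add: set_lebesgue_integral_def h_def)
    also have "\<dots> = f t x - f 0 x"
    proof (rule integral_unique[OF fundamental_theorem_of_calculus[OF tt(1)]])
      fix \<tau> assume "\<tau> \<in> {0..t}"
      then have "\<tau> \<in> I" using tt by auto
      from has_vector_derivative_within_subset[OF f_time_deriv[OF this], of "{0..t}"]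
      show "((\<lambda>\<tau>. f \<tau> x) has_vector_derivative ft \<tau> x) (at \<tau> within {0..t})" using tt by auto
    qed
    finally show ?thesis .
  qed
  have "(LINT x|lborel. f t x) - (LINT x|lborel. f 0 x) = (LINT x|lborel. f t x - f 0 x)"
    using integrable_facts(1)[OF t] integrable_facts(1)[OF t0] by simp
  also have "\<dots> = (LINT x|lborel. LINT \<tau>|lborel. h \<tau> x)" unfolding pt ..
  also have "\<dots> = (LINT \<tau>|lborel. LINT x|lborel. h \<tau> x)" by (rule lborel_pair.Fubini_integral[OF int])
  also have "\<dots> = (LINT \<tau>|lborel. indicator {0..t} \<tau> *\<^sub>R (LINT x|lborel. ft \<tau> x))" unfolding h_def by simp
  also have "\<dots> = integral {0..t} (\<lambda>\<tau>. LINT x|lborel. ft \<tau> x)"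
  proof -
    have "continuous_on {0..t} (\<lambda>\<tau>. LINT x|lborel. ft \<tau> x)"
      by (rule continuous_on_subset[OF integral_ft_continuous]) (use tt in auto)
    from set_borel_integral_eq_integral(2)[OF borel_integrable_atLeastAtMost'[OF this]]
    show ?thesis by (simp add: set_lebesgue_integral_def)
  qed
  finally show ?thesis by simp
qed

lemma energy_derivative:
  assumes t: "t \<in> I"
  shows "((\<lambda>\<tau>. LINT x|lborel. f \<tau> x) has_real_derivative (LINT x|lborel. ft t x)) (at t within I)"
  unfolding has_real_derivative_iff_has_vector_derivative
proof (rule has_vector_derivative_transform[OF t energy_formula])
  show "((\<lambda>\<tau>. (LINT x|lborel. f 0 x) + integral {0..\<tau>} (\<lambda>\<tau>. LINT x|lborel. ft \<tau> x)) has_vector_derivative (LINT x|lborel. ft t x)) (at t within I)"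
    using has_vector_derivative_add[OF has_vector_derivative_const integral_has_vector_derivative[OF integral_ft_continuous t]] by simp
qed

lemma energy_identity:
  assumes t: "t \<in> I"
  shows "integrable lborel (\<lambda>\<alpha>. (norm (d_space (Z t) \<alpha>))\<^sup>2 * (g t \<alpha>)\<^sup>2)"
    "integrable lborel (\<lambda>\<alpha>. (norm (d_space (Z t) \<alpha>))\<^sup>2 * (g t \<alpha>)\<^sup>2 * muskat_B1 (Z t) \<alpha>)"
    "((\<lambda>\<tau>. LINT \<alpha>|lborel. (norm (d_space (Z \<tau>) \<alpha>))\<^sup>2 * (g \<tau> \<alpha>)\<^sup>2) has_real_derivative (LINT x|lborel. ft t x)) (at t within I)"
    "(LINT x|lborel. ft t x) + (LINT \<alpha>|lborel. (norm (d_space (Z t) \<alpha>))\<^sup>2 * (g t \<alpha>)\<^sup>2 * muskat_B1 (Z t) \<alpha>)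
      + 2 * (Hdot_half_norm (\<lambda>\<alpha>. complex_of_real (g t \<alpha>)))\<^sup>2 = 0"
proof -
  have e: "(norm (d_space (Z \<tau>) \<alpha>))\<^sup>2 * (g \<tau> \<alpha>)\<^sup>2 = f \<tau> \<alpha>" if "\<tau> \<in> I" for \<tau> \<alpha>
    by (simp only: d_space_Z[OF that] f_def)
  show "integrable lborel (\<lambda>\<alpha>. (norm (d_space (Z t) \<alpha>))\<^sup>2 * (g t \<alpha>)\<^sup>2)"
    unfolding e[OF t] by (rule integrable_facts(1)[OF t])
  show "integrable lborel (\<lambda>\<alpha>. (norm (d_space (Z t) \<alpha>))\<^sup>2 * (g t \<alpha>)\<^sup>2 * muskat_B1 (Z t) \<alpha>)"
    unfolding e[OF t] B1_def[symmetric] by (rule integrable_facts(3)[OF t])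
  show "((\<lambda>\<tau>. LINT \<alpha>|lborel. (norm (d_space (Z \<tau>) \<alpha>))\<^sup>2 * (g \<tau> \<alpha>)\<^sup>2) has_real_derivative (LINT x|lborel. ft t x)) (at t within I)"
    unfolding has_real_derivative_iff_has_vector_derivative
    by (rule has_vector_derivative_transform[OF t _ energy_derivative[OF t, unfolded has_real_derivative_iff_has_vector_derivative]])
      (simp only: e)
  show "(LINT x|lborel. ft t x) + (LINT \<alpha>|lborel. (norm (d_space (Z t) \<alpha>))\<^sup>2 * (g t \<alpha>)\<^sup>2 * muskat_B1 (Z t) \<alpha>)
      + 2 * (Hdot_half_norm (\<lambda>\<alpha>. complex_of_real (g t \<alpha>)))\<^sup>2 = 0"
    unfolding e[OF t] B1_def[symmetric] integral_ft[OF t] Hdot_identity(2)[OF t] by simp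
qed

end

theorem mainTheorem3:
  fixes T :: real
    and Z :: "real \<Rightarrow> real \<Rightarrow> complex"
    and \<Psi> :: "real \<Rightarrow> complex \<Rightarrow> complex"
    and g :: "real \<Rightarrow> real \<Rightarrow> real"
  assumes T: "T > 0"
    and smooth: "smooth_on_strip T Z"
    and sol: "muskat_solution T Z \<Psi>"
    and reg: "\<And>s. s \<ge> 2 \<Longrightarrow>
        Linf_sobolev T s (\<lambda>t \<alpha>. d_space (Z t) \<alpha> - 1) \<and>
        Linf_sobolev T s (\<lambda>t \<alpha>. 1 / d_space (Z t) \<alpha> - 1)"
    and g: "g = (\<lambda>t \<alpha>. Im (boundary_log (deriv (\<Psi> t)) \<alpha>))"
  shows "\<forall>t\<in>{0..T}.
      integrable lborel (\<lambda>\<alpha>. (norm (d_space (Z t) \<alpha>))\<^sup>2 * (g t \<alpha>)\<^sup>2) \<and>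
      integrable lborel (\<lambda>\<alpha>. (norm (d_space (Z t) \<alpha>))\<^sup>2 * (g t \<alpha>)\<^sup>2 * muskat_B1 (Z t) \<alpha>) \<and>
      square_integrable (\<lambda>\<alpha>. complex_of_real (g t \<alpha>)) \<and>
      square_integrable (half_weighted (\<lambda>\<alpha>. complex_of_real (g t \<alpha>))) \<and>
      (\<exists>E'. ((\<lambda>\<tau>. LINT \<alpha>|lborel. (norm (d_space (Z \<tau>) \<alpha>))\<^sup>2 * (g \<tau> \<alpha>)\<^sup>2)
               has_real_derivative E') (at t within {0..T}) \<and>
            E' + (LINT \<alpha>|lborel. (norm (d_space (Z t) \<alpha>))\<^sup>2 * (g t \<alpha>)\<^sup>2 * muskat_B1 (Z t) \<alpha>)
               + 2 * (Hdot_half_norm (\<lambda>\<alpha>. complex_of_real (g t \<alpha>)))\<^sup>2 = 0)"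
proof
  fix t assume t: "t \<in> {0..T}"
  obtain D where D: "\<forall>t\<in>{0..T}. \<forall>\<alpha>. D 0 0 t \<alpha> = Z t \<alpha>"
    "\<forall>j k. continuous_on ({0..T} \<times> UNIV) (\<lambda>(t, \<alpha>). D j k t \<alpha>)"
    "\<forall>j k. \<forall>t\<in>{0..T}. \<forall>\<alpha>.
           ((\<lambda>\<tau>. D j k \<tau> \<alpha>) has_vector_derivative D (Suc j) k t \<alpha>) (at t within {0..T}) \<and>
           (D j k t has_vector_derivative D j (Suc k) t \<alpha>) (at \<alpha>)"
    using smooth unfolding smooth_on_strip_def by blast
  \<comment> \<open>The smoothness witness instantiates the locale, with the Sobolev bounds taken at
    s = 2.\<close>
  interpret s: muskat_strip T Z \<Psi> D
  proof
    show "Linf_sobolev T 2 (\<lambda>t \<alpha>. d_space (Z t) \<alpha> - 1)" "Linf_sobolev T 2 (\<lambda>t \<alpha>. 1 / d_space (Z t) \<alpha> - 1)"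
      using reg[of 2] by auto
  qed (use T D sol in auto)
  have "g = s.g" by (simp add: g s.g_def fun_eq_iff)
  then show "integrable lborel (\<lambda>\<alpha>. (norm (d_space (Z t) \<alpha>))\<^sup>2 * (g t \<alpha>)\<^sup>2) \<and>
      integrable lborel (\<lambda>\<alpha>. (norm (d_space (Z t) \<alpha>))\<^sup>2 * (g t \<alpha>)\<^sup>2 * muskat_B1 (Z t) \<alpha>) \<and>
      square_integrable (\<lambda>\<alpha>. complex_of_real (g t \<alpha>)) \<and>
      square_integrable (half_weighted (\<lambda>\<alpha>. complex_of_real (g t \<alpha>))) \<and>
      (\<exists>E'. ((\<lambda>\<tau>. LINT \<alpha>|lborel. (norm (d_space (Z \<tau>) \<alpha>))\<^sup>2 * (g \<tau> \<alpha>)\<^sup>2)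
               has_real_derivative E') (at t within {0..T}) \<and>
            E' + (LINT \<alpha>|lborel. (norm (d_space (Z t) \<alpha>))\<^sup>2 * (g t \<alpha>)\<^sup>2 * muskat_B1 (Z t) \<alpha>)
               + 2 * (Hdot_half_norm (\<lambda>\<alpha>. complex_of_real (g t \<alpha>)))\<^sup>2 = 0)"
    using s.energy_identity[OF t] s.g_facts(2)[OF t] s.Hdot_identity(1)[OF t] by blast
qed

end
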